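(* Let $N\ge 2$, let $\Omega\subset\mathbb{R}^N$ be a smooth bounded domain, and let $\phi:(0,\infty)\to(0,\infty)$ be of class $C^2$ such that $\lim_{t\to 0}t\phi(t)=0$, $\lim_{t\to\infty}t\phi(t)=\infty$, $t\mapsto t\phi(t)$ is strictly increasing, and, with $\ell-2:=\inf_{t>0}\frac{(t\phi(t))''t}{(t\phi(t))'}$ and $m-2:=\sup_{t>0}\frac{(t\phi(t))''t}{(t\phi(t))'}$, one has $-1<\ell-2\le m-2<N-2$. Let $f:\Omega\times\mathbb{R}\to\mathbb{R}$ be a Carathéodory function, of class $C^1$ in the second variable, such that: (a) there are a function $\psi:[0,\infty)\to[0,\infty)$ and a constant $C>0$ with $|f(x,t)|\le C[1+\psi(|t|)]$ for all $x\in\Omega$, $t\in\mathbb{R}$, where $\Psi(t)=\int_0^t\psi(s)\,ds$ is an N-function with $\Psi<<\Phi_*$ and $1<\ell\le m<\ell_\Psi:=\inf_{t>0}\frac{t\psi(t)}{\Psi(t)}\le \sup_{t>0}\frac{t\psi(t)}{\Psi(t)}=:m_\Psi<\ell^*:=\frac{\ell N}{N-\ell}$; (b) for each $x\in\Omega$, the function $t\mapsto \frac{f(x,t)}{|t|^{m-2}t}$ is strictly increasing on $(0,\infty)$ and strictly decreasing on $(-\infty,0)$; (c) $\lim_{t\to 0}\frac{f(x,t)}{t\phi(|t|)}<\lambda_1$ uniformly in $x\in\Omega$; (d) $\lim_{|t|\to\infty}\frac{f(x,t)}{|t|^{m-2}t}=+\infty$ uniformly in $x\in\Omega$. Then the problem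 $-\mathrm{div}(\phi(|\nabla u|)\nabla u)=f(x,u)$ in $\Omega$, $u=0$ on $\partial\Omega$, admits a nonzero ground state solution $u$, in the sense that $u\in\mathcal{N}$, $$\int_\Omega\phi(|\nabla u|)\nabla u\cdot\nabla v\,dx=\int_\Omega f(x,u)v\,dx\quad\text{for all }v\in W_0^{1,\Phi}(\Omega),$$ and $J(u)=\inf_{w\in\mathcal{N}}J(w)$.
   Context: Put $\Phi(t)=\int_0^t s\phi(s)\,ds$, where $s\mapsto s\phi(s)$ is extended to $\mathbb{R}$ as an odd function, so $\Phi$ is even. $L_\Phi(\Omega)$ is the Orlicz space with Luxemburg norm $\|u\|_\Phi=\inf\{\lambda>0:\int_\Omega\Phi(u/\lambda)\,dx\le1\}$, and $W_0^{1,\Phi}(\Omega)$ is the corresponding Orlicz–Sobolev space of functions with zero boundary values, normed by $\|u\|=\|\nabla u\|_\Phi$. $\Phi_*$ is the inverse of $t\in(0,\infty)\mapsto\int_0^t\frac{\Phi^{-1}(s)}{s^{(N+1)/N}}\,ds$, extended evenly to $\mathbb{R}$. $\Psi<<\Phi_*$ means $\lim_{t\to\infty}\Psi(\lambda t)/\Phi_*(t)=0$ for all $\lambda>0$. $\lambda_1>0$ is the first eigenvalue of $-\Delta_\Phi$, i.e. the best constant in $\lambda_1\int_\Omega\Phi(u)\,dx\le\int_\Omega\Phi(|\nabla u|)\,dx$, $u\in W_0^{1,\Phi}(\Omega)$. Expressions such as $\phi(|\nabla u|)\nabla u$ are read as $0$ where $\nabla u=0$. $F(x,t)=\int_0^tf(x,s)\,ds$;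 $J(u)=\int_\Omega\Phi(|\nabla u|)\,dx-\int_\Omega F(x,u)\,dx$ for $u\in W_0^{1,\Phi}(\Omega)$, a $C^1$ functional with $\langle J'(u),v\rangle=\int_\Omega\phi(|\nabla u|)\nabla u\cdot\nabla v\,dx-\int_\Omega f(x,u)v\,dx$. The Nehari manifold is $\mathcal{N}=\{u\in W_0^{1,\Phi}(\Omega)\setminus\{0\}:\langle J'(u),u\rangle=0\}$. *)

theory Defs
  imports "HOL-Analysis.Analysis"
begin

section \<open>Smoothness, smooth bounded domains, test functions\<close>

(* Intended for open S; g b is the partial derivative in the direction b. *)
primrec Ck_on :: "nat \<Rightarrow> 'a::euclidean_space set \<Rightarrow> ('a \<Rightarrow> real) \<Rightarrow> bool" where
  "Ck_on 0 S f \<longleftrightarrow> continuous_on S f"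
| "Ck_on (Suc k) S f \<longleftrightarrow>
     (\<exists>g. (\<forall>x\<in>S. (f has_derivative (\<lambda>h. \<Sum>b\<in>Basis. (h \<bullet> b) * g b x)) (at x)) \<and>
          (\<forall>b\<in>Basis. Ck_on k S (g b)))"

definition smooth_on :: "'a::euclidean_space set \<Rightarrow> ('a \<Rightarrow> real) \<Rightarrow> bool" where
  "smooth_on S f \<longleftrightarrow> (\<forall>k. Ck_on k S f)"

(* Near each boundary point, after a rigid change of coordinates T, the set is the region above
   the graph of a smooth function of the remaining N - 1 coordinates; such a function is
   represented by a smooth \<gamma> on the whole space that does not depend on coordinate i. *)
definition smooth_boundary :: "(real^'n) set \<Rightarrow> bool" where
  "smooth_boundary \<Omega> \<longleftrightarrow>
     (\<forall>p\<in>frontier \<Omega>. \<exists>r>0. \<exists>T :: real^'n \<Rightarrow> real^'n. \<exists>i. \<exists>\<gamma> :: real^'n \<Rightarrow> real.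
        orthogonal_transformation T \<and> smooth_on UNIV \<gamma> \<and>
        (\<forall>y z. (\<forall>j. j \<noteq> i \<longrightarrow> y $ j = z $ j) \<longrightarrow> \<gamma> y = \<gamma> z) \<and>
        \<Omega> \<inter> ball p r = {x \<in> ball p r. T x $ i > \<gamma> (T x)})"

definition smooth_bounded_domain :: "(real^'n) set \<Rightarrow> bool" where
  "smooth_bounded_domain \<Omega> \<longleftrightarrow>
     \<Omega> \<noteq> {} \<and> open \<Omega> \<and> connected \<Omega> \<and> bounded \<Omega> \<and> smooth_boundary \<Omega>"

definition test_functions :: "(real^'n) set \<Rightarrow> (real^'n \<Rightarrow> real) set" where
  "test_functions \<Omega> =
     {\<eta>. smooth_on UNIV \<eta> \<and> compact (closure {x. \<eta> x \<noteq> 0}) \<and> closure {x. \<eta> x \<noteq> 0} \<subseteq> \<Omega>}"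

section \<open>N-functions\<close>

(* The oriented integral of g from 0 to t. *)
definition int0 :: "(real \<Rightarrow> real) \<Rightarrow> real \<Rightarrow> real" where
  "int0 g t = (if 0 \<le> t then integral {0..t} g else - integral {t..0} g)"

(* N-functions are even; only the restriction to the nonnegative half-line is constrained here. *)
definition N_function :: "(real \<Rightarrow> real) \<Rightarrow> bool" where
  "N_function A \<longleftrightarrow>
     continuous_on {0..} A \<and> convex_on {0..} A \<and> A 0 = 0 \<and> (\<forall>t>0. A t > 0) \<and>
     ((\<lambda>t. A t / t) \<longlongrightarrow> 0) (at_right 0) \<and> filterlim (\<lambda>t. A t / t) at_top at_top"

definition Phi :: "(real \<Rightarrow> real) \<Rightarrow> real \<Rightarrow> real" where
  "Phi \<phi> t = int0 (\<lambda>s. s * \<phi> \<bar>s\<bar>) t"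

definition Phi_inv :: "(real \<Rightarrow> real) \<Rightarrow> real \<Rightarrow> real" where
  "Phi_inv \<phi> = the_inv_into {0..} (Phi \<phi>)"

(* The Sobolev conjugate in dimension N. *)
definition Phi_star :: "nat \<Rightarrow> (real \<Rightarrow> real) \<Rightarrow> real \<Rightarrow> real" where
  "Phi_star N \<phi> t =
     (if t = 0 then 0
      else the_inv_into {0<..}
             (int0 (\<lambda>s. Phi_inv \<phi> s / s powr ((real N + 1) / real N))) \<bar>t\<bar>)"

definition essentially_slower :: "(real \<Rightarrow> real) \<Rightarrow> (real \<Rightarrow> real) \<Rightarrow> bool" where
  "essentially_slower A B \<longleftrightarrow> (\<forall>c>0. ((\<lambda>t. A (c * t) / B t) \<longlongrightarrow> 0) at_top)"

section \<open>Orlicz and Orlicz--Sobolev spaces\<close>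

text \<open>Elements of the spaces are represented by functions on the whole space of which only the
  values on \<open>\<Omega>\<close>, up to a null set, matter.\<close>

definition orlicz :: "(real^'n) set \<Rightarrow> (real \<Rightarrow> real) \<Rightarrow> (real^'n \<Rightarrow> real) set" where
  "orlicz \<Omega> A =
     {u \<in> borel_measurable (lebesgue_on \<Omega>).
        \<exists>c>0. (\<integral>\<^sup>+x. ennreal (A (u x / c)) \<partial>lebesgue_on \<Omega>) < \<infinity>}"

definition luxemburg :: "(real^'n) set \<Rightarrow> (real \<Rightarrow> real) \<Rightarrow> (real^'n \<Rightarrow> real) \<Rightarrow> real" where
  "luxemburg \<Omega> A u =
     Inf {c. c > 0 \<and> (\<integral>\<^sup>+x. ennreal (A (u x / c)) \<partial>lebesgue_on \<Omega>) \<le> 1}"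

definition has_weak_grad ::
  "(real^'n) set \<Rightarrow> (real^'n \<Rightarrow> real) \<Rightarrow> (real^'n \<Rightarrow> real^'n) \<Rightarrow> bool" where
  "has_weak_grad \<Omega> u g \<longleftrightarrow>
     (\<forall>K. compact K \<and> K \<subseteq> \<Omega> \<longrightarrow> u absolutely_integrable_on K \<and> g absolutely_integrable_on K) \<and>
     (\<forall>\<eta>\<in>test_functions \<Omega>. \<forall>i.
        (LINT x|lebesgue_on \<Omega>. u x * frechet_derivative \<eta> (at x) (axis i 1)) =
        - (LINT x|lebesgue_on \<Omega>. g x $ i * \<eta> x))"

(* Weak gradients are unique only up to null sets, so this selects a representative. *)
definition weak_grad :: "(real^'n) set \<Rightarrow> (real^'n \<Rightarrow> real) \<Rightarrow> real^'n \<Rightarrow> real^'n" where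
  "weak_grad \<Omega> u = (SOME g. has_weak_grad \<Omega> u g)"

definition orlicz_sobolev :: "(real^'n) set \<Rightarrow> (real \<Rightarrow> real) \<Rightarrow> (real^'n \<Rightarrow> real) set" where
  "orlicz_sobolev \<Omega> A =
     {u \<in> orlicz \<Omega> A. (\<exists>g. has_weak_grad \<Omega> u g) \<and> (\<lambda>x. norm (weak_grad \<Omega> u x)) \<in> orlicz \<Omega> A}"

definition sobolev_norm :: "(real^'n) set \<Rightarrow> (real \<Rightarrow> real) \<Rightarrow> (real^'n \<Rightarrow> real) \<Rightarrow> real" where
  "sobolev_norm \<Omega> A u = luxemburg \<Omega> A u + luxemburg \<Omega> A (\<lambda>x. norm (weak_grad \<Omega> u x))"

(* Zero boundary values: the closure of the test functions. *)
definition orlicz_sobolev0 :: "(real^'n) set \<Rightarrow> (real \<Rightarrow> real) \<Rightarrow> (real^'n \<Rightarrow> real) set" where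
  "orlicz_sobolev0 \<Omega> A =
     {u \<in> orlicz_sobolev \<Omega> A.
        \<exists>\<eta> :: nat \<Rightarrow> real^'n \<Rightarrow> real. (\<forall>k. \<eta> k \<in> test_functions \<Omega>) \<and>
          (\<lambda>k. sobolev_norm \<Omega> A (\<lambda>x. u x - \<eta> k x)) \<longlonglongrightarrow> 0}"

section \<open>The variational problem\<close>

definition lambda1 :: "(real^'n) set \<Rightarrow> (real \<Rightarrow> real) \<Rightarrow> real" where
  "lambda1 \<Omega> \<phi> =
     Sup {c. \<forall>u\<in>orlicz_sobolev0 \<Omega> (Phi \<phi>).
            c * (LINT x|lebesgue_on \<Omega>. Phi \<phi> (u x))
            \<le> (LINT x|lebesgue_on \<Omega>. Phi \<phi> (norm (weak_grad \<Omega> u x)))}"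

definition caratheodory :: "(real^'n) set \<Rightarrow> (real^'n \<Rightarrow> real \<Rightarrow> real) \<Rightarrow> bool" where
  "caratheodory \<Omega> f \<longleftrightarrow>
     (\<forall>t. (\<lambda>x. f x t) \<in> borel_measurable (lebesgue_on \<Omega>)) \<and>
     (AE x in lebesgue_on \<Omega>. continuous_on UNIV (f x))"

definition energy ::
  "(real^'n) set \<Rightarrow> (real \<Rightarrow> real) \<Rightarrow> (real^'n \<Rightarrow> real \<Rightarrow> real) \<Rightarrow> (real^'n \<Rightarrow> real) \<Rightarrow> real" where
  "energy \<Omega> \<phi> f u =
     (LINT x|lebesgue_on \<Omega>. Phi \<phi> (norm (weak_grad \<Omega> u x))) -
     (LINT x|lebesgue_on \<Omega>. int0 (f x) (u x))"

(* Where the gradient of u vanishes, the first integrand is 0 whatever the value of \<phi> 0. *)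
definition energy_deriv ::
  "(real^'n) set \<Rightarrow> (real \<Rightarrow> real) \<Rightarrow> (real^'n \<Rightarrow> real \<Rightarrow> real) \<Rightarrow> (real^'n \<Rightarrow> real) \<Rightarrow>
     (real^'n \<Rightarrow> real) \<Rightarrow> real" where
  "energy_deriv \<Omega> \<phi> f u v =
     (LINT x|lebesgue_on \<Omega>.
        (\<phi> (norm (weak_grad \<Omega> u x)) *\<^sub>R weak_grad \<Omega> u x) \<bullet> weak_grad \<Omega> v x) -
     (LINT x|lebesgue_on \<Omega>. f x (u x) * v x)"

definition nehari ::
  "(real^'n) set \<Rightarrow> (real \<Rightarrow> real) \<Rightarrow> (real^'n \<Rightarrow> real \<Rightarrow> real) \<Rightarrow> (real^'n \<Rightarrow> real) set" where
  "nehari \<Omega> \<phi> f =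
     {u \<in> orlicz_sobolev0 \<Omega> (Phi \<phi>).
        \<not> (AE x in lebesgue_on \<Omega>. u x = 0) \<and> energy_deriv \<Omega> \<phi> f u u = 0}"

end

theory Submission
  imports Defs "HOL-Probability.Probability" "HOL-Complex_Analysis.Great_Picard" "HOL-Library.Diagonal_Subsequence"
    "HOL-Real_Asymp.Real_Asymp"
begin

text \<open>A ground state is found by minimising the energy \<open>J\<close> over the Nehari manifold \<open>\<N>\<close> and showing that a minimiser is
a free critical point. Three observations make this work without Lagrange multipliers or Palais--Smale sequences.

The first concerns rays. The upper index \<open>m\<close> bounds the growth of \<open>t \<phi>(t)\<close>, and \<open>f(x,t) / (\<bar>t\<bar>\<^sup>m\<^sup>-\<^sup>2 t)\<close> is strictly
monotone, so \<open>\<langle>J'(su), u\<rangle> / s\<^sup>m\<^sup>-\<^sup>1\<close> strictly decreases in \<open>s > 0\<close> (\<open>fibre_decreasing\<close>). Along each ray \<open>J\<close> is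
positive near the origin, because the slope of \<open>f\<close> at \<open>0\<close> stays below the first eigenvalue, and nonpositive far out,
because the primitive of \<open>f\<close> outgrows \<open>\<bar>t\<bar>\<^sup>m\<close>. Hence each ray meets \<open>\<N>\<close>, and a point of \<open>\<N>\<close> maximises \<open>J\<close> on its
ray (\<open>nehari_ray\<close>, \<open>nehari_fibre\<close>).

The second is the existence of a minimiser (\<open>minimizer_exists\<close>). The points of a minimising sequence are rescaled to
energy \<open>1\<close>; a subsequence \<open>v\<^sub>n\<close> then converges in \<open>L\<^sup>q\<close> to some \<open>z\<close>. For every \<open>s > 0\<close> the maximum property gives
\<open>J(s v\<^sub>n) \<le> inf J + o(1)\<close>. If \<open>z\<close> were \<open>0\<close>, the left side would be at least \<open>s - o(1)\<close>, which is false for large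
\<open>s\<close>. So \<open>z \<noteq> 0\<close>, lower semicontinuity of the modular yields \<open>J(s z) \<le> inf J\<close> for all \<open>s\<close>, and the point of
\<open>\<N>\<close> on the ray of \<open>z\<close> is a minimiser.

The third is that a minimiser \<open>u\<close> is critical (\<open>minimizer_nonneg\<close>). If \<open>\<langle>J'(u), v\<rangle> < 0\<close>, then some \<open>s (u + \<tau> v)\<close> with
\<open>s\<close> near \<open>1\<close> and small \<open>\<tau> > 0\<close> lies on \<open>\<N>\<close> by the intermediate value theorem, and its energy is smaller than
\<open>J(s u) \<le> J(u)\<close>.

The functional analysis is carried out with modulars. Since the indices satisfy \<open>1 < l \<le> m < \<infinity>\<close>, Luxemburg
convergence is convergence of the modular (\<open>luxemburg_tendsto_iff\<close>), and \<open>\<Phi>\<close> of the norm of a vector is uniformly convex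
(\<open>uniform_convexity\<close>). Uniform convexity replaces reflexivity: in nested convex sets of functions near the
limit, almost minimal elements have gradients that are Cauchy in the modular, which gives lower semicontinuity
(\<open>closed_sublevel\<close>). As \<open>t\<^sup>l \<le> 1 + \<Phi>(t) / \<Phi>(1)\<close>, only the classical embeddings with exponent \<open>l\<close> are needed. They are
derived from averages over balls: comparing a function with its averages gives weak-type estimates whose
iteration reaches every exponent below the critical one (\<open>subcritical_sobolev\<close>), and the averages are equicontinuous,
which gives compactness (\<open>rellich\<close>).

Finally, the pointwise hypotheses are turned into inequalities: the indices of \<open>t \<phi>(t)\<close> become monotonicity of the
quotients by powers (\<open>power_growth_of_indices\<close>), the upper index \<open>q\<close> of \<open>\<Psi>\<close> gives \<open>\<bar>f(x,t)\<bar> \<le> C (1 + \<bar>t\<bar>\<^sup>q\<^sup>-\<^sup>1)\<close> with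
\<open>q\<close> strictly between \<open>m\<close> and the critical exponent (\<open>density_le_powr\<close>), and the condition at \<open>0\<close> is integrated
against the definition of the first eigenvalue (\<open>energy_below\<close>).\<close>

section \<open>Smooth functions\<close>

lemma Ck_on_Suc_imp: "Ck_on (Suc k) S f \<Longrightarrow> Ck_on k S f"
proof (induction k arbitrary: f)
  case 0
  then obtain g where g: "\<forall>x\<in>S. (f has_derivative (\<lambda>h. \<Sum>b\<in>Basis. (h \<bullet> b) * g b x)) (at x)"
    unfolding Ck_on.simps by blast
  have "isCont f x" if "x \<in> S" for x
    using g that by (auto intro!: has_derivative_continuous)
  then show ?case by (simp add: continuous_at_imp_continuous_on)
next
  case (Suc k)
  from Suc.prems obtain g where g: "\<forall>x\<in>S. (f has_derivative (\<lambda>h. \<Sum>b\<in>Basis. (h \<bullet> b) * g b x)) (at x)"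
    and gb: "\<forall>b\<in>Basis. Ck_on (Suc k) S (g b)"
    unfolding Ck_on.simps(2)[of "Suc k"] by blast
  with Suc.IH show ?case by (auto simp only: Ck_on.simps intro!: exI[of _ g])
qed

lemma Ck_on_const: "Ck_on k S (\<lambda>x. c)"
proof (induction k arbitrary: c)
  case (Suc k)
  then show ?case by (auto intro!: exI[of _ "\<lambda>b x. 0"])
qed simp

lemma Ck_on_add: "Ck_on k S f \<Longrightarrow> Ck_on k S g \<Longrightarrow> Ck_on k S (\<lambda>x. f x + g x)"
proof (induction k arbitrary: f g)
  case 0
  then show ?case by (simp add: continuous_on_add)
next
  case (Suc k)
  from Suc.prems obtain f' g' where 1: "\<forall>x\<in>S. (f has_derivative (\<lambda>h. \<Sum>b\<in>Basis. (h \<bullet> b) * f' b x)) (at x)"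
    "\<forall>b\<in>Basis. Ck_on k S (f' b)"
    "\<forall>x\<in>S. (g has_derivative (\<lambda>h. \<Sum>b\<in>Basis. (h \<bullet> b) * g' b x)) (at x)"
    "\<forall>b\<in>Basis. Ck_on k S (g' b)"
    by auto
  have "((\<lambda>x. f x + g x) has_derivative (\<lambda>h. \<Sum>b\<in>Basis. (h \<bullet> b) * (f' b x + g' b x))) (at x)" if "x \<in> S" for x
    using has_derivative_add[OF 1(1)[rule_format, OF that] 1(3)[rule_format, OF that]]
    by (simp add: distrib_left sum.distrib)
  moreover have "\<forall>b\<in>Basis. Ck_on k S (\<lambda>x. f' b x + g' b x)"
    using 1 by (intro ballI Suc.IH) auto
  ultimately show ?case unfolding Ck_on.simps
    by (intro exI[of _ "\<lambda>b x. f' b x + g' b x"] conjI) auto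
qed

lemma Ck_on_mult: "Ck_on k S f \<Longrightarrow> Ck_on k S g \<Longrightarrow> Ck_on k S (\<lambda>x. f x * g x)"
proof (induction k arbitrary: f g)
  case 0
  then show ?case by (simp add: continuous_on_mult)
next
  case (Suc k)
  have low: "Ck_on k S f" "Ck_on k S g" using Suc.prems Ck_on_Suc_imp by blast+
  from Suc.prems obtain f' g' where 1: "\<forall>x\<in>S. (f has_derivative (\<lambda>h. \<Sum>b\<in>Basis. (h \<bullet> b) * f' b x)) (at x)"
    "\<forall>b\<in>Basis. Ck_on k S (f' b)"
    "\<forall>x\<in>S. (g has_derivative (\<lambda>h. \<Sum>b\<in>Basis. (h \<bullet> b) * g' b x)) (at x)"
    "\<forall>b\<in>Basis. Ck_on k S (g' b)"
    by auto
  have "((\<lambda>x. f x * g x) has_derivative (\<lambda>h. \<Sum>b\<in>Basis. (h \<bullet> b) * (f x * g' b x + f' b x * g x))) (at x)" if "x \<in> S" for x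
    using has_derivative_mult[OF 1(1)[rule_format, OF that] 1(3)[rule_format, OF that]]
    by (simp add: distrib_left sum.distrib sum_distrib_left sum_distrib_right mult_ac)
  moreover have "\<forall>b\<in>Basis. Ck_on k S (\<lambda>x. f x * g' b x + f' b x * g x)"
    using 1 by (intro ballI Ck_on_add Suc.IH low) auto
  ultimately show ?case unfolding Ck_on.simps
    by (intro exI[of _ "\<lambda>b x. f x * g' b x + f' b x * g x"] conjI) auto
qed

lemma Ck_on_prod: "finite I \<Longrightarrow> (\<And>i. i \<in> I \<Longrightarrow> Ck_on k S (f i)) \<Longrightarrow> Ck_on k S (\<lambda>x. \<Prod>i\<in>I. f i x)"
  by (induction I rule: finite_induct) (auto intro: Ck_on_const Ck_on_mult)

lemma Ck_on_affine:
  fixes c :: "'a::euclidean_space"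
  shows "Ck_on k S (\<lambda>x. x \<bullet> c + d)"
proof (cases k)
  case (Suc k)
  have "((\<lambda>x. x \<bullet> c + d) has_derivative (\<lambda>h. \<Sum>b\<in>Basis. (h \<bullet> b) * (b \<bullet> c))) (at x)" for x
  proof -
    have eq: "(\<lambda>h. h \<bullet> c) = (\<lambda>h. \<Sum>b\<in>Basis. (h \<bullet> b) * (b \<bullet> c))"
      by (rule ext, subst euclidean_inner, rule sum.cong) (auto simp: inner_commute)
    have "((\<lambda>x. x \<bullet> c + d) has_derivative (\<lambda>h. h \<bullet> c)) (at x)"
      by (auto intro!: derivative_eq_intros)
    then show ?thesis by (rule has_derivative_eq_rhs[OF _ eq])
  qed
  then show ?thesis unfolding Suc Ck_on.simps
    by (intro exI[of _ "\<lambda>b x. b \<bullet> c"] conjI ballI Ck_on_const)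
qed (auto intro!: continuous_intros)

text \<open>These are \<open>exp(-1/t) / t\<^sup>n\<close> extended by \<open>0\<close>. The whole family is needed because its linear span is closed under
differentiation, so that smoothness becomes an induction over the order.\<close>

definition flat :: "nat \<Rightarrow> real \<Rightarrow> real" where
  "flat n t = (if 0 < t then exp (- inverse t) * inverse t ^ n else 0)"

lemma flat_nonpos[simp]: "t \<le> 0 \<Longrightarrow> flat n t = 0" by (simp add: flat_def)

lemma flat_tendsto_0: "(flat n \<longlongrightarrow> 0) (at 0)"
proof (rule filterlim_split_at)
  show "(flat n \<longlongrightarrow> 0) (at_left 0)"
    by (rule tendsto_eventually) (auto simp: eventually_at_filter)
  have "((\<lambda>t. inverse t ^ n / exp (inverse t)) \<longlongrightarrow> (0::real)) (at_right 0)"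
    by (rule filterlim_compose[OF tendsto_power_div_exp_0 filterlim_inverse_at_top_right])
  then show "(flat n \<longlongrightarrow> 0) (at_right 0)"
    by (rule Lim_transform_eventually)
      (auto simp: eventually_at_filter flat_def exp_minus field_simps)
qed

lemma DERIV_flat: "(flat n has_real_derivative flat (n + 2) t - real n * flat (n + 1) t) (at t)"
proof -
  consider "t > 0" | "t < 0" | "t = 0" by linarith
  then show ?thesis
  proof cases
    case 1
    have "((\<lambda>t. exp (- inverse t) * inverse t ^ n) has_real_derivative flat (n + 2) t - real n * flat (n + 1) t) (at t)"
    proof -
      have i: "(inverse has_real_derivative - (inverse t ^ 2)) (at t)"
        using DERIV_inverse[of t UNIV] 1 by (simp add: power2_eq_square numeral_2_eq_2)
      have e: "((\<lambda>t. exp (- inverse t)) has_real_derivative exp (- inverse t) * inverse t ^ 2) (at t)"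
        using DERIV_chain2[OF DERIV_exp DERIV_minus[OF i]] by simp
      have d: "((\<lambda>t. exp (- inverse t) * inverse t ^ n) has_real_derivative
          exp (- inverse t) * inverse t ^ 2 * inverse t ^ n + (real n * (- (inverse t ^ 2)) * inverse t ^ (n - Suc 0)) * exp (- inverse t)) (at t)"
        using DERIV_mult[OF e DERIV_power[OF i, of n]] by (simp add: mult_ac)
      show ?thesis
        by (rule DERIV_cong[OF d])
          (use 1 in \<open>cases n; simp add: flat_def power2_eq_square algebra_simps\<close>)
    qed
    then show ?thesis
      by (rule has_field_derivative_transform_within_open[of _ _ _ "{0<..}"]) (use 1 in \<open>auto simp: flat_def\<close>)
  next
    case 2
    have "((\<lambda>t. 0) has_real_derivative flat (n + 2) t - real n * flat (n + 1) t) (at t)"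
      using 2 by simp
    then show ?thesis
      by (rule has_field_derivative_transform_within_open[of _ _ _ "{..<0}"]) (use 2 in auto)
  next
    case 3
    have "((\<lambda>h. (flat n (0 + h) - flat n 0) / h) \<longlongrightarrow> 0) (at 0)"
      by (rule Lim_transform_eventually[OF flat_tendsto_0[of "Suc n"]])
        (auto simp: eventually_at_filter flat_def field_simps)
    then show ?thesis using 3 by (simp add: DERIV_def)
  qed
qed

text \<open>The derivative of \<open>flat n \<circ> p\<close> is again built from \<open>flat\<close>, \<open>p\<close> and the derivative of \<open>p\<close>; hence \<open>n\<close> and \<open>p\<close> vary in
the induction.\<close>

lemma Ck_on_flat: "Ck_on k S p \<Longrightarrow> Ck_on k S (\<lambda>x. flat n (p x))"
proof (induction k arbitrary: n p)
  case 0
  have "isCont (flat n) t" for t using DERIV_flat by (rule DERIV_isCont)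
  then have "continuous_on UNIV (flat n)" by (simp add: continuous_at_imp_continuous_on)
  from continuous_on_compose2[OF this, of S p] 0 show ?case by simp
next
  case (Suc k)
  have low: "Ck_on k S p" using Suc.prems Ck_on_Suc_imp by blast
  from Suc.prems obtain p' where p': "\<forall>x\<in>S. (p has_derivative (\<lambda>h. \<Sum>b\<in>Basis. (h \<bullet> b) * p' b x)) (at x)"
    "\<forall>b\<in>Basis. Ck_on k S (p' b)" by auto
  let ?g = "\<lambda>b x. (flat (n + 2) (p x) + (- real n) * flat (n + 1) (p x)) * p' b x"
  have "((\<lambda>x. flat n (p x)) has_derivative (\<lambda>h. \<Sum>b\<in>Basis. (h \<bullet> b) * ?g b x)) (at x)" if "x \<in> S" for x
    by (rule has_derivative_eq_rhs[OF has_derivative_compose[OF p'(1)[rule_format, OF that]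
          DERIV_flat[of n, unfolded has_field_derivative_def]]])
       (auto simp: fun_eq_iff sum_distrib_left intro!: sum.cong)
  moreover have "\<forall>b\<in>Basis. Ck_on k S (?g b)"
    using Suc.IH low p' by (intro ballI Ck_on_mult Ck_on_add Ck_on_const) auto
  ultimately show ?case unfolding Ck_on.simps by (intro exI[of _ ?g] conjI) auto
qed

section \<open>Test functions\<close>

definition grad :: "(real^'n \<Rightarrow> real) \<Rightarrow> real^'n \<Rightarrow> real^'n" where
  "grad \<eta> x = (\<chi> i. frechet_derivative \<eta> (at x) (axis i 1))"

text \<open>A linear functional is determined by its values on the basis, which are the components of the gradient.\<close>

lemma grad_inner: "\<eta> differentiable at x \<Longrightarrow> frechet_derivative \<eta> (at x) v = grad \<eta> x \<bullet> v"
proof -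
  assume "\<eta> differentiable at x"
  then have "linear (frechet_derivative \<eta> (at x))" by (rule linear_frechet_derivative)
  then have "frechet_derivative \<eta> (at x) (\<Sum>i\<in>UNIV. (v $ i) *\<^sub>R axis i 1) = (\<Sum>i\<in>UNIV. (v $ i) * frechet_derivative \<eta> (at x) (axis i 1))"
    by (simp add: linear_sum linear_scale)
  then show ?thesis by (simp add: grad_def inner_vec_def mult.commute basis_expansion flip: scalar_mult_eq_scaleR)
qed

lemma test_has_derivative:
  assumes "\<eta> \<in> test_functions \<Omega>"
  shows "(\<eta> has_derivative (\<lambda>v. grad \<eta> x \<bullet> v)) (at x)"
proof -
  have "Ck_on (Suc 0) UNIV \<eta>" using assms by (auto simp: test_functions_def smooth_on_def simp del: Ck_on.simps)
  then have "\<eta> differentiable at x" by (auto simp: differentiable_def)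
  then have "(\<eta> has_derivative frechet_derivative \<eta> (at x)) (at x)" "frechet_derivative \<eta> (at x) = (\<lambda>v. grad \<eta> x \<bullet> v)"
    using frechet_derivative_works grad_inner by blast+
  then show ?thesis by simp
qed

lemma grad_eqI: "(\<eta> has_derivative (\<lambda>v. g \<bullet> v)) (at x) \<Longrightarrow> grad \<eta> x = g"
  by (auto simp: grad_def vec_eq_iff frechet_derivative_at[symmetric] inner_axis)

lemma continuous_on_grad:
  assumes "\<eta> \<in> test_functions \<Omega>"
  shows "continuous_on S (grad \<eta>)"
proof -
  have "Ck_on (Suc 0) UNIV \<eta>" using assms by (auto simp: test_functions_def smooth_on_def simp del: Ck_on.simps)
  then obtain g where g: "\<And>x. (\<eta> has_derivative (\<lambda>h. \<Sum>b\<in>Basis. (h \<bullet> b) * g b x)) (at x)"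
    "\<And>b. b \<in> Basis \<Longrightarrow> continuous_on UNIV (g b)" by auto
  have "grad \<eta> x $ i = g (axis i 1) x" for x i
  proof -
    have "frechet_derivative \<eta> (at x) (axis i 1) = (\<Sum>b\<in>Basis. (axis i 1 \<bullet> b) * g b x)"
      by (simp add: frechet_derivative_at[OF g(1), symmetric])
    also have "\<dots> = (\<Sum>b\<in>Basis. if b = axis i 1 then g b x else 0)"
      by (intro sum.cong) (auto simp: inner_Basis axis_in_Basis_iff)
    finally show ?thesis by (simp add: grad_def axis_in_Basis_iff)
  qed
  then have "continuous_on UNIV (\<lambda>x. grad \<eta> x $ i)" for i
    using g(2)[of "axis i 1"] by (simp add: axis_in_Basis_iff)
  then have "continuous_on UNIV (grad \<eta>)"
    using continuous_on_vec_lambda[of UNIV "\<lambda>i x. grad \<eta> x $ i"] by simp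
  then show ?thesis by (rule continuous_on_subset) simp
qed

lemma continuous_on_test:
  assumes "\<eta> \<in> test_functions \<Omega>" shows "continuous_on S \<eta>"
  by (rule continuous_at_imp_continuous_on) (simp add: has_derivative_continuous[OF test_has_derivative[OF assms]])

lemma test_support:
  assumes "\<eta> \<in> test_functions \<Omega>"
  obtains K where "compact K" "K \<subseteq> \<Omega>" "\<And>x. x \<notin> K \<Longrightarrow> \<eta> x = 0" "\<And>x. x \<notin> K \<Longrightarrow> grad \<eta> x = 0"
proof -
  define K where "K = closure {x. \<eta> x \<noteq> 0}"
  have K: "compact K" "K \<subseteq> \<Omega>" using assms by (auto simp: test_functions_def K_def)
  have 0: "\<eta> x = 0" if "x \<notin> K" for x
    using that closure_subset[of "{x. \<eta> x \<noteq> 0}"] unfolding K_def by blast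
  have "grad \<eta> x = 0" if x: "x \<notin> K" for x
  proof (rule grad_eqI)
    have "open (- K)" using K by (simp add: compact_imp_closed open_Compl)
    then show "(\<eta> has_derivative (\<lambda>v. 0 \<bullet> v)) (at x)"
      by (rule has_derivative_transform_within_open[of "\<lambda>_. 0" _ _ _ "- K", rotated]) (use 0 x in auto)
  qed
  with K 0 that show thesis by blast
qed

lemma test_functions_combination:
  assumes "\<eta> \<in> test_functions \<Omega>" "\<zeta> \<in> test_functions \<Omega>"
  shows "(\<lambda>x. a * \<eta> x + b * \<zeta> x) \<in> test_functions \<Omega>"
    and "grad (\<lambda>x. a * \<eta> x + b * \<zeta> x) x = a *\<^sub>R grad \<eta> x + b *\<^sub>R grad \<zeta> x"
proof -
  let ?K = "closure {x. \<eta> x \<noteq> 0} \<union> closure {x. \<zeta> x \<noteq> 0}"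
  have K: "compact ?K" "?K \<subseteq> \<Omega>" using assms by (auto simp: test_functions_def)
  have sub: "closure {x. a * \<eta> x + b * \<zeta> x \<noteq> 0} \<subseteq> ?K"
    unfolding closure_Un[symmetric] by (rule closure_mono) auto
  have "smooth_on UNIV (\<lambda>x. a * \<eta> x + b * \<zeta> x)"
    using assms by (auto simp: smooth_on_def test_functions_def intro!: Ck_on_add Ck_on_mult Ck_on_const)
  then show "(\<lambda>x. a * \<eta> x + b * \<zeta> x) \<in> test_functions \<Omega>"
    using bounded_subset[OF compact_imp_bounded[OF K(1)] order_trans[OF closure_subset sub]] sub K
    by (auto simp: test_functions_def compact_closure)
  show "grad (\<lambda>x. a * \<eta> x + b * \<zeta> x) x = a *\<^sub>R grad \<eta> x + b *\<^sub>R grad \<zeta> x"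
    by (rule grad_eqI, rule has_derivative_eq_rhs,
      (rule derivative_intros test_has_derivative[OF assms(1)] test_has_derivative[OF assms(2)])+)
      (auto simp: inner_add_left)
qed

text \<open>The parameter \<open>k\<close> controls the width of the transition layer: each factor belongs to one face, vanishes
beyond it and up to the distance \<open>1/k\<close> before it, and tends to \<open>1\<close> further inside as \<open>k\<close> grows.\<close>

definition box_bump :: "real^'n \<Rightarrow> real^'n \<Rightarrow> nat \<Rightarrow> real^'n \<Rightarrow> real" where
  "box_bump a b k x = (\<Prod>i\<in>Basis. flat 0 (real k * (x \<bullet> i - a \<bullet> i) - 1) * flat 0 (real k * (b \<bullet> i - x \<bullet> i) - 1))"

lemma flat0_bounds: "0 \<le> flat 0 t" "flat 0 t \<le> 1" by (auto simp: flat_def)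

lemma box_bump_bounds: "0 \<le> box_bump a b k x" "box_bump a b k x \<le> 1"
  unfolding box_bump_def by (auto intro!: prod_nonneg prod_le_1 mult_nonneg_nonneg mult_le_one flat0_bounds)

lemma box_bump_outside: "x \<notin> box a b \<Longrightarrow> box_bump a b k x = 0"
proof -
  assume "x \<notin> box a b"
  then obtain i where i: "i \<in> Basis" "x \<bullet> i \<le> a \<bullet> i \<or> b \<bullet> i \<le> x \<bullet> i" by (auto simp: mem_box not_less)
  have "real k * (x \<bullet> i - a \<bullet> i) - 1 \<le> 0 \<or> real k * (b \<bullet> i - x \<bullet> i) - 1 \<le> 0"
    using i(2) by (auto simp: mult_nonneg_nonpos intro: order_trans[of _ 0])
  then show ?thesis using i(1) unfolding box_bump_def
    by (auto intro!: prod_zero bexI[of _ i])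
qed

lemma box_bump_test:
  assumes "cbox a b \<subseteq> \<Omega>"
  shows "box_bump a b k \<in> test_functions \<Omega>"
proof -
  have "Ck_on j UNIV (\<lambda>x. flat 0 (real k * (x \<bullet> i - a \<bullet> i) - 1))" for i j
  proof (rule Ck_on_flat)
    show "Ck_on j UNIV (\<lambda>x. real k * (x \<bullet> i - a \<bullet> i) - 1)"
      using Ck_on_affine[of j UNIV "real k *\<^sub>R i" "- real k * (a \<bullet> i) - 1"] by (simp add: algebra_simps)
  qed
  moreover have "Ck_on j UNIV (\<lambda>x. flat 0 (real k * (b \<bullet> i - x \<bullet> i) - 1))" for i j
  proof (rule Ck_on_flat)
    show "Ck_on j UNIV (\<lambda>x. real k * (b \<bullet> i - x \<bullet> i) - 1)"
      using Ck_on_affine[of j UNIV "- real k *\<^sub>R i" "real k * (b \<bullet> i) - 1"] by (simp add: algebra_simps)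
  qed
  ultimately have "smooth_on UNIV (box_bump a b k)"
    unfolding smooth_on_def box_bump_def[abs_def] by (intro allI Ck_on_prod Ck_on_mult) auto
  moreover have sub: "closure {x. box_bump a b k x \<noteq> 0} \<subseteq> cbox a b"
    using box_bump_outside[of _ a b k] box_subset_cbox[of a b] by (intro closure_minimal) auto
  moreover have "compact (closure {x. box_bump a b k x \<noteq> 0})"
    using bounded_subset[OF bounded_cbox order_trans[OF closure_subset sub]] by (simp add: compact_closure)
  ultimately show ?thesis using assms by (auto simp: test_functions_def)
qed

text \<open>The bounded pointwise limit makes indicators of open boxes accessible to integrals against test functions.\<close>

lemma box_bump_tendsto:
  fixes x :: "real^'n"
  shows "(\<lambda>k. box_bump a b k x) \<longlonglongrightarrow> indicator (box a b) x"
proof (cases "x \<in> box a b")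
  case False
  then show ?thesis by (simp add: box_bump_outside)
next
  case True
  have lim: "(\<lambda>k. flat 0 (real k * t - 1)) \<longlonglongrightarrow> 1" if "0 < t" for t
  proof -
    have inf: "filterlim (\<lambda>k. real k * t - 1) at_top sequentially"
      using that by real_asymp
    have "(\<lambda>k. exp (- inverse (real k * t - 1))) \<longlonglongrightarrow> exp (- 0)"
      by (intro tendsto_intros tendsto_inverse_0_at_top inf)
    moreover have "\<forall>\<^sub>F k in sequentially. exp (- inverse (real k * t - 1)) = flat 0 (real k * t - 1)"
      using filterlim_at_top_dense[THEN iffD1, OF inf, rule_format, of 0]
      by eventually_elim (simp add: flat_def)
    ultimately show ?thesis by (auto elim: Lim_transform_eventually)
  qed
  have "(\<lambda>k. flat 0 (real k * (x \<bullet> i - a \<bullet> i) - 1) * flat 0 (real k * (b \<bullet> i - x \<bullet> i) - 1)) \<longlonglongrightarrow> 1 * 1"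
    if "i \<in> Basis" for i :: "real^'n"
    using True that by (intro tendsto_mult lim) (auto simp: mem_box)
  from Limits.tendsto_prod[OF this] have "(\<lambda>k. box_bump a b k x) \<longlonglongrightarrow> (\<Prod>i\<in>(Basis::(real^'n) set). 1 * 1)"
    unfolding box_bump_def .
  then show ?thesis using True by simp
qed

section \<open>Weak gradients\<close>

text \<open>Borel functions that vanish off the domain can be integrated on the whole space, where translations are available.\<close>

lemma lebesgue_on_cong_lborel:
  fixes f :: "real^'n \<Rightarrow> 'b::{banach, second_countable_topology}"
  assumes "f \<in> borel_measurable borel" "\<Omega> \<in> sets lebesgue" "\<And>x. x \<notin> \<Omega> \<Longrightarrow> f x = 0"
  shows "integral\<^sup>L (lebesgue_on \<Omega>) f = integral\<^sup>L lborel f"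
    "integrable (lebesgue_on \<Omega>) f \<longleftrightarrow> integrable lborel f"
proof -
  have eq: "(\<lambda>x. indicator \<Omega> x *\<^sub>R f x) = f" using assms(3) by (auto simp: indicator_def)
  show "integral\<^sup>L (lebesgue_on \<Omega>) f = integral\<^sup>L lborel f"
    using assms by (simp add: integral_restrict_space eq integral_completion)
  show "integrable (lebesgue_on \<Omega>) f \<longleftrightarrow> integrable lborel f"
    using assms by (simp add: integrable_restrict_space eq integrable_completion)
qed

lemma integrable_compact_support:
  fixes f :: "'a::euclidean_space \<Rightarrow> 'b::{banach, second_countable_topology}"
  assumes "continuous_on UNIV f" "compact K" "\<And>x. x \<notin> K \<Longrightarrow> f x = 0"
  shows "integrable lborel f"
proof -
  have "integrable lborel (\<lambda>x. indicator K x *\<^sub>R f x)"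
    using assms by (intro borel_integrable_compact) (auto intro: continuous_on_subset)
  moreover have "(\<lambda>x. indicator K x *\<^sub>R f x) = f" using assms(3) by (auto simp: indicator_def)
  ultimately show ?thesis by simp
qed

lemma bounded_compact_support:
  fixes f :: "'a::euclidean_space \<Rightarrow> 'b::real_normed_vector"
  assumes "continuous_on UNIV f" "compact K" "\<And>x. x \<notin> K \<Longrightarrow> f x = 0"
  obtains B where "0 < B" "\<And>x. norm (f x) \<le> B"
proof -
  have "compact (f ` K)" using assms by (intro compact_continuous_image) (auto intro: continuous_on_subset)
  then obtain B where B: "0 < B" "\<And>y. y \<in> f ` K \<Longrightarrow> norm y \<le> B"
    using compact_imp_bounded[of "f ` K"] unfolding bounded_pos by blast
  have "norm (f x) \<le> B" for x
  proof (cases "x \<in> K")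
    case False
    then show ?thesis using assms(3)[of x] B(1) by simp
  qed (use B in auto)
  then show thesis using that B(1) by blast
qed

lemma integral_translate:
  fixes f :: "'a::euclidean_space \<Rightarrow> 'b::{banach, second_countable_topology}"
  assumes [measurable]: "f \<in> borel_measurable borel"
  shows "(LINT x|lborel. f (x + c)) = (LINT x|lborel. f x)"
proof -
  have "(LINT x|lborel. f x) = (LINT x|distr lborel borel ((+) c). f x)"
    by (simp add: lborel_distr_plus)
  also have "\<dots> = (LINT x|lborel. f (c + x))" by (rule integral_distr) auto
  finally show ?thesis by (simp add: add.commute)
qed

text \<open>The mean value inequality on a segment.\<close>

lemma line_difference_bound:
  fixes u :: "'a::euclidean_space \<Rightarrow> real"
  assumes "\<And>x. (u has_derivative (\<lambda>v. D x \<bullet> v)) (at x)" "\<And>x. norm (D x) \<le> B"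
  shows "\<bar>u (x + z) - u x\<bar> \<le> B * norm z"
proof -
  have on: "onorm (\<lambda>v. D y \<bullet> v) \<le> B" for y
  proof (rule onorm_le)
    fix v show "norm (D y \<bullet> v) \<le> B * norm v"
      using Cauchy_Schwarz_ineq2[of "D y" v] mult_right_mono[OF assms(2), of "norm v" y] by simp
  qed
  have "norm (u (x + z) - u x) \<le> B * norm (x + z - x)"
    using assms(1) by (intro differentiable_bound[of UNIV u "\<lambda>y v. D y \<bullet> v"] on) auto
  then show ?thesis by simp
qed

lemma DERIV_line:
  fixes u :: "'a::euclidean_space \<Rightarrow> real"
  assumes "\<And>x. (u has_derivative (\<lambda>v. D x \<bullet> v)) (at x)"
  shows "((\<lambda>t. u (x + t *\<^sub>R z)) has_real_derivative D (x + t *\<^sub>R z) \<bullet> z) (at t)"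
proof -
  have "((\<lambda>t. x + t *\<^sub>R z) has_derivative (\<lambda>h. h *\<^sub>R z)) (at t)"
    by (auto intro!: derivative_eq_intros)
  from has_derivative_compose[OF this assms[of "x + t *\<^sub>R z"]]
  have "((\<lambda>t. u (x + t *\<^sub>R z)) has_derivative (\<lambda>h. D (x + t *\<^sub>R z) \<bullet> (h *\<^sub>R z))) (at t)" .
  then show ?thesis unfolding has_field_derivative_def
    by (rule has_derivative_eq_rhs) (auto simp: fun_eq_iff)
qed

text \<open>Translation invariance makes the integral of every difference quotient vanish; the quotients are dominated because
they are bounded and live in a fixed compact neighbourhood of the support.\<close>

lemma integral_gradient_eq_0:
  fixes u :: "'a::euclidean_space \<Rightarrow> real"
  assumes D: "\<And>x. (u has_derivative (\<lambda>v. D x \<bullet> v)) (at x)" and cD: "continuous_on UNIV D"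
    and K: "compact K" "\<And>x. x \<notin> K \<Longrightarrow> u x = 0" "\<And>x. x \<notin> K \<Longrightarrow> D x = 0"
  shows "(LINT x|lborel. D x \<bullet> z) = 0"
proof -
  have cu: "continuous_on UNIV u"
    by (rule continuous_at_imp_continuous_on) (simp add: has_derivative_continuous[OF D])
  have [measurable]: "u \<in> borel_measurable borel" "D \<in> borel_measurable borel"
    using cu cD by (auto intro: borel_measurable_continuous_onI)
  have iu: "integrable lborel u" by (rule integrable_compact_support[OF cu K(1,2)])
  obtain B where B: "0 < B" "\<And>x. norm (D x) \<le> B"
    using bounded_compact_support[OF cD K(1,3)] by blast
  \<comment> \<open>All translates of \<open>K\<close> by the increments of the difference quotients lie in \<open>K'\<close>.\<close>
  define K' where "K' = {x + y |x y. x \<in> K \<and> y \<in> cball 0 (norm z)}"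
  have K': "compact K'" unfolding K'_def using K(1) by (intro compact_sums) auto
  define t where "t n = inverse (real (Suc n))" for n
  have t: "0 < t n" "t n \<le> 1" for n by (auto simp: t_def field_simps)
  define F where "F n x = (u (x + t n *\<^sub>R z) - u x) / t n" for n x
  have [measurable]: "F n \<in> borel_measurable borel" for n unfolding F_def[abs_def] by measurable
  have "integrable lborel (\<lambda>x. u (x + c))" for c
  proof -
    have "integrable (distr lborel borel ((+) c)) u" using iu by (simp add: lborel_distr_plus)
    then show ?thesis by (subst (asm) integrable_distr_eq) (auto simp: add.commute)
  qed
  then have F0: "(LINT x|lborel. F n x) = 0" for n
    using iu integral_translate[of u "t n *\<^sub>R z"] by (simp add: F_def)
  have "(\<lambda>n. LINT x|lborel. F n x) \<longlonglongrightarrow> (LINT x|lborel. D x \<bullet> z)"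
  proof (rule integral_dominated_convergence[where w="\<lambda>x. indicator K' x *\<^sub>R (B * norm z)"])
    show "integrable lborel (\<lambda>x. indicator K' x *\<^sub>R (B * norm z))"
      using K' by (intro borel_integrable_compact) auto
    show "AE x in lborel. (\<lambda>n. F n x) \<longlonglongrightarrow> D x \<bullet> z"
    proof (rule AE_I2)
      fix x
      have "((\<lambda>h. (u (x + h *\<^sub>R z) - u x) / h) \<longlongrightarrow> D x \<bullet> z) (at 0)"
        using DERIV_line[OF D, of x z 0] by (simp add: DERIV_def)
      moreover have "filterlim t (at 0) sequentially"
        unfolding t_def filterlim_at using LIMSEQ_inverse_real_of_nat by auto
      ultimately show "(\<lambda>n. F n x) \<longlonglongrightarrow> D x \<bullet> z" unfolding F_def by (rule filterlim_compose)
    qed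
    fix n
    show "AE x in lborel. norm (F n x) \<le> indicator K' x *\<^sub>R (B * norm z)"
    proof (rule AE_I2)
      fix x
      show "norm (F n x) \<le> indicator K' x *\<^sub>R (B * norm z)"
      proof (cases "x \<in> K'")
        case True
        have "\<bar>u (x + t n *\<^sub>R z) - u x\<bar> \<le> B * norm (t n *\<^sub>R z)" by (rule line_difference_bound[OF D B(2)])
        then show ?thesis using True t[of n] by (simp add: F_def field_simps)
      next
        case False
        have nz: "norm (t n *\<^sub>R z) \<le> norm z" using t[of n] by (simp add: mult_left_le_one_le)
        have "x + 0 \<in> K'" if "x \<in> K" unfolding K'_def using that by (intro CollectI exI conjI) auto
        then have "x \<notin> K" using False by auto
        moreover have "x + t n *\<^sub>R z \<notin> K"
        proof
          assume "x + t n *\<^sub>R z \<in> K"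
          then have "(x + t n *\<^sub>R z) + (- (t n *\<^sub>R z)) \<in> K'" unfolding K'_def using nz by fastforce
          then show False using False by simp
        qed
        ultimately show ?thesis using K(2) B(1) by (simp add: F_def)
      qed
    qed
  qed auto
  then show ?thesis unfolding F0 using LIMSEQ_unique tendsto_const by blast
qed

lemma open_sets_lebesgue: "open \<Omega> \<Longrightarrow> \<Omega> \<in> sets lebesgue"
  by (simp add: borel_open sets_completionI_sets)

text \<open>Integration by parts for test functions: the gradient of the product of two of them has integral zero.\<close>

lemma has_weak_grad_test:
  fixes \<eta> :: "real^'n \<Rightarrow> real"
  assumes \<Omega>: "open \<Omega>" and \<eta>: "\<eta> \<in> test_functions \<Omega>"
  shows "has_weak_grad \<Omega> \<eta> (grad \<eta>)"
  unfolding has_weak_grad_def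
proof (intro conjI allI impI ballI)
  fix K assume K: "compact K \<and> K \<subseteq> \<Omega>"
  have set: "set_integrable lebesgue K f" if f: "continuous_on UNIV f" for f :: "real^'n \<Rightarrow> 'b::euclidean_space"
  proof -
    have [measurable]: "f \<in> borel_measurable borel" using f by (rule borel_measurable_continuous_onI)
    have [measurable]: "K \<in> sets borel" using K by (simp add: borel_compact)
    have "integrable lborel (\<lambda>x. indicator K x *\<^sub>R f x)"
      using K f by (intro borel_integrable_compact) (auto intro: continuous_on_subset)
    then show ?thesis unfolding set_integrable_def by (subst integrable_completion) auto
  qed
  show "\<eta> absolutely_integrable_on K" by (rule set[OF continuous_on_test[OF \<eta>]])
  show "grad \<eta> absolutely_integrable_on K" by (rule set[OF continuous_on_grad[OF \<eta>]])
next
  fix \<zeta> i assume \<zeta>: "\<zeta> \<in> test_functions \<Omega>"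
  obtain K where K: "compact K" "K \<subseteq> \<Omega>" "\<And>x. x \<notin> K \<Longrightarrow> \<eta> x = 0" "\<And>x. x \<notin> K \<Longrightarrow> grad \<eta> x = 0"
    using test_support[OF \<eta>] by blast
  note cont = continuous_on_test[OF \<eta>, of UNIV] continuous_on_test[OF \<zeta>, of UNIV]
    continuous_on_grad[OF \<eta>, of UNIV] continuous_on_grad[OF \<zeta>, of UNIV]
  have 0: "(LINT x|lborel. (\<eta> x *\<^sub>R grad \<zeta> x + \<zeta> x *\<^sub>R grad \<eta> x) \<bullet> axis i 1) = 0"
  proof (rule integral_gradient_eq_0[where u="\<lambda>x. \<eta> x * \<zeta> x" and K=K])
    fix x show "((\<lambda>x. \<eta> x * \<zeta> x) has_derivative (\<lambda>v. (\<eta> x *\<^sub>R grad \<zeta> x + \<zeta> x *\<^sub>R grad \<eta> x) \<bullet> v)) (at x)"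
      by (rule has_derivative_eq_rhs[OF has_derivative_mult[OF test_has_derivative[OF \<eta>] test_has_derivative[OF \<zeta>]]])
        (auto simp: inner_add_left)
  qed (use K cont in \<open>auto intro!: continuous_intros\<close>)
  have out: "\<eta> x = 0" "grad \<eta> x = 0" if "x \<notin> \<Omega>" for x using K that by auto
  have c1: "continuous_on UNIV (\<lambda>x. \<eta> x * (grad \<zeta> x $ i))" "continuous_on UNIV (\<lambda>x. grad \<eta> x $ i * \<zeta> x)"
    using cont by (auto intro!: continuous_intros)
  have i1: "integrable lborel (\<lambda>x. \<eta> x * (grad \<zeta> x $ i))" "integrable lborel (\<lambda>x. grad \<eta> x $ i * \<zeta> x)"
    using K by (auto intro!: integrable_compact_support[OF _ K(1)] c1)
  have "(LINT x|lborel. \<eta> x * (grad \<zeta> x $ i)) + (LINT x|lborel. grad \<eta> x $ i * \<zeta> x) = 0"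
    using 0 unfolding Bochner_Integration.integral_add[OF i1, symmetric]
    by (simp add: inner_axis inner_add_left mult.commute)
  moreover have "(LINT x|lebesgue_on \<Omega>. \<eta> x * (grad \<zeta> x $ i)) = (LINT x|lborel. \<eta> x * (grad \<zeta> x $ i))"
    by (intro lebesgue_on_cong_lborel borel_measurable_continuous_onI c1 open_sets_lebesgue \<Omega>) (simp add: out)
  moreover have "(LINT x|lebesgue_on \<Omega>. grad \<eta> x $ i * \<zeta> x) = (LINT x|lborel. grad \<eta> x $ i * \<zeta> x)"
    by (intro lebesgue_on_cong_lborel borel_measurable_continuous_onI c1 open_sets_lebesgue \<Omega>) (simp add: out)
  ultimately show "(LINT x|lebesgue_on \<Omega>. \<eta> x * frechet_derivative \<zeta> (at x) (axis i 1)) = - (LINT x|lebesgue_on \<Omega>. grad \<eta> x $ i * \<zeta> x)"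
    by (simp add: grad_def)
qed

lemma integrable_times_compact_support:
  fixes f c :: "real^'n \<Rightarrow> real"
  assumes \<Omega>: "\<Omega> \<in> sets lebesgue" and f: "f absolutely_integrable_on K" and K: "compact K" "K \<subseteq> \<Omega>"
    and c: "continuous_on UNIV c" "\<And>x. x \<notin> K \<Longrightarrow> c x = 0"
  shows "integrable (lebesgue_on \<Omega>) (\<lambda>x. f x * c x)"
proof -
  obtain B where B: "0 < B" "\<And>x. norm (c x) \<le> B"
    using bounded_compact_support[OF c(1) K(1) c(2)] by blast
  have "c \<in> borel_measurable borel" using c by (intro borel_measurable_continuous_onI)
  then have [measurable]: "c \<in> borel_measurable lebesgue" by (intro measurable_completion) simp
  have i: "integrable lebesgue (\<lambda>x. indicator K x * f x)" using f by (simp add: set_integrable_def)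
  have [measurable]: "(\<lambda>x. indicator K x * f x) \<in> borel_measurable lebesgue" using i by simp
  have "integrable lebesgue (\<lambda>x. (indicator K x * f x) * c x)"
  proof (rule Bochner_Integration.integrable_bound[of _ "\<lambda>x. B * (indicator K x * f x)"])
    show "integrable lebesgue (\<lambda>x. B * (indicator K x * f x))" using i by simp
    show "AE x in lebesgue. norm (indicator K x * f x * c x) \<le> norm (B * (indicator K x * f x))"
      using B by (intro AE_I2) (auto simp: abs_mult mult.commute intro!: mult_right_mono)
  qed measurable
  moreover have "(indicator K x * f x) * c x = indicator \<Omega> x *\<^sub>R (f x * c x)" for x
    using c(2)[of x] K(2) by (cases "x \<in> K") auto
  ultimately show ?thesis using \<Omega> by (simp add: integrable_restrict_space)
qed

lemma absolutely_integrable_nth: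
  fixes g :: "real^'n \<Rightarrow> real^'m"
  shows "g absolutely_integrable_on K \<Longrightarrow> (\<lambda>x. g x $ i) absolutely_integrable_on K"
  unfolding set_integrable_def
  by (drule integrable_bounded_linear[OF bounded_linear_vec_nth[of i]]) simp

text \<open>Open boxes form an intersection-stable generator of the Borel sets, so an integrable function whose integrals over boxes
vanish has vanishing integrals over all Borel sets.\<close>

lemma borel_null_by_boxes:
  fixes f :: "'a::euclidean_space \<Rightarrow> real"
  assumes f: "integrable lborel f" and boxes: "\<And>a b. (LINT x:box a b|lborel. f x) = 0"
  shows "AE x in lborel. f x = 0"
proof (rule sigma_finite_measure.density_zero[OF lborel.sigma_finite_measure_axioms f])
  \<comment> \<open>The total integral, as a limit over growing boxes; it is needed for complements.\<close>
  have tot: "(LINT x|lborel. f x) = 0"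
  proof (rule LIMSEQ_unique)
    show "(\<lambda>n::nat. LINT x:box (- (real n *\<^sub>R One)) (real n *\<^sub>R One)|lborel. f x) \<longlonglongrightarrow> (LINT x|lborel. f x)"
      unfolding set_lebesgue_integral_def
    proof (rule integral_dominated_convergence[where w="\<lambda>x. norm (f x)"])
      show "AE x in lborel. (\<lambda>n::nat. indicat_real (box (- (real n *\<^sub>R One)) (real n *\<^sub>R One)) x *\<^sub>R f x) \<longlonglongrightarrow> f x"
      proof (rule AE_I2, rule tendsto_eventually)
        fix x :: 'a
        obtain n0 :: nat where n0: "norm x < real n0" using reals_Archimedean2 by blast
        have "x \<in> box (- (real n *\<^sub>R One)) (real n *\<^sub>R One)" if "n0 \<le> n" for n
          unfolding mem_box
        proof
          fix i :: 'a assume i: "i \<in> Basis"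
          have "\<bar>x \<bullet> i\<bar> < real n" using Basis_le_norm[OF i, of x] n0 that by linarith
          then show "- (real n *\<^sub>R One) \<bullet> i < x \<bullet> i \<and> x \<bullet> i < (real n *\<^sub>R One) \<bullet> i" using i by auto
        qed
        then show "\<forall>\<^sub>F n in sequentially. indicat_real (box (- (real n *\<^sub>R One)) (real n *\<^sub>R One)) x *\<^sub>R f x = f x"
          unfolding eventually_sequentially by (intro exI[of _ n0]) auto
      qed
    qed (use f in \<open>auto simp: indicator_def\<close>)
    show "(\<lambda>n::nat. LINT x:box (- (real n *\<^sub>R One)) (real n *\<^sub>R One)|lborel. f x) \<longlonglongrightarrow> 0" using boxes by simp
  qed
  have si: "set_integrable lborel A f" if "A \<in> sets borel" for A
    using integrable_mult_indicator[of A lborel f] f that by (simp add: set_integrable_def)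
  fix A :: "'a set" assume A: "A \<in> sets lborel"
  have "Int_stable (range (\<lambda>(a, b). box a b :: 'a set))"
    by (auto simp: Int_stable_def box_Int_box)
  moreover have "range (\<lambda>(a, b). box a b :: 'a set) \<subseteq> Pow UNIV" by simp
  moreover have "A \<in> sigma_sets UNIV (range (\<lambda>(a, b). box a b))"
    using A by (simp add: borel_eq_box)
  ultimately show "(LINT x:A|lborel. f x) = 0"
  proof (induction rule: sigma_sets_induct_disjoint)
    case (basic A) then show ?case using boxes by auto
  next
    case empty then show ?case by (simp add: set_lebesgue_integral_def)
  next
    case (compl A)
    then have A: "A \<in> sets borel" by (simp add: borel_eq_box)
    have "(LINT x:UNIV|lborel. f x) = (LINT x:A|lborel. f x) + (LINT x:UNIV - A|lborel. f x)"
      using set_integral_Un[of A "UNIV - A" lborel f] si A by (simp add: Un_Diff_cancel)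
    then show ?case using tot compl by (simp add: set_lebesgue_integral_def)
  next
    case (union A)
    then have A: "A i \<in> sets borel" for i by (auto simp: borel_eq_box)
    show ?case using union A
      by (subst lebesgue_integral_countable_add) (auto simp: disjoint_family_on_def intro!: si)
  qed
qed

text \<open>Du Bois-Reymond: bumps converge boundedly to indicators of boxes, so the integral of \<open>g\<close> over every box whose closure lies in
the domain vanishes. Inside one closed box this gives \<open>g = 0\<close> almost everywhere, and countably many such boxes
exhaust the domain.\<close>

lemma fundamental_lemma:
  fixes g :: "real^'n \<Rightarrow> real"
  assumes \<Omega>: "open \<Omega>" and g: "\<And>K. compact K \<Longrightarrow> K \<subseteq> \<Omega> \<Longrightarrow> g absolutely_integrable_on K"
    and 0: "\<And>\<eta>. \<eta> \<in> test_functions \<Omega> \<Longrightarrow> (LINT x|lebesgue_on \<Omega>. g x * \<eta> x) = 0"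
  shows "AE x in lebesgue_on \<Omega>. g x = 0"
proof -
  have \<Omega>m: "\<Omega> \<in> sets lebesgue" using \<Omega> by (rule open_sets_lebesgue)
  have zero: "(LINT x|lebesgue. indicator (box a b) x * g x) = 0" if ab: "cbox a b \<subseteq> \<Omega>" for a b
  proof -
    have ig: "integrable lebesgue (\<lambda>x. indicator (cbox a b) x * g x)"
      using g[OF _ ab] by (simp add: set_integrable_def)
    have m[measurable]: "(\<lambda>x. indicator (cbox a b) x * g x) \<in> borel_measurable lebesgue" using ig by simp
    have b0: "(LINT x|lebesgue. box_bump a b k x * (indicator (cbox a b) x * g x)) = 0" for k
    proof -
      have "(\<lambda>x. box_bump a b k x * (indicator (cbox a b) x * g x)) = (\<lambda>x. indicator \<Omega> x *\<^sub>R (g x * box_bump a b k x))"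
        using ab box_bump_outside[of _ a b k] box_subset_cbox[of a b] by (auto simp: indicator_def fun_eq_iff)
      then show ?thesis using 0[OF box_bump_test[OF ab]] \<Omega>m by (simp add: integral_restrict_space)
    qed
    have "(\<lambda>k. LINT x|lebesgue. box_bump a b k x * (indicator (cbox a b) x * g x)) \<longlonglongrightarrow>
      (LINT x|lebesgue. indicator (box a b) x * (indicator (cbox a b) x * g x))"
    proof (rule integral_dominated_convergence[where w="\<lambda>x. norm (indicator (cbox a b) x * g x)"])
      have "box_bump a b k \<in> borel_measurable borel" for k
        by (rule borel_measurable_continuous_onI[OF continuous_on_test[OF box_bump_test[OF ab]]])
      then have bm: "box_bump a b k \<in> borel_measurable lebesgue" for k
        by (intro measurable_completion) simp
      show "(\<lambda>x. box_bump a b k x * (indicator (cbox a b) x * g x)) \<in> borel_measurable lebesgue" for k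
        by (intro borel_measurable_times bm m)
      show "(\<lambda>x. indicator (box a b) x * (indicator (cbox a b) x * g x)) \<in> borel_measurable lebesgue"
        by (intro borel_measurable_times m borel_measurable_indicator) simp
      show "AE x in lebesgue. (\<lambda>k. box_bump a b k x * (indicator (cbox a b) x * g x)) \<longlonglongrightarrow> indicator (box a b) x * (indicator (cbox a b) x * g x)"
        by (intro AE_I2 tendsto_intros box_bump_tendsto)
      show "AE x in lebesgue. norm (box_bump a b k x * (indicator (cbox a b) x * g x)) \<le> norm (indicator (cbox a b) x * g x)" for k
        using box_bump_bounds[of a b k] by (intro AE_I2) (auto simp: abs_mult mult_left_le_one_le)
    qed (use ig in auto)
    then have "(LINT x|lebesgue. indicator (box a b) x * (indicator (cbox a b) x * g x)) = 0"
      unfolding b0 using LIMSEQ_unique tendsto_const by blast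
    moreover have "(\<lambda>x. indicator (box a b) x * (indicator (cbox a b) x * g x)) = (\<lambda>x. indicator (box a b) x * g x)"
      using box_subset_cbox[of a b] by (auto simp: indicator_def fun_eq_iff)
    ultimately show ?thesis by simp
  qed
  have local: "AE x in lebesgue. x \<in> cbox a b \<longrightarrow> g x = 0" if ab: "cbox a b \<subseteq> \<Omega>" for a b
  proof -
    have ig: "integrable lebesgue (\<lambda>x. indicator (cbox a b) x * g x)"
      using g[OF _ ab] by (simp add: set_integrable_def)
    then obtain G where G[measurable]: "G \<in> borel_measurable lborel" and GE: "AE x in lborel. indicator (cbox a b) x * g x = G x"
      using completion_ex_borel_measurable_real[of "\<lambda>x. indicator (cbox a b) x * g x" lborel] by auto
    from GE have GE': "AE x in lebesgue. indicator (cbox a b) x * g x = G x" by (rule AE_completion)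
    have "integrable lebesgue G"
      using ig integrable_cong_AE[OF borel_measurable_integrable[OF ig] measurable_completion[OF G] GE'] by simp
    then have iG: "integrable lborel G" by (simp add: integrable_completion)
    have "AE x in lborel. G x = 0"
    proof (rule borel_null_by_boxes[OF iG])
      fix c d :: "real^'n"
      \<comment> \<open>The intersection of the two boxes is again a box.\<close>
      define a' where "a' = (\<Sum>i\<in>Basis. max (a\<bullet>i) (c\<bullet>i) *\<^sub>R i)"
      define b' where "b' = (\<Sum>i\<in>Basis. min (b\<bullet>i) (d\<bullet>i) *\<^sub>R i)"
      have eq: "box a' b' = box a b \<inter> box c d" unfolding a'_def b'_def by (rule box_Int_box[symmetric])
      have "cbox a' b' \<subseteq> cbox a b" unfolding a'_def b'_def by (auto simp: mem_box)
      then have z: "(LINT x|lebesgue. indicator (box a' b') x * g x) = 0" using ab by (intro zero) auto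
      have "AE x in lborel. x \<notin> cbox a b - box a b"
      proof (rule AE_not_in)
        have "emeasure lborel (cbox a b - box a b) = emeasure lborel (cbox a b) - emeasure lborel (box a b)"
          by (rule emeasure_Diff) (auto simp: box_subset_cbox emeasure_lborel_box_eq)
        then show "cbox a b - box a b \<in> null_sets lborel"
          by (simp add: null_sets_def emeasure_lborel_cbox_eq emeasure_lborel_box_eq)
      qed
      then have bd: "AE x in lebesgue. x \<notin> cbox a b - box a b" by (rule AE_completion)
      have "(LINT x:box c d|lborel. G x) = (LINT x|lebesgue. indicator (box c d) x * G x)"
        unfolding set_lebesgue_integral_def by (subst integral_completion) auto
      also have "\<dots> = (LINT x|lebesgue. indicator (box a' b') x * g x)"
      proof (rule integral_cong_AE)
        show "(\<lambda>x. indicator (box c d) x * G x) \<in> borel_measurable lebesgue"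
          using G by (intro measurable_completion) auto
        have "(\<lambda>x. indicator (box a' b') x * g x) = (\<lambda>x. indicator (box a' b') x * (indicator (cbox a b) x * g x))"
          using \<open>cbox a' b' \<subseteq> cbox a b\<close> box_subset_cbox[of a' b'] by (auto simp: indicator_def fun_eq_iff)
        moreover have "(\<lambda>x. indicator (box a' b') x * (indicator (cbox a b) x * g x)) \<in> borel_measurable lebesgue"
          by (intro borel_measurable_times borel_measurable_indicator borel_measurable_integrable[OF ig]) simp
        ultimately show "(\<lambda>x. indicator (box a' b') x * g x) \<in> borel_measurable lebesgue" by (simp only:)
        show "AE x in lebesgue. indicator (box c d) x * G x = indicator (box a' b') x * g x"
          using GE' bd by eventually_elim (use box_subset_cbox[of a b] in \<open>auto simp: eq indicator_def split: if_splits\<close>)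
      qed
      finally show "(LINT x:box c d|lborel. G x) = 0" using z by simp
    qed
    then have "AE x in lebesgue. G x = 0" by (rule AE_completion)
    with GE' show ?thesis by eventually_elim (auto simp: indicator_def)
  qed
  obtain \<D> where D: "countable \<D>" "\<D> \<subseteq> Pow \<Omega>" "\<And>X. X \<in> \<D> \<Longrightarrow> \<exists>a b. X = cbox a b" "\<Union>\<D> = \<Omega>"
    using open_countable_Union_open_cbox[OF \<Omega>] by blast
  have "AE x in lebesgue. \<forall>X\<in>\<D>. x \<in> X \<longrightarrow> g x = 0"
    unfolding AE_ball_countable[OF D(1)]
  proof
    fix X assume X: "X \<in> \<D>"
    then obtain a b where ab: "X = cbox a b" using D(3) by blast
    show "AE x in lebesgue. x \<in> X \<longrightarrow> g x = 0" using X D(2) unfolding ab by (intro local) auto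
  qed
  then have "AE x in lebesgue. x \<in> \<Omega> \<longrightarrow> g x = 0" by eventually_elim (use D(4) in auto)
  then show ?thesis using \<Omega>m by (simp add: AE_restrict_space_iff)
qed

lemma test_support_nth:
  assumes "\<eta> \<in> test_functions \<Omega>"
  obtains K where "compact K" "K \<subseteq> \<Omega>" "\<And>x. x \<notin> K \<Longrightarrow> \<eta> x = 0"
    "\<And>x i. x \<notin> K \<Longrightarrow> frechet_derivative \<eta> (at x) (axis i 1) = 0"
    "continuous_on UNIV \<eta>" "\<And>i. continuous_on UNIV (\<lambda>x. frechet_derivative \<eta> (at x) (axis i 1))"
proof -
  have eq: "(\<lambda>x. frechet_derivative \<eta> (at x) (axis i 1)) = (\<lambda>x. grad \<eta> x $ i)" for i by (simp add: grad_def)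
  obtain K where K: "compact K" "K \<subseteq> \<Omega>" "\<And>x. x \<notin> K \<Longrightarrow> \<eta> x = 0" "\<And>x. x \<notin> K \<Longrightarrow> grad \<eta> x = 0"
    using test_support[OF assms] by blast
  show thesis
    using K continuous_on_test[OF assms] continuous_on_grad[OF assms, of UNIV]
    by (intro that[OF K(1-3)]) (auto simp: eq[THEN fun_cong] vec_eq_iff intro!: continuous_intros)
qed

lemma has_weak_grad_unique:
  assumes \<Omega>: "open \<Omega>" and g: "has_weak_grad \<Omega> u g" and k: "has_weak_grad \<Omega> u k"
  shows "AE x in lebesgue_on \<Omega>. g x = k x"
proof -
  have gK: "(\<lambda>x. g x $ i) absolutely_integrable_on K" "(\<lambda>x. k x $ i) absolutely_integrable_on K" if "compact K" "K \<subseteq> \<Omega>" for K i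
    using g k that by (auto simp: has_weak_grad_def intro: absolutely_integrable_nth)
  have "AE x in lebesgue_on \<Omega>. g x $ i - k x $ i = 0" for i
  proof (rule fundamental_lemma[OF \<Omega>])
    fix K assume "compact K" "K \<subseteq> \<Omega>"
    then show "(\<lambda>x. g x $ i - k x $ i) absolutely_integrable_on K" using gK by (intro set_integral_diff(1)) auto
  next
    fix \<eta> assume \<eta>: "\<eta> \<in> test_functions \<Omega>"
    obtain K where K: "compact K" "K \<subseteq> \<Omega>" "\<And>x. x \<notin> K \<Longrightarrow> \<eta> x = 0" "continuous_on UNIV \<eta>"
      using test_support_nth[OF \<eta>] by metis
    have "integrable (lebesgue_on \<Omega>) (\<lambda>x. g x $ i * \<eta> x)" "integrable (lebesgue_on \<Omega>) (\<lambda>x. k x $ i * \<eta> x)"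
      by (rule integrable_times_compact_support[OF open_sets_lebesgue[OF \<Omega>] _ K(1,2,4,3)]; use gK K in blast)+
    then show "(LINT x|lebesgue_on \<Omega>. (g x $ i - k x $ i) * \<eta> x) = 0"
      using g k \<eta> unfolding has_weak_grad_def by (simp add: left_diff_distrib)
  qed
  then have "AE x in lebesgue_on \<Omega>. \<forall>i\<in>UNIV. g x $ i = k x $ i"
    by (subst AE_ball_countable) auto
  then show ?thesis by (simp add: vec_eq_iff)
qed

lemma has_weak_grad_weak_grad: "has_weak_grad \<Omega> u g \<Longrightarrow> has_weak_grad \<Omega> u (weak_grad \<Omega> u)"
  unfolding weak_grad_def using someI[of "has_weak_grad \<Omega> u" g] .

lemma weak_grad_AE: "open \<Omega> \<Longrightarrow> has_weak_grad \<Omega> u g \<Longrightarrow> AE x in lebesgue_on \<Omega>. weak_grad \<Omega> u x = g x"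
  using has_weak_grad_unique[OF _ has_weak_grad_weak_grad] by blast

lemma has_weak_grad_combination:
  assumes \<Omega>: "open \<Omega>" and u: "has_weak_grad \<Omega> u g" and v: "has_weak_grad \<Omega> v k"
  shows "has_weak_grad \<Omega> (\<lambda>x. a * u x + b * v x) (\<lambda>x. a *\<^sub>R g x + b *\<^sub>R k x)"
  unfolding has_weak_grad_def
proof (intro conjI allI impI ballI)
  fix K assume K: "compact K \<and> K \<subseteq> \<Omega>"
  have i: "set_integrable lebesgue K u" "set_integrable lebesgue K v" "set_integrable lebesgue K g" "set_integrable lebesgue K k"
    using u v K by (auto simp: has_weak_grad_def)
  show "(\<lambda>x. a * u x + b * v x) absolutely_integrable_on K"
    using i(1,2) by (intro set_integral_add(1)) auto
  show "(\<lambda>x. a *\<^sub>R g x + b *\<^sub>R k x) absolutely_integrable_on K"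
    using i(3,4) by (intro set_integral_add(1)) auto
next
  fix \<eta> i assume \<eta>: "\<eta> \<in> test_functions \<Omega>"
  let ?d = "\<lambda>x. frechet_derivative \<eta> (at x) (axis i 1)"
  obtain K where K: "compact K" "K \<subseteq> \<Omega>" "\<And>x. x \<notin> K \<Longrightarrow> \<eta> x = 0" "\<And>x. x \<notin> K \<Longrightarrow> ?d x = 0"
     "continuous_on UNIV \<eta>" "continuous_on UNIV ?d"
    using test_support_nth[OF \<eta>] by metis
  have i: "u absolutely_integrable_on K" "v absolutely_integrable_on K"
    "(\<lambda>x. g x $ i) absolutely_integrable_on K" "(\<lambda>x. k x $ i) absolutely_integrable_on K"
    using u v K(1,2) by (auto simp: has_weak_grad_def intro: absolutely_integrable_nth)
  note int = integrable_times_compact_support[OF open_sets_lebesgue[OF \<Omega>] _ K(1,2)]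
  have ii: "integrable (lebesgue_on \<Omega>) (\<lambda>x. u x * ?d x)" "integrable (lebesgue_on \<Omega>) (\<lambda>x. v x * ?d x)"
    "integrable (lebesgue_on \<Omega>) (\<lambda>x. g x $ i * \<eta> x)" "integrable (lebesgue_on \<Omega>) (\<lambda>x. k x $ i * \<eta> x)"
    using int[OF i(1) K(6,4)] int[OF i(2) K(6,4)] int[OF i(3) K(5,3)] int[OF i(4) K(5,3)] by auto
  have e: "(LINT x|lebesgue_on \<Omega>. u x * ?d x) = - (LINT x|lebesgue_on \<Omega>. g x $ i * \<eta> x)"
    "(LINT x|lebesgue_on \<Omega>. v x * ?d x) = - (LINT x|lebesgue_on \<Omega>. k x $ i * \<eta> x)"
    using u v \<eta> by (auto simp: has_weak_grad_def)
  have "(LINT x|lebesgue_on \<Omega>. (a * u x + b * v x) * ?d x) = a * (LINT x|lebesgue_on \<Omega>. u x * ?d x) + b * (LINT x|lebesgue_on \<Omega>. v x * ?d x)"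
    using ii by (simp add: distrib_right mult.assoc)
  also have "\<dots> = - (a * (LINT x|lebesgue_on \<Omega>. g x $ i * \<eta> x) + b * (LINT x|lebesgue_on \<Omega>. k x $ i * \<eta> x))"
    unfolding e by simp
  also have "a * (LINT x|lebesgue_on \<Omega>. g x $ i * \<eta> x) + b * (LINT x|lebesgue_on \<Omega>. k x $ i * \<eta> x) =
      (LINT x|lebesgue_on \<Omega>. (a *\<^sub>R g x + b *\<^sub>R k x) $ i * \<eta> x)"
    using ii by (simp add: distrib_right mult.assoc)
  finally show "(LINT x|lebesgue_on \<Omega>. (a * u x + b * v x) * ?d x) = - (LINT x|lebesgue_on \<Omega>. (a *\<^sub>R g x + b *\<^sub>R k x) $ i * \<eta> x)" .
qed

text \<open>Convergence in mean passes to the integral against a bounded factor; this is how both sides of the definition of weak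
gradients pass to the limit.\<close>

lemma integral_product_tendsto:
  fixes f :: "'a \<Rightarrow> real"
  assumes fn: "\<And>n. integrable M (\<lambda>x. fn n x * c x)" "integrable M (\<lambda>x. f x * c x)"
    and d: "\<And>n. integrable M (\<lambda>x. fn n x - f x)" and B: "\<And>x. \<bar>c x\<bar> \<le> B"
    and lim: "(\<lambda>n. LINT x|M. \<bar>fn n x - f x\<bar>) \<longlonglongrightarrow> 0"
  shows "(\<lambda>n. LINT x|M. fn n x * c x) \<longlonglongrightarrow> (LINT x|M. f x * c x)"
proof (rule LIM_zero_cancel, rule tendsto_rabs_zero_cancel, rule tendsto_sandwich[OF _ _ tendsto_const])
  show "(\<lambda>n. B * (LINT x|M. \<bar>fn n x - f x\<bar>)) \<longlonglongrightarrow> 0"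
    using tendsto_mult_left[OF lim, of B] by simp
  show "\<forall>\<^sub>F n in sequentially. \<bar>(LINT x|M. fn n x * c x) - (LINT x|M. f x * c x)\<bar> \<le> B * (LINT x|M. \<bar>fn n x - f x\<bar>)"
  proof (rule always_eventually, rule allI)
    fix n
    have "\<bar>(LINT x|M. fn n x * c x) - (LINT x|M. f x * c x)\<bar> = \<bar>LINT x|M. fn n x * c x - f x * c x\<bar>"
      using fn by simp
    also have "\<dots> \<le> (LINT x|M. \<bar>fn n x * c x - f x * c x\<bar>)" by (rule integral_abs_bound)
    also have "\<dots> \<le> (LINT x|M. B * \<bar>fn n x - f x\<bar>)"
    proof (rule integral_mono)
      show "integrable M (\<lambda>x. \<bar>fn n x * c x - f x * c x\<bar>)" using fn by auto
      show "integrable M (\<lambda>x. B * \<bar>fn n x - f x\<bar>)" using d by auto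
      show "\<bar>fn n x * c x - f x * c x\<bar> \<le> B * \<bar>fn n x - f x\<bar>" for x
        using mult_right_mono[OF B[of x], of "\<bar>fn n x - f x\<bar>"]
        unfolding left_diff_distrib[symmetric] abs_mult by (simp add: mult.commute)
    qed
    finally show "\<bar>(LINT x|M. fn n x * c x) - (LINT x|M. f x * c x)\<bar> \<le> B * (LINT x|M. \<bar>fn n x - f x\<bar>)" by simp
  qed
qed auto

lemma integrable_lebesgue_on_imp_compact:
  assumes "\<Omega> \<in> sets lebesgue" "compact K" "K \<subseteq> \<Omega>" "integrable (lebesgue_on \<Omega>) f"
  shows "f absolutely_integrable_on K"
proof (rule set_integrable_subset[of _ \<Omega>])
  show "set_integrable lebesgue \<Omega> f" using assms by (simp add: set_integrable_def integrable_restrict_space)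
  show "K \<in> sets lebesgue" using assms by (simp add: borel_compact sets_completionI_sets)
qed fact

text \<open>Weak differentiation is a closed operation with respect to convergence in mean.\<close>

lemma has_weak_grad_limit:
  assumes \<Omega>: "open \<Omega>" and gn: "\<And>n. has_weak_grad \<Omega> (un n) (gn n)"
    and int: "\<And>n. integrable (lebesgue_on \<Omega>) (un n)" "\<And>n. integrable (lebesgue_on \<Omega>) (gn n)"
      "integrable (lebesgue_on \<Omega>) u" "integrable (lebesgue_on \<Omega>) g"
    and lim: "(\<lambda>n. LINT x|lebesgue_on \<Omega>. \<bar>un n x - u x\<bar>) \<longlonglongrightarrow> 0"
      "(\<lambda>n. LINT x|lebesgue_on \<Omega>. norm (gn n x - g x)) \<longlonglongrightarrow> 0"
  shows "has_weak_grad \<Omega> u g"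
  unfolding has_weak_grad_def
proof (intro conjI allI impI ballI)
  have \<Omega>m: "\<Omega> \<in> sets lebesgue" using \<Omega> by (rule open_sets_lebesgue)
  note sub = integrable_lebesgue_on_imp_compact[OF \<Omega>m]
  show "u absolutely_integrable_on K" "g absolutely_integrable_on K" if "compact K \<and> K \<subseteq> \<Omega>" for K
    using that by (auto intro!: sub[OF _ _ int(3)] sub[OF _ _ int(4)])
  fix \<eta> i assume \<eta>: "\<eta> \<in> test_functions \<Omega>"
  let ?d = "\<lambda>x. frechet_derivative \<eta> (at x) (axis i 1)"
  obtain K where K: "compact K" "K \<subseteq> \<Omega>" "\<And>x. x \<notin> K \<Longrightarrow> \<eta> x = 0" "\<And>x. x \<notin> K \<Longrightarrow> ?d x = 0"
     "continuous_on UNIV \<eta>" "continuous_on UNIV ?d"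
    using test_support_nth[OF \<eta>] by metis
  obtain B where B: "\<And>x. \<bar>?d x\<bar> \<le> B" using bounded_compact_support[OF K(6,1,4)] by auto
  obtain B' where B': "\<And>x. \<bar>\<eta> x\<bar> \<le> B'" using bounded_compact_support[OF K(5,1,3)] by auto
  note ints = integrable_times_compact_support[OF \<Omega>m _ K(1,2)]
  have nth: "integrable (lebesgue_on \<Omega>) (\<lambda>x. k x $ i)" if "integrable (lebesgue_on \<Omega>) k" for k
    by (rule integrable_bounded_linear[OF bounded_linear_vec_nth[of i] that])
  have "(\<lambda>n. LINT x|lebesgue_on \<Omega>. un n x * ?d x) \<longlonglongrightarrow> (LINT x|lebesgue_on \<Omega>. u x * ?d x)"
    by (intro integral_product_tendsto[OF _ _ _ B lim(1)] ints[OF sub[OF K(1,2)] K(6,4)] int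
      Bochner_Integration.integrable_diff)
  moreover have L2: "(\<lambda>n. LINT x|lebesgue_on \<Omega>. gn n x $ i * \<eta> x) \<longlonglongrightarrow> (LINT x|lebesgue_on \<Omega>. g x $ i * \<eta> x)"
  proof (intro integral_product_tendsto[OF _ _ _ B'] ints[OF sub[OF K(1,2)] K(5,3)] nth int)
    show "integrable (lebesgue_on \<Omega>) (\<lambda>x. gn n x $ i - g x $ i)" for n
      by (intro Bochner_Integration.integrable_diff nth int)
    show "(\<lambda>n. LINT x|lebesgue_on \<Omega>. \<bar>gn n x $ i - g x $ i\<bar>) \<longlonglongrightarrow> 0"
    proof (rule tendsto_sandwich[OF _ _ tendsto_const lim(2)])
      show "\<forall>\<^sub>F n in sequentially. (LINT x|lebesgue_on \<Omega>. \<bar>gn n x $ i - g x $ i\<bar>) \<le> (LINT x|lebesgue_on \<Omega>. norm (gn n x - g x))"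
      proof (rule always_eventually, rule allI, rule integral_mono)
        show "\<bar>gn n x $ i - g x $ i\<bar> \<le> norm (gn n x - g x)" for n x
          using component_le_norm_cart[of "gn n x - g x" i] by simp
      qed (intro integrable_abs Bochner_Integration.integrable_diff nth int integrable_norm)+
    qed auto
  qed
  moreover have "(LINT x|lebesgue_on \<Omega>. un n x * ?d x) = - (LINT x|lebesgue_on \<Omega>. gn n x $ i * \<eta> x)" for n
    using gn \<eta> by (auto simp: has_weak_grad_def)
  ultimately have "(\<lambda>n. - (LINT x|lebesgue_on \<Omega>. gn n x $ i * \<eta> x)) \<longlonglongrightarrow> (LINT x|lebesgue_on \<Omega>. u x * ?d x)"
    by simp
  from LIMSEQ_unique[OF this tendsto_minus[OF L2]]
  show "(LINT x|lebesgue_on \<Omega>. u x * ?d x) = - (LINT x|lebesgue_on \<Omega>. g x $ i * \<eta> x)" .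
qed

section \<open>Jensen's inequality for power means\<close>

text \<open>The tangent line of the convex function \<open>t\<^sup>p\<close> at \<open>a\<close>, which also lies below the graph at the end point \<open>t = 0\<close>.\<close>

lemma powr_tangent:
  assumes "0 < a" "0 \<le> t" "1 \<le> (p::real)"
  shows "a powr p + p * a powr (p - 1) * (t - a) \<le> t powr p"
proof (cases "t = 0")
  case True
  have "p * a powr (p - 1) * a = p * a powr p" using assms powr_mult_base[of a "p - 1"] by (simp add: mult_ac)
  moreover have "a powr p \<le> p * a powr p" using assms by simp
  ultimately show ?thesis using True assms by (simp add: algebra_simps)
next
  case False
  have "p * a powr (p - 1) * (t - a) \<le> t powr p - a powr p"
  proof (rule convex_on_imp_above_tangent[OF powr_convex[OF assms(3)]])
    have "((\<lambda>x. x powr p) has_real_derivative p * a powr (p - 1)) (at a)"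
      using assms by (intro has_real_derivative_powr) auto
    then show "((\<lambda>x. x powr p) has_real_derivative p * a powr (p - 1)) (at a within {0<..})"
      by (rule has_field_derivative_at_within)
  qed (use assms False in \<open>auto simp: interior_open\<close>)
  then show ?thesis by simp
qed

text \<open>The tangent inequality at the mean of \<open>\<bar>f\<bar>\<close> is integrated; its linear term has integral zero.\<close>

lemma (in prob_space) powr_jensen:
  fixes f :: "'a \<Rightarrow> real"
  assumes [measurable]: "f \<in> borel_measurable M" and B: "\<And>x. x \<in> space M \<Longrightarrow> \<bar>f x\<bar> \<le> B" and p: "1 \<le> p"
  shows "\<bar>LINT x|M. f x\<bar> powr p \<le> (LINT x|M. \<bar>f x\<bar> powr p)"
proof -
  define a where "a = (LINT x|M. \<bar>f x\<bar>)"
  have i: "integrable M (\<lambda>x. \<bar>f x\<bar>)"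
    by (rule integrable_const_bound[where B=B]) (use B in auto)
  have "\<bar>f x\<bar> powr p \<le> B powr p" if "x \<in> space M" for x
    using B[OF that] p by (intro powr_mono2) auto
  then have ip: "integrable M (\<lambda>x. \<bar>f x\<bar> powr p)"
    by (intro integrable_const_bound[where B="B powr p"]) auto
  have a0: "0 \<le> a" unfolding a_def by simp
  have "a powr p \<le> (LINT x|M. \<bar>f x\<bar> powr p)"
  proof (cases "a = 0")
    case False
    have "a powr p = (LINT x|M. a powr p + p * a powr (p - 1) * (\<bar>f x\<bar> - a))"
      using i prob_space by (simp add: a_def[symmetric])
    also have "\<dots> \<le> (LINT x|M. \<bar>f x\<bar> powr p)"
      using i ip False a0 p by (intro integral_mono powr_tangent) auto
    finally show ?thesis .
  qed simp
  moreover have "\<bar>LINT x|M. f x\<bar> \<le> a" unfolding a_def by (rule integral_abs_bound)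
  ultimately show ?thesis using powr_mono2[of p "\<bar>LINT x|M. f x\<bar>" a] p by auto
qed

text \<open>A bound for each slice \<open>G(\<cdot>, y)\<close> is inherited by the mean over \<open>y\<close>. Used twice: with \<open>y\<close> a point of a segment and with
\<open>y\<close> a point of a ball.\<close>

lemma (in prob_space) jensen_fubini:
  fixes G :: "'b::euclidean_space \<Rightarrow> 'a \<Rightarrow> real"
  assumes [measurable]: "(\<lambda>(x, y). G x y) \<in> borel_measurable (lborel \<Otimes>\<^sub>M M)"
    and B: "\<And>x y. \<bar>G x y\<bar> \<le> B" and p: "1 \<le> p"
    and c: "\<And>y. y \<in> space M \<Longrightarrow> (\<integral>\<^sup>+x. ennreal (\<bar>G x y\<bar> powr p) \<partial>lborel) \<le> c"
  shows "(\<integral>\<^sup>+x. ennreal (\<bar>LINT y|M. G x y\<bar> powr p) \<partial>lborel) \<le> c"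
proof -
  interpret pair_sigma_finite lborel M ..
  have [measurable]: "G x \<in> borel_measurable M" for x
    using measurable_Pair2[of "\<lambda>(x, y). G x y" lborel M borel x] by simp
  have "ennreal (\<bar>LINT y|M. G x y\<bar> powr p) \<le> (\<integral>\<^sup>+y. ennreal (\<bar>G x y\<bar> powr p) \<partial>M)" for x
  proof -
    have "\<bar>G x y\<bar> powr p \<le> B powr p" for y
      using B[of x y] p by (intro powr_mono2) auto
    then have "integrable M (\<lambda>y. \<bar>G x y\<bar> powr p)"
      by (intro integrable_const_bound[where B="B powr p"]) auto
    then have "(\<integral>\<^sup>+y. ennreal (\<bar>G x y\<bar> powr p) \<partial>M) = ennreal (LINT y|M. \<bar>G x y\<bar> powr p)"
      by (intro nn_integral_eq_integral) auto
    then show ?thesis using powr_jensen[of "G x" B p] B p by (simp add: ennreal_leI)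
  qed
  then have "(\<integral>\<^sup>+x. ennreal (\<bar>LINT y|M. G x y\<bar> powr p) \<partial>lborel) \<le> (\<integral>\<^sup>+x. (\<integral>\<^sup>+y. ennreal (\<bar>G x y\<bar> powr p) \<partial>M) \<partial>lborel)"
    by (intro nn_integral_mono)
  also have "\<dots> = (\<integral>\<^sup>+y. (\<integral>\<^sup>+x. ennreal (\<bar>G x y\<bar> powr p) \<partial>lborel) \<partial>M)"
    by (intro Fubini'[symmetric]) measurable
  also have "\<dots> \<le> (\<integral>\<^sup>+y. c \<partial>M)" by (intro nn_integral_mono c)
  finally show ?thesis by (simp add: emeasure_space_1)
qed

section \<open>Continuously differentiable functions of compact support\<close>

text \<open>A function is carried along with its gradient, so that estimates apply to test functions and to their differences
without computing derivatives.\<close>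

definition c1_supp :: "'a::euclidean_space set \<Rightarrow> ('a \<Rightarrow> real) \<Rightarrow> ('a \<Rightarrow> 'a) \<Rightarrow> bool" where
  "c1_supp K u D \<longleftrightarrow> (\<forall>x. (u has_derivative (\<lambda>v. D x \<bullet> v)) (at x)) \<and> continuous_on UNIV D \<and>
     (\<forall>x. x \<notin> K \<longrightarrow> u x = 0 \<and> D x = 0)"

context
  fixes K :: "'a::euclidean_space set" and u :: "'a \<Rightarrow> real" and D :: "'a \<Rightarrow> 'a"
  assumes K: "compact K" and uD: "c1_supp K u D"
begin

lemma c1_has_derivative: "(u has_derivative (\<lambda>v. D x \<bullet> v)) (at x)" using uD by (simp add: c1_supp_def)
lemma c1_continuous: "continuous_on UNIV u"
  by (rule continuous_at_imp_continuous_on) (simp add: has_derivative_continuous[OF c1_has_derivative])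
lemma c1_continuous_grad: "continuous_on UNIV D" using uD by (simp add: c1_supp_def)
lemma c1_zero: "x \<notin> K \<Longrightarrow> u x = 0" "x \<notin> K \<Longrightarrow> D x = 0" using uD by (auto simp: c1_supp_def)
lemma c1_measurable: "u \<in> borel_measurable borel" "D \<in> borel_measurable borel"
  using c1_continuous c1_continuous_grad by (auto intro: borel_measurable_continuous_onI)

lemma c1_bounded: "\<exists>B>0. \<forall>x. \<bar>u x\<bar> \<le> B \<and> norm (D x) \<le> B"
proof -
  obtain B1 where "0 < B1" "\<And>x. norm (u x) \<le> B1" using bounded_compact_support[OF c1_continuous K c1_zero(1)] by blast
  moreover obtain B2 where "0 < B2" "\<And>x. norm (D x) \<le> B2" using bounded_compact_support[OF c1_continuous_grad K c1_zero(2)] by blast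
  ultimately show ?thesis by (intro exI[of _ "max B1 B2"]) (auto simp: le_max_iff_disj)
qed

lemma c1_integrable_powr: "0 < s \<Longrightarrow> integrable lborel (\<lambda>x. \<bar>u x\<bar> powr s)"
  using c1_zero(1) by (intro integrable_compact_support[OF _ K] continuous_on_powr' continuous_intros c1_continuous) auto

lemma c1_integrable_grad_powr: "0 < s \<Longrightarrow> integrable lborel (\<lambda>x. norm (D x) powr s)"
  using c1_zero(2) by (intro integrable_compact_support[OF _ K] continuous_on_powr' continuous_intros c1_continuous_grad) auto

lemma nn_integral_translate:
  fixes f :: "'a \<Rightarrow> ennreal"
  assumes [measurable]: "f \<in> borel_measurable borel"
  shows "(\<integral>\<^sup>+x. f (x + c) \<partial>lborel) = (\<integral>\<^sup>+x. f x \<partial>lborel)"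
proof -
  have "(\<integral>\<^sup>+x. f x \<partial>lborel) = (\<integral>\<^sup>+x. f x \<partial>distr lborel borel ((+) c))"
    by (simp add: lborel_distr_plus)
  also have "\<dots> = (\<integral>\<^sup>+x. f (c + x) \<partial>lborel)" by (rule nn_integral_distr) auto
  finally show ?thesis by (simp add: add.commute)
qed

text \<open>\<open>u(x + z) - u(x)\<close> is the mean over \<open>t \<in> [0, 1]\<close> of \<open>D(x + t z) \<bullet> z\<close>, and for each \<open>t\<close> the integral over \<open>x\<close> is
invariant under translation.\<close>

lemma translation_estimate:
  assumes p: "1 \<le> p"
  shows "(\<integral>\<^sup>+x. ennreal (\<bar>u (x + z) - u x\<bar> powr p) \<partial>lborel) \<le> ennreal (norm z powr p * (LINT x|lborel. norm (D x) powr p))"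
proof -
  note [measurable] = c1_measurable
  interpret I: prob_space "restrict_space lborel {0..1::real}"
    by (rule prob_spaceI) (simp add: emeasure_restrict_space space_restrict_space)
  obtain B where B: "0 < B" "\<And>x. norm (D x) \<le> B" using c1_bounded by blast
  have ftc: "(LINT t|restrict_space lborel {0..1}. D (x + t *\<^sub>R z) \<bullet> z) = u (x + z) - u x" for x
  proof -
    have "(LINT t|lborel. (D (x + t *\<^sub>R z) \<bullet> z) * indicator {0..1} t) = u (x + 1 *\<^sub>R z) - u (x + 0 *\<^sub>R z)"
    proof (rule integral_FTC_Icc_real)
      show "DERIV (\<lambda>t. u (x + t *\<^sub>R z)) t :> D (x + t *\<^sub>R z) \<bullet> z" for t
        by (rule DERIV_line[OF c1_has_derivative])
      have "continuous_on UNIV (\<lambda>t. D (x + t *\<^sub>R z) \<bullet> z)"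
        by (intro continuous_intros continuous_on_compose2[OF c1_continuous_grad]) auto
      then show "isCont (\<lambda>t. D (x + t *\<^sub>R z) \<bullet> z) t" for t
        by (simp add: continuous_on_eq_continuous_at)
    qed auto
    then show ?thesis by (simp add: integral_restrict_space mult.commute)
  qed
  have Bz: "\<bar>D x \<bullet> z\<bar> \<le> norm z * norm (D x)" for x using Cauchy_Schwarz_ineq2[of "D x" z] by (simp add: mult.commute)
  have "(\<integral>\<^sup>+x. ennreal (\<bar>LINT t|restrict_space lborel {0..1}. D (x + t *\<^sub>R z) \<bullet> z\<bar> powr p) \<partial>lborel) \<le>
      ennreal (norm z powr p * (LINT x|lborel. norm (D x) powr p))"
  proof (rule I.jensen_fubini[where B="norm z * B"])
    let ?M = "lborel \<Otimes>\<^sub>M restrict_space lborel {0..1::real} :: ('a \<times> real) measure"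
    have "(\<lambda>t. t) \<in> borel_measurable (restrict_space lborel {0..1::real})"
      by (rule measurable_restrict_space1) simp
    from measurable_compose[OF measurable_snd this] have s: "(\<lambda>w. snd w) \<in> borel_measurable ?M" .
    have "(\<lambda>t. t) \<in> borel_measurable (lborel :: 'a measure)" by simp
    from measurable_compose[OF measurable_fst this] have f: "(\<lambda>w. fst w) \<in> borel_measurable ?M" .
    have "(\<lambda>w. D (fst w + snd w *\<^sub>R z) \<bullet> z) \<in> borel_measurable ?M"
      by (intro borel_measurable_inner measurable_compose[OF _ c1_measurable(2)] borel_measurable_add
        borel_measurable_scaleR f s borel_measurable_const)
    then show "(\<lambda>(x, t). D (x + t *\<^sub>R z) \<bullet> z) \<in> borel_measurable (lborel \<Otimes>\<^sub>M restrict_space lborel {0..1})"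
      by (simp add: case_prod_beta')
    show "\<bar>D (x + t *\<^sub>R z) \<bullet> z\<bar> \<le> norm z * B" for x t
      by (rule order_trans[OF Bz mult_left_mono[OF B(2)]]) simp
    fix t
    have "(\<integral>\<^sup>+x. ennreal (\<bar>D (x + t *\<^sub>R z) \<bullet> z\<bar> powr p) \<partial>lborel) = (\<integral>\<^sup>+x. ennreal (\<bar>D x \<bullet> z\<bar> powr p) \<partial>lborel)"
      by (rule nn_integral_translate[of "\<lambda>x. ennreal (\<bar>D x \<bullet> z\<bar> powr p)"]) measurable
    also have "\<dots> \<le> (\<integral>\<^sup>+x. ennreal (norm z powr p * norm (D x) powr p) \<partial>lborel)"
      using Bz p by (intro nn_integral_mono ennreal_leI) (auto simp: powr_mult[symmetric] intro!: powr_mono2)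
    also have "\<dots> = ennreal (norm z powr p * (LINT x|lborel. norm (D x) powr p))"
      using c1_integrable_grad_powr[of p] p by (subst nn_integral_eq_integral) auto
    finally show "(\<integral>\<^sup>+x. ennreal (\<bar>D (x + t *\<^sub>R z) \<bullet> z\<bar> powr p) \<partial>lborel) \<le> ennreal (norm z powr p * (LINT x|lborel. norm (D x) powr p))" .
  qed (rule p)
  then show ?thesis by (simp only: ftc)
qed

end

section \<open>Averages over balls\<close>

definition unif_ball :: "real \<Rightarrow> 'a::euclidean_space measure" where
  "unif_ball r = uniform_measure lborel (ball 0 r)"

definition avg :: "real \<Rightarrow> ('a::euclidean_space \<Rightarrow> real) \<Rightarrow> 'a \<Rightarrow> real" where
  "avg r u x = (LINT y|unif_ball r. u (x + y))"

definition vol :: "'a::euclidean_space itself \<Rightarrow> real \<Rightarrow> real" where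
  "vol _ r = unit_ball_vol (DIM('a)) * r ^ DIM('a)"

lemma unit_ball_vol_neq_0 [simp]: "unit_ball_vol (real n) \<noteq> 0"
proof -
  have "0 < unit_ball_vol (real n)" by (rule unit_ball_vol_pos) simp
  then show ?thesis by (rule dual_order.strict_implies_not_eq)
qed

lemma vol_pos: "0 < r \<Longrightarrow> 0 < vol TYPE('a::euclidean_space) r"
  unfolding vol_def by (intro mult_pos_pos unit_ball_vol_pos zero_less_power) auto

lemma prob_space_unif_ball: "0 < r \<Longrightarrow> prob_space (unif_ball r :: 'a::euclidean_space measure)"
  unfolding unif_ball_def using vol_pos[of r, where 'a='a]
  by (intro prob_space_uniform_measure) (auto simp: emeasure_ball vol_def)

lemma sets_unif_ball[measurable_cong, simp]: "sets (unif_ball r) = sets borel" by (simp add: unif_ball_def)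

lemma measurable_unif_ball: "f \<in> borel_measurable borel \<Longrightarrow> f \<in> borel_measurable (unif_ball r)"
  using measurable_cong_sets[OF sets_unif_ball refl] by blast

lemma avg_nonneg_le:
  fixes g :: "'a::euclidean_space \<Rightarrow> real"
  assumes r: "0 < r" and g: "\<And>y. 0 \<le> g y" "integrable lborel g" and B: "\<And>y. g y \<le> B"
  shows "(LINT y|unif_ball r. g y) \<le> (LINT y|lborel. g y) / vol TYPE('a) r"
proof -
  interpret prob_space "unif_ball r :: 'a measure" by (rule prob_space_unif_ball[OF r])
  have [measurable]: "g \<in> borel_measurable borel" using g(2) by (simp add: integrable_iff_bounded)
  have "integrable (unif_ball r) g" by (rule integrable_const_bound[where B=B]) (use B g in auto)
  then have "ennreal (LINT y|unif_ball r. g y) = (\<integral>\<^sup>+y. ennreal (g y) \<partial>unif_ball r)"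
    using g by (intro nn_integral_eq_integral[symmetric]) auto
  also have "\<dots> = (\<integral>\<^sup>+y. ennreal (g y) * indicator (ball 0 r) y \<partial>lborel) / ennreal (vol TYPE('a) r)"
    using r unfolding unif_ball_def by (subst nn_integral_uniform_measure) (auto simp: emeasure_ball vol_def)
  also have "\<dots> \<le> (\<integral>\<^sup>+y. ennreal (g y) \<partial>lborel) / ennreal (vol TYPE('a) r)"
    by (intro divide_right_mono_ennreal nn_integral_mono) (auto simp: indicator_def)
  also have "\<dots> = ennreal ((LINT y|lborel. g y) / vol TYPE('a) r)"
    using g vol_pos[OF r, where 'a='a] by (subst nn_integral_eq_integral) (auto simp: divide_ennreal)
  finally show ?thesis using g vol_pos[OF r, where 'a='a] by (simp add: ennreal_le_iff)
qed

context
  fixes K :: "'a::euclidean_space set" and u :: "'a \<Rightarrow> real" and D :: "'a \<Rightarrow> 'a" and r :: real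
  assumes K: "compact K" and uD: "c1_supp K u D" and r: "0 < r"
begin

interpretation prob_space "unif_ball r :: 'a measure" by (rule prob_space_unif_ball[OF r])

lemma avg_shift_measurable: "(\<lambda>y. u (x + y)) \<in> borel_measurable (unif_ball r)"
proof (rule measurable_unif_ball)
  note [measurable] = c1_measurable[OF K uD]
  show "(\<lambda>y. u (x + y)) \<in> borel_measurable borel" by measurable
qed

lemma avg_shift_integrable: "integrable (unif_ball r) (\<lambda>y. u (x + y))"
proof -
  obtain B where "\<And>x. \<bar>u x\<bar> \<le> B" using c1_bounded[OF K uD] by blast
  then show ?thesis by (intro integrable_const_bound[where B=B] avg_shift_measurable) auto
qed

lemma translate_integrable:
  assumes [measurable]: "f \<in> borel_measurable borel" and f: "integrable lborel (f :: 'a \<Rightarrow> real)"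
  shows "integrable lborel (\<lambda>y. f (x + y))"
proof -
  have "integrable (distr lborel borel ((+) x)) f" using f by (simp add: lborel_distr_plus)
  then show ?thesis by (subst (asm) integrable_distr_eq) auto
qed

text \<open>The price of boundedness is the volume of the ball: a small radius gives a large bound for the average.\<close>

lemma avg_powr_le:
  assumes s: "1 \<le> s"
  shows "\<bar>avg r u x\<bar> powr s \<le> (LINT y|lborel. \<bar>u y\<bar> powr s) / vol TYPE('a) r"
proof -
  note [measurable] = c1_measurable[OF K uD]
  obtain B where B: "\<And>x. \<bar>u x\<bar> \<le> B" using c1_bounded[OF K uD] by blast
  have i: "integrable lborel (\<lambda>y. \<bar>u y\<bar> powr s)" using s by (intro c1_integrable_powr[OF K uD]) auto
  have "\<bar>avg r u x\<bar> powr s \<le> (LINT y|unif_ball r. \<bar>u (x + y)\<bar> powr s)"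
    unfolding avg_def using B s by (intro powr_jensen avg_shift_measurable) auto
  also have "\<dots> \<le> (LINT y|lborel. \<bar>u (x + y)\<bar> powr s) / vol TYPE('a) r"
    using B s by (intro avg_nonneg_le[OF r, where B="B powr s"] translate_integrable i powr_mono2) auto
  also have "(LINT y|lborel. \<bar>u (x + y)\<bar> powr s) = (LINT y|lborel. \<bar>u y\<bar> powr s)"
    using integral_translate[of "\<lambda>y. \<bar>u y\<bar> powr s" x] by (simp add: add.commute)
  finally show ?thesis .
qed

lemma avg_lipschitz:
  "\<bar>avg r u x - avg r u x'\<bar> \<le> norm (x - x') * (LINT y|lborel. norm (D y)) / vol TYPE('a) r"
proof -
  note [measurable] = c1_measurable[OF K uD]
  obtain B where B: "\<And>x. \<bar>u x\<bar> \<le> B" using c1_bounded[OF K uD] by blast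
  let ?g = "\<lambda>y. \<bar>u (x + y) - u (x' + y)\<bar>"
  have iu: "integrable lborel u" by (rule integrable_compact_support[OF c1_continuous[OF K uD] K c1_zero(1)[OF K uD]])
  have ig: "integrable lborel ?g" using translate_integrable[OF _ iu] by auto
  have "\<bar>avg r u x - avg r u x'\<bar> = \<bar>LINT y|unif_ball r. u (x + y) - u (x' + y)\<bar>"
    unfolding avg_def using avg_shift_integrable by simp
  also have "\<dots> \<le> (LINT y|unif_ball r. ?g y)" by (rule integral_abs_bound)
  also have "\<dots> \<le> (LINT y|lborel. ?g y) / vol TYPE('a) r"
  proof (rule avg_nonneg_le[OF r _ ig])
    show "\<bar>u (x + y) - u (x' + y)\<bar> \<le> 2 * B" for y using B[of "x + y"] B[of "x' + y"] by linarith
  qed simp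
  also have "(LINT y|lborel. ?g y) \<le> norm (x - x') * (LINT y|lborel. norm (D y))"
  proof -
    have "ennreal (LINT y|lborel. ?g y) = (\<integral>\<^sup>+y. ennreal (?g y) \<partial>lborel)"
      using ig by (intro nn_integral_eq_integral[symmetric]) auto
    also have "\<dots> = (\<integral>\<^sup>+y. ennreal \<bar>u ((y + x') + (x - x')) - u (y + x')\<bar> \<partial>lborel)" by (simp add: add.commute)
    also have "\<dots> = (\<integral>\<^sup>+y. ennreal \<bar>u (y + (x - x')) - u y\<bar> \<partial>lborel)"
      by (rule nn_integral_translate[OF K uD, of "\<lambda>y. ennreal \<bar>u (y + (x - x')) - u y\<bar>"]) measurable
    also have "\<dots> \<le> ennreal (norm (x - x') * (LINT y|lborel. norm (D y)))"
      using translation_estimate[OF K uD, of 1 "x - x'"] by simp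
    finally show ?thesis by (simp add: ennreal_le_iff)
  qed
  then have "(LINT y|lborel. ?g y) / vol TYPE('a) r \<le> norm (x - x') * (LINT y|lborel. norm (D y)) / vol TYPE('a) r"
    using vol_pos[OF r, where 'a='a] by (intro divide_right_mono) auto
  finally show ?thesis .
qed

text \<open>The difference is a mean of \<open>u(x + y) - u(x)\<close> over \<open>\<bar>y\<bar> < r\<close>, each of which obeys the translation estimate.\<close>

lemma avg_estimate:
  assumes p: "1 \<le> p"
  shows "(\<integral>\<^sup>+x. ennreal (\<bar>avg r u x - u x\<bar> powr p) \<partial>lborel) \<le> ennreal (r powr p * (LINT x|lborel. norm (D x) powr p))"
proof -
  note [measurable] = c1_measurable[OF K uD]
  obtain B where B: "\<And>x. \<bar>u x\<bar> \<le> B" using c1_bounded[OF K uD] by blast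
  define G where "G x y = (if norm y < r then u (x + y) - u x else 0)" for x y
  have G: "(LINT y|unif_ball r. G x y) = avg r u x - u x" for x
  proof -
    have "avg r u x - u x = (LINT y|unif_ball r. u (x + y) - u x)"
      unfolding avg_def using avg_shift_integrable prob_space by simp
    also have "\<dots> = (LINT y|unif_ball r. G x y)"
    proof (rule integral_cong_AE)
      have "AE y in unif_ball r. y \<in> ball (0::'a) r"
        unfolding unif_ball_def by (rule AE_uniform_measureI) auto
      then show "AE y in unif_ball r. u (x + y) - u x = G x y"
        by eventually_elim (auto simp: G_def)
    qed (unfold G_def, (rule measurable_unif_ball, measurable)+)
    finally show ?thesis ..
  qed
  have "(\<integral>\<^sup>+x. ennreal (\<bar>LINT y|unif_ball r. G x y\<bar> powr p) \<partial>lborel) \<le> ennreal (r powr p * (LINT x|lborel. norm (D x) powr p))"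
  proof (rule jensen_fubini[where B="2 * B"])
    show "(\<lambda>(x, y). G x y) \<in> borel_measurable (lborel \<Otimes>\<^sub>M unif_ball r)"
      unfolding G_def[abs_def] by measurable
    show "\<bar>G x y\<bar> \<le> 2 * B" for x y using B[of "x + y"] B[of x] by (auto simp: G_def)
    fix y
    show "(\<integral>\<^sup>+x. ennreal (\<bar>G x y\<bar> powr p) \<partial>lborel) \<le> ennreal (r powr p * (LINT x|lborel. norm (D x) powr p))"
    proof (cases "norm y < r")
      case True
      have "(\<integral>\<^sup>+x. ennreal (\<bar>G x y\<bar> powr p) \<partial>lborel) = (\<integral>\<^sup>+x. ennreal (\<bar>u (x + y) - u x\<bar> powr p) \<partial>lborel)"
        using True by (simp add: G_def)
      also have "\<dots> \<le> ennreal (norm y powr p * (LINT x|lborel. norm (D x) powr p))"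
        by (rule translation_estimate[OF K uD p])
      also have "\<dots> \<le> ennreal (r powr p * (LINT x|lborel. norm (D x) powr p))"
        using True p by (intro ennreal_leI mult_right_mono powr_mono2) auto
      finally show ?thesis .
    qed (simp add: G_def)
  qed (rule p)
  then show ?thesis by (simp only: G)
qed

lemma measurable_avg: "avg r u \<in> borel_measurable borel"
proof -
  note [measurable] = c1_measurable[OF K uD]
  have "(\<lambda>x. LINT y|unif_ball r. (\<lambda>(x, y). u (x + y)) (x, y)) \<in> borel_measurable lborel"
    by (rule borel_measurable_lebesgue_integral) measurable
  then show ?thesis by (simp add: avg_def[abs_def])
qed

end

section \<open>The subcritical Sobolev inequality\<close>

text \<open>The radius \<open>r\<close> depends on the level \<open>t\<close>: it is chosen such that the \<open>L\<^sup>s\<close> bound forces the average over balls of radius \<open>r\<close>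
below \<open>t/2\<close>. Where \<open>\<bar>u\<bar> > t\<close>, the function then differs from its average by at least \<open>t/2\<close>, and Markov's inequality
applies to the \<open>p\<close>-th power of the difference, whose integral is of order \<open>r\<^sup>p\<close>.\<close>

lemma weak_type_estimate:
  fixes u :: "'a::euclidean_space \<Rightarrow> real"
  assumes K: "compact K" and uD: "c1_supp K u D" and ps: "1 \<le> p" "1 \<le> s" and RC: "0 < R" "0 < C"
    and b: "(LINT x|lborel. norm (D x) powr p) \<le> R" "(LINT x|lborel. \<bar>u x\<bar> powr s) \<le> C"
    and t: "0 < t"
  defines "c \<equiv> (C * 2 powr s / unit_ball_vol DIM('a)) powr (1 / DIM('a))"
  shows "emeasure lborel {x. t < \<bar>u x\<bar>} \<le> ennreal (2 powr p * R * c powr p * t powr (- (p + p * s / DIM('a))))"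
proof -
  let ?N = "real DIM('a)"
  have N: "0 < ?N" by simp
  have \<omega>: "0 < unit_ball_vol ?N" by (intro unit_ball_vol_pos) simp
  have c0: "0 < C * 2 powr s / unit_ball_vol ?N" using RC \<omega> by simp
  have c: "0 < c" using c0 RC by (simp add: c_def)
  \<comment> \<open>With this radius the volume of the ball equals \<open>C 2\<^sup>s t\<^sup>-\<^sup>s\<close>.\<close>
  define r where "r = c * t powr (- (s / ?N))"
  have r: "0 < r" using c t by (simp add: r_def)
  have "r ^ DIM('a) = r powr ?N" using r by (simp add: powr_realpow)
  also have "\<dots> = c powr ?N * t powr (- s)"
    using c t N by (simp add: r_def powr_mult powr_powr)
  also have "c powr ?N = C * 2 powr s / unit_ball_vol ?N"
    using c0 N RC unfolding c_def by (simp add: powr_powr)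
  finally have vol: "vol TYPE('a) r = C * 2 powr s * t powr (- s)"
    using \<omega> by (simp add: vol_def)
  have small: "\<bar>avg r u x\<bar> \<le> t / 2" for x
  proof (rule ccontr)
    assume "\<not> \<bar>avg r u x\<bar> \<le> t / 2"
    then have "(t / 2) powr s < \<bar>avg r u x\<bar> powr s" using t ps by (intro powr_less_mono2) auto
    also have "\<dots> \<le> (LINT y|lborel. \<bar>u y\<bar> powr s) / vol TYPE('a) r"
      by (rule avg_powr_le[OF K uD r ps(2)])
    also have "\<dots> \<le> C / vol TYPE('a) r"
      using b vol_pos[OF r, where 'a='a] by (intro divide_right_mono) auto
    also have "\<dots> = (t / 2) powr s"
      using t RC by (simp add: vol powr_divide powr_minus field_simps)
    finally show False by simp
  qed
  note [measurable] = c1_measurable[OF K uD] measurable_avg[OF K uD r]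
  have "{x. t < \<bar>u x\<bar>} \<subseteq> {x\<in>UNIV. 1 \<le> ennreal ((2 / t) powr p) * ennreal (\<bar>avg r u x - u x\<bar> powr p)}"
  proof clarsimp
    fix x assume "t < \<bar>u x\<bar>"
    moreover have "\<bar>u x\<bar> \<le> \<bar>avg r u x\<bar> + \<bar>avg r u x - u x\<bar>"
      using abs_triangle_ineq4[of "avg r u x" "avg r u x - u x"] by simp
    moreover have "t \<le> 2 * w" if "t < a" "a \<le> b + w" "b \<le> t / 2" for a b w :: real using that by linarith
    ultimately have "t \<le> 2 * \<bar>avg r u x - u x\<bar>" using small[of x] by blast
    then have "1 \<le> (2 / t) * \<bar>avg r u x - u x\<bar>" using t by (simp add: field_simps)
    then have "1 powr p \<le> ((2 / t) * \<bar>avg r u x - u x\<bar>) powr p" using ps by (intro powr_mono2) auto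
    also have "\<dots> = (2 / t) powr p * \<bar>avg r u x - u x\<bar> powr p" by (rule powr_mult)
    finally show "1 \<le> ennreal ((2 / t) powr p) * ennreal (\<bar>avg r u x - u x\<bar> powr p)"
      by (simp add: ennreal_mult'[symmetric] del: ennreal_mult)
  qed
  then have "emeasure lborel {x. t < \<bar>u x\<bar>} \<le> emeasure lborel {x\<in>UNIV. 1 \<le> ennreal ((2 / t) powr p) * ennreal (\<bar>avg r u x - u x\<bar> powr p)}"
    by (intro emeasure_mono) auto
  also have "\<dots> \<le> ennreal ((2 / t) powr p) * (\<integral>\<^sup>+x. ennreal (\<bar>avg r u x - u x\<bar> powr p) * indicator UNIV x \<partial>lborel)"
    by (rule nn_integral_Markov_inequality) auto
  also have "\<dots> \<le> ennreal ((2 / t) powr p) * ennreal (r powr p * (LINT x|lborel. norm (D x) powr p))"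
    using avg_estimate[OF K uD r ps(1)] by (intro mult_left_mono) auto
  also have "\<dots> \<le> ennreal ((2 / t) powr p) * ennreal (r powr p * R)"
    using b by (intro mult_left_mono ennreal_leI) auto
  also have "\<dots> = ennreal ((2 / t) powr p * (r powr p * R))" using RC by (simp add: ennreal_mult)
  also have "(2 / t) powr p * (r powr p * R) = 2 powr p * R * c powr p * t powr (- (p + p * s / ?N))"
  proof -
    have "r powr p = c powr p * t powr (- (p * s / ?N))"
      using c t by (simp add: r_def powr_mult powr_powr mult.commute)
    moreover have "(2 / t) powr p = 2 powr p * t powr (- p)"
      using t by (simp add: powr_divide powr_minus field_simps)
    moreover have "t powr (- (p + p * s / ?N)) = t powr (- p) * t powr (- (p * s / ?N))"
      by (simp add: powr_add[symmetric])
    ultimately show ?thesis by (simp only: mult_ac)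
  qed
  finally show ?thesis .
qed

text \<open>Decay of order \<open>\<sigma>\<close> of the distribution function controls every moment of order \<open>s < \<sigma>\<close>: the levels \<open>2\<^sup>j\<close> contribute a geometric
series with ratio \<open>2\<^sup>s\<^sup>-\<^sup>\<sigma>\<close>.\<close>

lemma layer_cake_bound:
  fixes u :: "'a::euclidean_space \<Rightarrow> real"
  assumes K: "compact K" and [measurable]: "u \<in> borel_measurable borel" and u0: "\<And>x. x \<notin> K \<Longrightarrow> u x = 0"
    and W: "0 \<le> W" "\<And>t. 1 \<le> t \<Longrightarrow> emeasure lborel {x. t < \<bar>u x\<bar>} \<le> ennreal (W * t powr (- \<sigma>))"
    and s: "0 < s" "s < \<sigma>"
  shows "(\<integral>\<^sup>+x. ennreal (\<bar>u x\<bar> powr s) \<partial>lborel) \<le> ennreal (measure lborel K + 2 powr s * W / (1 - 2 powr (s - \<sigma>)))"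
proof -
  define \<rho> where "\<rho> = 2 powr (s - \<sigma>)"
  have \<rho>: "0 < \<rho>" "\<rho> < 1" using s by (auto simp: \<rho>_def powr_less_one)
  have [measurable]: "K \<in> sets borel" using K by (simp add: borel_compact)
  define T where "T j x = ennreal (2 powr (real (Suc j) * s)) * indicator {x. 2 ^ j < \<bar>u x\<bar>} x" for j x
  have [measurable]: "T j \<in> borel_measurable borel" for j unfolding T_def by measurable
  \<comment> \<open>On \<open>2\<^sup>j < \<bar>u x\<bar> \<le> 2\<^sup>j\<^sup>+\<^sup>1\<close> the term \<open>T j\<close> alone suffices.\<close>
  have pw: "ennreal (\<bar>u x\<bar> powr s) \<le> indicator K x + (\<Sum>j. T j x)" for x
  proof (cases "\<bar>u x\<bar> \<le> 1")
    case True
    show ?thesis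
    proof (cases "x \<in> K")
      case xK: True
      have "\<bar>u x\<bar> powr s \<le> 1" using True s by (intro powr_le1) auto
      then have "ennreal (\<bar>u x\<bar> powr s) \<le> 1" by (simp add: ennreal_le_1)
      then show ?thesis using xK by (simp add: add_increasing2)
    qed (use u0 in simp)
  next
    case False
    obtain n0 where "\<bar>u x\<bar> < 2 ^ n0" using real_arch_pow[of 2 "\<bar>u x\<bar>"] by auto
    then have ex: "\<exists>n. \<bar>u x\<bar> \<le> 2 ^ n" by (intro exI[of _ n0]) simp
    define n where "n = (LEAST n. \<bar>u x\<bar> \<le> 2 ^ n)"
    have n: "\<bar>u x\<bar> \<le> 2 ^ n" unfolding n_def using ex by (rule LeastI_ex)
    have "n \<noteq> 0" using n False by (intro notI) auto
    then obtain j where j: "n = Suc j" by (cases n) auto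
    have "\<not> \<bar>u x\<bar> \<le> 2 ^ j" using not_less_Least[of j "\<lambda>n. \<bar>u x\<bar> \<le> 2 ^ n"] j by (simp add: n_def)
    then have jx: "2 ^ j < \<bar>u x\<bar>" by simp
    have "\<bar>u x\<bar> powr s \<le> (2 ^ n) powr s" using n s by (intro powr_mono2) auto
    also have "(2 ^ n) powr s = 2 powr (real (Suc j) * s)"
    proof -
      have "(2::real) ^ n = 2 powr real (Suc j)" unfolding j by (rule powr_realpow[symmetric]) simp
      then show ?thesis by (simp only: powr_powr)
    qed
    finally have "ennreal (\<bar>u x\<bar> powr s) \<le> T j x" using jx by (simp add: T_def ennreal_leI)
    also have "\<dots> = (\<Sum>j\<in>{j}. T j x)" by simp
    also have "\<dots> \<le> (\<Sum>j. T j x)" by (rule sum_le_suminf) auto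
    finally show ?thesis by (rule order_trans) (simp add: add_increasing)
  qed
  have Ti: "(\<integral>\<^sup>+x. T j x \<partial>lborel) \<le> ennreal (2 powr s * W * \<rho> ^ j)" for j
  proof -
    have "(\<integral>\<^sup>+x. T j x \<partial>lborel) = ennreal (2 powr (real (Suc j) * s)) * emeasure lborel {x. 2 ^ j < \<bar>u x\<bar>}"
      unfolding T_def by (subst nn_integral_cmult) auto
    also have "\<dots> \<le> ennreal (2 powr (real (Suc j) * s)) * ennreal (W * (2 ^ j) powr (- \<sigma>))"
      by (intro mult_left_mono W) auto
    also have "\<dots> = ennreal (2 powr (real (Suc j) * s) * (W * (2 ^ j) powr (- \<sigma>)))"
      using W by (simp add: ennreal_mult)
    also have "2 powr (real (Suc j) * s) * (W * (2 ^ j) powr (- \<sigma>)) = 2 powr s * W * \<rho> ^ j"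
    proof -
      have "(2 ^ j) powr (- \<sigma>) = 2 powr (real j * (- \<sigma>))" by (simp add: powr_powr flip: powr_realpow)
      moreover have "\<rho> ^ j = 2 powr (real j * s + real j * (- \<sigma>))"
        using \<rho>(1) by (simp add: \<rho>_def powr_powr algebra_simps flip: powr_realpow)
      moreover have "2 powr (real (Suc j) * s) = 2 powr s * 2 powr (real j * s)"
        by (simp add: powr_add[symmetric] algebra_simps)
      ultimately show ?thesis by (simp only: powr_add mult_ac)
    qed
    finally show ?thesis .
  qed
  have "(\<lambda>j. 2 powr s * W * \<rho> ^ j) sums (2 powr s * W * (1 / (1 - \<rho>)))"
    using \<rho> by (intro sums_mult geometric_sums) auto
  then have sums: "(\<Sum>j. ennreal (2 powr s * W * \<rho> ^ j)) = ennreal (2 powr s * W * (1 / (1 - \<rho>)))"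
    using \<rho> W by (intro suminf_ennreal_eq) auto
  have "(\<integral>\<^sup>+x. ennreal (\<bar>u x\<bar> powr s) \<partial>lborel) \<le> (\<integral>\<^sup>+x. indicator K x + (\<Sum>j. T j x) \<partial>lborel)"
    by (intro nn_integral_mono pw)
  also have "\<dots> = (\<integral>\<^sup>+x. indicator K x \<partial>lborel) + (\<integral>\<^sup>+x. (\<Sum>j. T j x) \<partial>lborel)"
    by (intro nn_integral_add) measurable
  also have "\<dots> = emeasure lborel K + (\<Sum>j. \<integral>\<^sup>+x. T j x \<partial>lborel)"
    by (subst nn_integral_suminf) auto
  also have "\<dots> \<le> emeasure lborel K + (\<Sum>j. ennreal (2 powr s * W * \<rho> ^ j))"
    by (intro add_left_mono suminf_le Ti) auto
  also have "\<dots> = ennreal (measure lborel K + 2 powr s * W / (1 - \<rho>))"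
    using emeasure_compact_finite[OF K] \<rho> W
    by (simp add: sums emeasure_eq_ennreal_measure ennreal_plus[symmetric] del: ennreal_plus)
  finally show ?thesis by (simp add: \<rho>_def)
qed

definition sobolev_bound :: "'a::euclidean_space set \<Rightarrow> real \<Rightarrow> real \<Rightarrow> bool" where
  "sobolev_bound K p s \<longleftrightarrow> (\<forall>R>0. \<exists>C>0. \<forall>u D. c1_supp K u D \<longrightarrow> (LINT x|lborel. norm (D x) powr p) \<le> R \<longrightarrow>
     (LINT x|lborel. \<bar>u x\<bar> powr s) \<le> C)"

text \<open>Poincare's inequality: a translation by more than the diameter of \<open>K\<close> moves the support off itself, so the translation
estimate bounds the function itself.\<close>

lemma sobolev_bound_base:
  fixes K :: "'a::euclidean_space set"
  assumes K: "compact K" and p: "1 \<le> p"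
  shows "sobolev_bound K p p"
proof -
  obtain B where B: "0 < B" "\<And>x. x \<in> K \<Longrightarrow> norm x \<le> B"
    using compact_imp_bounded[OF K] unfolding bounded_pos by blast
  obtain e :: 'a where e: "e \<in> Basis" using nonempty_Basis by blast
  \<comment> \<open>Any vector longer than the diameter of \<open>K\<close> would do.\<close>
  define z where "z = (3 * B) *\<^sub>R e"
  have nz: "norm z = 3 * B" using e B by (simp add: z_def)
  have "(LINT x|lborel. \<bar>u x\<bar> powr p) \<le> (3 * B) powr p * R"
    if R: "0 < R" and uD: "c1_supp K u D" and b: "(LINT x|lborel. norm (D x) powr p) \<le> R" for R u D
  proof -
    have i: "integrable lborel (\<lambda>x. \<bar>u x\<bar> powr p)" using p by (intro c1_integrable_powr[OF K uD]) auto
    have le: "\<bar>u x\<bar> \<le> \<bar>u (x + z) - u x\<bar>" for x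
    proof (cases "x \<in> K")
      case True
      have "3 * B \<le> norm (x + z) + norm x" using norm_triangle_ineq4[of "x + z" x] nz by simp
      then have "\<not> norm (x + z) \<le> B" using B(1) B(2)[OF True] by linarith
      then have "x + z \<notin> K" using B by auto
      then show ?thesis using c1_zero(1)[OF K uD] by simp
    qed (use c1_zero(1)[OF K uD] in simp)
    have "ennreal (LINT x|lborel. \<bar>u x\<bar> powr p) = (\<integral>\<^sup>+x. ennreal (\<bar>u x\<bar> powr p) \<partial>lborel)"
      using i by (intro nn_integral_eq_integral[symmetric]) auto
    also have "\<dots> \<le> (\<integral>\<^sup>+x. ennreal (\<bar>u (x + z) - u x\<bar> powr p) \<partial>lborel)"
      using le p by (intro nn_integral_mono ennreal_leI powr_mono2) auto
    also have "\<dots> \<le> ennreal (norm z powr p * (LINT x|lborel. norm (D x) powr p))"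
      by (rule translation_estimate[OF K uD p])
    also have "\<dots> \<le> ennreal ((3 * B) powr p * R)" unfolding nz by (intro ennreal_leI mult_left_mono b) simp
    finally show ?thesis using R by (simp add: ennreal_le_iff)
  qed
  then show ?thesis unfolding sobolev_bound_def using B
    by (intro allI impI exI[of _ "(3 * B) powr p * R" for R]) auto
qed

lemma sobolev_bound_mono:
  fixes K :: "'a::euclidean_space set"
  assumes K: "compact K" and sb: "sobolev_bound K p s" and s': "0 < s'" "s' \<le> s"
  shows "sobolev_bound K p s'"
  unfolding sobolev_bound_def
proof (intro allI impI)
  fix R :: real assume "0 < R"
  then obtain C where C: "0 < C" "\<And>u D. c1_supp K u D \<Longrightarrow> (LINT x|lborel. norm (D x) powr p) \<le> R \<Longrightarrow>
     (LINT x|lborel. \<bar>u x\<bar> powr s) \<le> C"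
    using sb unfolding sobolev_bound_def by blast
  have [measurable]: "K \<in> sets borel" using K by (simp add: borel_compact)
  have iK: "integrable lborel (indicator K :: 'a \<Rightarrow> real)"
    using emeasure_compact_finite[OF K] by (simp add: integrable_indicator_iff)
  have "(LINT x|lborel. \<bar>u x\<bar> powr s') \<le> measure lborel K + C"
    if uD: "c1_supp K u D" and b: "(LINT x|lborel. norm (D x) powr p) \<le> R" for u D
  proof -
    have i: "integrable lborel (\<lambda>x. \<bar>u x\<bar> powr s')" "integrable lborel (\<lambda>x. \<bar>u x\<bar> powr s)"
      using s' by (auto intro!: c1_integrable_powr[OF K uD])
    have pw: "\<bar>u x\<bar> powr s' \<le> indicator K x + \<bar>u x\<bar> powr s" for x
    proof (cases "x \<in> K")
      case True
      show ?thesis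
      proof (cases "\<bar>u x\<bar> \<le> 1")
        case True
        then have "\<bar>u x\<bar> powr s' \<le> 1" using s' by (intro powr_le1) auto
        then show ?thesis using \<open>x \<in> K\<close> by (simp add: add_increasing2)
      next
        case False
        then have "\<bar>u x\<bar> powr s' \<le> \<bar>u x\<bar> powr s" using s' by (intro powr_mono) auto
        then show ?thesis by (simp add: add_increasing)
      qed
    qed (use c1_zero(1)[OF K uD] in simp)
    have "(LINT x|lborel. \<bar>u x\<bar> powr s') \<le> (LINT x|lborel. indicator K x + \<bar>u x\<bar> powr s)"
      using i iK by (intro integral_mono pw) auto
    also have "\<dots> = measure lborel K + (LINT x|lborel. \<bar>u x\<bar> powr s)"
      using i iK by simp
    finally show ?thesis using C(2)[OF uD b] by linarith
  qed
  then show "\<exists>C>0. \<forall>u D. c1_supp K u D \<longrightarrow> (LINT x|lborel. norm (D x) powr p) \<le> R \<longrightarrow> (LINT x|lborel. \<bar>u x\<bar> powr s') \<le> C"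
    using C(1) by (intro exI[of _ "measure lborel K + C"]) (auto simp: add_nonneg_pos)
qed

text \<open>One step of the iteration. The weak-type estimate improves the exponent \<open>s\<close> to anything below \<open>p + p s / N\<close>; the strict
inequality pays for the passage from weak to strong type.\<close>

lemma sobolev_bound_step:
  fixes K :: "'a::euclidean_space set"
  assumes K: "compact K" and p: "1 \<le> p" and s: "1 \<le> s" and sb: "sobolev_bound K p s"
    and s': "0 < s'" "s' < p + p * s / DIM('a)"
  shows "sobolev_bound K p s'"
  unfolding sobolev_bound_def
proof (intro allI impI)
  fix R :: real assume R: "0 < R"
  then obtain C where C: "0 < C" "\<And>u D. c1_supp K u D \<Longrightarrow> (LINT x|lborel. norm (D x) powr p) \<le> R \<Longrightarrow>
     (LINT x|lborel. \<bar>u x\<bar> powr s) \<le> C"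
    using sb unfolding sobolev_bound_def by blast
  define c where "c = (C * 2 powr s / unit_ball_vol DIM('a)) powr (1 / DIM('a))"
  define W where "W = 2 powr p * R * c powr p"
  define C' where "C' = measure lborel K + 2 powr s' * W / (1 - 2 powr (s' - (p + p * s / DIM('a))))"
  have W: "0 \<le> W" using R by (simp add: W_def)
  have "2 powr (s' - (p + p * s / DIM('a))) < 1" using s' by (simp add: powr_less_one)
  then have C': "0 \<le> C'" using W by (simp add: C'_def)
  have "(LINT x|lborel. \<bar>u x\<bar> powr s') \<le> C'"
    if uD: "c1_supp K u D" and b: "(LINT x|lborel. norm (D x) powr p) \<le> R" for u D
  proof -
    have i: "integrable lborel (\<lambda>x. \<bar>u x\<bar> powr s')"
      using s' by (auto intro!: c1_integrable_powr[OF K uD])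
    have "ennreal (LINT x|lborel. \<bar>u x\<bar> powr s') = (\<integral>\<^sup>+x. ennreal (\<bar>u x\<bar> powr s') \<partial>lborel)"
      using i by (intro nn_integral_eq_integral[symmetric]) auto
    also have "\<dots> \<le> ennreal C'"
      unfolding C'_def
    proof (rule layer_cake_bound[OF K c1_measurable(1)[OF K uD] c1_zero(1)[OF K uD] W _ s'])
      fix t :: real assume "1 \<le> t"
      then show "emeasure lborel {x. t < \<bar>u x\<bar>} \<le> ennreal (W * t powr (- (p + p * s / DIM('a))))"
        unfolding W_def c_def by (intro weak_type_estimate[OF K uD p s R C(1) b C(2)[OF uD b]]) simp
    qed
    finally show ?thesis using C' by (simp add: ennreal_le_iff)
  qed
  then show "\<exists>C>0. \<forall>u D. c1_supp K u D \<longrightarrow> (LINT x|lborel. norm (D x) powr p) \<le> R \<longrightarrow> (LINT x|lborel. \<bar>u x\<bar> powr s') \<le> C"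
    using C' by (intro exI[of _ "C' + 1"]) force
qed

text \<open>The map \<open>s \<mapsto> p + p s / N\<close> is a contraction whose fixed point is the critical exponent \<open>p N / (N - p)\<close>. Starting from \<open>s = p\<close>,
its iterates, slightly lowered, come arbitrarily close to the fixed point.\<close>

theorem subcritical_sobolev:
  fixes K :: "'a::euclidean_space set" and p q :: real
  assumes K: "compact K" and p: "1 \<le> p" "p < DIM('a)" and q: "0 < q" "q < p * DIM('a) / (DIM('a) - p)"
  shows "sobolev_bound K p q"
proof -
  let ?N = "real DIM('a)"
  define a where "a = p / ?N"
  have a: "0 < a" "a < 1" using p by (auto simp: a_def)
  have pa: "p / (1 - a) = p * ?N / (?N - p)" using p by (simp add: a_def field_simps)
  have "p < p / (1 - a)" using a p by (simp add: field_simps)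
  then have "max p q < p / (1 - a)" using q pa by simp
  then obtain L where L: "max p q < L" "L < p / (1 - a)" using dense by blast
  \<comment> \<open>The fixed point iteration towards \<open>L\<close> instead of \<open>p / (1 - a)\<close>; as \<open>L\<close> is smaller, each step stays strictly below the
  exponent that one application of the previous lemma allows.\<close>
  define s where "s n = L - a ^ n * (L - p)" for n
  have Lp: "0 < L - p" using L by simp
  have La: "L * (1 - a) < p" using L(2) a by (simp add: field_simps)
  have sp: "p \<le> s n" for n
  proof -
    have "a ^ n * (L - p) \<le> 1 * (L - p)" using a Lp by (intro mult_right_mono power_le_one) auto
    then show ?thesis by (simp add: s_def)
  qed
  have sn: "sobolev_bound K p (s n)" for n
  proof (induction n)
    case 0
    then show ?case using sobolev_bound_base[OF K p(1)] by (simp add: s_def)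
  next
    case (Suc n)
    have "s (Suc n) < p + a * s n" using La by (simp add: s_def algebra_simps)
    then have "s (Suc n) < p + p * s n / ?N" by (simp add: a_def)
    then show ?case using sp[of n] sp[of "Suc n"] p by (intro sobolev_bound_step[OF K p(1) _ Suc.IH]) auto
  qed
  have "(\<lambda>n. L - a ^ n * (L - p)) \<longlonglongrightarrow> L - 0 * (L - p)"
    using a by (intro tendsto_intros LIMSEQ_power_zero) auto
  then have "s \<longlonglongrightarrow> L" by (simp add: s_def[abs_def])
  moreover have "q < L" using L by simp
  ultimately have "\<forall>\<^sub>F n in sequentially. q < s n" by (rule order_tendstoD(1))
  then obtain n where "q < s n" by (meson eventually_happens trivial_limit_sequentially)
  then show ?thesis by (intro sobolev_bound_mono[OF K sn[of n] q(1)]) auto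
qed

section \<open>Rellich's compactness theorem\<close>

text \<open>For a fixed small radius the averages are bounded and equi-Lipschitz, so Arzela--Ascoli provides a uniformly convergent
subsequence on \<open>K\<close>; the functions differ from their averages by at most \<open>r R\<close> in mean.\<close>

lemma rellich_aux:
  fixes u :: "nat \<Rightarrow> 'a::euclidean_space \<Rightarrow> real"
  assumes K: "compact K" and uD: "\<And>n. c1_supp K (u n) (D n)"
    and b: "\<And>n. (LINT x|lborel. norm (D n x)) \<le> R" "\<And>n. (LINT x|lborel. \<bar>u n x\<bar>) \<le> R" and e: "0 < e"
  shows "\<exists>k :: nat \<Rightarrow> nat. strict_mono k \<and> (\<forall>i j. (LINT x|lborel. \<bar>u (k i) x - u (k j) x\<bar>) < (e::real))"
proof -
  have "0 \<le> (LINT x|lborel. \<bar>u 0 x\<bar>)" by simp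
  then have R: "0 \<le> R" using b(2)[of 0] by linarith
  have [measurable]: "K \<in> sets borel" using K by (simp add: borel_compact)
  have iK: "integrable lborel (indicator K :: 'a \<Rightarrow> real)"
    using emeasure_compact_finite[OF K] by (simp add: integrable_indicator_iff)
  \<comment> \<open>The error budget is \<open>e/4\<close> for each of the two averages and less than \<open>e/2\<close> for their distance.\<close>
  define r where "r = e / (4 * (R + 1))"
  have r: "0 < r" using e R by (simp add: r_def)
  have rR: "r * R \<le> e / 4"
  proof -
    have "r * R \<le> r * (R + 1)" using r by (intro mult_left_mono) auto
    also have "\<dots> = e / 4" using R by (simp add: r_def field_simps)
    finally show ?thesis .
  qed
  define V where "V = vol TYPE('a) r"
  have V: "0 < V" unfolding V_def by (rule vol_pos[OF r])
  obtain g k where k: "strict_mono (k :: nat \<Rightarrow> nat)"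
    and g: "\<And>e. 0 < e \<Longrightarrow> \<exists>N. \<forall>n x. n \<ge> N \<and> x \<in> K \<longrightarrow> norm (avg r (u (k n)) x - g x) < e"
  proof (rule Arzela_Ascoli[OF K, of "\<lambda>n. avg r (u n)" "R / V"])
    fix n x
    show "norm (avg r (u n) x) \<le> R / V"
      using avg_powr_le[OF K uD r, of 1 n x] divide_right_mono[OF b(2)[of n], of V] V by (simp add: V_def)
  next
    fix x :: 'a and \<epsilon> :: real assume \<epsilon>: "0 < \<epsilon>"
    show "\<exists>d>0. \<forall>n y. y \<in> K \<and> norm (x - y) < d \<longrightarrow> norm (avg r (u n) x - avg r (u n) y) < \<epsilon>"
    proof (intro exI[of _ "\<epsilon> * V / (R + 1)"] conjI allI impI)
      show "0 < \<epsilon> * V / (R + 1)" using \<epsilon> V R by simp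
      fix n y assume y: "y \<in> K \<and> norm (x - y) < \<epsilon> * V / (R + 1)"
      have "norm (avg r (u n) x - avg r (u n) y) \<le> norm (x - y) * (LINT y|lborel. norm (D n y)) / V"
        using avg_lipschitz[OF K uD r, of n x y] by (simp add: V_def)
      also have "\<dots> \<le> norm (x - y) * (R + 1) / V"
        using b(1)[of n] V by (intro divide_right_mono mult_left_mono) auto
      also have "\<dots> < \<epsilon>" using y V R by (simp add: field_simps)
      finally show "norm (avg r (u n) x - avg r (u n) y) < \<epsilon>" .
    qed
  qed blast
  define \<delta> where "\<delta> = e / (4 * (measure lborel K + 1))"
  have mK: "0 \<le> measure lborel K" by simp
  have \<delta>: "0 < \<delta>" unfolding \<delta>_def by (intro divide_pos_pos mult_pos_pos add_nonneg_pos mK e) auto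
  have \<delta>K: "\<delta> * measure lborel K < e / 4"
  proof -
    have "\<delta> * measure lborel K < \<delta> * (measure lborel K + 1)" using \<delta> by (intro mult_strict_left_mono) auto
    also have "\<dots> = e / 4"
    proof -
      have "e / (4 * (t + 1)) * (t + 1) = e / 4" if "0 \<le> t" for t :: real using that by (simp add: field_simps)
      then show ?thesis unfolding \<delta>_def using mK by blast
    qed
    finally show ?thesis .
  qed
  obtain N where N: "\<And>n x. n \<ge> N \<Longrightarrow> x \<in> K \<Longrightarrow> norm (avg r (u (k n)) x - g x) < \<delta>"
    using g[OF \<delta>] by blast
  have iu: "integrable lborel (u n)" for n
    by (rule integrable_compact_support[OF c1_continuous[OF K uD] K c1_zero(1)[OF K uD]])
  have est: "integrable lborel (\<lambda>x. \<bar>avg r (u n) x - u n x\<bar>)" "(LINT x|lborel. \<bar>avg r (u n) x - u n x\<bar>) \<le> r * R" for n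
  proof -
    note [measurable] = c1_measurable(1)[OF K uD[of n]] measurable_avg[OF K uD[of n] r]
    have le: "(\<integral>\<^sup>+x. ennreal \<bar>avg r (u n) x - u n x\<bar> \<partial>lborel) \<le> ennreal (r * (LINT x|lborel. norm (D n x)))"
      using avg_estimate[OF K uD r, of 1 n] r by simp
    show i: "integrable lborel (\<lambda>x. \<bar>avg r (u n) x - u n x\<bar>)"
      unfolding integrable_iff_bounded using le by (auto intro: le_less_trans)
    have "ennreal (LINT x|lborel. \<bar>avg r (u n) x - u n x\<bar>) \<le> ennreal (r * (LINT x|lborel. norm (D n x)))"
      using le i by (subst nn_integral_eq_integral[symmetric]) auto
    also have "\<dots> \<le> ennreal (r * R)" using b(1)[of n] r by (intro ennreal_leI mult_left_mono) auto
    finally show "(LINT x|lborel. \<bar>avg r (u n) x - u n x\<bar>) \<le> r * R" using r R by (simp add: ennreal_le_iff)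
  qed
  have "(LINT x|lborel. \<bar>u (k (N + i)) x - u (k (N + j)) x\<bar>) < e" for i j
  proof -
    let ?i = "k (N + i)" and ?j = "k (N + j)"
    have "(LINT x|lborel. \<bar>u ?i x - u ?j x\<bar>) \<le>
       (LINT x|lborel. \<bar>avg r (u ?i) x - u ?i x\<bar> + \<bar>avg r (u ?j) x - u ?j x\<bar> + 2 * \<delta> * indicator K x)"
    proof (rule integral_mono)
      show "integrable lborel (\<lambda>x. \<bar>u ?i x - u ?j x\<bar>)" using iu by auto
      show "integrable lborel (\<lambda>x. \<bar>avg r (u ?i) x - u ?i x\<bar> + \<bar>avg r (u ?j) x - u ?j x\<bar> + 2 * \<delta> * indicator K x)"
        using est(1) iK by auto
      fix x
      show "\<bar>u ?i x - u ?j x\<bar> \<le> \<bar>avg r (u ?i) x - u ?i x\<bar> + \<bar>avg r (u ?j) x - u ?j x\<bar> + 2 * \<delta> * indicator K x"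
      proof (cases "x \<in> K")
        case True
        have "norm (avg r (u ?i) x - g x) < \<delta>" "norm (avg r (u ?j) x - g x) < \<delta>" using N True by auto
        then show ?thesis using True by simp
      next
        case False
        then show ?thesis using c1_zero(1)[OF K uD] by simp
      qed
    qed
    also have "\<dots> = (LINT x|lborel. \<bar>avg r (u ?i) x - u ?i x\<bar>) + (LINT x|lborel. \<bar>avg r (u ?j) x - u ?j x\<bar>) + 2 * \<delta> * measure lborel K"
      using est(1) iK by simp
    also have "\<dots> < e" using est(2)[of ?i] est(2)[of ?j] rR \<delta>K by linarith
    finally show ?thesis .
  qed
  moreover have "strict_mono (\<lambda>i. k (N + i))" using k by (simp add: strict_mono_def)
  ultimately show ?thesis by (intro exI[of _ "\<lambda>i. k (N + i)"] conjI allI)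
qed

text \<open>A diagonal sequence through the subsequences for the accuracies \<open>1/n\<close>.\<close>

theorem rellich:
  fixes u :: "nat \<Rightarrow> 'a::euclidean_space \<Rightarrow> real"
  assumes K: "compact K" and uD: "\<And>n. c1_supp K (u n) (D n)"
    and b: "\<And>n. (LINT x|lborel. norm (D n x)) \<le> R" "\<And>n. (LINT x|lborel. \<bar>u n x\<bar>) \<le> R"
  obtains k where "strict_mono (k :: nat \<Rightarrow> nat)"
    "\<And>e. 0 < e \<Longrightarrow> \<exists>N. \<forall>i\<ge>N. \<forall>j\<ge>N. (LINT x|lborel. \<bar>u (k i) x - u (k j) x\<bar>) < (e::real)"
proof -
  define P where "P n s \<longleftrightarrow> (\<forall>i j. (LINT x|lborel. \<bar>u (s i) x - u (s j) x\<bar>) < inverse (real (Suc n)))" for n and s :: "nat \<Rightarrow> nat"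
  interpret subseqs P
  proof
    fix n and s :: "nat \<Rightarrow> nat"
    show "\<exists>r'. strict_mono r' \<and> P n (s \<circ> r')"
      using rellich_aux[OF K, of "\<lambda>n. u (s n)" "\<lambda>n. D (s n)" R "inverse (real (Suc n))"] uD b
      by (simp add: P_def)
  qed
  have h: "P n (diagseq \<circ> ((+) (Suc n)))" for n
    by (rule diagseq_holds) (auto simp: P_def)
  have PD: "(LINT x|lborel. \<bar>u (s i) x - u (s j) x\<bar>) < inverse (real (Suc n))" if "P n s" for n s i j
    using that by (simp add: P_def)
  show thesis
  proof
    show "strict_mono diagseq" by (rule subseq_diagseq)
    fix e :: real assume "0 < e"
    then obtain n where n: "inverse (real (Suc n)) < e" using reals_Archimedean by blast
    have "(LINT x|lborel. \<bar>u (diagseq i) x - u (diagseq j) x\<bar>) < e" if "i \<ge> Suc n" "j \<ge> Suc n" for i j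
      using PD[OF h[of n], of "i - Suc n" "j - Suc n"] n that by (simp add: o_def del: of_nat_Suc)
    then show "\<exists>N. \<forall>i\<ge>N. \<forall>j\<ge>N. (LINT x|lborel. \<bar>u (diagseq i) x - u (diagseq j) x\<bar>) < e" by blast
  qed
qed

section \<open>N-functions between two powers\<close>

lemma int0_has_real_derivative:
  assumes g: "continuous_on UNIV g"
  shows "(int0 g has_real_derivative g t) (at t)"
proof -
  define a where "a = min t 0 - 1"
  define b where "b = max t 0 + 1"
  have ab: "a < t" "t < b" "a < 0" "0 < b" by (auto simp: a_def b_def)
  have cg: "continuous_on S g" for S using g continuous_on_subset by blast
  have ig: "g integrable_on {x..y}" for x y by (intro integrable_continuous_interval cg)
  have eq: "int0 g x = integral {a..x} g - integral {a..0} g" if "x \<in> {a<..<b}" for x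
  proof (cases "0 \<le> x")
    case True
    then show ?thesis using Henstock_Kurzweil_Integration.integral_combine[of a 0 x g] ab ig that
      by (auto simp: int0_def)
  next
    case False
    then show ?thesis using Henstock_Kurzweil_Integration.integral_combine[of a x 0 g] ab ig that
      by (auto simp: int0_def)
  qed
  have "((\<lambda>x. integral {a..x} g) has_real_derivative g t) (at t within {a..b})"
    using integral_has_real_derivative[OF cg, of t a b] ab by auto
  then have "((\<lambda>x. integral {a..x} g) has_real_derivative g t) (at t)"
    using ab at_within_Icc_at[of a t b] by simp
  then have "((\<lambda>x. integral {a..x} g - integral {a..0} g) has_real_derivative g t) (at t)"
    by (auto intro!: derivative_eq_intros)
  then show ?thesis
    by (rule has_field_derivative_transform_within_open[where S="{a<..<b}"]) (use ab eq in auto)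
qed

text \<open>The two quotient conditions are the integrated form of the index bounds. No derivative of \<open>\<phi>\<close> occurs, so that all later
comparison arguments rest on monotonicity alone.\<close>

locale power_growth =
  fixes \<phi> :: "real \<Rightarrow> real" and l m :: real
  assumes lm: "1 < l" "l \<le> m"
    and pos: "t > 0 \<Longrightarrow> \<phi> t > 0"
    and cont: "continuous_on {0..} (\<lambda>t. t * \<phi> t)"
    and lower: "0 < s \<Longrightarrow> s \<le> t \<Longrightarrow> s * \<phi> s / s powr (l - 1) \<le> t * \<phi> t / t powr (l - 1)"
    and upper: "0 < s \<Longrightarrow> s \<le> t \<Longrightarrow> t * \<phi> t / t powr (m - 1) \<le> s * \<phi> s / s powr (m - 1)"
begin

abbreviation "P \<equiv> Phi \<phi>"
text \<open>The odd extension of \<open>t \<phi>(t)\<close>, the derivative of \<open>\<Phi>\<close>.\<close>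

definition "h t = t * \<phi> \<bar>t\<bar>"

lemma h_0[simp]: "h 0 = 0" by (simp add: h_def)
lemma h_minus: "h (- t) = - h t" by (simp add: h_def)
lemma h_pos: "t > 0 \<Longrightarrow> h t > 0" using pos by (simp add: h_def)
lemma h_nonneg: "t \<ge> 0 \<Longrightarrow> h t \<ge> 0" using h_pos[of t] by (cases "t = 0") (auto simp: )

lemma continuous_h: "continuous_on UNIV h"
proof -
  have 1: "continuous_on {0..} h"
    using cont by (rule continuous_on_eq) (auto simp: h_def)
  have "continuous_on {..0} (\<lambda>t. - h (- t))"
    by (intro continuous_intros continuous_on_compose2[OF 1]) auto
  then have 2: "continuous_on {..0} h" by (simp add: h_minus)
  have "continuous_on ({..0} \<union> {0..}) h"
    by (intro continuous_on_closed_Un 1 2) auto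
  moreover have "{..0} \<union> {0..} = (UNIV :: real set)" by auto
  ultimately show ?thesis by simp
qed

lemma P_int0: "P = int0 h" by (rule ext) (simp add: Phi_def h_def[abs_def])

lemma DERIV_P: "(P has_real_derivative h t) (at t)"
  unfolding P_int0 by (rule int0_has_real_derivative[OF continuous_h])

lemma P_0[simp]: "P 0 = 0" by (simp add: Phi_def int0_def)

lemma P_minus[simp]: "P (- t) = P t"
proof -
  have D: "((\<lambda>s. P (- s) - P s) has_real_derivative 0) (at x)" for x
  proof -
    have "((\<lambda>s. P (- s)) has_real_derivative h (- x) * (- 1)) (at x)"
      by (rule DERIV_chain2[OF DERIV_P]) (auto intro!: derivative_eq_intros)
    from DERIV_diff[OF this DERIV_P[of x]] show ?thesis by (simp add: h_minus)
  qed
  show ?thesis using DERIV_isconst_all[of "\<lambda>s. P (- s) - P s" t 0] D by simp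
qed

lemma P_abs[simp]: "P \<bar>t\<bar> = P t" by (cases "t \<ge> 0") auto

lemma continuous_P: "continuous_on UNIV P"
  using DERIV_P DERIV_continuous_on by blast

lemma continuous_on_P[continuous_intros]:
  "continuous_on S g \<Longrightarrow> continuous_on S (\<lambda>x. P (g x))"
  by (rule continuous_on_compose2[OF continuous_P]) auto

lemma h_scale_le_l: "0 \<le> s \<Longrightarrow> s \<le> 1 \<Longrightarrow> 0 \<le> t \<Longrightarrow> h (s * t) \<le> s powr (l - 1) * h t"
proof (cases "s = 0 \<or> t = 0")
  case False
  assume a: "0 \<le> s" "s \<le> 1" "0 \<le> t"
  have st: "0 < s * t" "s * t \<le> t" using a False by (auto simp: mult_le_cancel_right1)
  have "h (s * t) / (s * t) powr (l - 1) \<le> h t / t powr (l - 1)"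
    using lower[OF st] a by (simp add: h_def)
  then show ?thesis using a False st
    by (simp add: powr_mult field_simps)
qed auto

lemma h_scale_ge_m: "0 \<le> s \<Longrightarrow> s \<le> 1 \<Longrightarrow> 0 \<le> t \<Longrightarrow> s powr (m - 1) * h t \<le> h (s * t)"
proof (cases "s = 0 \<or> t = 0")
  case False
  assume a: "0 \<le> s" "s \<le> 1" "0 \<le> t"
  have st: "0 < s * t" "s * t \<le> t" using a False by (auto simp: mult_le_cancel_right1)
  have "h t / t powr (m - 1) \<le> h (s * t) / (s * t) powr (m - 1)"
    using upper[OF st] a by (simp add: h_def)
  then show ?thesis using a False st
    by (simp add: powr_mult field_simps)
qed auto

lemma h_scale_le_m: "1 \<le> s \<Longrightarrow> 0 \<le> t \<Longrightarrow> h (s * t) \<le> s powr (m - 1) * h t"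
  using h_scale_ge_m[of "1 / s" "s * t"] by (simp add: powr_divide field_simps)

lemma h_scale_ge_l: "1 \<le> s \<Longrightarrow> 0 \<le> t \<Longrightarrow> s powr (l - 1) * h t \<le> h (s * t)"
  using h_scale_le_l[of "1 / s" "s * t"] by (simp add: powr_divide field_simps)

lemma h_mono_nonneg: assumes "0 \<le> s" "s \<le> t" shows "h s \<le> h t"
proof (cases "t = 0")
  case False
  have "h (s / t * t) \<le> (s / t) powr (l - 1) * h t"
    using assms False by (intro h_scale_le_l) auto
  also have "\<dots> \<le> 1 * h t"
    using assms False lm by (intro mult_right_mono h_nonneg powr_le1) auto
  finally show ?thesis using False by simp
qed (use assms in auto)

lemma h_mono: "s \<le> t \<Longrightarrow> h s \<le> h t"
  using h_mono_nonneg[of s t] h_mono_nonneg[of "- t" "- s"] h_nonneg[of t] h_nonneg[of "- s"]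
  by (cases "0 \<le> s"; cases "0 \<le> t") (auto simp: h_minus)

lemma P_mono: assumes "0 \<le> s" "s \<le> t" shows "P s \<le> P t"
proof (rule DERIV_nonneg_imp_nondecreasing[OF assms(2)])
  fix x assume "s \<le> x" "x \<le> t"
  then show "\<exists>y. (P has_real_derivative y) (at x) \<and> 0 \<le> y"
    using DERIV_P[of x] h_nonneg[of x] assms by auto
qed

lemma P_nonneg[simp]: "0 \<le> P t"
  using P_mono[of 0 "\<bar>t\<bar>"] by simp

lemma P_pos: assumes "t \<noteq> 0" shows "0 < P t"
proof -
  have "P 0 < P \<bar>t\<bar>"
  proof (rule DERIV_pos_imp_increasing_open[where f=P])
    show "continuous_on {0..\<bar>t\<bar>} P" using continuous_P continuous_on_subset by blast
    fix x :: real assume "0 < x"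
    then show "\<exists>y. (P has_real_derivative y) (at x) \<and> 0 < y" using DERIV_P h_pos by blast
  qed (use assms in auto)
  then show ?thesis by simp
qed

lemma P_eq_0_iff[simp]: "P t = 0 \<longleftrightarrow> t = 0" using P_pos[of t] by force

text \<open>The scaling inequalities for \<open>P\<close> are obtained from those for its derivative, since both sides vanish at \<open>0\<close>.\<close>

lemma deriv_compare:
  assumes "0 \<le> t" "\<And>x. 0 \<le> x \<Longrightarrow> x \<le> t \<Longrightarrow> (g has_real_derivative g' x) (at x)"
    "\<And>x. 0 \<le> x \<Longrightarrow> x \<le> t \<Longrightarrow> 0 \<le> g' x" "g (0::real) = 0"
  shows "0 \<le> g t"
  using DERIV_nonneg_imp_nondecreasing[of 0 t g] assms by force

lemma DERIV_P_scale: "((\<lambda>x. P (s * x)) has_real_derivative s * h (s * x)) (at x)"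
proof -
  have "((\<lambda>x. s * x) has_real_derivative s) (at x)" by (auto intro!: derivative_eq_intros)
  from DERIV_chain2[OF DERIV_P this] show ?thesis by (simp add: mult.commute)
qed

lemma P_scale_le_m: assumes "1 \<le> s" shows "P (s * t) \<le> s powr m * P t"
proof -
  have "0 \<le> s powr m * P \<bar>t\<bar> - P (s * \<bar>t\<bar>)"
  proof (rule deriv_compare[where g="\<lambda>x. s powr m * P x - P (s * x)" and g'="\<lambda>x. s powr m * h x - s * h (s * x)"])
    fix x :: real assume x: "0 \<le> x"
    show "((\<lambda>x. s powr m * P x - P (s * x)) has_real_derivative (s powr m * h x - s * h (s * x))) (at x)"
      by (intro DERIV_diff DERIV_P_scale DERIV_cmult DERIV_P)
    show "0 \<le> s powr m * h x - s * h (s * x)"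
      using mult_left_mono[OF h_scale_le_m[OF assms x], of s] assms
      by (simp add: powr_mult_base flip: mult.assoc)
  qed auto
  then show ?thesis using assms P_abs[of "s * t"] by (simp add: abs_mult del: P_abs) simp
qed

lemma P_scale_ge_l: assumes "1 \<le> s" shows "s powr l * P t \<le> P (s * t)"
proof -
  have "0 \<le> P (s * \<bar>t\<bar>) - s powr l * P \<bar>t\<bar>"
  proof (rule deriv_compare[where g="\<lambda>x. P (s * x) - s powr l * P x" and g'="\<lambda>x. s * h (s * x) - s powr l * h x"])
    fix x :: real assume x: "0 \<le> x"
    show "((\<lambda>x. P (s * x) - s powr l * P x) has_real_derivative (s * h (s * x) - s powr l * h x)) (at x)"
      by (intro DERIV_diff DERIV_P_scale DERIV_cmult DERIV_P)
    show "0 \<le> s * h (s * x) - s powr l * h x"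
      using mult_left_mono[OF h_scale_ge_l[OF assms x], of s] assms
      by (simp add: powr_mult_base flip: mult.assoc)
  qed auto
  then show ?thesis using assms P_abs[of "s * t"] by (simp add: abs_mult del: P_abs) simp
qed

lemma P_scale_le_l: assumes "0 \<le> s" "s \<le> 1" shows "P (s * t) \<le> s powr l * P t"
proof (cases "s = 0")
  case False
  then show ?thesis using P_scale_ge_l[of "1 / s" "s * t"] assms by (simp add: powr_divide field_simps)
qed auto

lemma P_scale_ge_m: assumes "0 \<le> s" "s \<le> 1" shows "s powr m * P t \<le> P (s * t)"
proof (cases "s = 0")
  case False
  then show ?thesis using P_scale_le_m[of "1 / s" "s * t"] assms by (simp add: powr_divide field_simps)
qed auto

text \<open>A version for arbitrary factors, in which the additive \<open>1\<close> covers small \<open>s\<close>.\<close>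

lemma P_scale_le: "P (s * t) \<le> (1 + \<bar>s\<bar> powr m) * P t"
proof -
  have "P (\<bar>s\<bar> * t) \<le> (1 + \<bar>s\<bar> powr m) * P t"
  proof (cases "\<bar>s\<bar> \<le> 1")
    case True
    have "P (\<bar>s\<bar> * t) \<le> \<bar>s\<bar> powr l * P t" using True by (intro P_scale_le_l) auto
    also have "\<dots> \<le> (1 + \<bar>s\<bar> powr m) * P t"
      using True lm powr_le1[of l "\<bar>s\<bar>"] by (intro mult_right_mono) (auto intro: add_increasing2)
    finally show ?thesis .
  next
    case False
    then have "P (\<bar>s\<bar> * t) \<le> \<bar>s\<bar> powr m * P t" by (intro P_scale_le_m) auto
    also have "\<dots> \<le> (1 + \<bar>s\<bar> powr m) * P t" by (intro mult_right_mono) auto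
    finally show ?thesis .
  qed
  then show ?thesis by (cases "s \<ge> 0") auto
qed

text \<open>Integration of the upper quotient bound. It is the estimate behind Young's inequality below.\<close>

lemma h_le_P: "0 \<le> t \<Longrightarrow> t * h t \<le> m * P t"
proof (cases "t = 0")
  case False
  assume t: "0 \<le> t"
  define A where "A = h t / t powr (m - 1)"
  have D: "((\<lambda>x. x powr m) has_real_derivative m * x powr (m - 1)) (at x)" if "0 < x" for x
    using that has_real_derivative_powr by blast
  have "(\<lambda>x. P x - A * x powr m / m) 0 \<le> (\<lambda>x. P x - A * x powr m / m) t"
  proof (rule DERIV_nonneg_imp_increasing_open[where f="\<lambda>x. P x - A * x powr m / m"])
    show "continuous_on {0..t} (\<lambda>x. P x - A * x powr m / m)"
      using lm by (intro continuous_intros continuous_on_powr') auto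
    fix x assume x: "0 < x" "x < t"
    have "(x / t) powr (m - 1) * h t \<le> h (x / t * t)"
      using x by (intro h_scale_ge_m) auto
    then have "0 \<le> h x - A * (m * x powr (m - 1)) / m"
      using x lm by (simp add: A_def powr_divide mult.commute)
    moreover have "((\<lambda>x. P x - A * x powr m / m) has_real_derivative h x - A * (m * x powr (m - 1)) / m) (at x)"
      by (intro DERIV_diff DERIV_P DERIV_cdivide DERIV_cmult D x)
    ultimately show "\<exists>y. ((\<lambda>x. P x - A * x powr m / m) has_real_derivative y) (at x) \<and> 0 \<le> y"
      by blast
  qed (use t in auto)
  moreover have "A * t powr m = t * h t"
    using False t powr_mult_base[of t "m - 1"] by (simp add: A_def field_simps)
  ultimately show ?thesis using lm by (simp add: field_simps)
qed auto

text \<open>With \<open>r\<close> the larger argument, \<open>h(s) t \<le> h(r) r\<close> by monotonicity, and \<open>r h(r)\<close> is comparable with \<open>P(r)\<close>.\<close>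

lemma young: assumes "0 \<le> s" "0 \<le> t" shows "h s * t \<le> m * (P s + P t)"
proof -
  define r where "r = max s t"
  have "h s * t \<le> h r * r" using assms
    by (intro mult_mono h_mono h_nonneg) (auto simp: r_def)
  also have "\<dots> \<le> m * P r" using h_le_P[of r] assms by (simp add: r_def mult.commute)
  also have "\<dots> \<le> m * (P s + P t)"
    using lm by (intro mult_left_mono) (auto simp: r_def max_def)
  finally show ?thesis .
qed

lemma convex_P: "convex_on UNIV P"
  by (rule convex_on_realI[where f'=h]) (auto intro: DERIV_P h_mono)

lemma P_midpoint: "P ((s + t) / 2) \<le> (P s + P t) / 2"
  using convex_onD[OF convex_P, of "1/2" s t] by (simp add: field_simps)

text \<open>The sum is twice the midpoint: convexity handles the midpoint, and doubling costs the factor \<open>2\<^sup>m\<close> (the \<open>\<Delta>\<^sub>2\<close> condition).\<close>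

lemma P_add_le: "P (s + t) \<le> 2 powr m * (P s + P t)"
proof -
  have "P (2 * ((s + t) / 2)) \<le> 2 powr m * P ((s + t) / 2)" by (rule P_scale_le_m) simp
  also have "\<dots> \<le> 2 powr m * (P s + P t)"
    by (intro mult_left_mono order_trans[OF P_midpoint]) (auto simp: divide_le_eq)
  finally show ?thesis by (simp add: add_divide_distrib[symmetric] del: distrib_left_numeral)
qed

lemma P_norm_add_le:
  fixes a b :: "'b::real_normed_vector"
  shows "P (norm (a + b)) \<le> 2 powr m * (P (norm a) + P (norm b))"
  by (rule order_trans[OF P_mono P_add_le]) (auto intro: norm_triangle_ineq)

lemma P_norm_diff_le:
  fixes a b :: "'b::real_normed_vector"
  shows "P (norm (a - b)) \<le> 2 powr m * (P (norm a) + P (norm b))"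
  using P_norm_add_le[of a "- b"] by simp

text \<open>The lower index makes \<open>\<Phi>\<close> dominate \<open>t\<^sup>l\<close> away from the origin, which reduces the embedding theorems to the classical ones.\<close>

lemma powr_l_le: "0 \<le> t \<Longrightarrow> t powr l \<le> 1 + P t / P 1"
proof (cases "t \<le> 1")
  case True
  assume "0 \<le> t"
  then have "t powr l \<le> 1" using True lm by (intro powr_le1) auto
  then show ?thesis by (simp add: add_increasing2)
next
  case False
  then have "t powr l * P 1 \<le> P (t * 1)" by (intro P_scale_ge_l) auto
  then show ?thesis using P_pos[of 1] by (simp add: field_simps)
qed

lemma P_le_powr: assumes "m \<le> q" shows "P t \<le> P 1 * (\<bar>t\<bar> + \<bar>t\<bar> powr q)"
proof -
  have "P \<bar>t\<bar> \<le> P 1 * (\<bar>t\<bar> + \<bar>t\<bar> powr q)"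
  proof (cases "\<bar>t\<bar> \<le> 1")
    case True
    have "P (\<bar>t\<bar> * 1) \<le> \<bar>t\<bar> powr l * P 1" using True by (intro P_scale_le_l) auto
    also have "\<dots> \<le> \<bar>t\<bar> powr 1 * P 1"
      using True lm by (intro mult_right_mono powr_mono') auto
    also have "\<dots> \<le> P 1 * (\<bar>t\<bar> + \<bar>t\<bar> powr q)" by (simp add: field_simps)
    finally show ?thesis by simp
  next
    case False
    have "P (\<bar>t\<bar> * 1) \<le> \<bar>t\<bar> powr m * P 1" using False by (intro P_scale_le_m) auto
    also have "\<dots> \<le> \<bar>t\<bar> powr q * P 1"
      using False assms by (intro mult_right_mono powr_mono) auto
    also have "\<dots> \<le> P 1 * (\<bar>t\<bar> + \<bar>t\<bar> powr q)" by (simp add: field_simps)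
    finally show ?thesis by simp
  qed
  then show ?thesis by simp
qed

text \<open>Strict convexity on the half-line in quantitative form. With \<open>s\<close> half the distance of \<open>\<alpha>\<close> and \<open>\<beta>\<close>, the second difference
\<open>P \<alpha> - 2 P \<mu> + P \<beta>\<close> is the increment over \<open>[\<mu>, \<alpha>]\<close> of \<open>P(t) - P(t - s)\<close>. There \<open>t - s\<close> is at most \<open>\<rho> t\<close>, so the lower
index bounds \<open>h(t - s)\<close> by a fixed fraction of \<open>h(t)\<close>.\<close>

lemma scalar_gap:
  assumes "0 \<le> \<beta>" "\<beta> \<le> \<sigma> * \<alpha>" "0 < \<alpha>" "0 < \<sigma>" "\<sigma> < 1"
  defines "\<rho> \<equiv> (1 + \<sigma>) / 2"
  shows "P ((\<alpha> + \<beta>) / 2) \<le> (1 - (1 - \<rho> powr (l - 1)) * (1 - \<rho>) / 2) * ((P \<alpha> + P \<beta>) / 2)"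
proof -
  define c where "c = 1 - \<rho> powr (l - 1)"
  define s where "s = (\<alpha> - \<beta>) / 2"
  define \<mu> where "\<mu> = (\<alpha> + \<beta>) / 2"
  have rho: "0 < \<rho>" "\<rho> < 1" using assms by (auto simp: \<rho>_def)
  have ba: "\<beta> \<le> \<alpha>" using assms(2) mult_right_mono[of \<sigma> 1 \<alpha>] assms by linarith
  have c: "0 \<le> c" "c \<le> 1" using rho lm by (auto simp: c_def intro!: powr_le1)
  have mu: "\<mu> \<le> \<rho> * \<alpha>" "0 < \<mu>" "\<mu> \<le> \<alpha>" using assms ba by (auto simp: \<mu>_def \<rho>_def field_simps)
  have "(\<lambda>t. P t - P (t - s) - c * P t) \<mu> \<le> (\<lambda>t. P t - P (t - s) - c * P t) \<alpha>"
  proof (rule DERIV_nonneg_imp_nondecreasing[where f="\<lambda>t. P t - P (t - s) - c * P t"])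
    fix t assume t: "\<mu> \<le> t" "t \<le> \<alpha>"
    have t0: "0 < t" "0 \<le> t - s" using mu t assms ba by (auto simp: s_def \<mu>_def field_simps)
    have "t * (1 - \<rho>) \<le> \<alpha> * (1 - \<rho>)" using t rho by (intro mult_right_mono) auto
    \<comment> \<open>The quotient \<open>(t - s) / t\<close> is largest at \<open>t = \<alpha>\<close>, where it is at most \<open>(1 + \<sigma>) / 2\<close>.\<close>
    then have ts: "(t - s) / t \<le> \<rho>" using t0 assms by (auto simp: s_def \<rho>_def field_simps)
    have "h ((t - s) / t * t) \<le> ((t - s) / t) powr (l - 1) * h t"
      using t0 ts rho ba by (intro h_scale_le_l) (auto simp: s_def)
    also have "\<dots> \<le> \<rho> powr (l - 1) * h t"
      using t0 ts lm by (intro mult_right_mono powr_mono2 h_nonneg) auto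
    also have "(t - s) / t * t = t - s" using t0 by simp
    finally have "0 \<le> h t - h (t - s) - c * h t" by (simp add: c_def algebra_simps)
    moreover have "((\<lambda>t. t - s) has_real_derivative 1) (at t)" by (auto intro!: derivative_eq_intros)
    from DERIV_chain2[OF DERIV_P this]
    have "((\<lambda>t. P (t - s)) has_real_derivative h (t - s)) (at t)" by simp
    then have "((\<lambda>t. P t - P (t - s) - c * P t) has_real_derivative h t - h (t - s) - c * h t) (at t)"
      by (intro DERIV_diff DERIV_cmult DERIV_P)
    ultimately show "\<exists>y. ((\<lambda>t. P t - P (t - s) - c * P t) has_real_derivative y) (at t) \<and> 0 \<le> y"
      by blast
  qed (rule mu)
  moreover have "\<mu> - s = \<beta>" "\<alpha> - s = \<mu>" by (auto simp: \<mu>_def s_def field_simps)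
  ultimately have gap: "c * (P \<alpha> - P \<mu>) \<le> P \<alpha> + P \<beta> - 2 * P \<mu>" by (simp add: algebra_simps)
  have "P \<mu> \<le> P (\<rho> * \<alpha>)" using mu by (intro P_mono) auto
  also have "\<dots> \<le> \<rho> powr l * P \<alpha>" using rho by (intro P_scale_le_l) auto
  also have "\<dots> \<le> \<rho> powr 1 * P \<alpha>" using rho lm by (intro mult_right_mono powr_mono') auto
  finally have "P \<mu> \<le> \<rho> * P \<alpha>" using rho by simp
  then have "(1 - \<rho>) * P \<alpha> \<le> P \<alpha> - P \<mu>" by (simp add: algebra_simps)
  from mult_left_mono[OF this c(1)] gap
  have 1: "c * (1 - \<rho>) * P \<alpha> \<le> P \<alpha> + P \<beta> - 2 * P \<mu>" by (simp add: mult.assoc)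
  have "(P \<alpha> + P \<beta>) / 2 \<le> P \<alpha>" using P_mono[of \<beta> \<alpha>] ba assms by simp
  then have "c * (1 - \<rho>) * ((P \<alpha> + P \<beta>) / 2) \<le> c * (1 - \<rho>) * P \<alpha>"
    using c rho by (intro mult_left_mono) auto
  with 1 show ?thesis unfolding c_def[symmetric] \<mu>_def[symmetric] by (simp add: field_simps)
qed

text \<open>Two cases. If the norms differ by a definite factor, the gap comes from the scalar inequality. If they are comparable, the
parallelogram law shortens the midpoint by the factor \<open>\<theta>\<close>. The threshold \<open>\<sigma>\<close> is chosen with \<open>\<sigma>\<^sup>m = \<theta>\<close>, so that
\<open>P(\<bar>b\<bar>) \<ge> \<theta> P(\<bar>a\<bar>)\<close> in the second case.\<close>

lemma uniform_convexity_aux: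
  fixes a b :: "'b::real_inner"
  assumes e: "0 < \<epsilon>" "\<epsilon> \<le> 1"
  defines "\<theta> \<equiv> sqrt (1 - \<epsilon>\<^sup>2 / 4)"
  defines "\<sigma> \<equiv> \<theta> powr (1 / m)"
  defines "\<rho> \<equiv> (1 + \<sigma>) / 2"
  assumes ab: "norm b \<le> norm a" "\<epsilon> * norm a \<le> norm (a - b)"
  shows "P (norm ((a + b) /\<^sub>R 2)) \<le> (1 - min ((1 - \<theta>) / (1 + \<theta>)) ((1 - \<rho> powr (l - 1)) * (1 - \<rho>) / 2)) * ((P (norm a) + P (norm b)) / 2)"
    (is "_ \<le> (1 - min ?d1 ?d2) * ?S")
proof (cases "a = 0")
  case False
  have e2: "\<epsilon>\<^sup>2 \<le> 1" using e power_le_one[of \<epsilon> 2] by simp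
  have th: "0 < \<theta>" "\<theta> < 1" using e e2 by (auto simp: \<theta>_def)
  have sg: "0 < \<sigma>" "\<sigma> < 1" using th lm by (auto simp: \<sigma>_def powr01_less_one)
  have S: "0 \<le> ?S" by simp
  have nm: "norm ((a + b) /\<^sub>R 2) \<le> (norm a + norm b) / 2"
    using norm_triangle_ineq[of a b] by simp
  show ?thesis
  proof (cases "norm b \<le> \<sigma> * norm a")
    case True
    have "P (norm ((a + b) /\<^sub>R 2)) \<le> P ((norm a + norm b) / 2)" using nm by (intro P_mono) auto
    also have "\<dots> \<le> (1 - ?d2) * ?S" unfolding \<rho>_def using True sg False by (intro scalar_gap) auto
    also have "\<dots> \<le> (1 - min ?d1 ?d2) * ?S"
      by (intro mult_right_mono S diff_left_mono min.cobounded2)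
    finally show ?thesis .
  next
    case bs: False
    have "(norm (a + b))\<^sup>2 + (norm (a - b))\<^sup>2 = 2 * (norm a)\<^sup>2 + 2 * (norm b)\<^sup>2"
      by (simp add: power2_norm_eq_inner algebra_simps inner_commute)
    moreover have "(norm b)\<^sup>2 \<le> (norm a)\<^sup>2" using ab by (intro power_mono) auto
    moreover have "(\<epsilon> * norm a)\<^sup>2 \<le> (norm (a - b))\<^sup>2" using ab e by (intro power_mono) auto
    ultimately have "(norm (a + b))\<^sup>2 \<le> (4 - \<epsilon>\<^sup>2) * (norm a)\<^sup>2"
      unfolding power_mult_distrib left_diff_distrib by linarith
    also have "\<dots> = (2 * \<theta> * norm a)\<^sup>2" using e2 by (simp add: \<theta>_def power_mult_distrib algebra_simps)
    finally have "norm (a + b) \<le> 2 * \<theta> * norm a" using th by (auto intro: power2_le_imp_le)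
    then have "P (norm ((a + b) /\<^sub>R 2)) \<le> P (\<theta> * norm a)" by (intro P_mono) auto
    also have "\<dots> \<le> \<theta> powr l * P (norm a)" using th by (intro P_scale_le_l) auto
    also have "\<dots> \<le> \<theta> powr 1 * P (norm a)" using th lm by (intro mult_right_mono powr_mono') auto
    finally have 1: "P (norm ((a + b) /\<^sub>R 2)) \<le> \<theta> * P (norm a)" using th by simp
    have "\<sigma> powr m * P (norm a) \<le> P (\<sigma> * norm a)" using sg by (intro P_scale_ge_m) auto
    also have "\<dots> \<le> P (norm b)" using bs sg by (intro P_mono) auto
    also have "\<sigma> powr m = \<theta>" using th lm by (simp add: \<sigma>_def powr_powr)
    finally have "(1 + \<theta>) / 2 * P (norm a) \<le> ?S" by (simp add: field_simps)
    then have "(1 - ?d1) * ((1 + \<theta>) / 2 * P (norm a)) \<le> (1 - ?d1) * ?S"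
      using th by (intro mult_left_mono) (auto simp: field_simps)
    moreover have "(1 - ?d1) * ((1 + \<theta>) / 2 * P (norm a)) = \<theta> * P (norm a)"
      using th by (simp add: field_simps)
    moreover have "(1 - ?d1) * ?S \<le> (1 - min ?d1 ?d2) * ?S" by (intro mult_right_mono S) auto
    ultimately show ?thesis using 1 by linarith
  qed
qed (use ab in auto)

text \<open>The modular of a difference is small as soon as the convexity defect of the midpoint is. Either \<open>a - b\<close> is short compared
with \<open>a\<close> and \<open>b\<close>, which is absorbed by \<open>\<epsilon>\<close>, or the defect is a fixed fraction of \<open>P \<bar>a\<bar> + P \<bar>b\<bar>\<close>.\<close>

lemma uniform_convexity:
  assumes "0 < \<epsilon>"
  obtains K where "0 \<le> K" "\<And>a b :: 'b::real_inner. P (norm (a - b)) \<le>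
    \<epsilon> * (P (norm a) + P (norm b)) + K * ((P (norm a) + P (norm b)) / 2 - P (norm ((a + b) /\<^sub>R 2)))"
proof -
  define e where "e = min 1 \<epsilon>"
  have e: "0 < e" "e \<le> 1" "e \<le> \<epsilon>" using assms by (auto simp: e_def)
  define \<theta> where "\<theta> = sqrt (1 - e\<^sup>2 / 4)"
  define \<sigma> where "\<sigma> = \<theta> powr (1 / m)"
  define \<rho> where "\<rho> = (1 + \<sigma>) / 2"
  define d where "d = min ((1 - \<theta>) / (1 + \<theta>)) ((1 - \<rho> powr (l - 1)) * (1 - \<rho>) / 2)"
  have e2: "e\<^sup>2 \<le> 1" using e power_le_one[of e 2] by simp
  have th: "0 < \<theta>" "\<theta> < 1" using e e2 by (auto simp: \<theta>_def)
  have sg: "0 < \<sigma>" "\<sigma> < 1" using th lm by (auto simp: \<sigma>_def powr01_less_one)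
  have rho: "0 < \<rho>" "\<rho> < 1" using sg by (auto simp: \<rho>_def)
  have "\<rho> powr (l - 1) < 1" using rho lm by (auto simp: powr01_less_one)
  then have d: "0 < d" using th rho by (auto simp: d_def)
  have gap: "P (norm ((a + b) /\<^sub>R 2)) \<le> (1 - d) * ((P (norm a) + P (norm b)) / 2)"
    if "e * max (norm a) (norm b) \<le> norm (a - b)" for a b :: 'b
  proof (cases "norm b \<le> norm a")
    case True
    then show ?thesis using uniform_convexity_aux[OF e(1,2), of b a] that
      by (simp add: d_def \<rho>_def \<sigma>_def \<theta>_def max_def)
  next
    case False
    then show ?thesis using uniform_convexity_aux[OF e(1,2), of a b] that
      by (simp add: d_def \<rho>_def \<sigma>_def \<theta>_def max_def norm_minus_commute add.commute)
  qed
  have gen: "d * S / 2 \<le> S / 2 - M" if "M \<le> (1 - d) * (S / 2)" for S M :: real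
    using that by (simp add: field_simps)
  define K where "K = 2 powr m * 2 / d"
  show thesis
  proof
    show "0 \<le> K" using d by (simp add: K_def)
    fix a b :: 'b
    let ?S = "P (norm a) + P (norm b)"
    let ?M = "P (norm ((a + b) /\<^sub>R 2))"
    have S: "0 \<le> ?S" by simp
    have "?M \<le> P ((norm a + norm b) / 2)"
      using norm_triangle_ineq[of a b] by (intro P_mono) auto
    also have "\<dots> \<le> ?S / 2" by (rule P_midpoint)
    finally have M: "0 \<le> ?S / 2 - ?M" by simp
    show "P (norm (a - b)) \<le> \<epsilon> * ?S + K * (?S / 2 - ?M)"
    proof (cases "e * max (norm a) (norm b) \<le> norm (a - b)")
      case True
      have "P (norm (a - b)) \<le> 2 powr m * ?S" by (rule P_norm_diff_le)
      also have "\<dots> = K * (d * ?S / 2)" using d by (simp add: K_def)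
      also have "\<dots> \<le> K * (?S / 2 - ?M)"
        by (intro mult_left_mono gen[OF gap[OF True]] \<open>0 \<le> K\<close>)
      also have "\<dots> \<le> \<epsilon> * ?S + K * (?S / 2 - ?M)" using S assms by simp
      finally show ?thesis .
    next
      case False
      have "P (norm (a - b)) \<le> P (e * max (norm a) (norm b))" using False by (intro P_mono) auto
      also have "\<dots> \<le> e powr l * P (max (norm a) (norm b))" using e by (intro P_scale_le_l) auto
      also have "\<dots> \<le> e powr 1 * P (max (norm a) (norm b))"
        using e lm by (intro mult_right_mono powr_mono') auto
      also have "\<dots> \<le> \<epsilon> * ?S" using e by (intro mult_mono) (auto simp: max_def)
      also have "\<dots> \<le> \<epsilon> * ?S + K * (?S / 2 - ?M)" using M \<open>0 \<le> K\<close> by simp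
      finally show ?thesis .
    qed
  qed
qed

definition "A a = \<phi> (norm a) *\<^sub>R a"

lemma norm_A: "norm (A a) = h (norm a)" for a :: "'b::real_inner"
proof (cases "a = 0")
  case False
  then show ?thesis using pos[of "norm a"] by (simp add: A_def h_def)
qed (simp add: A_def)

lemma A_scale: "0 \<le> s \<Longrightarrow> A (s *\<^sub>R a) \<bullet> a = h (s * norm a) * norm a" for a :: "'b::real_inner"
  by (simp add: A_def h_def power2_norm_eq_inner[symmetric] power2_eq_square)

text \<open>At the origin continuity holds because the length of \<open>A a\<close> is \<open>h(\<bar>a\<bar>)\<close>, whatever the value \<open>\<phi> 0\<close>.\<close>

lemma continuous_A: "continuous_on UNIV (A :: 'b::real_inner \<Rightarrow> 'b)"
  unfolding continuous_on_eq_continuous_at[OF open_UNIV]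
proof
  fix a :: 'b
  show "isCont A a"
  proof (cases "a = 0")
    case True
    have "isCont h 0" using continuous_h by (simp add: continuous_on_eq_continuous_at)
    then have "(h \<longlongrightarrow> 0) (at 0)" by (simp add: isCont_def)
    have "isCont (\<lambda>a::'b. h (norm a)) 0"
      by (rule isCont_o2[where g=h]) (use \<open>isCont h 0\<close> in auto)
    then have "((\<lambda>a::'b. h (norm a)) \<longlongrightarrow> 0) (at 0)" by (simp add: isCont_def)
    then have "((\<lambda>a::'b. norm (A a)) \<longlongrightarrow> 0) (at 0)" by (simp add: norm_A)
    then have "(A \<longlongrightarrow> (0::'b)) (at 0)" by (simp add: tendsto_norm_zero_iff)
    then show ?thesis using True by (simp add: isCont_def A_def)
  next
    case False
    have "continuous_on (- {0}) (\<lambda>a::'b. (h (norm a) / norm a) *\<^sub>R a)"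
      by (intro continuous_intros continuous_on_compose2[OF continuous_h]) auto
    then have "continuous_on (- {0}) (A :: 'b \<Rightarrow> 'b)"
      by (rule continuous_on_eq) (simp add: A_def h_def)
    then show ?thesis using False by (simp add: continuous_on_eq_continuous_at open_Compl)
  qed
qed

lemma measurable_A[measurable]: "A \<in> borel_measurable (borel :: ('b::real_inner) measure)"
  by (rule borel_measurable_continuous_onI[OF continuous_A])

lemma DERIV_P_norm_line:
  fixes a b :: "'b::real_inner"
  shows "((\<lambda>t. P (norm (a + t *\<^sub>R b))) has_real_derivative A (a + t *\<^sub>R b) \<bullet> b) (at t)"
proof (cases "a + t *\<^sub>R b = 0")
  case True
  then have a: "a = - (t *\<^sub>R b)" by (simp add: eq_neg_iff_add_eq_0)
  have "norm (a + s *\<^sub>R b) = \<bar>(s - t) * norm b\<bar>" for s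
    unfolding a by (simp add: scaleR_left_diff_distrib[symmetric] abs_mult)
  then have eq: "P (norm (a + s *\<^sub>R b)) = P ((s - t) * norm b)" for s
    by (simp only: P_abs)
  have "((\<lambda>s. (s - t) * norm b) has_real_derivative norm b) (at t)"
    by (auto intro!: derivative_eq_intros)
  from DERIV_chain2[OF DERIV_P this] show ?thesis by (simp add: eq True A_def)
next
  case False
  let ?y = "a + t *\<^sub>R b"
  have "((\<lambda>t. (a + t *\<^sub>R b) \<bullet> (a + t *\<^sub>R b)) has_real_derivative 2 * (?y \<bullet> b)) (at t)"
    unfolding has_field_derivative_def
    by (rule has_derivative_eq_rhs, (rule derivative_intros)+)
      (auto simp: fun_eq_iff inner_commute algebra_simps)
  moreover have pos': "?y \<bullet> ?y > 0" using False by simp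
  ultimately have "((\<lambda>t. sqrt ((a + t *\<^sub>R b) \<bullet> (a + t *\<^sub>R b))) has_real_derivative
      inverse (sqrt (?y \<bullet> ?y)) / 2 * (2 * (?y \<bullet> b))) (at t)"
    by (intro DERIV_chain2[OF DERIV_real_sqrt]) auto
  then have "((\<lambda>t. norm (a + t *\<^sub>R b)) has_real_derivative (?y \<bullet> b) / norm ?y) (at t)"
    by (simp add: norm_eq_sqrt_inner field_simps)
  from DERIV_chain2[OF DERIV_P this] show ?thesis using False
    by (simp add: A_def h_def)
qed

end

section \<open>Modular convergence\<close>

text \<open>The common properties of \<open>\<Phi>\<close> and of the powers \<open>\<bar>t\<bar>\<^sup>q\<close>. Quasi-subadditivity replaces the triangle inequality, and the
linear lower bound gives control of the \<open>L\<^sup>1\<close> norm on finite measure spaces, so completeness can be inherited from \<open>L\<^sup>1\<close>.\<close>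

locale modular =
  fixes A :: "real \<Rightarrow> real"
  assumes A_cont: "continuous_on UNIV A" and A_nonneg: "0 \<le> A t" and A_0: "A 0 = 0"
    and A_tri: "\<exists>K\<ge>0. \<forall>r s t. 0 \<le> r \<longrightarrow> 0 \<le> s \<longrightarrow> 0 \<le> t \<longrightarrow> t \<le> r + s \<longrightarrow> A t \<le> K * (A r + A s)"
    and A_linear: "0 < \<delta> \<Longrightarrow> \<exists>C\<ge>0. \<forall>t\<ge>0. t \<le> \<delta> + C * A t"
begin

lemma A_measurable[measurable]: "A \<in> borel_measurable borel"
  by (rule borel_measurable_continuous_onI[OF A_cont])

lemma L1_bound:
  fixes f :: "'a \<Rightarrow> 'b::{banach, second_countable_topology}"
  assumes "finite_measure M" and [measurable]: "f \<in> borel_measurable M" and i: "integrable M (\<lambda>x. A (norm (f x)))"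
    and C: "0 \<le> C" "\<And>t. 0 \<le> t \<Longrightarrow> t \<le> \<delta> + C * A t"
  shows "integrable M f" "(LINT x|M. norm (f x)) \<le> \<delta> * measure M (space M) + C * (LINT x|M. A (norm (f x)))"
proof -
  interpret finite_measure M by fact
  have "0 \<le> \<delta>" using C(2)[of 0] A_0 by simp
  have ib: "integrable M (\<lambda>x. \<delta> + C * A (norm (f x)))" using i by auto
  show f: "integrable M f"
    by (rule Bochner_Integration.integrable_bound[OF ib])
      (use C \<open>0 \<le> \<delta>\<close> A_nonneg in \<open>auto intro!: AE_I2 order_trans[OF C(2)]\<close>)
  have "(LINT x|M. norm (f x)) \<le> (LINT x|M. \<delta> + C * A (norm (f x)))"
    using f ib C by (intro integral_mono) auto
  also have "\<dots> = \<delta> * measure M (space M) + C * (LINT x|M. A (norm (f x)))" using i by simp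
  finally show "(LINT x|M. norm (f x)) \<le> \<delta> * measure M (space M) + C * (LINT x|M. A (norm (f x)))" .
qed

lemma L1_small:
  assumes "finite_measure M" and e: "0 < e"
  obtains d where "0 < d" "\<And>f :: 'a \<Rightarrow> 'b::{banach, second_countable_topology}. f \<in> borel_measurable M \<Longrightarrow>
    integrable M (\<lambda>x. A (norm (f x))) \<Longrightarrow> (LINT x|M. A (norm (f x))) < d \<Longrightarrow> (LINT x|M. norm (f x)) < e"
proof -
  define \<delta> where "\<delta> = e / (2 * (measure M (space M) + 1))"
  have mu: "0 \<le> measure M (space M)" by simp
  have \<delta>: "0 < \<delta>" unfolding \<delta>_def by (intro divide_pos_pos mult_pos_pos add_nonneg_pos mu e) auto
  have "e / (2 * (t + 1)) * t \<le> e / 2" if "0 \<le> t" for t using that e by (simp add: field_simps)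
  then have \<delta>m: "\<delta> * measure M (space M) \<le> e / 2" unfolding \<delta>_def using mu by blast
  obtain C where C: "0 \<le> C" "\<And>t. 0 \<le> t \<Longrightarrow> t \<le> \<delta> + C * A t" using A_linear[OF \<delta>] by blast
  show thesis
  proof
    show "0 < e / (2 * (C + 1))" using C e by simp
    fix f :: "'a \<Rightarrow> 'b" assume f: "f \<in> borel_measurable M" "integrable M (\<lambda>x. A (norm (f x)))"
      and d: "(LINT x|M. A (norm (f x))) < e / (2 * (C + 1))"
    have 0: "0 \<le> (LINT x|M. A (norm (f x)))" using A_nonneg by simp
    have "C * (LINT x|M. A (norm (f x))) \<le> (C + 1) * (LINT x|M. A (norm (f x)))" using 0 by (simp add: distrib_right)
    also have "\<dots> < (C + 1) * (e / (2 * (C + 1)))" using d C by (intro mult_strict_left_mono) auto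
    also have "\<dots> = e / 2" using C by (simp add: field_simps)
    finally show "(LINT x|M. norm (f x)) < e" using L1_bound(2)[OF assms(1) f C] \<delta>m by linarith
  qed
qed

lemma integrable_tri:
  fixes f g h :: "'a \<Rightarrow> 'b::{banach, second_countable_topology}"
  assumes [measurable]: "f \<in> borel_measurable M"
    and i: "integrable M (\<lambda>x. A (norm (g x)))" "integrable M (\<lambda>x. A (norm (h x)))"
    and le: "\<And>x. norm (f x) \<le> norm (g x) + norm (h x)"
  shows "integrable M (\<lambda>x. A (norm (f x)))"
proof -
  obtain K where K: "0 \<le> K" "\<And>r s t. 0 \<le> r \<Longrightarrow> 0 \<le> s \<Longrightarrow> 0 \<le> t \<Longrightarrow> t \<le> r + s \<Longrightarrow> A t \<le> K * (A r + A s)"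
    using A_tri by blast
  show ?thesis
  proof (rule Bochner_Integration.integrable_bound)
    show "integrable M (\<lambda>x. K * (A (norm (g x)) + A (norm (h x))))" using i by auto
    show "AE x in M. norm (A (norm (f x))) \<le> norm (K * (A (norm (g x)) + A (norm (h x))))"
      using K A_nonneg le by (intro AE_I2) (auto intro: order_trans[OF K(2)])
  qed measurable
qed

text \<open>Fatou's lemma, in the form of a bound that survives almost everywhere convergence.\<close>

lemma fatou_modular:
  fixes f :: "nat \<Rightarrow> 'a \<Rightarrow> 'b::{banach, second_countable_topology}"
  assumes [measurable]: "\<And>n. f n \<in> borel_measurable M" "g \<in> borel_measurable M"
    and i: "\<And>n. integrable M (\<lambda>x. A (norm (f n x)))"
    and R: "\<forall>\<^sub>F n in sequentially. (LINT x|M. A (norm (f n x))) \<le> R"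
    and lim: "AE x in M. (\<lambda>n. f n x) \<longlonglongrightarrow> g x"
  shows "integrable M (\<lambda>x. A (norm (g x)))" "(LINT x|M. A (norm (g x))) \<le> R"
proof -
  obtain n0 where "(LINT x|M. A (norm (f n0 x))) \<le> R" using R by (meson eventually_happens trivial_limit_sequentially)
  moreover have "0 \<le> (LINT x|M. A (norm (f n0 x)))" using A_nonneg by simp
  ultimately have R0: "0 \<le> R" by linarith
  have cA: "isCont A t" for t using A_cont by (simp add: continuous_on_eq_continuous_at)
  have "AE x in M. ennreal (A (norm (g x))) = liminf (\<lambda>n. ennreal (A (norm (f n x))))"
    using lim
  proof eventually_elim
    case (elim x)
    have "(\<lambda>n. ennreal (A (norm (f n x)))) \<longlonglongrightarrow> ennreal (A (norm (g x)))"
      by (intro tendsto_ennrealI isCont_tendsto_compose[OF cA] tendsto_norm elim)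
    then show ?case by (intro lim_imp_Liminf[symmetric]) auto
  qed
  then have "(\<integral>\<^sup>+x. ennreal (A (norm (g x))) \<partial>M) = (\<integral>\<^sup>+x. liminf (\<lambda>n. ennreal (A (norm (f n x)))) \<partial>M)"
    by (rule nn_integral_cong_AE)
  also have "\<dots> \<le> liminf (\<lambda>n. \<integral>\<^sup>+x. ennreal (A (norm (f n x))) \<partial>M)"
    by (rule nn_integral_liminf) auto
  also have "\<dots> = liminf (\<lambda>n. ennreal (LINT x|M. A (norm (f n x))))"
    using i A_nonneg by (subst nn_integral_eq_integral) auto
  also have "\<dots> \<le> ennreal R"
  proof (rule order_trans[OF Liminf_le_Limsup])
    show "limsup (\<lambda>n. ennreal (LINT x|M. A (norm (f n x)))) \<le> ennreal R"
      by (rule Limsup_bounded) (use R in \<open>eventually_elim, auto intro: ennreal_leI\<close>)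
  qed simp
  finally have le: "(\<integral>\<^sup>+x. ennreal (A (norm (g x))) \<partial>M) \<le> ennreal R" .
  show ig: "integrable M (\<lambda>x. A (norm (g x)))"
    unfolding integrable_iff_bounded using le A_nonneg by (auto intro: le_less_trans)
  have "ennreal (LINT x|M. A (norm (g x))) \<le> ennreal R"
    using le nn_integral_eq_integral[OF ig] A_nonneg by simp
  then show "(LINT x|M. A (norm (g x))) \<le> R" using R0 by (simp add: ennreal_le_iff)
qed

text \<open>A Cauchy sequence for the modular is Cauchy in the mean, so a subsequence converges almost everywhere; Fatou's lemma,
applied to \<open>f\<^sub>n - f\<^sub>k\<close> as \<open>k\<close> tends to infinity, identifies the modular limit.\<close>

lemma complete:
  fixes f :: "nat \<Rightarrow> 'a \<Rightarrow> 'b::{banach, second_countable_topology}"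
  assumes M: "finite_measure M" and f[measurable]: "\<And>n. f n \<in> borel_measurable M"
    and i: "\<And>n. integrable M (\<lambda>x. A (norm (f n x)))" "\<And>n k. integrable M (\<lambda>x. A (norm (f n x - f k x)))"
    and cauchy: "\<And>e. 0 < e \<Longrightarrow> \<exists>N. \<forall>n\<ge>N. \<forall>k\<ge>N. (LINT x|M. A (norm (f n x - f k x))) < e"
  obtains g r where "g \<in> borel_measurable M" "strict_mono (r :: nat \<Rightarrow> nat)" "AE x in M. (\<lambda>n. f (r n) x) \<longlonglongrightarrow> g x"
    "\<And>n. integrable M (\<lambda>x. A (norm (f n x - g x)))" "(\<lambda>n. LINT x|M. A (norm (f n x - g x))) \<longlonglongrightarrow> 0"
proof -
  obtain C where C: "0 \<le> C" "\<And>t. 0 \<le> t \<Longrightarrow> t \<le> 1 + C * A t" using A_linear[of 1] by auto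
  have if1: "integrable M (f n)" for n by (rule L1_bound(1)[OF M f i(1) C])
  have "\<exists>N. \<forall>n\<ge>N. \<forall>k\<ge>N. (LINT x|M. norm (f n x - f k x)) < e" if e: "0 < e" for e
  proof -
    obtain d where d: "0 < d" "\<And>g :: 'a \<Rightarrow> 'b. g \<in> borel_measurable M \<Longrightarrow>
      integrable M (\<lambda>x. A (norm (g x))) \<Longrightarrow> (LINT x|M. A (norm (g x))) < d \<Longrightarrow> (LINT x|M. norm (g x)) < e"
      using L1_small[OF M e] by blast
    obtain N where "\<forall>n\<ge>N. \<forall>k\<ge>N. (LINT x|M. A (norm (f n x - f k x))) < d" using cauchy[OF d(1)] by blast
    then have "\<forall>n\<ge>N. \<forall>k\<ge>N. (LINT x|M. norm (f n x - f k x)) < e"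
      by (intro allI impI d(2)) (auto intro: i)
    then show ?thesis by blast
  qed
  then obtain r where r: "strict_mono r" "AE x in M. Cauchy (\<lambda>i. f (r i) x)"
    using cauchy_L1_AE_cauchy_subseq[of M f, OF if1] by blast
  define g where "g x = lim (\<lambda>i. f (r i) x)" for x
  have g[measurable]: "g \<in> borel_measurable M"
    unfolding g_def by (rule borel_measurable_lim_metric) simp
  have lim: "AE x in M. (\<lambda>n. f (r n) x) \<longlonglongrightarrow> g x"
    using r(2) by eventually_elim (simp add: g_def Cauchy_convergent_iff convergent_LIMSEQ_iff)
  have est: "integrable M (\<lambda>x. A (norm (f n x - g x)))" "(LINT x|M. A (norm (f n x - g x))) \<le> e"
    if "\<forall>\<^sub>F k in sequentially. (LINT x|M. A (norm (f n x - f (r k) x))) \<le> e" for n e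
  proof -
    have "AE x in M. (\<lambda>k. f n x - f (r k) x) \<longlonglongrightarrow> f n x - g x"
      using lim by eventually_elim (intro tendsto_intros)
    from fatou_modular[OF _ _ i(2)[of n "r k" for k] that this]
    show "integrable M (\<lambda>x. A (norm (f n x - g x)))" "(LINT x|M. A (norm (f n x - g x))) \<le> e" by auto
  qed
  have small: "\<exists>N. \<forall>n\<ge>N. integrable M (\<lambda>x. A (norm (f n x - g x))) \<and> (LINT x|M. A (norm (f n x - g x))) \<le> e" if "0 < e" for e
  proof -
    obtain N where N: "\<And>n k. n \<ge> N \<Longrightarrow> k \<ge> N \<Longrightarrow> (LINT x|M. A (norm (f n x - f k x))) < e" using cauchy[OF \<open>0 < e\<close>] by blast
    have "\<forall>\<^sub>F k in sequentially. (LINT x|M. A (norm (f n x - f (r k) x))) \<le> e" if n: "n \<ge> N" for n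
      unfolding eventually_sequentially
    proof (intro exI[of _ N] allI impI)
      fix k assume "N \<le> k"
      then have "N \<le> r k" using seq_suble[OF r(1), of k] by linarith
      then show "(LINT x|M. A (norm (f n x - f (r k) x))) \<le> e" using N[OF n, of "r k"] by linarith
    qed
    then show ?thesis using est by blast
  qed
  show thesis
  proof (rule that[OF g r(1) lim])
    show L: "(\<lambda>n. LINT x|M. A (norm (f n x - g x))) \<longlonglongrightarrow> 0"
    proof (rule LIMSEQ_I)
      fix e :: real assume "0 < e"
      then obtain N where "\<forall>n\<ge>N. (LINT x|M. A (norm (f n x - g x))) \<le> e / 2" using small[of "e / 2"] by auto
      moreover have "0 \<le> (LINT x|M. A (norm (f n x - g x)))" for n using A_nonneg by simp
      ultimately show "\<exists>N. \<forall>n\<ge>N. norm ((LINT x|M. A (norm (f n x - g x))) - 0) < e"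
        using \<open>0 < e\<close> by (intro exI[of _ N]) (auto intro: le_less_trans)
    qed
    fix n
    obtain N where iN: "integrable M (\<lambda>x. A (norm (f N x - g x)))" using small[of 1] by auto
    show "integrable M (\<lambda>x. A (norm (f n x - g x)))"
    proof (rule integrable_tri[OF _ i(2)[of n N] iN])
      show "norm (f n x - g x) \<le> norm (f n x - f N x) + norm (f N x - g x)" for x
        using norm_triangle_ineq[of "f n x - f N x" "f N x - g x"] by simp
    qed measurable
  qed
qed

end

lemma modular_powr:
  assumes q: "1 < q"
  shows "modular (\<lambda>t. \<bar>t\<bar> powr q)"
proof
  show "continuous_on UNIV (\<lambda>t::real. \<bar>t\<bar> powr q)"
    using q by (intro continuous_on_powr' continuous_intros) auto
  show "\<exists>K\<ge>0. \<forall>r s t. 0 \<le> r \<longrightarrow> 0 \<le> s \<longrightarrow> 0 \<le> t \<longrightarrow> t \<le> r + s \<longrightarrow> \<bar>t\<bar> powr q \<le> K * (\<bar>r\<bar> powr q + \<bar>s\<bar> powr q)"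
  proof (intro exI[of _ "2 powr q"] conjI allI impI)
    fix r s t :: real assume a: "0 \<le> r" "0 \<le> s" "0 \<le> t" "t \<le> r + s"
    have "\<bar>t\<bar> powr q \<le> (2 * max r s) powr q" using a q by (intro powr_mono2) auto
    also have "\<dots> = 2 powr q * max r s powr q" using a by (simp add: powr_mult)
    also have "\<dots> \<le> 2 powr q * (\<bar>r\<bar> powr q + \<bar>s\<bar> powr q)" using a by (intro mult_left_mono) (auto simp: max_def)
    finally show "\<bar>t\<bar> powr q \<le> 2 powr q * (\<bar>r\<bar> powr q + \<bar>s\<bar> powr q)" .
  qed simp
  fix \<delta> :: real assume \<delta>: "0 < \<delta>"
  show "\<exists>C\<ge>0. \<forall>t\<ge>0. t \<le> \<delta> + C * \<bar>t\<bar> powr q"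
  proof (intro exI[of _ "\<delta> powr (1 - q)"] conjI allI impI)
    fix t :: real assume t: "0 \<le> t"
    show "t \<le> \<delta> + \<delta> powr (1 - q) * \<bar>t\<bar> powr q"
    proof (cases "t \<le> \<delta>")
      case True
      then show ?thesis by (simp add: add_increasing2)
    next
      case False
      have "t powr (1 - q) \<le> \<delta> powr (1 - q)" using False \<delta> q by (intro powr_mono2') auto
      then have "t powr (1 - q) * t powr q \<le> \<delta> powr (1 - q) * t powr q" by (intro mult_right_mono) auto
      moreover have "t powr (1 - q) * t powr q = t" using False \<delta> by (simp add: powr_add[symmetric])
      ultimately show ?thesis using t \<delta> by simp
    qed
  qed simp
qed simp_all

context power_growth
begin

text \<open>The linear lower bound comes from the lower index \<open>l > 1\<close>, quasi-subadditivity from the upper index.\<close>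

lemma modular_P: "modular P"
proof
  show "\<exists>K\<ge>0. \<forall>r s t. 0 \<le> r \<longrightarrow> 0 \<le> s \<longrightarrow> 0 \<le> t \<longrightarrow> t \<le> r + s \<longrightarrow> P t \<le> K * (P r + P s)"
    by (intro exI[of _ "2 powr m"] conjI allI impI order_trans[OF P_mono P_add_le]) auto
  fix \<delta> :: real assume \<delta>: "0 < \<delta>"
  show "\<exists>C\<ge>0. \<forall>t\<ge>0. t \<le> \<delta> + C * P t"
  proof (intro exI[of _ "\<delta> / P \<delta>"] conjI allI impI)
    have P\<delta>: "0 < P \<delta>" using \<delta> by (intro P_pos) simp
    show "0 \<le> \<delta> / P \<delta>" using \<delta> by simp
    fix t :: real assume t: "0 \<le> t"
    show "t \<le> \<delta> + \<delta> / P \<delta> * P t"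
    proof (cases "t \<le> \<delta>")
      case True
      then show ?thesis using \<delta> by (simp add: add_increasing2)
    next
      case False
      then have s: "1 \<le> t / \<delta>" using \<delta> by simp
      have "(t / \<delta>) powr 1 * P \<delta> \<le> (t / \<delta>) powr l * P \<delta>" using s lm by (intro mult_right_mono powr_mono) auto
      also have "\<dots> \<le> P (t / \<delta> * \<delta>)" by (rule P_scale_ge_l[OF s])
      finally have "t / \<delta> * P \<delta> \<le> P t" using \<delta> t by simp
      then have "t \<le> \<delta> / P \<delta> * P t" using \<delta> P\<delta> by (simp add: field_simps)
      then show ?thesis using \<delta> by simp
    qed
  qed
qed (auto intro: continuous_P)

end

section \<open>Abstract Sobolev spaces with a uniformly convex modular\<close>

text \<open>An abstract space of functions with a gradient, of which only the properties used by the variational argument are recorded: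
linearity, an embedding into \<open>L\<^sup>q\<close>, compactness of that embedding, and closedness of the gradient.\<close>

locale sobolev_setting = power_growth \<phi> l m + finite_measure M
  for \<phi> l m and M :: "'a measure" +
  fixes X :: "('a \<Rightarrow> real) set" and D :: "('a \<Rightarrow> real) \<Rightarrow> 'a \<Rightarrow> 'b::euclidean_space" and q :: real
  assumes mq: "m < q"
    and X_measurable: "u \<in> X \<Longrightarrow> u \<in> borel_measurable M" "u \<in> X \<Longrightarrow> D u \<in> borel_measurable M"
    and X_P: "u \<in> X \<Longrightarrow> integrable M (\<lambda>x. P (norm (D u x)))"
    and X_q: "u \<in> X \<Longrightarrow> integrable M (\<lambda>x. \<bar>u x\<bar> powr q)"
    and X_combination: "u \<in> X \<Longrightarrow> v \<in> X \<Longrightarrow> (\<lambda>x. a * u x + b * v x) \<in> X"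
    and D_combination: "u \<in> X \<Longrightarrow> v \<in> X \<Longrightarrow> AE x in M. D (\<lambda>x. a * u x + b * v x) x = a *\<^sub>R D u x + b *\<^sub>R D v x"
    and X_sobolev: "\<exists>C. \<forall>u\<in>X. (LINT x|M. P (norm (D u x))) \<le> 1 \<longrightarrow> (LINT x|M. \<bar>u x\<bar> powr q) \<le> C"
    and X_precompact: "(\<And>n::nat. vs n \<in> X) \<Longrightarrow> (\<And>n. (LINT x|M. P (norm (D (vs n) x))) \<le> R) \<Longrightarrow>
      \<exists>k w. strict_mono (k :: nat \<Rightarrow> nat) \<and> w \<in> borel_measurable M \<and> integrable M (\<lambda>x. \<bar>w x\<bar> powr q) \<and>
        (\<lambda>n. LINT x|M. \<bar>vs (k n) x - w x\<bar> powr q) \<longlonglongrightarrow> 0"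
    and X_closed: "(\<And>n::nat. vs n \<in> X) \<Longrightarrow> w \<in> borel_measurable M \<Longrightarrow> integrable M (\<lambda>x. \<bar>w x\<bar> powr q) \<Longrightarrow>
      g \<in> borel_measurable M \<Longrightarrow> integrable M (\<lambda>x. P (norm (g x))) \<Longrightarrow>
      (\<lambda>n. LINT x|M. \<bar>vs n x - w x\<bar> powr q) \<longlonglongrightarrow> 0 \<Longrightarrow> (\<lambda>n. LINT x|M. P (norm (D (vs n) x - g x))) \<longlonglongrightarrow> 0 \<Longrightarrow>
      w \<in> X \<and> (AE x in M. D w x = g x)"
    and X_nonzero: "\<exists>u\<in>X. \<not> (AE x in M. u x = 0)"
begin

definition E where "E u = (LINT x|M. P (norm (D u x)))"

lemma q1: "1 < q" using lm mq by simp

sublocale Pmod: modular P by (rule modular_P)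
sublocale qmod: modular "\<lambda>t. \<bar>t\<bar> powr q" by (rule modular_powr[OF q1])

lemma E_nonneg: "0 \<le> E u" by (simp add: E_def)

lemma X_scale: "u \<in> X \<Longrightarrow> (\<lambda>x. s * u x) \<in> X"
  using X_combination[of u u s 0] by simp

lemma D_scale: "u \<in> X \<Longrightarrow> AE x in M. D (\<lambda>x. s * u x) x = s *\<^sub>R D u x"
  using D_combination[of u u s 0] by simp

lemma integrable_q_diff:
  assumes "u \<in> borel_measurable M" "v \<in> borel_measurable M" "integrable M (\<lambda>x. \<bar>u x\<bar> powr q)" "integrable M (\<lambda>x. \<bar>v x\<bar> powr q)"
  shows "integrable M (\<lambda>x. \<bar>u x - v x\<bar> powr q)"
  using qmod.integrable_tri[of "\<lambda>x. u x - v x" M u v] assms by (simp add: abs_triangle_ineq4)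

lemma integrable_P_combination:
  assumes [measurable]: "g \<in> borel_measurable M" "k \<in> borel_measurable M"
    and i: "integrable M (\<lambda>x. P (norm (g x)))" "integrable M (\<lambda>x. P (norm (k x :: 'b)))"
  shows "integrable M (\<lambda>x. P (norm (a *\<^sub>R g x + b *\<^sub>R k x)))"
proof -
  have s: "integrable M (\<lambda>x. P (norm (c *\<^sub>R f x)))" if [measurable]: "f \<in> borel_measurable M" and "integrable M (\<lambda>x. P (norm (f x)))"
    for c and f :: "'a \<Rightarrow> 'b"
  proof (rule Bochner_Integration.integrable_bound)
    show "integrable M (\<lambda>x. (1 + \<bar>c\<bar> powr m) * P (norm (f x)))" using that by auto
    show "AE x in M. norm (P (norm (c *\<^sub>R f x))) \<le> norm ((1 + \<bar>c\<bar> powr m) * P (norm (f x)))"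
      using P_scale_le[of "\<bar>c\<bar>"] by (intro AE_I2) simp
  qed measurable
  show ?thesis
    by (rule Pmod.integrable_tri[OF _ s[OF _ i(1), of a] s[OF _ i(2), of b]])
      (measurable, rule norm_triangle_ineq)
qed

lemma E_combination:
  assumes "u \<in> X" "v \<in> X"
  shows "E (\<lambda>x. a * u x + b * v x) = (LINT x|M. P (norm (a *\<^sub>R D u x + b *\<^sub>R D v x)))"
  unfolding E_def
proof (rule integral_cong_AE)
  note [measurable] = X_measurable[OF assms(1)] X_measurable[OF assms(2)] X_measurable[OF X_combination[OF assms]]
  show "AE x in M. P (norm (D (\<lambda>x. a * u x + b * v x) x)) = P (norm (a *\<^sub>R D u x + b *\<^sub>R D v x))"
    using D_combination[OF assms, of a b] by eventually_elim simp
qed (use X_measurable[OF assms(1)] X_measurable[OF assms(2)] X_measurable[OF X_combination[OF assms, of a b]] in measurable)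

lemma E_scale: "u \<in> X \<Longrightarrow> E (\<lambda>x. s * u x) = (LINT x|M. P (\<bar>s\<bar> * norm (D u x)))"
  using E_combination[of u u s 0] by simp

lemma integrable_P_scale: "u \<in> X \<Longrightarrow> integrable M (\<lambda>x. P (s * norm (D u x)))"
proof -
  assume u: "u \<in> X"
  have "integrable M (\<lambda>x. P (norm (s *\<^sub>R D u x + 0 *\<^sub>R D u x)))"
    by (intro integrable_P_combination X_measurable X_P u)
  moreover have "P (norm (s *\<^sub>R D u x + 0 *\<^sub>R D u x)) = P (s * norm (D u x))" for x by (cases "0 \<le> s") auto
  ultimately show ?thesis by simp
qed

lemma E_scale_bounds:
  assumes u: "u \<in> X"
  shows "1 \<le> s \<Longrightarrow> s powr l * E u \<le> E (\<lambda>x. s * u x)" "1 \<le> s \<Longrightarrow> E (\<lambda>x. s * u x) \<le> s powr m * E u"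
    "0 \<le> s \<Longrightarrow> s \<le> 1 \<Longrightarrow> s powr m * E u \<le> E (\<lambda>x. s * u x)"
proof -
  have i: "integrable M (\<lambda>x. P (\<bar>s\<bar> * norm (D u x)))" "integrable M (\<lambda>x. P (norm (D u x)))"
    using integrable_P_scale[OF u] X_P[OF u] by auto
  have e: "c * E u = (LINT x|M. c * P (norm (D u x)))" for c by (simp add: E_def)
  have i1: "integrable M (\<lambda>x. c * P (norm (D u x)))" for c using i(2) by auto
  show "s powr l * E u \<le> E (\<lambda>x. s * u x)" if "1 \<le> s"
    unfolding E_scale[OF u] e by (rule integral_mono[OF i1 i(1)]) (use that in \<open>simp add: P_scale_ge_l\<close>)
  show "E (\<lambda>x. s * u x) \<le> s powr m * E u" if "1 \<le> s"
    unfolding E_scale[OF u] e by (rule integral_mono[OF i(1) i1]) (use that in \<open>simp add: P_scale_le_m\<close>)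
  show "s powr m * E u \<le> E (\<lambda>x. s * u x)" if "0 \<le> s" "s \<le> 1"
    unfolding E_scale[OF u] e by (rule integral_mono[OF i1 i(1)]) (use that in \<open>simp add: P_scale_ge_m\<close>)
qed

text \<open>If the energy vanished, the embedding would bound the \<open>L\<^sup>q\<close> integrals of all multiples of \<open>u\<close> by one constant.\<close>

lemma E_pos:
  assumes u: "u \<in> X" and nz: "\<not> (AE x in M. u x = 0)"
  shows "0 < E u"
proof (rule ccontr)
  assume "\<not> 0 < E u"
  then have E0: "E u = 0" using E_nonneg[of u] by simp
  obtain C where C: "\<And>u. u \<in> X \<Longrightarrow> (LINT x|M. P (norm (D u x))) \<le> 1 \<Longrightarrow> (LINT x|M. \<bar>u x\<bar> powr q) \<le> C"
    using X_sobolev by blast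
  let ?I = "LINT x|M. \<bar>u x\<bar> powr q"
  have bound: "s powr q * ?I \<le> C" if s: "1 \<le> s" for s
  proof -
    have "E (\<lambda>x. s * u x) \<le> 1" using E_scale_bounds(2)[OF u s] E0 by simp
    then have "(LINT x|M. \<bar>s * u x\<bar> powr q) \<le> C" using C[OF X_scale[OF u]] by (simp add: E_def)
    also have "(LINT x|M. \<bar>s * u x\<bar> powr q) = s powr q * ?I" using s by (simp add: abs_mult powr_mult)
    finally show ?thesis .
  qed
  have "?I \<noteq> 0"
  proof
    assume "?I = 0"
    then have "AE x in M. \<bar>u x\<bar> powr q = 0"
      using integral_nonneg_eq_0_iff_AE[OF X_q[OF u]] by simp
    then have "AE x in M. u x = 0" by eventually_elim simp
    then show False using nz by simp
  qed
  moreover have "0 \<le> ?I" by simp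
  ultimately have I: "0 < ?I" by linarith
  \<comment> \<open>For this multiple the \<open>L\<^sup>q\<close> integral exceeds \<open>\<bar>C\<bar>\<close>.\<close>
  define s where "s = (\<bar>C\<bar> / ?I + 1) powr (1 / q) + 1"
  have s: "1 \<le> s" by (simp add: s_def)
  have "\<bar>C\<bar> / ?I + 1 = ((\<bar>C\<bar> / ?I + 1) powr (1 / q)) powr q"
    using I q1 by (simp add: powr_powr add_nonneg_pos)
  also have "\<dots> \<le> s powr q" using q1 by (intro powr_mono2) (auto simp: s_def)
  finally have "(\<bar>C\<bar> / ?I + 1) * ?I \<le> s powr q * ?I" using I by (intro mult_right_mono) auto
  moreover have "(\<bar>C\<bar> / ?I + 1) * ?I = \<bar>C\<bar> + ?I" using I by (simp add: distrib_right)
  ultimately show False using bound[OF s] I abs_ge_self[of C] by linarith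
qed

lemma E_scale_one:
  assumes u: "u \<in> X" and nz: "\<not> (AE x in M. u x = 0)"
  obtains s where "0 < s" "E (\<lambda>x. s * u x) = 1"
proof -
  define S where "S = max 1 (1 / E u)"
  have Ep: "0 < E u" by (rule E_pos[OF u nz])
  have S: "1 \<le> S" "1 / E u \<le> S" by (auto simp: S_def)
  have "1 \<le> S * E u" using S Ep by (simp add: field_simps)
  also have "\<dots> \<le> S powr l * E u" using S Ep lm powr_mono[of 1 l S] by (intro mult_right_mono) auto
  also have "\<dots> \<le> E (\<lambda>x. S * u x)" by (rule E_scale_bounds(1)[OF u S(1)])
  finally have ES: "1 \<le> E (\<lambda>x. S * u x)" .
  have eq: "E (\<lambda>x. s * u x) = (LINT x|M. P (s * norm (D u x)))" for s
    unfolding E_scale[OF u] by (cases "0 \<le> s") auto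
  note [measurable] = X_measurable[OF u]
  have "continuous_on {0..S} (\<lambda>s. LINT x|M. P (s * norm (D u x)))"
    unfolding continuous_on_sequentially
  proof (intro ballI allI impI, elim conjE)
    fix s0 and s :: "nat \<Rightarrow> real" assume s: "s0 \<in> {0..S}" "\<forall>n. s n \<in> {0..S}" "s \<longlonglongrightarrow> s0"
    show "((\<lambda>s. LINT x|M. P (s * norm (D u x))) \<circ> s) \<longlonglongrightarrow> (LINT x|M. P (s0 * norm (D u x)))"
      unfolding o_def
    proof (rule integral_dominated_convergence[where w="\<lambda>x. P (S * norm (D u x))"])
      show "integrable M (\<lambda>x. P (S * norm (D u x)))" by (rule integrable_P_scale[OF u])
      have cP: "isCont P t" for t using continuous_P by (simp add: continuous_on_eq_continuous_at)
      show "AE x in M. (\<lambda>n. P (s n * norm (D u x))) \<longlonglongrightarrow> P (s0 * norm (D u x))"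
        by (intro AE_I2 isCont_tendsto_compose[OF cP] tendsto_intros s)
      show "AE x in M. norm (P (s n * norm (D u x))) \<le> P (S * norm (D u x))" for n
        using s(2) by (intro AE_I2) (auto intro!: P_mono mult_right_mono)
    qed measurable
  qed
  moreover have "(LINT x|M. P (0 * norm (D u x))) \<le> 1" by simp
  ultimately obtain s where s: "0 \<le> s" "s \<le> S" "(LINT x|M. P (s * norm (D u x))) = 1"
    using IVT'[of "\<lambda>s. LINT x|M. P (s * norm (D u x))" 0 1 S] ES S by (auto simp: eq)
  then have "s \<noteq> 0" by (intro notI) auto
  then show thesis using that[of s] s by (simp add: eq)
qed

lemma E_midpoint:
  assumes u: "u \<in> X" and v: "v \<in> X"
  shows "E (\<lambda>x. 1/2 * u x + 1/2 * v x) = (LINT x|M. P (norm ((D u x + D v x) /\<^sub>R 2)))"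
  unfolding E_combination[OF u v] by (simp add: scaleR_add_right)

lemma midpoint_integrable:
  assumes u: "u \<in> X" and v: "v \<in> X"
  shows "integrable M (\<lambda>x. P (norm ((D u x + D v x) /\<^sub>R 2)))" "integrable M (\<lambda>x. P (norm (D u x - D v x)))"
proof -
  have "integrable M (\<lambda>x. P (norm ((1/2) *\<^sub>R D u x + (1/2) *\<^sub>R D v x)))" "integrable M (\<lambda>x. P (norm (1 *\<^sub>R D u x + (-1) *\<^sub>R D v x)))"
    by (intro integrable_P_combination X_measurable X_P u v)+
  then show "integrable M (\<lambda>x. P (norm ((D u x + D v x) /\<^sub>R 2)))" "integrable M (\<lambda>x. P (norm (D u x - D v x)))"
    by (simp_all add: scaleR_add_right)
qed

lemma E_midpoint_le:
  assumes u: "u \<in> X" and v: "v \<in> X"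
  shows "E (\<lambda>x. 1/2 * u x + 1/2 * v x) \<le> (E u + E v) / 2"
proof -
  have "(LINT x|M. P (norm ((D u x + D v x) /\<^sub>R 2))) \<le> (LINT x|M. (P (norm (D u x)) + P (norm (D v x))) / 2)"
  proof (rule integral_mono)
    show "P (norm ((D u x + D v x) /\<^sub>R 2)) \<le> (P (norm (D u x)) + P (norm (D v x))) / 2" for x
      using norm_triangle_ineq[of "D u x" "D v x"] by (intro order_trans[OF P_mono P_midpoint]) auto
  qed (use midpoint_integrable[OF u v] X_P[OF u] X_P[OF v] in auto)
  also have "\<dots> = (E u + E v) / 2" using X_P[OF u] X_P[OF v] by (simp add: E_def)
  finally show ?thesis unfolding E_midpoint[OF u v] .
qed

text \<open>The pointwise uniform convexity is integrated.\<close>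

lemma modular_gap:
  assumes "0 < \<epsilon>"
  obtains K where "0 \<le> K" "\<And>u v. u \<in> X \<Longrightarrow> v \<in> X \<Longrightarrow>
    (LINT x|M. P (norm (D u x - D v x))) \<le> \<epsilon> * (E u + E v) + K * ((E u + E v) / 2 - E (\<lambda>x. 1/2 * u x + 1/2 * v x))"
proof -
  obtain K where K: "0 \<le> K" "\<And>a b :: 'b. P (norm (a - b)) \<le>
    \<epsilon> * (P (norm a) + P (norm b)) + K * ((P (norm a) + P (norm b)) / 2 - P (norm ((a + b) /\<^sub>R 2)))"
    using uniform_convexity[OF assms, where 'b='b] by blast
  show thesis
  proof (rule that[OF K(1)])
    fix u v assume u: "u \<in> X" and v: "v \<in> X"
    note i = midpoint_integrable[OF u v] X_P[OF u] X_P[OF v]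
    have "(LINT x|M. P (norm (D u x - D v x))) \<le> (LINT x|M. \<epsilon> * (P (norm (D u x)) + P (norm (D v x))) +
       K * ((P (norm (D u x)) + P (norm (D v x))) / 2 - P (norm ((D u x + D v x) /\<^sub>R 2))))"
      by (intro integral_mono K(2)) (use i in auto)
    also have "\<dots> = \<epsilon> * (E u + E v) + K * ((E u + E v) / 2 - (LINT x|M. P (norm ((D u x + D v x) /\<^sub>R 2))))"
      unfolding E_def using i by (subst Bochner_Integration.integral_add) (auto simp: Bochner_Integration.integral_diff)
    finally show "(LINT x|M. P (norm (D u x - D v x))) \<le> \<epsilon> * (E u + E v) + K * ((E u + E v) / 2 - E (\<lambda>x. 1/2 * u x + 1/2 * v x))"
      unfolding E_midpoint[OF u v] .
  qed
qed

text \<open>Lower semicontinuity of the energy without weak convergence. The sets \<open>S n\<close> of functions of energy at most \<open>R\<close> that are close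
to \<open>w\<close> in \<open>L\<^sup>q\<close> are nested and closed under midpoints. Elements that almost minimise the energy on \<open>S n\<close> have small convexity
defects with one another, so their gradients are Cauchy in the modular; the functions converge to \<open>w\<close> and the gradient is
closed.\<close>

theorem closed_sublevel:
  assumes v: "\<And>n::nat. v n \<in> X" and w[measurable]: "w \<in> borel_measurable M" and wq: "integrable M (\<lambda>x. \<bar>w x\<bar> powr q)"
    and lim: "(\<lambda>n. LINT x|M. \<bar>v n x - w x\<bar> powr q) \<longlonglongrightarrow> 0" and R: "\<And>n. E (v n) \<le> R"
  shows "w \<in> X" "E w \<le> R"
proof -
  define S where "S n = {z \<in> X. (LINT x|M. \<bar>z x - w x\<bar> powr q) \<le> inverse (real (Suc n)) \<and> E z \<le> R}" for n
  have S_ne: "\<exists>z. z \<in> S n" for n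
  proof -
    have "\<forall>\<^sub>F k in sequentially. (LINT x|M. \<bar>v k x - w x\<bar> powr q) < inverse (real (Suc n))"
      using lim by (rule order_tendstoD(2)) simp
    then obtain k where "(LINT x|M. \<bar>v k x - w x\<bar> powr q) < inverse (real (Suc n))"
      by (meson eventually_happens trivial_limit_sequentially)
    then show ?thesis unfolding S_def using v R by (intro exI[of _ "v k"]) auto
  qed
  have S_mono: "S k \<subseteq> S n" if "n \<le> k" for n k
  proof -
    have "inverse (real (Suc k)) \<le> inverse (real (Suc n))" using that by (intro le_imp_inverse_le) auto
    note inv = this
    show ?thesis
    proof
      fix z assume "z \<in> S k"
      then have z: "z \<in> X" "(LINT x|M. \<bar>z x - w x\<bar> powr q) \<le> inverse (real (Suc k))" "E z \<le> R"
        unfolding S_def by blast+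
      show "z \<in> S n" unfolding S_def using z(1) order_trans[OF z(2) inv] z(3) by blast
    qed
  qed
  have S_mid: "(\<lambda>x. 1/2 * y x + 1/2 * z x) \<in> S n" if "y \<in> S n" "z \<in> S n" for y z n
  proof -
    have yz: "y \<in> X" "z \<in> X" using that by (auto simp: S_def)
    have i: "integrable M (\<lambda>x. \<bar>y x - w x\<bar> powr q)" "integrable M (\<lambda>x. \<bar>z x - w x\<bar> powr q)"
      by (rule integrable_q_diff; intro X_measurable(1) X_q w wq yz)+
    have im: "integrable M (\<lambda>x. \<bar>(1/2 * y x + 1/2 * z x) - w x\<bar> powr q)"
      by (intro integrable_q_diff X_measurable(1) X_q X_combination yz w wq)
    \<comment> \<open>Convexity of \<open>\<bar>t\<bar>\<^sup>q\<close> keeps midpoints close to \<open>w\<close>.\<close>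
    have cv: "convex_on UNIV (\<lambda>t::real. \<bar>t\<bar> powr q)"
    proof (rule convex_onI)
      fix t x y :: real assume t: "0 < t" "t < 1"
      have "\<bar>(1 - t) * x + t * y\<bar> powr q \<le> ((1 - t) * \<bar>x\<bar> + t * \<bar>y\<bar>) powr q"
        using t q1 abs_triangle_ineq[of "(1 - t) * x" "t * y"] by (intro powr_mono2) (auto simp: abs_mult)
      also have "\<dots> \<le> (1 - t) * \<bar>x\<bar> powr q + t * \<bar>y\<bar> powr q"
      proof (cases "x = 0 \<or> y = 0")
        case True
        have "t powr q \<le> t" "(1 - t) powr q \<le> 1 - t"
          using t q1 powr_mono'[of 1 q t] powr_mono'[of 1 q "1 - t"] by auto
        then have "t powr q * \<bar>y\<bar> powr q \<le> t * \<bar>y\<bar> powr q" "(1 - t) powr q * \<bar>x\<bar> powr q \<le> (1 - t) * \<bar>x\<bar> powr q"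
          by (auto intro: mult_right_mono)
        then show ?thesis using True t by (auto simp: powr_mult)
      next
        case False
        then show ?thesis using convex_onD[OF powr_convex[of q], of t "\<bar>x\<bar>" "\<bar>y\<bar>"] t q1 by auto
      qed
      finally show "\<bar>(1 - t) *\<^sub>R x + t *\<^sub>R y\<bar> powr q \<le> (1 - t) * \<bar>x\<bar> powr q + t * \<bar>y\<bar> powr q" by simp
    qed auto
    have "(LINT x|M. \<bar>(1/2 * y x + 1/2 * z x) - w x\<bar> powr q) \<le> (LINT x|M. (\<bar>y x - w x\<bar> powr q + \<bar>z x - w x\<bar> powr q) / 2)"
    proof (rule integral_mono)
      fix x
      have "(1/2 * y x + 1/2 * z x) - w x = (1 - 1/2) *\<^sub>R (y x - w x) + (1/2) *\<^sub>R (z x - w x)" by (simp add: field_simps)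
      then show "\<bar>(1/2 * y x + 1/2 * z x) - w x\<bar> powr q \<le> (\<bar>y x - w x\<bar> powr q + \<bar>z x - w x\<bar> powr q) / 2"
        using convex_onD[OF cv, of "1/2" "y x - w x" "z x - w x"] by (simp add: add_divide_distrib)
    qed (use i im in auto)
    also have "\<dots> \<le> inverse (real (Suc n))" using that i by (simp add: S_def)
    finally have 1: "(LINT x|M. \<bar>(1/2 * y x + 1/2 * z x) - w x\<bar> powr q) \<le> inverse (real (Suc n))" .
    have "E (\<lambda>x. 1/2 * y x + 1/2 * z x) \<le> R"
      using E_midpoint_le[OF yz] that by (simp add: S_def)
    with 1 show ?thesis unfolding S_def using X_combination[OF yz] by blast
  qed
  define d where "d n = Inf (E ` S n)" for n
  have bdd: "bdd_below (E ` S n)" for n using E_nonneg by (intro bdd_belowI[of _ 0]) auto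
  have d_le: "d n \<le> E z" if "z \<in> S n" for n z unfolding d_def using that by (intro cInf_lower bdd) auto
  have "\<exists>z\<in>S n. E z < d n + inverse (real (Suc n))" for n
  proof -
    have "Inf (E ` S n) < d n + inverse (real (Suc n))" by (simp add: d_def)
    then show ?thesis using cInf_lessD[of "E ` S n"] S_ne[of n] by blast
  qed
  then obtain y where y: "\<And>n. y n \<in> S n" "\<And>n. E (y n) < d n + inverse (real (Suc n))" by metis
  have yX: "y n \<in> X" and yR: "E (y n) \<le> R" for n using y(1)[of n] by (auto simp: S_def)
  have d_mono: "d n \<le> d k" if "n \<le> k" for n k
    unfolding d_def using S_ne[of k] S_mono[OF that] by (intro cInf_superset_mono bdd) auto
  have "d n \<le> R" for n using S_ne[of n] d_le[of _ n] by (force simp: S_def)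
  then have "bdd_above (range d)" by (intro bdd_aboveI[of _ R]) auto
  then obtain d' where d': "d \<longlonglongrightarrow> d'" using d_mono
    by (meson LIMSEQ_incseq_SUP incseq_def)
  have d_le': "d n \<le> d'" for n using d' d_mono by (meson incseq_def incseq_le)
  have cauchy: "\<exists>N. \<forall>n\<ge>N. \<forall>k\<ge>N. (LINT x|M. P (norm (D (y n) x - D (y k) x))) < e" if e: "0 < e" for e
  proof -
    define \<epsilon> where "\<epsilon> = e / (4 * (\<bar>R\<bar> + 1))"
    have \<epsilon>: "0 < \<epsilon>" using e by (simp add: \<epsilon>_def)
    have "0 \<le> R" using E_nonneg[of "y 0"] yR[of 0] by linarith
    then have \<epsilon>R: "\<epsilon> * (2 * R) \<le> e / 2" using e by (simp add: \<epsilon>_def field_simps)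
    obtain K where K: "0 \<le> K" "\<And>u v. u \<in> X \<Longrightarrow> v \<in> X \<Longrightarrow>
      (LINT x|M. P (norm (D u x - D v x))) \<le> \<epsilon> * (E u + E v) + K * ((E u + E v) / 2 - E (\<lambda>x. 1/2 * u x + 1/2 * v x))"
      using modular_gap[OF \<epsilon>] by blast
    define \<eta> where "\<eta> = e / (4 * (K + 1))"
    have \<eta>: "0 < \<eta>" using e K by (simp add: \<eta>_def)
    have K\<eta>: "K * \<eta> \<le> e / 4"  using e K(1) by (simp add: \<eta>_def field_simps)
    have "\<forall>\<^sub>F n in sequentially. d' - \<eta> / 2 < d n" using d' \<eta> by (intro order_tendstoD(1)) auto
    then obtain N1 where N1: "\<And>n. n \<ge> N1 \<Longrightarrow> d' - \<eta> / 2 < d n" by (auto simp: eventually_sequentially)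
    obtain N2 where N2: "inverse (real (Suc N2)) < \<eta> / 2" using reals_Archimedean[of "\<eta> / 2"] \<eta> by auto
    have inv: "inverse (real (Suc n)) < \<eta> / 2" if "n \<ge> N2" for n
    proof -
      have "inverse (real (Suc n)) \<le> inverse (real (Suc N2))" using that by (intro le_imp_inverse_le) auto
      then show ?thesis using N2 by linarith
    qed
    define N where "N = max N1 N2"
    have "(LINT x|M. P (norm (D (y n) x - D (y k) x))) < e" if nk: "N \<le> n" "N \<le> k" for n k
    proof -
      \<comment> \<open>Both elements lie in \<open>S j\<close>, hence so does their midpoint, whose energy is therefore at least \<open>d j\<close>.\<close>
      define j where "j = min n k"
      have j: "N \<le> j" "j \<le> n" "j \<le> k" using nk by (auto simp: j_def)
      have "y n \<in> S j" "y k \<in> S j" using y(1) S_mono j by blast+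
      then have "d j \<le> E (\<lambda>x. 1/2 * y n x + 1/2 * y k x)" by (intro d_le S_mid)
      moreover have "d' - \<eta> / 2 < d j" using j by (intro N1) (simp add: N_def)
      moreover have "E (y n) < d' + \<eta> / 2" "E (y k) < d' + \<eta> / 2"
        using y(2)[of n] y(2)[of k] d_le'[of n] d_le'[of k] inv[of n] inv[of k] nk by (auto simp: N_def)
      ultimately have "(E (y n) + E (y k)) / 2 - E (\<lambda>x. 1/2 * y n x + 1/2 * y k x) \<le> \<eta>" by argo
      then have "K * ((E (y n) + E (y k)) / 2 - E (\<lambda>x. 1/2 * y n x + 1/2 * y k x)) \<le> K * \<eta>"
        using K(1) by (rule mult_left_mono)
      moreover have "\<epsilon> * (E (y n) + E (y k)) \<le> \<epsilon> * (2 * R)"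
        using yR[of n] yR[of k] \<epsilon> by (intro mult_left_mono) auto
      ultimately show ?thesis using K(2)[OF yX yX, of n k] \<epsilon>R K\<eta> e by linarith
    qed
    then show ?thesis by blast
  qed
  obtain g r where g: "g \<in> borel_measurable M" "strict_mono (r :: nat \<Rightarrow> nat)" "AE x in M. (\<lambda>n. D (y (r n)) x) \<longlonglongrightarrow> g x"
    "\<And>n. integrable M (\<lambda>x. P (norm (D (y n) x - g x)))" "(\<lambda>n. LINT x|M. P (norm (D (y n) x - g x))) \<longlonglongrightarrow> 0"
    using Pmod.complete[OF finite_measure_axioms X_measurable(2)[OF yX] X_P[OF yX] midpoint_integrable(2)[OF yX yX] cauchy]
    by blast
  have gP: "integrable M (\<lambda>x. P (norm (g x)))" "(LINT x|M. P (norm (g x))) \<le> R"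
    using Pmod.fatou_modular[OF X_measurable(2)[OF yX] g(1) X_P[OF yX] _ g(3), of R] yR
    by (auto simp: E_def)
  have yw: "(\<lambda>n. LINT x|M. \<bar>y n x - w x\<bar> powr q) \<longlonglongrightarrow> 0"
  proof (rule tendsto_sandwich[OF _ _ tendsto_const LIMSEQ_inverse_real_of_nat])
    show "\<forall>\<^sub>F n in sequentially. (LINT x|M. \<bar>y n x - w x\<bar> powr q) \<le> inverse (real (Suc n))"
      using y(1) by (intro always_eventually) (auto simp: S_def)
  qed simp
  have cl: "w \<in> X" "AE x in M. D w x = g x"
    using X_closed[OF yX w wq g(1) gP(1) yw g(5)] by auto
  show "w \<in> X" by (rule cl)
  have "E w = (LINT x|M. P (norm (g x)))"
    unfolding E_def
  proof (rule integral_cong_AE)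
    show "AE x in M. P (norm (D w x)) = P (norm (g x))" using cl(2) by eventually_elim simp
  qed (use g(1) X_measurable(2)[OF cl(1)] in measurable)
  then show "E w \<le> R" using gP by simp
qed

end

section \<open>Differentiation under the integral and superposition operators\<close>

lemma DERIV_integral:
  fixes g g' :: "real \<Rightarrow> 'a \<Rightarrow> real"
  assumes int: "\<And>t. integrable M (g t)" and meas: "g' t0 \<in> borel_measurable M"
    and der: "\<And>t x. x \<in> space M \<Longrightarrow> ((\<lambda>t. g t x) has_real_derivative g' t x) (at t)"
    and w: "integrable M w" "\<And>t x. \<bar>t - t0\<bar> \<le> 1 \<Longrightarrow> x \<in> space M \<Longrightarrow> \<bar>g' t x\<bar> \<le> w x"
  shows "((\<lambda>t. LINT x|M. g t x) has_real_derivative (LINT x|M. g' t0 x)) (at t0)"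
  unfolding DERIV_def tendsto_at_iff_sequentially o_def
proof (intro allI impI)
  fix X :: "nat \<Rightarrow> real" assume X0: "\<forall>i. X i \<in> UNIV - {0}" and X: "X \<longlonglongrightarrow> 0"
  have "\<forall>\<^sub>F i in sequentially. \<bar>X i\<bar> < 1"
    using tendsto_rabs[OF X] by (intro order_tendstoD(2)[of _ "\<bar>0\<bar>"]) auto
  then obtain N where N: "\<And>i. N \<le> i \<Longrightarrow> \<bar>X i\<bar> < 1" by (auto simp: eventually_sequentially)
  define Y where "Y i = X (i + N)" for i
  have "Y \<longlonglongrightarrow> 0" unfolding Y_def[abs_def] by (rule LIMSEQ_ignore_initial_segment[OF X])
  then have Y: "Y \<longlonglongrightarrow> 0" "\<And>i. Y i \<noteq> 0" "\<And>i. \<bar>Y i\<bar> < 1"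
    using X0 N by (auto simp: Y_def)
  have "(\<lambda>i. LINT x|M. (g (t0 + Y i) x - g t0 x) / Y i) \<longlonglongrightarrow> (LINT x|M. g' t0 x)"
  proof (rule integral_dominated_convergence[OF meas _ w(1)])
    show "(\<lambda>x. (g (t0 + Y i) x - g t0 x) / Y i) \<in> borel_measurable M" for i
      using int[of "t0 + Y i"] int[of t0] by (intro borel_measurable_divide borel_measurable_diff) auto
    show "AE x in M. (\<lambda>i. (g (t0 + Y i) x - g t0 x) / Y i) \<longlonglongrightarrow> g' t0 x"
    proof (rule AE_I2)
      fix x assume "x \<in> space M"
      then have "((\<lambda>h. (g (t0 + h) x - g t0 x) / h) \<longlongrightarrow> g' t0 x) (at 0)"
        using der[of x t0] by (simp add: DERIV_def)
      then show "(\<lambda>i. (g (t0 + Y i) x - g t0 x) / Y i) \<longlonglongrightarrow> g' t0 x"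
        using Y by (auto simp: tendsto_at_iff_sequentially o_def)
    qed
    show "AE x in M. norm ((g (t0 + Y i) x - g t0 x) / Y i) \<le> w x" for i
    proof (rule AE_I2)
      fix x assume x: "x \<in> space M"
      have "norm (g (t0 + Y i) x - g t0 x) \<le> w x * norm (t0 + Y i - t0)"
      proof (rule field_differentiable_bound[of "cball t0 1" "\<lambda>t. g t x" "\<lambda>t. g' t x"])
        show "((\<lambda>t. g t x) has_field_derivative g' z x) (at z within cball t0 1)" for z
          using der[OF x] by (rule has_field_derivative_at_within)
        show "norm (g' z x) \<le> w x" if "z \<in> cball t0 1" for z
          using w(2)[OF _ x, of z] that by (simp add: dist_real_def abs_minus_commute)
      qed (use Y(3)[of i] in \<open>auto simp: dist_real_def\<close>)
      then show "norm ((g (t0 + Y i) x - g t0 x) / Y i) \<le> w x" using Y(2)[of i] by (simp add: field_simps)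
    qed
  qed
  then have "(\<lambda>i. ((LINT x|M. g (t0 + X (i + N)) x) - (LINT x|M. g t0 x)) / X (i + N)) \<longlonglongrightarrow> (LINT x|M. g' t0 x)"
    using int by (simp add: Y_def)
  then show "(\<lambda>i. ((LINT x|M. g (t0 + X i) x) - (LINT x|M. g t0 x)) / X i) \<longlonglongrightarrow> (LINT x|M. g' t0 x)"
    by (rule LIMSEQ_offset)
qed

text \<open>The values of \<open>u\<close> are rounded to multiples of \<open>1 / (n + 1)\<close>, which reduces the claim to countably many sections.\<close>

lemma caratheodory_compose:
  fixes f :: "'a \<Rightarrow> real \<Rightarrow> real"
  assumes f: "\<And>t. (\<lambda>x. f x t) \<in> borel_measurable N" "\<And>x. x \<in> space N \<Longrightarrow> continuous_on UNIV (f x)"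
    and u[measurable]: "u \<in> borel_measurable N"
  shows "(\<lambda>x. f x (u x)) \<in> borel_measurable N"
proof (rule borel_measurable_LIMSEQ_real)
  define k where "k n x = \<lfloor>real (Suc n) * u x\<rfloor>" for n x
  show "(\<lambda>x. f x (real_of_int (k n x) / real (Suc n))) \<in> borel_measurable N" for n
  proof (rule measurable_compose_countable[of "\<lambda>i x. f x (real_of_int i / real (Suc n))" N borel "k n"])
    show "k n \<in> N \<rightarrow>\<^sub>M count_space UNIV" unfolding k_def[abs_def] by measurable
  qed (rule f(1))
  fix x assume x: "x \<in> space N"
  have "(\<lambda>n. real_of_int (k n x) / real (Suc n)) \<longlonglongrightarrow> u x"
  proof (rule LIM_zero_cancel, rule Lim_null_comparison[OF _ LIMSEQ_inverse_real_of_nat], rule always_eventually, rule allI)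
    fix n
    have "\<bar>real_of_int (k n x) - real (Suc n) * u x\<bar> \<le> 1" unfolding k_def by linarith
    then have "\<bar>(real_of_int (k n x) - real (Suc n) * u x) / real (Suc n)\<bar> \<le> 1 / real (Suc n)"
      unfolding abs_divide by (simp add: divide_right_mono)
    moreover have "(real_of_int (k n x) - real (Suc n) * u x) / real (Suc n) = real_of_int (k n x) / real (Suc n) - u x"
      by (simp add: diff_divide_distrib)
    ultimately show "norm (real_of_int (k n x) / real (Suc n) - u x) \<le> inverse (real (Suc n))"
      by (simp only: inverse_eq_divide real_norm_def)
  qed
  moreover have "isCont (f x) (u x)" using f(2)[OF x] by (simp add: continuous_on_eq_continuous_at)
  ultimately show "(\<lambda>n. f x (real_of_int (k n x) / real (Suc n))) \<longlonglongrightarrow> f x (u x)"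
    by (rule isCont_tendsto_compose[rotated])
qed

lemma measurable_int0:
  fixes f :: "'a \<Rightarrow> real \<Rightarrow> real"
  assumes f: "\<And>t. (\<lambda>x. f x t) \<in> borel_measurable N" "\<And>x. x \<in> space N \<Longrightarrow> continuous_on UNIV (f x)"
  shows "(\<lambda>x. int0 (f x) t) \<in> borel_measurable N"
proof -
  have joint[measurable]: "(\<lambda>w. f (fst w) (snd w)) \<in> borel_measurable (N \<Otimes>\<^sub>M lborel)"
  proof (rule caratheodory_compose[of "\<lambda>w. f (fst w)"])
    show "(\<lambda>w. f (fst w) t) \<in> borel_measurable (N \<Otimes>\<^sub>M lborel)" for t
      by (rule measurable_compose[OF measurable_fst f(1)])
  qed (auto simp: space_pair_measure f(2))
  have eq: "integral {a..b} (f x) = (LINT s|lborel. indicator {a..b} s *\<^sub>R f x s)" if "x \<in> space N" for x a b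
  proof -
    have "set_integrable lborel {a..b} (f x)"
      unfolding set_integrable_def
      by (intro borel_integrable_compact) (auto intro: continuous_on_subset[OF f(2)[OF that]])
    from set_borel_integral_eq_integral(2)[OF this] show ?thesis by (simp add: set_lebesgue_integral_def)
  qed
  have m: "(\<lambda>x. LINT s|lborel. indicator {a..b} s *\<^sub>R f x s) \<in> borel_measurable N" for a b
  proof -
    have "(\<lambda>x. LINT s|lborel. (\<lambda>w. indicator {a..b} (snd w) *\<^sub>R f (fst w) (snd w)) (x, s)) \<in> borel_measurable N"
      by (rule lborel.borel_measurable_lebesgue_integral) (simp add: case_prod_beta')
    then show ?thesis by simp
  qed
  show ?thesis
  proof (cases "0 \<le> t")
    case True
    have "(\<lambda>x. integral {0..t} (f x)) \<in> borel_measurable N"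
      using m[of 0 t] by (rule measurable_cong[THEN iffD1, rotated]) (simp add: eq)
    then show ?thesis using True by (simp add: int0_def[abs_def])
  next
    case False
    have "(\<lambda>x. integral {t..0} (f x)) \<in> borel_measurable N"
      using m[of t 0] by (rule measurable_cong[THEN iffD1, rotated]) (simp add: eq)
    then show ?thesis using False by (simp add: int0_def[abs_def])
  qed
qed

text \<open>Young's inequality with a small factor on the first term, by comparing \<open>Y\<close> with \<open>\<epsilon> X\<close>.\<close>

lemma powr_young:
  fixes X Y q \<epsilon> :: real
  assumes "0 \<le> X" "0 \<le> Y" "0 < \<epsilon>" "1 < q"
  shows "X powr (q - 1) * Y \<le> \<epsilon> * X powr q + \<epsilon> powr (1 - q) * Y powr q"
proof (cases "Y \<le> \<epsilon> * X")
  case True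
  then have "X powr (q - 1) * Y \<le> X powr (q - 1) * (\<epsilon> * X)" by (intro mult_left_mono) auto
  also have "\<dots> = \<epsilon> * X powr q" using powr_mult_base[OF assms(1), of "q - 1"] by (simp add: mult_ac)
  finally show ?thesis by (simp add: add_increasing2)
next
  case False
  have Y: "0 < Y"
  proof -
    have "0 \<le> \<epsilon> * X" using assms by simp
    then show ?thesis using False by linarith
  qed
  have "X \<le> Y / \<epsilon>" using False assms by (simp add: field_simps)
  then have "X powr (q - 1) \<le> (Y / \<epsilon>) powr (q - 1)" using assms by (intro powr_mono2) auto
  then have "X powr (q - 1) * Y \<le> (Y / \<epsilon>) powr (q - 1) * Y" using Y by (intro mult_right_mono) auto
  also have "\<dots> = \<epsilon> powr (1 - q) * (Y powr (q - 1) * Y)"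
    using Y assms by (simp add: powr_divide powr_diff field_simps)
  also have "Y powr (q - 1) * Y = Y powr q" using powr_mult_base[of Y "q - 1"] Y by (simp add: mult_ac)
  finally show ?thesis using assms by (simp add: add_increasing)
qed

section \<open>The Nehari manifold\<close>

text \<open>The last three conditions express the geometry of \<open>J\<close>: monotone quotients along rays, coercivity up to an \<open>L\<^sup>q\<close> term of
higher order, and dominance of the primitive over every multiple of \<open>\<bar>t\<bar>\<^sup>m\<close>.\<close>

locale nehari_setting = sobolev_setting \<phi> l m M X D q
  for \<phi> l m and M :: "'a measure" and X and D :: "('a \<Rightarrow> real) \<Rightarrow> 'a \<Rightarrow> 'b::euclidean_space" and q +
  fixes f :: "'a \<Rightarrow> real \<Rightarrow> real"
  assumes f_measurable: "(\<lambda>x. f x t) \<in> borel_measurable M"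
    and f_continuous: "x \<in> space M \<Longrightarrow> continuous_on UNIV (f x)"
    and f_growth: "\<exists>C\<ge>0. \<forall>x\<in>space M. \<forall>t. \<bar>f x t\<bar> \<le> C * (1 + \<bar>t\<bar> powr (q - 1))"
    and f_fibre: "x \<in> space M \<Longrightarrow> y \<noteq> 0 \<Longrightarrow> 0 < s \<Longrightarrow> s < t \<Longrightarrow>
      f x (s * y) * y / s powr (m - 1) < f x (t * y) * y / t powr (m - 1)"
    and f_small: "\<exists>\<delta>>0. \<exists>C. \<forall>u\<in>X. \<delta> * (LINT x|M. P (norm (D u x))) - C * (LINT x|M. \<bar>u x\<bar> powr q)
      \<le> (LINT x|M. P (norm (D u x))) - (LINT x|M. int0 (f x) (u x))"
    and f_super: "\<exists>K. \<forall>x\<in>space M. \<forall>t. B * \<bar>t\<bar> powr m - K \<le> int0 (f x) t"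
begin

abbreviation "F x \<equiv> int0 (f x)"

definition "J u = E u - (LINT x|M. F x (u x))"
definition "J' u v = (LINT x|M. A (D u x) \<bullet> D v x) - (LINT x|M. f x (u x) * v x)"
definition "\<N> = {u \<in> X. \<not> (AE x in M. u x = 0) \<and> J' u u = 0}"
text \<open>The plane spanned by two functions. Rays and perturbations of rays are both of this form, so differentiability of \<open>J\<close> and
continuity of \<open>J'\<close> need to be established on planes only.\<close>

definition "comb a u b w = (\<lambda>x. a * u x + b * w x)" for a b :: real and u w :: "'a \<Rightarrow> real"

lemma comb_X: "u \<in> X \<Longrightarrow> w \<in> X \<Longrightarrow> comb a u b w \<in> X"
  unfolding comb_def by (rule X_combination)

lemma F_DERIV: "x \<in> space M \<Longrightarrow> (F x has_real_derivative f x t) (at t)"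
  by (rule int0_has_real_derivative[OF f_continuous])

lemma F_0[simp]: "F x 0 = 0" by (simp add: int0_def)

lemma F_compose_measurable: "u \<in> borel_measurable M \<Longrightarrow> (\<lambda>x. F x (u x)) \<in> borel_measurable M"
proof (rule caratheodory_compose[of F])
  show "continuous_on UNIV (F x)" if "x \<in> space M" for x
    using F_DERIV[OF that] by (intro continuous_at_imp_continuous_on) (auto intro: DERIV_isCont)
qed (rule measurable_int0[OF f_measurable f_continuous])

lemma f_compose_measurable: "u \<in> borel_measurable M \<Longrightarrow> (\<lambda>x. f x (u x)) \<in> borel_measurable M"
  by (rule caratheodory_compose[OF f_measurable f_continuous])

lemma f_bound:
  obtains C where "0 \<le> C" "\<And>x a b. x \<in> space M \<Longrightarrow> \<bar>f x a * b\<bar> \<le> C * (1 + \<bar>a\<bar> powr q + 2 * \<bar>b\<bar> powr q)"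
proof -
  obtain C where C: "0 \<le> C" "\<And>x t. x \<in> space M \<Longrightarrow> \<bar>f x t\<bar> \<le> C * (1 + \<bar>t\<bar> powr (q - 1))"
    using f_growth by blast
  show thesis
  proof (rule that[OF C(1)])
    fix x a b assume x: "x \<in> space M"
    have "\<bar>f x a * b\<bar> \<le> C * (1 + \<bar>a\<bar> powr (q - 1)) * \<bar>b\<bar>"
      unfolding abs_mult by (intro mult_right_mono C x) auto
    also have "\<dots> = C * (1 powr (q - 1) * \<bar>b\<bar> + \<bar>a\<bar> powr (q - 1) * \<bar>b\<bar>)" by (simp add: algebra_simps)
    also have "\<dots> \<le> C * ((1 * 1 powr q + 1 powr (1 - q) * \<bar>b\<bar> powr q) + (1 * \<bar>a\<bar> powr q + 1 powr (1 - q) * \<bar>b\<bar> powr q))"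
      using q1 by (intro mult_left_mono add_mono powr_young C(1)) auto
    also have "\<dots> = C * (1 + \<bar>a\<bar> powr q + 2 * \<bar>b\<bar> powr q)" by simp
    finally show "\<bar>f x a * b\<bar> \<le> C * (1 + \<bar>a\<bar> powr q + 2 * \<bar>b\<bar> powr q)" .
  qed
qed

text \<open>The term with \<open>e\<close> absorbs the growth of \<open>b\<close>, so convergence in \<open>L\<^sup>q\<close> alone suffices for the convergence of the integrals.\<close>

lemma F_diff:
  assumes e: "0 < e"
  obtains K where "0 \<le> K" "\<And>x a b. x \<in> space M \<Longrightarrow> \<bar>F x a - F x b\<bar> \<le> e * (1 + \<bar>b\<bar> powr q) + K * \<bar>a - b\<bar> powr q"
proof -
  obtain C where C: "0 \<le> C" "\<And>x t. x \<in> space M \<Longrightarrow> \<bar>f x t\<bar> \<le> C * (1 + \<bar>t\<bar> powr (q - 1))"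
    using f_growth by blast
  define \<epsilon> where "\<epsilon> = e / ((C + 1) * 2 powr q)"
  have \<epsilon>: "0 < \<epsilon>" using e C by (simp add: \<epsilon>_def)
  have "C * (\<epsilon> * 2 powr q) = C * (e / (C + 1))" using C by (simp add: \<epsilon>_def)
  also have "\<dots> \<le> e" using C e by (simp add: field_simps)
  finally have C\<epsilon>2: "C * (\<epsilon> * 2 powr q) \<le> e" .
  have "(1::real) \<le> 2 powr q" using q1 by (simp add: ge_one_powr_ge_zero)
  then have "C * (\<epsilon> * 1) \<le> C * (\<epsilon> * 2 powr q)" using C \<epsilon> by (intro mult_left_mono) auto
  then have C\<epsilon>: "C * \<epsilon> \<le> e" using C\<epsilon>2 by simp
  define K where "K = C * (2 * \<epsilon> powr (1 - q) + \<epsilon> * 2 powr q)"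
  show thesis
  proof
    show "0 \<le> K" using C \<epsilon> by (simp add: K_def)
    fix x and a b :: real assume x: "x \<in> space M"
    define Y where "Y = \<bar>a - b\<bar>"
    define r where "r = \<bar>b\<bar> + Y"
    have Y: "0 \<le> Y" and r: "0 \<le> r" by (auto simp: Y_def r_def)
    have "norm (F x a - F x b) \<le> (C * (1 + r powr (q - 1))) * norm (a - b)"
    proof (rule field_differentiable_bound[of "cball 0 r" "F x" "f x"])
      show "(F x has_field_derivative f x z) (at z within cball 0 r)" for z
        using F_DERIV[OF x] by (rule has_field_derivative_at_within)
      show "norm (f x z) \<le> C * (1 + r powr (q - 1))" if "z \<in> cball 0 r" for z
      proof -
        have "\<bar>z\<bar> powr (q - 1) \<le> r powr (q - 1)" using that q1 by (intro powr_mono2) auto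
        then have "C * (1 + \<bar>z\<bar> powr (q - 1)) \<le> C * (1 + r powr (q - 1))" using C by (intro mult_left_mono) auto
        then show ?thesis using C(2)[OF x, of z] by simp
      qed
    qed (auto simp: r_def Y_def)
    then have "\<bar>F x a - F x b\<bar> \<le> C * (1 powr (q - 1) * Y + r powr (q - 1) * Y)" by (simp add: Y_def algebra_simps)
    also have "\<dots> \<le> C * ((\<epsilon> * 1 powr q + \<epsilon> powr (1 - q) * Y powr q) + (\<epsilon> * r powr q + \<epsilon> powr (1 - q) * Y powr q))"
      using q1 \<epsilon> Y r by (intro mult_left_mono add_mono powr_young C(1)) auto
    also have "\<dots> \<le> C * ((\<epsilon> * 1 powr q + \<epsilon> powr (1 - q) * Y powr q) + (\<epsilon> * (2 powr q * (\<bar>b\<bar> powr q + Y powr q)) + \<epsilon> powr (1 - q) * Y powr q))"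
    proof (intro mult_left_mono add_mono order_refl)
      have "r powr q \<le> (2 * max \<bar>b\<bar> Y) powr q" using Y q1 by (intro powr_mono2) (auto simp: r_def)
      also have "\<dots> = 2 powr q * max \<bar>b\<bar> Y powr q" using Y by (simp add: powr_mult)
      also have "\<dots> \<le> 2 powr q * (\<bar>b\<bar> powr q + Y powr q)" by (intro mult_left_mono) (auto simp: max_def)
      finally show "r powr q \<le> 2 powr q * (\<bar>b\<bar> powr q + Y powr q)" .
    qed (use C \<epsilon> in auto)
    also have "\<dots> = C * \<epsilon> + C * (\<epsilon> * 2 powr q) * \<bar>b\<bar> powr q + K * Y powr q"
      by (simp add: K_def algebra_simps)
    also have "\<dots> \<le> e + e * \<bar>b\<bar> powr q + K * Y powr q"
      using C\<epsilon> C\<epsilon>2 by (intro add_mono mult_right_mono) auto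
    finally show "\<bar>F x a - F x b\<bar> \<le> e * (1 + \<bar>b\<bar> powr q) + K * \<bar>a - b\<bar> powr q"
      by (simp add: Y_def algebra_simps)
  qed
qed

lemma F_integrable:
  assumes [measurable]: "u \<in> borel_measurable M" and i: "integrable M (\<lambda>x. \<bar>u x\<bar> powr q)"
  shows "integrable M (\<lambda>x. F x (u x))"
proof -
  obtain K where K: "0 \<le> K" "\<And>x a b. x \<in> space M \<Longrightarrow> \<bar>F x a - F x b\<bar> \<le> 1 * (1 + \<bar>b\<bar> powr q) + K * \<bar>a - b\<bar> powr q"
    using F_diff[of 1] by auto
  show ?thesis
  proof (rule Bochner_Integration.integrable_bound[OF _ F_compose_measurable[OF assms(1)]])
    show "integrable M (\<lambda>x. 1 + K * \<bar>u x\<bar> powr q)" using i by auto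
    show "AE x in M. norm (F x (u x)) \<le> norm (1 + K * \<bar>u x\<bar> powr q)"
      using K(2)[of _ "u _" 0] K(1) by (intro AE_I2) (auto simp: abs_of_nonneg)
  qed
qed

lemma F_integral_tendsto:
  assumes v: "\<And>n. v n \<in> borel_measurable M" "\<And>n. integrable M (\<lambda>x. \<bar>v n x\<bar> powr q)"
    and w: "w \<in> borel_measurable M" "integrable M (\<lambda>x. \<bar>w x\<bar> powr q)"
    and lim: "(\<lambda>n. LINT x|M. \<bar>v n x - w x\<bar> powr q) \<longlonglongrightarrow> 0"
  shows "(\<lambda>n. LINT x|M. F x (v n x)) \<longlonglongrightarrow> (LINT x|M. F x (w x))"
proof (rule LIMSEQ_I)
  fix e :: real assume e: "0 < e"
  define Q where "Q = (LINT x|M. 1 + \<bar>w x\<bar> powr q)"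
  have Q: "0 \<le> Q" unfolding Q_def by (intro integral_nonneg_AE AE_I2) auto
  have eQ: "0 < e / (2 * (Q + 1))" using e Q by simp
  obtain K where K: "0 \<le> K" "\<And>x a b. x \<in> space M \<Longrightarrow> \<bar>F x a - F x b\<bar> \<le> e / (2 * (Q + 1)) * (1 + \<bar>b\<bar> powr q) + K * \<bar>a - b\<bar> powr q"
    using F_diff[OF eQ] by blast
  have "e / (2 * (Q + 1)) * Q \<le> e / 2" using e Q by (simp add: field_simps)
  have "(\<lambda>n. K * (LINT x|M. \<bar>v n x - w x\<bar> powr q)) \<longlonglongrightarrow> K * 0" by (intro tendsto_intros lim)
  then have "\<forall>\<^sub>F n in sequentially. K * (LINT x|M. \<bar>v n x - w x\<bar> powr q) < e / 2"
    using e by (intro order_tendstoD(2)) auto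
  then obtain N where N: "\<And>n. N \<le> n \<Longrightarrow> K * (LINT x|M. \<bar>v n x - w x\<bar> powr q) < e / 2"
    by (auto simp: eventually_sequentially)
  have "\<bar>(LINT x|M. F x (v n x)) - (LINT x|M. F x (w x))\<bar> < e" if n: "N \<le> n" for n
  proof -
    note iF = F_integrable[OF v(1,2)[of n]] F_integrable[OF w]
    note id = integrable_q_diff[OF v(1)[of n] w(1) v(2)[of n] w(2)]
    have "\<bar>(LINT x|M. F x (v n x)) - (LINT x|M. F x (w x))\<bar> = \<bar>LINT x|M. F x (v n x) - F x (w x)\<bar>" using iF by simp
    also have "\<dots> \<le> (LINT x|M. \<bar>F x (v n x) - F x (w x)\<bar>)" by (rule integral_abs_bound)
    also have "\<dots> \<le> (LINT x|M. e / (2 * (Q + 1)) * (1 + \<bar>w x\<bar> powr q) + K * \<bar>v n x - w x\<bar> powr q)"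
      using iF id w by (intro integral_mono K(2)) auto
    also have "\<dots> = e / (2 * (Q + 1)) * Q + K * (LINT x|M. \<bar>v n x - w x\<bar> powr q)"
      unfolding Q_def using id w by (subst Bochner_Integration.integral_add) auto
    also have "\<dots> < e" using N[OF n] \<open>e / (2 * (Q + 1)) * Q \<le> e / 2\<close> by linarith
    finally show ?thesis .
  qed
  then show "\<exists>N. \<forall>n\<ge>N. norm ((LINT x|M. F x (v n x)) - (LINT x|M. F x (w x))) < e" by auto
qed

lemma A_bound: "\<bar>A a \<bullet> b\<bar> \<le> m * (P (norm a) + P (norm b))" for a b :: 'b
proof -
  have "\<bar>A a \<bullet> b\<bar> \<le> h (norm a) * norm b" using Cauchy_Schwarz_ineq2[of "A a" b] by (simp add: norm_A)
  also have "\<dots> \<le> m * (P (norm a) + P (norm b))" by (rule young) auto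
  finally show ?thesis .
qed

text \<open>A majorant that is uniform for bounded coefficients, for dominated convergence.\<close>

definition "dom_A B g k e x = m * (2 powr m * (P (B * norm (g x)) + P (B * norm (k x))) + P (norm (e x)))"
  for B :: real and g k e :: "'a \<Rightarrow> 'b"

lemma dom_A:
  assumes "\<bar>a\<bar> \<le> B" "\<bar>b\<bar> \<le> B"
  shows "\<bar>A (a *\<^sub>R g x + b *\<^sub>R k x) \<bullet> e x\<bar> \<le> dom_A B g k e x"
proof -
  have "P (norm (a *\<^sub>R g x + b *\<^sub>R k x)) \<le> 2 powr m * (P (norm (a *\<^sub>R g x)) + P (norm (b *\<^sub>R k x)))"
    by (rule P_norm_add_le)
  also have "\<dots> \<le> 2 powr m * (P (B * norm (g x)) + P (B * norm (k x)))"
    using assms by (intro mult_left_mono add_mono P_mono) (auto intro: mult_right_mono)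
  finally have "m * (P (norm (a *\<^sub>R g x + b *\<^sub>R k x)) + P (norm (e x))) \<le> dom_A B g k e x"
    unfolding dom_A_def using lm by (intro mult_left_mono add_mono) auto
  then show ?thesis using A_bound[of "a *\<^sub>R g x + b *\<^sub>R k x" "e x"] by linarith
qed

lemma dom_A_integrable: "u \<in> X \<Longrightarrow> w \<in> X \<Longrightarrow> v \<in> X \<Longrightarrow> integrable M (dom_A B (D u) (D w) (D v))"
  unfolding dom_A_def using integrable_P_scale X_P by auto

definition "dom_f C B u w v x = C * (1 + 2 powr q * (\<bar>B * u x\<bar> powr q + \<bar>B * w x\<bar> powr q) + 2 * \<bar>v x\<bar> powr q)"
  for C B :: real and u w v :: "'a \<Rightarrow> real"

lemma dom_f:
  assumes "0 \<le> C" "\<And>x a b. x \<in> space M \<Longrightarrow> \<bar>f x a * b\<bar> \<le> C * (1 + \<bar>a\<bar> powr q + 2 * \<bar>b\<bar> powr q)"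
    and ab: "\<bar>a\<bar> \<le> B" "\<bar>b\<bar> \<le> B" and x: "x \<in> space M"
  shows "\<bar>f x (a * u x + b * w x) * v x\<bar> \<le> dom_f C B u w v x"
proof -
  have "\<bar>a * u x + b * w x\<bar> \<le> \<bar>B * u x\<bar> + \<bar>B * w x\<bar>"
  proof -
    have "\<bar>a * u x + b * w x\<bar> \<le> \<bar>a\<bar> * \<bar>u x\<bar> + \<bar>b\<bar> * \<bar>w x\<bar>"
      unfolding abs_mult[symmetric] by (rule abs_triangle_ineq)
    also have "\<dots> \<le> B * \<bar>u x\<bar> + B * \<bar>w x\<bar>" using ab by (intro add_mono mult_right_mono) auto
    finally show ?thesis using ab by (simp add: abs_mult)
  qed
  also have "\<dots> \<le> 2 * max \<bar>B * u x\<bar> \<bar>B * w x\<bar>" by simp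
  finally have "\<bar>a * u x + b * w x\<bar> powr q \<le> (2 * max \<bar>B * u x\<bar> \<bar>B * w x\<bar>) powr q"
    using q1 by (intro powr_mono2) auto
  also have "\<dots> = 2 powr q * max \<bar>B * u x\<bar> \<bar>B * w x\<bar> powr q" by (rule powr_mult)
  also have "\<dots> \<le> 2 powr q * (\<bar>B * u x\<bar> powr q + \<bar>B * w x\<bar> powr q)" by (intro mult_left_mono) (auto simp: max_def)
  finally have "C * (1 + \<bar>a * u x + b * w x\<bar> powr q + 2 * \<bar>v x\<bar> powr q) \<le> dom_f C B u w v x"
    unfolding dom_f_def using assms(1) by (intro mult_left_mono add_mono) auto
  then show ?thesis using assms(2)[OF x, of "a * u x + b * w x" "v x"] by linarith
qed

lemma dom_f_integrable: "u \<in> X \<Longrightarrow> w \<in> X \<Longrightarrow> v \<in> X \<Longrightarrow> integrable M (dom_f C B u w v)"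
  unfolding dom_f_def using X_q by (auto simp: abs_mult powr_mult)

lemma J_integrable:
  assumes u: "u \<in> X" and v: "v \<in> X"
  shows "integrable M (\<lambda>x. A (D u x) \<bullet> D v x)" "integrable M (\<lambda>x. f x (u x) * v x)" "integrable M (\<lambda>x. F x (u x))"
proof -
  note [measurable] = X_measurable[OF u] X_measurable[OF v]
  show "integrable M (\<lambda>x. A (D u x) \<bullet> D v x)"
  proof (rule Bochner_Integration.integrable_bound)
    show "integrable M (\<lambda>x. m * (P (norm (D u x)) + P (norm (D v x))))" using X_P[OF u] X_P[OF v] by auto
    show "AE x in M. norm (A (D u x) \<bullet> D v x) \<le> norm (m * (P (norm (D u x)) + P (norm (D v x))))"
      using A_bound lm by (intro AE_I2) (auto simp: abs_mult)
  qed measurable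
  obtain C where C: "0 \<le> C" "\<And>x a b. x \<in> space M \<Longrightarrow> \<bar>f x a * b\<bar> \<le> C * (1 + \<bar>a\<bar> powr q + 2 * \<bar>b\<bar> powr q)"
    using f_bound by blast
  show "integrable M (\<lambda>x. f x (u x) * v x)"
  proof (rule Bochner_Integration.integrable_bound)
    show "integrable M (\<lambda>x. C * (1 + \<bar>u x\<bar> powr q + 2 * \<bar>v x\<bar> powr q))" using X_q[OF u] X_q[OF v] by auto
    show "AE x in M. norm (f x (u x) * v x) \<le> norm (C * (1 + \<bar>u x\<bar> powr q + 2 * \<bar>v x\<bar> powr q))"
      using C by (intro AE_I2) (auto intro: order_trans[OF C(2) abs_ge_self])
  qed (use f_compose_measurable[of u] in measurable)
  show "integrable M (\<lambda>x. F x (u x))" by (rule F_integrable[OF X_measurable(1)[OF u] X_q[OF u]])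
qed

lemma J_comb:
  assumes "u \<in> X" "w \<in> X"
  shows "J (comb a u b w) = (LINT x|M. P (norm (a *\<^sub>R D u x + b *\<^sub>R D w x))) - (LINT x|M. F x (a * u x + b * w x))"
  unfolding J_def comb_def E_combination[OF assms] ..

lemma J'_comb:
  assumes u: "u \<in> X" "w \<in> X" and v: "v \<in> X"
  shows "J' (comb a u b w) v = (LINT x|M. A (a *\<^sub>R D u x + b *\<^sub>R D w x) \<bullet> D v x) - (LINT x|M. f x (a * u x + b * w x) * v x)"
proof -
  note [measurable] = X_measurable[OF u(1)] X_measurable[OF u(2)] X_measurable[OF comb_X[OF u, of a b]] X_measurable[OF v]
  have "(LINT x|M. A (D (comb a u b w) x) \<bullet> D v x) = (LINT x|M. A (a *\<^sub>R D u x + b *\<^sub>R D w x) \<bullet> D v x)"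
  proof (rule integral_cong_AE)
    show "AE x in M. A (D (comb a u b w) x) \<bullet> D v x = A (a *\<^sub>R D u x + b *\<^sub>R D w x) \<bullet> D v x"
      using D_combination[OF u, of a b] unfolding comb_def by eventually_elim simp
  qed measurable
  then show ?thesis by (simp add: J'_def) (simp add: comb_def)
qed

lemma J'_linear:
  assumes z: "z \<in> X" and u: "u \<in> X" and w: "w \<in> X"
  shows "J' z (comb a u b w) = a * J' z u + b * J' z w"
proof -
  note [measurable] = X_measurable[OF z] X_measurable[OF u] X_measurable[OF w] X_measurable[OF comb_X[OF u w, of a b]]
  have "(LINT x|M. A (D z x) \<bullet> D (comb a u b w) x) = (LINT x|M. a * (A (D z x) \<bullet> D u x) + b * (A (D z x) \<bullet> D w x))"
  proof (rule integral_cong_AE)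
    show "AE x in M. A (D z x) \<bullet> D (comb a u b w) x = a * (A (D z x) \<bullet> D u x) + b * (A (D z x) \<bullet> D w x)"
      using D_combination[OF u w, of a b] unfolding comb_def by eventually_elim (simp add: inner_add_right)
  qed measurable
  moreover have "(LINT x|M. f x (z x) * comb a u b w x) = (LINT x|M. a * (f x (z x) * u x) + b * (f x (z x) * w x))"
    by (simp add: comb_def algebra_simps)
  ultimately show ?thesis
    using J_integrable[OF z u] J_integrable[OF z w] by (simp add: J'_def algebra_simps)
qed

text \<open>Differentiation under the integral sign along lines, with the two majorants above.\<close>

lemma J_DERIV:
  assumes u: "u \<in> X" and w: "w \<in> X"
  shows "((\<lambda>b. J (comb a u b w)) has_real_derivative J' (comb a u b0 w) w) (at b0)"
proof -
  define B where "B = max \<bar>a\<bar> (\<bar>b0\<bar> + 1)"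
  have aB: "\<bar>a\<bar> \<le> B" and bB: "\<bar>b - b0\<bar> \<le> 1 \<Longrightarrow> \<bar>b\<bar> \<le> B" for b by (auto simp: B_def)
  note [measurable] = X_measurable[OF u] X_measurable[OF w]
  have 1: "((\<lambda>b. LINT x|M. P (norm (a *\<^sub>R D u x + b *\<^sub>R D w x))) has_real_derivative
    (LINT x|M. A (a *\<^sub>R D u x + b0 *\<^sub>R D w x) \<bullet> D w x)) (at b0)"
  proof (rule DERIV_integral[where w="dom_A B (D u) (D w) (D w)"])
    show "integrable M (\<lambda>x. P (norm (a *\<^sub>R D u x + b *\<^sub>R D w x)))" for b
      by (intro integrable_P_combination X_measurable X_P u w)
    show "((\<lambda>b. P (norm (a *\<^sub>R D u x + b *\<^sub>R D w x))) has_real_derivative A (a *\<^sub>R D u x + b *\<^sub>R D w x) \<bullet> D w x) (at b)" for b x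
      by (rule DERIV_P_norm_line)
  qed (auto intro!: dom_A_integrable u w dom_A aB bB)
  obtain C where C: "0 \<le> C" "\<And>x a b. x \<in> space M \<Longrightarrow> \<bar>f x a * b\<bar> \<le> C * (1 + \<bar>a\<bar> powr q + 2 * \<bar>b\<bar> powr q)"
    using f_bound by blast
  have 2: "((\<lambda>b. LINT x|M. F x (a * u x + b * w x)) has_real_derivative
    (LINT x|M. f x (a * u x + b0 * w x) * w x)) (at b0)"
  proof (rule DERIV_integral[where w="dom_f C B u w w"])
    show "integrable M (\<lambda>x. F x (a * u x + b * w x))" for b
      using J_integrable(3)[OF comb_X[OF u w] u, of a b] by (simp add: comb_def)
    show "((\<lambda>b. F x (a * u x + b * w x)) has_real_derivative f x (a * u x + b * w x) * w x) (at b)" if "x \<in> space M" for b x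
    proof -
      have "((\<lambda>b. a * u x + b * w x) has_real_derivative w x) (at b)" by (auto intro!: derivative_eq_intros)
      from DERIV_chain2[OF F_DERIV[OF that] this] show ?thesis .
    qed
    show "(\<lambda>x. f x (a * u x + b0 * w x) * w x) \<in> borel_measurable M"
      using f_compose_measurable[of "\<lambda>x. a * u x + b0 * w x"] by measurable
    show "\<bar>f x (a * u x + b * w x) * w x\<bar> \<le> dom_f C B u w w x" if "\<bar>b - b0\<bar> \<le> 1" "x \<in> space M" for b x
      by (rule dom_f[OF C aB bB[OF that(1)] that(2)])
  qed (rule dom_f_integrable[OF u w w])
  show ?thesis unfolding J_comb[OF u w] J'_comb[OF u w w] by (rule DERIV_diff[OF 1 2])
qed

lemma J'_tendsto:
  assumes u: "u \<in> X" and w: "w \<in> X" and v: "v \<in> X" and ab: "a \<longlonglongrightarrow> a0" "b \<longlonglongrightarrow> b0"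
  shows "(\<lambda>n. J' (comb (a n) u (b n) w) v) \<longlonglongrightarrow> J' (comb a0 u b0 w) v"
proof -
  obtain B1 where B1: "\<And>n. norm (a n) \<le> B1" using convergent_imp_Bseq[OF convergentI[OF ab(1)]] by (auto simp: Bseq_def)
  obtain B2 where B2: "\<And>n. norm (b n) \<le> B2" using convergent_imp_Bseq[OF convergentI[OF ab(2)]] by (auto simp: Bseq_def)
  define B where "B = max B1 B2"
  have aB: "\<bar>a n\<bar> \<le> B" and bB: "\<bar>b n\<bar> \<le> B" for n using B1[of n] B2[of n] by (auto simp: B_def)
  note [measurable] = X_measurable[OF u] X_measurable[OF w] X_measurable[OF v]
  have "continuous_on UNIV (A :: 'b \<Rightarrow> 'b)" by (rule continuous_A)
  then have cA: "isCont A y" for y :: 'b by (simp add: continuous_on_eq_continuous_at)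
  obtain C where C: "0 \<le> C" "\<And>x a b. x \<in> space M \<Longrightarrow> \<bar>f x a * b\<bar> \<le> C * (1 + \<bar>a\<bar> powr q + 2 * \<bar>b\<bar> powr q)"
    using f_bound by blast
  have 1: "(\<lambda>n. LINT x|M. A (a n *\<^sub>R D u x + b n *\<^sub>R D w x) \<bullet> D v x) \<longlonglongrightarrow> (LINT x|M. A (a0 *\<^sub>R D u x + b0 *\<^sub>R D w x) \<bullet> D v x)"
  proof (rule integral_dominated_convergence[where w="dom_A B (D u) (D w) (D v)"])
    show "AE x in M. (\<lambda>n. A (a n *\<^sub>R D u x + b n *\<^sub>R D w x) \<bullet> D v x) \<longlonglongrightarrow> A (a0 *\<^sub>R D u x + b0 *\<^sub>R D w x) \<bullet> D v x"
      by (intro AE_I2 tendsto_intros isCont_tendsto_compose[OF cA] ab)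
    show "AE x in M. norm (A (a n *\<^sub>R D u x + b n *\<^sub>R D w x) \<bullet> D v x) \<le> dom_A B (D u) (D w) (D v) x" for n
      using dom_A[OF aB bB] by (intro AE_I2) simp
  qed (measurable, rule dom_A_integrable[OF u w v])
  have 2: "(\<lambda>n. LINT x|M. f x (a n * u x + b n * w x) * v x) \<longlonglongrightarrow> (LINT x|M. f x (a0 * u x + b0 * w x) * v x)"
  proof (rule integral_dominated_convergence[where w="dom_f C B u w v"])
    show "AE x in M. (\<lambda>n. f x (a n * u x + b n * w x) * v x) \<longlonglongrightarrow> f x (a0 * u x + b0 * w x) * v x"
    proof (rule AE_I2)
      fix x assume "x \<in> space M"
      then have cf: "isCont (f x) y" for y using f_continuous by (simp add: continuous_on_eq_continuous_at)
      show "(\<lambda>n. f x (a n * u x + b n * w x) * v x) \<longlonglongrightarrow> f x (a0 * u x + b0 * w x) * v x"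
        by (intro tendsto_intros isCont_tendsto_compose[OF cf] ab)
    qed
    show "AE x in M. norm (f x (a n * u x + b n * w x) * v x) \<le> dom_f C B u w v x" for n
      using dom_f[OF C aB bB] by (intro AE_I2) simp
    show "(\<lambda>x. f x (a n * u x + b n * w x) * v x) \<in> borel_measurable M" for n
      using f_compose_measurable[of "\<lambda>x. a n * u x + b n * w x"] by measurable
    show "(\<lambda>x. f x (a0 * u x + b0 * w x) * v x) \<in> borel_measurable M"
      using f_compose_measurable[of "\<lambda>x. a0 * u x + b0 * w x"] by measurable
  qed (rule dom_f_integrable[OF u w v])
  show ?thesis unfolding J'_comb[OF u w v] by (rule tendsto_diff[OF 1 2])
qed

definition "ray s u = (\<lambda>x. s * u x)" for s :: real and u :: "'a \<Rightarrow> real"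

lemma ray_comb: "ray s u = comb 0 u s u" "ray s u = comb s u 0 w" by (auto simp: ray_def comb_def)

lemma ray_X: "u \<in> X \<Longrightarrow> ray s u \<in> X" unfolding ray_comb(1) by (rule comb_X)

lemma ray_DERIV: "u \<in> X \<Longrightarrow> ((\<lambda>s. J (ray s u)) has_real_derivative J' (ray s u) u) (at s)"
  unfolding ray_comb(1) by (rule J_DERIV)

lemma ray_1[simp]: "ray 1 u = u" by (simp add: ray_def)

lemma J'_ray_right: "z \<in> X \<Longrightarrow> u \<in> X \<Longrightarrow> J' z (ray s u) = s * J' z u"
  unfolding ray_comb(1) by (simp add: J'_linear)

lemma J'_ray: "u \<in> X \<Longrightarrow> 0 < s \<Longrightarrow> J' (ray s u) u = (LINT x|M. h (s * norm (D u x)) * norm (D u x)) - (LINT x|M. f x (s * u x) * u x)"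
  unfolding ray_comb(1) by (subst J'_comb) (auto simp: A_scale)

lemma J_ray_0: "u \<in> X \<Longrightarrow> J (ray 0 u) = 0"
  unfolding ray_comb(1) by (subst J_comb) auto

text \<open>The gradient part of \<open>J'(su) u / s\<^sup>m\<^sup>-\<^sup>1\<close> is nonincreasing by the upper index, the part with \<open>f\<close> strictly increasing because
\<open>u\<close> does not vanish almost everywhere.\<close>

lemma fibre_decreasing:
  assumes u: "u \<in> X" and nz: "\<not> (AE x in M. u x = 0)" and st: "0 < s" "s < t"
  shows "J' (ray t u) u / t powr (m - 1) < J' (ray s u) u / s powr (m - 1)"
proof -
  have i: "integrable M (\<lambda>x. h (s * norm (D u x)) * norm (D u x))" "integrable M (\<lambda>x. f x (s * u x) * u x)" if "0 < s" for s
  proof -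
    have "integrable M (\<lambda>x. A (s *\<^sub>R D u x) \<bullet> D u x)"
    proof (rule integrable_cong_AE_imp[OF J_integrable(1)[OF ray_X[OF u] u, of s]])
      show "(\<lambda>x. A (s *\<^sub>R D u x) \<bullet> D u x) \<in> borel_measurable M" using X_measurable(2)[OF u] by measurable
      show "AE x in M. A (D (ray s u) x) \<bullet> D u x = A (s *\<^sub>R D u x) \<bullet> D u x"
        using D_scale[OF u, of s] unfolding ray_def by eventually_elim simp
    qed
    then show "integrable M (\<lambda>x. h (s * norm (D u x)) * norm (D u x))" using that by (simp add: A_scale)
    show "integrable M (\<lambda>x. f x (s * u x) * u x)" using J_integrable(2)[OF ray_X[OF u] u, of s] by (simp add: ray_def)
  qed
  have t: "0 < t" using st by simp
  have "(LINT x|M. h (t * norm (D u x)) * norm (D u x) / t powr (m - 1)) \<le> (LINT x|M. h (s * norm (D u x)) * norm (D u x) / s powr (m - 1))"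
  proof (rule integral_mono)
    fix x
    have "h (t / s * (s * norm (D u x))) \<le> (t / s) powr (m - 1) * h (s * norm (D u x))"
      using st by (intro h_scale_le_m) auto
    then have "h (t * norm (D u x)) / t powr (m - 1) \<le> h (s * norm (D u x)) / s powr (m - 1)"
      using st t by (simp add: powr_divide field_simps)
    from mult_right_mono[OF this, of "norm (D u x)"]
    show "h (t * norm (D u x)) * norm (D u x) / t powr (m - 1) \<le> h (s * norm (D u x)) * norm (D u x) / s powr (m - 1)" by simp
  qed (use i st t in auto)
  moreover have "(LINT x|M. f x (s * u x) * u x / s powr (m - 1)) < (LINT x|M. f x (t * u x) * u x / t powr (m - 1))"
  proof -
    let ?d = "\<lambda>x. f x (t * u x) * u x / t powr (m - 1) - f x (s * u x) * u x / s powr (m - 1)"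
    have di: "integrable M ?d" using i st t by auto
    have pos: "0 \<le> ?d x" if "x \<in> space M" for x
      using f_fibre[OF that _ st, of "u x"] by (cases "u x = 0") auto
    then have 0: "0 \<le> integral\<^sup>L M ?d" by (intro integral_nonneg_AE AE_I2)
    have "integral\<^sup>L M ?d \<noteq> 0"
    proof
      assume "integral\<^sup>L M ?d = 0"
      then have "AE x in M. ?d x = 0" using integral_nonneg_eq_0_iff_AE[OF di] pos by auto
      then have "AE x in M. u x = 0"
      proof (rule AE_mp, intro AE_I2 impI)
        fix x assume "x \<in> space M" "?d x = 0"
        then show "u x = 0" using f_fibre[of x "u x" s t] st by (cases "u x = 0") auto
      qed
      then show False using nz by simp
    qed
    then have "0 < integral\<^sup>L M ?d" using 0 by linarith
    then show ?thesis using i st t by simp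
  qed
  ultimately show ?thesis using u st t by (simp add: J'_ray diff_divide_distrib)
qed

text \<open>At \<open>s = 1\<close> the derivative along the ray is zero, so it is positive before and negative after.\<close>

lemma nehari_fibre:
  assumes u: "u \<in> \<N>"
  shows "0 < s \<Longrightarrow> s < 1 \<Longrightarrow> 0 < J' (ray s u) u" "1 < s \<Longrightarrow> J' (ray s u) u < 0" "0 < s \<Longrightarrow> J (ray s u) \<le> J u"
proof -
  have uX: "u \<in> X" and nz: "\<not> (AE x in M. u x = 0)" and 0: "J' (ray 1 u) u = 0" using u by (auto simp: \<N>_def)
  show lt: "0 < J' (ray s u) u" if "0 < s" "s < 1" for s
    using fibre_decreasing[OF uX nz that] 0 that by (simp add: zero_less_divide_iff)
  show gt: "J' (ray s u) u < 0" if "1 < s" for s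
    using fibre_decreasing[OF uX nz _ that] 0 that by (simp add: divide_less_0_iff)
  show "J (ray s u) \<le> J u" if s: "0 < s"
  proof (cases "s \<le> 1")
    case True
    have "J (ray s u) \<le> J (ray 1 u)"
    proof (rule DERIV_nonneg_imp_nondecreasing[of s 1 "\<lambda>s. J (ray s u)"])
      show "\<exists>y. ((\<lambda>s. J (ray s u)) has_real_derivative y) (at t) \<and> 0 \<le> y" if "s \<le> t" "t \<le> 1" for t
        using ray_DERIV[OF uX, of t] lt[of t] 0 s that by (cases "t = 1") (auto intro: less_imp_le)
    qed (rule True)
    then show ?thesis by simp
  next
    case False
    have "J (ray 1 u) \<ge> J (ray s u)"
    proof (rule DERIV_nonpos_imp_nonincreasing[of 1 s "\<lambda>s. J (ray s u)"])
      show "\<exists>y. ((\<lambda>s. J (ray s u)) has_real_derivative y) (at t) \<and> y \<le> 0" if "1 \<le> t" "t \<le> s" for t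
        using ray_DERIV[OF uX, of t] gt[of t] 0 s that by (cases "t = 1") (auto intro: less_imp_le)
    qed (use False in simp)
    then show ?thesis by simp
  qed
qed

lemma powr_m_integrable:
  assumes u: "u \<in> X" shows "integrable M (\<lambda>x. \<bar>u x\<bar> powr m)"
proof (rule Bochner_Integration.integrable_bound)
  show "integrable M (\<lambda>x. 1 + \<bar>u x\<bar> powr q)" using X_q[OF u] by auto
  show "(\<lambda>x. \<bar>u x\<bar> powr m) \<in> borel_measurable M" using X_measurable(1)[OF u] by measurable
  show "AE x in M. norm (\<bar>u x\<bar> powr m) \<le> norm (1 + \<bar>u x\<bar> powr q)"
  proof (rule AE_I2)
    fix x
    show "norm (\<bar>u x\<bar> powr m) \<le> norm (1 + \<bar>u x\<bar> powr q)"
    proof (cases "\<bar>u x\<bar> \<le> 1")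
      case True
      then have "\<bar>u x\<bar> powr m \<le> 1" using lm by (intro powr_le1) auto
      then show ?thesis by (simp add: add_increasing2)
    next
      case False
      then have "\<bar>u x\<bar> powr m \<le> \<bar>u x\<bar> powr q" using mq by (intro powr_mono) auto
      then show ?thesis by simp
    qed
  qed
qed

text \<open>The constant \<open>B\<close> is chosen such that the integral of \<open>B \<bar>u\<bar>\<^sup>m\<close> exceeds the energy of \<open>u\<close> by \<open>1\<close>; the integral scales
like \<open>s\<^sup>m\<close>, the energy at most so.\<close>

lemma J_ray_nonpos:
  assumes u: "u \<in> X" and nz: "\<not> (AE x in M. u x = 0)"
  obtains S where "0 < S" "\<And>s. S \<le> s \<Longrightarrow> J (ray s u) \<le> 0"
proof -
  let ?I = "LINT x|M. \<bar>u x\<bar> powr m"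
  have i: "integrable M (\<lambda>x. \<bar>u x\<bar> powr m)" by (rule powr_m_integrable[OF u])
  have "?I \<noteq> 0"
  proof
    assume "?I = 0"
    then have "AE x in M. \<bar>u x\<bar> powr m = 0" using integral_nonneg_eq_0_iff_AE[OF i] by simp
    then have "AE x in M. u x = 0" by eventually_elim simp
    then show False using nz by simp
  qed
  moreover have "0 \<le> ?I" by simp
  ultimately have I: "0 < ?I" by linarith
  define B where "B = (E u + 1) / ?I"
  have BI: "B * ?I = E u + 1" using I by (simp add: B_def)
  obtain K where K: "\<And>x t. x \<in> space M \<Longrightarrow> B * \<bar>t\<bar> powr m - K \<le> F x t" using f_super[of B] by blast
  define \<mu> where "\<mu> = measure M (space M)"
  define S where "S = max 1 (K * \<mu>)"
  have est: "J (ray s u) \<le> K * \<mu> - s powr m" if s: "1 \<le> s" for s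
  proof -
    have iF: "integrable M (\<lambda>x. F x (s * u x))" using J_integrable(3)[OF ray_X[OF u] u, of s] by (simp add: ray_def)
    have eq: "\<bar>s * u x\<bar> powr m = s powr m * \<bar>u x\<bar> powr m" for x using s by (simp add: abs_mult powr_mult)
    have "s powr m * (B * ?I) - K * \<mu> = (LINT x|M. B * \<bar>s * u x\<bar> powr m - K)"
      unfolding eq using i by (simp add: \<mu>_def mult.left_commute)
    also have "\<dots> \<le> (LINT x|M. F x (s * u x))"
    proof (rule integral_mono[OF _ iF])
      show "integrable M (\<lambda>x. B * \<bar>s * u x\<bar> powr m - K)" unfolding eq using i by auto
    qed (rule K)
    finally have "s powr m * (E u + 1) - K * \<mu> \<le> (LINT x|M. F x (s * u x))" by (simp only: BI)
    moreover have "E (ray s u) \<le> s powr m * E u" unfolding ray_def by (rule E_scale_bounds(2)[OF u s])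
    ultimately show ?thesis by (simp add: J_def ray_def algebra_simps)
  qed
  show thesis
  proof
    show "0 < S" by (simp add: S_def)
    fix s assume s: "S \<le> s"
    then have s1: "1 \<le> s" "K * \<mu> \<le> s" by (auto simp: S_def)
    have "s powr 1 \<le> s powr m" using s1 lm by (intro powr_mono) auto
    then show "J (ray s u) \<le> 0" using est[OF s1(1)] s1 by simp
  qed
qed

text \<open>The energy scales at least like \<open>s\<^sup>m\<close> for small \<open>s\<close>, the error term like \<open>s\<^sup>q\<close> with \<open>q > m\<close>.\<close>

lemma J_ray_pos:
  assumes u: "u \<in> X" and nz: "\<not> (AE x in M. u x = 0)" and S: "0 < S"
  obtains s where "0 < s" "s < S" "0 < J (ray s u)"
proof -
  obtain \<delta> C where \<delta>: "0 < \<delta>" and C: "\<And>u. u \<in> X \<Longrightarrow> \<delta> * E u - C * (LINT x|M. \<bar>u x\<bar> powr q) \<le> J u"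
    using f_small unfolding J_def E_def by blast
  have Eu: "0 < E u" by (rule E_pos[OF u nz])
  let ?I = "LINT x|M. \<bar>u x\<bar> powr q"
  have I: "0 \<le> ?I" by simp
  define a where "a = \<bar>C\<bar> * ?I + 1"
  have a: "0 < a" using I by (simp add: a_def add_nonneg_pos)
  have est: "s powr m * (\<delta> * E u - a * s powr (q - m)) < J (ray s u)" if s: "0 < s" "s \<le> 1" for s
  proof -
    have "\<delta> * (s powr m * E u) \<le> \<delta> * E (ray s u)"
      unfolding ray_def using E_scale_bounds(3)[OF u, of s] s \<delta> by (intro mult_left_mono) auto
    moreover have "(LINT x|M. \<bar>ray s u x\<bar> powr q) = s powr q * ?I"
      using s by (simp add: ray_def abs_mult powr_mult)
    moreover have "C * (s powr q * ?I) < s powr q * a"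
    proof -
      have "C * ?I \<le> \<bar>C\<bar> * ?I" using I by (intro mult_right_mono) auto
      then have "C * ?I < a" by (simp add: a_def)
      then have "s powr q * (C * ?I) < s powr q * a" using s by (intro mult_strict_left_mono) auto
      then show ?thesis by (simp add: mult.left_commute)
    qed
    moreover have "s powr q = s powr m * s powr (q - m)" by (simp add: powr_add[symmetric])
    ultimately show ?thesis using C[OF ray_X[OF u, of s]] by (simp add: algebra_simps)
  qed
  define t where "t = min (S / 2) (min 1 ((\<delta> * E u / a) powr (1 / (q - m))))"
  have dE: "0 < \<delta> * E u / a" using \<delta> Eu a by simp
  then have t0: "0 < t" using S by (simp add: t_def) (use dE in fastforce)
  have t1: "t < S" "t \<le> 1" "t \<le> (\<delta> * E u / a) powr (1 / (q - m))" using S by (auto simp: t_def)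
  have "t powr (q - m) \<le> ((\<delta> * E u / a) powr (1 / (q - m))) powr (q - m)"
    using t1 t0 mq by (intro powr_mono2) auto
  also have "\<dots> = \<delta> * E u / a" using dE a \<delta> Eu mq by (simp add: powr_powr)
  finally have "a * t powr (q - m) \<le> \<delta> * E u" using a by (simp add: field_simps)
  then have "0 \<le> t powr m * (\<delta> * E u - a * t powr (q - m))" by simp
  then show thesis using that[OF t0 t1(1)] est[OF t0 t1(2)] by linarith
qed

text \<open>An interior maximum of \<open>J\<close> along the ray is a critical point of the restriction.\<close>

lemma nehari_ray:
  assumes u: "u \<in> X" and nz: "\<not> (AE x in M. u x = 0)"
  obtains s where "0 < s" "ray s u \<in> \<N>"
proof -
  obtain S where S: "0 < S" "\<And>s. S \<le> s \<Longrightarrow> J (ray s u) \<le> 0" using J_ray_nonpos[OF u nz] by blast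
  obtain s1 where s1: "0 < s1" "s1 < S" "0 < J (ray s1 u)" using J_ray_pos[OF u nz S(1)] by blast
  have cont: "continuous_on {0..S} (\<lambda>s. J (ray s u))"
    by (intro continuous_at_imp_continuous_on ballI DERIV_isCont[OF ray_DERIV[OF u]])
  obtain s where s: "s \<in> {0..S}" "\<And>t. t \<in> {0..S} \<Longrightarrow> J (ray t u) \<le> J (ray s u)"
    using continuous_attains_sup[OF _ _ cont] S(1) by auto
  have Jp: "0 < J (ray s u)" using s(2)[of s1] s1 by auto
  have s0: "0 < s" using Jp J_ray_0[OF u] s(1) by (cases "s = 0") auto
  have sS: "s < S" using Jp S(2)[of s] by (meson not_le)
  have "J' (ray s u) u = 0"
  proof (rule DERIV_local_max[OF ray_DERIV[OF u]])
    show "0 < min s (S - s)" using s0 sS by simp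
    show "\<forall>y. \<bar>s - y\<bar> < min s (S - s) \<longrightarrow> J (ray y u) \<le> J (ray s u)"
      by (intro allI impI s(2)) auto
  qed
  then have "J' (ray s u) (ray s u) = 0" by (simp add: J'_ray_right[OF ray_X[OF u] u])
  moreover have "\<not> (AE x in M. ray s u x = 0)"
    using nz s0 by (simp add: ray_def)
  ultimately show thesis using that[OF s0] ray_X[OF u] by (simp add: \<N>_def)
qed

lemma nehari_J_pos:
  assumes u: "u \<in> \<N>" shows "0 < J u"
proof -
  have uX: "u \<in> X" and nz: "\<not> (AE x in M. u x = 0)" using u by (auto simp: \<N>_def)
  obtain s where "0 < s" "0 < J (ray s u)" using J_ray_pos[OF uX nz, of 1] by auto
  then show ?thesis using nehari_fibre(3)[OF u, of s] by linarith
qed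

text \<open>The sequence is compared along all multiples of the normalised functions rather than at the points of the Nehari manifold
themselves, so no bound on the minimising sequence is required beforehand.\<close>

theorem minimizer_exists: "\<exists>u\<in>\<N>. \<forall>w\<in>\<N>. J u \<le> J w"
proof -
  obtain u0 where "u0 \<in> X" "\<not> (AE x in M. u0 x = 0)" using X_nonzero by blast
  then obtain w0 where w0: "w0 \<in> \<N>" using nehari_ray by blast
  define c where "c = Inf (J ` \<N>)"
  have bdd: "bdd_below (J ` \<N>)" using nehari_J_pos by (intro bdd_belowI[of _ 0]) (auto intro: less_imp_le)
  have c_le: "c \<le> J w" if "w \<in> \<N>" for w unfolding c_def using that by (intro cInf_lower bdd) auto
  have "\<exists>w\<in>\<N>. J w < c + inverse (real (Suc n))" for n
  proof -
    have "Inf (J ` \<N>) < c + inverse (real (Suc n))" by (simp add: c_def)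
    then show ?thesis using cInf_lessD[of "J ` \<N>"] w0 by blast
  qed
  then obtain w where w: "\<And>n. w n \<in> \<N>" "\<And>n. J (w n) < c + inverse (real (Suc n))" by metis
  have wX: "w n \<in> X" and wnz: "\<not> (AE x in M. w n x = 0)" for n using w(1)[of n] by (auto simp: \<N>_def)
  have "\<exists>t. 0 < t \<and> E (ray t (w n)) = 1" for n
    using E_scale_one[OF wX wnz, of n] unfolding ray_def by metis
  then obtain t where t: "\<And>n. 0 < t n" "\<And>n. E (ray (t n) (w n)) = 1" by metis
  define v where "v n = ray (t n) (w n)" for n
  have vX: "v n \<in> X" and v1: "E (v n) = 1" for n using ray_X[OF wX] t(2) by (auto simp: v_def)
  have Jv: "J (ray s (v n)) < c + inverse (real (Suc n))" if "0 < s" for s n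
  proof -
    have "ray s (v n) = ray (s * t n) (w n)" by (simp add: v_def ray_def mult.assoc)
    then have "J (ray s (v n)) \<le> J (w n)" using nehari_fibre(3)[OF w(1), of "s * t n" n] that t(1)[of n] by simp
    then show ?thesis using w(2)[of n] by linarith
  qed
  obtain k z where k: "strict_mono (k :: nat \<Rightarrow> nat)" and z: "z \<in> borel_measurable M" "integrable M (\<lambda>x. \<bar>z x\<bar> powr q)"
    and lim: "(\<lambda>n. LINT x|M. \<bar>v (k n) x - z x\<bar> powr q) \<longlonglongrightarrow> 0"
  proof -
    have "(LINT x|M. P (norm (D (v n) x))) \<le> 1" for n using v1[of n] by (simp add: E_def)
    from X_precompact[of v 1, OF vX this] show thesis by (elim exE conjE) (rule that)
  qed
  have zX: "z \<in> X" using closed_sublevel(1)[of "\<lambda>n. v (k n)" z 1] vX z lim v1 by simp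
  have inv_lim: "(\<lambda>n. inverse (real (Suc (k n)))) \<longlonglongrightarrow> 0"
    using LIMSEQ_subseq_LIMSEQ[OF LIMSEQ_inverse_real_of_nat k] by (simp add: o_def)
  have ray_lim: "(\<lambda>n. LINT x|M. \<bar>ray s (v (k n)) x - ray s z x\<bar> powr q) \<longlonglongrightarrow> 0" for s
  proof -
    have "\<bar>ray s (v (k n)) x - ray s z x\<bar> powr q = \<bar>s\<bar> powr q * \<bar>v (k n) x - z x\<bar> powr q" for n x
      unfolding ray_def right_diff_distrib[symmetric] abs_mult by (rule powr_mult)
    then show ?thesis using tendsto_mult_left[OF lim, of "\<bar>s\<bar> powr q"] by simp
  qed
  have F_lim: "(\<lambda>n. LINT x|M. F x (ray s (v (k n)) x)) \<longlonglongrightarrow> (LINT x|M. F x (ray s z x))" for s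
    by (intro F_integral_tendsto ray_lim X_measurable(1) X_q ray_X vX zX)
  have znz: "\<not> (AE x in M. z x = 0)"
  proof
    assume "AE x in M. z x = 0"
    then have F0: "(LINT x|M. F x (ray s z x)) = 0" for s
      by (intro integral_eq_zero_AE) (auto simp: ray_def elim: AE_mp)
    \<comment> \<open>Energy at least \<open>s\<close> and an \<open>F\<close>-term below \<open>1\<close> give \<open>J > c + 1\<close>.\<close>
    define s where "s = \<bar>c\<bar> + 2"
    have s: "1 \<le> s" "0 < s" by (auto simp: s_def)
    have "\<forall>\<^sub>F n in sequentially. (LINT x|M. F x (ray s (v (k n)) x)) < 1"
      using F_lim[of s] F0 by (intro order_tendstoD(2)) auto
    then obtain n where n: "(LINT x|M. F x (ray s (v (k n)) x)) < 1" by (meson eventually_happens trivial_limit_sequentially)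
    have "s powr 1 \<le> s powr l" using s lm by (intro powr_mono) auto
    also have "\<dots> \<le> E (ray s (v (k n)))" using E_scale_bounds(1)[OF vX[of "k n"] s(1)] v1 by (simp add: ray_def)
    finally have "s - 1 < J (ray s (v (k n)))" using n s by (simp add: J_def)
    moreover have "inverse (real (Suc (k n))) \<le> 1" by (simp add: inverse_le_1_iff)
    ultimately show False using Jv[OF s(2), of "k n"] by (simp add: s_def)
  qed
  have Jz: "J (ray s z) \<le> c" if s: "0 < s" for s
  proof (rule field_le_epsilon)
    fix e :: real assume e: "0 < e"
    let ?R = "c + e + (LINT x|M. F x (ray s z x))"
    have "(\<lambda>n. c + inverse (real (Suc (k n))) + (LINT x|M. F x (ray s (v (k n)) x))) \<longlonglongrightarrow> c + 0 + (LINT x|M. F x (ray s z x))"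
      by (intro tendsto_intros inv_lim F_lim)
    then have "\<forall>\<^sub>F n in sequentially. c + inverse (real (Suc (k n))) + (LINT x|M. F x (ray s (v (k n)) x)) < ?R"
      using e by (intro order_tendstoD(2)) auto
    then obtain N where N: "\<And>n. N \<le> n \<Longrightarrow> c + inverse (real (Suc (k n))) + (LINT x|M. F x (ray s (v (k n)) x)) < ?R"
      by (auto simp: eventually_sequentially)
    have "E (ray s z) \<le> ?R"
    proof (rule closed_sublevel(2)[of "\<lambda>n. ray s (v (k (n + N)))"])
      show "(\<lambda>n. LINT x|M. \<bar>ray s (v (k (n + N))) x - ray s z x\<bar> powr q) \<longlonglongrightarrow> 0"
        by (rule LIMSEQ_ignore_initial_segment[OF ray_lim])
      show "E (ray s (v (k (n + N)))) \<le> ?R" for n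
        using N[of "n + N"] Jv[OF s, of "k (n + N)"] by (simp add: J_def)
    qed (intro X_measurable(1) X_q ray_X vX zX)+
    then show "J (ray s z) \<le> c + e" by (simp add: J_def)
  qed
  obtain s where s: "0 < s" "ray s z \<in> \<N>" using nehari_ray[OF zX znz] by blast
  then show ?thesis using Jz[OF s(1)] c_le by (intro bexI[of _ "ray s z"]) (auto intro: order_trans)
qed

text \<open>Functions are not identified when they agree almost everywhere, so locality of the gradient has to be derived from its
closedness.\<close>

lemma D_zero:
  assumes u: "u \<in> X" and z: "AE x in M. u x = 0"
  shows "AE x in M. D u x = 0"
proof -
  let ?v = "\<lambda>x. 0 * u x"
  have vX: "?v \<in> X" by (rule X_scale[OF u])
  have Dv: "AE x in M. D ?v x = 0" using D_scale[OF u, of 0] by simp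
  have "u \<in> X \<and> (AE x in M. D u x = 0)"
  proof (rule X_closed[of "\<lambda>n. ?v" u "\<lambda>x. 0"])
    have "(LINT x|M. \<bar>?v x - u x\<bar> powr q) = 0"
      using z by (intro integral_eq_zero_AE) (auto elim: AE_mp)
    then show "(\<lambda>n. LINT x|M. \<bar>?v x - u x\<bar> powr q) \<longlonglongrightarrow> 0" by simp
    have "(LINT x|M. P (norm (D ?v x - 0))) = 0"
      using Dv by (intro integral_eq_zero_AE) (auto elim: AE_mp)
    then show "(\<lambda>n. LINT x|M. P (norm (D ?v x - 0))) \<longlonglongrightarrow> 0" by simp
  qed (use vX X_measurable(1)[OF u] X_q[OF u] in auto)
  then show ?thesis by simp
qed

lemma J'_zero:
  assumes u: "u \<in> X" and z: "z \<in> X" and 0: "AE x in M. u x = 0"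
  shows "J' z u = 0"
proof -
  have "(LINT x|M. A (D z x) \<bullet> D u x) = 0"
    using D_zero[OF u 0] by (intro integral_eq_zero_AE) (auto elim: AE_mp)
  moreover have "(LINT x|M. f x (z x) * u x) = 0"
    using 0 by (intro integral_eq_zero_AE) (auto elim: AE_mp)
  ultimately show ?thesis by (simp add: J'_def)
qed

text \<open>A descent direction \<open>v\<close> at \<open>u\<close> is perturbed back onto the Nehari manifold. The sign of \<open>J'\<close> in direction \<open>v\<close> persists in a
neighbourhood, the function \<open>H s \<tau>\<close> measures \<open>J'\<close> of \<open>s (u + \<tau> v)\<close> in its own direction, and for small \<open>\<tau>\<close> it changes sign between
\<open>1 - \<delta>\<close> and \<open>1 + \<delta>\<close>.\<close>

lemma minimizer_nonneg:
  assumes u: "u \<in> \<N>" and min: "\<And>w. w \<in> \<N> \<Longrightarrow> J u \<le> J w" and v: "v \<in> X"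
  shows "0 \<le> J' u v"
proof (rule ccontr)
  assume neg: "\<not> 0 \<le> J' u v"
  have uX: "u \<in> X" using u by (simp add: \<N>_def)
  have u10: "comb 1 u 0 v = u" by (simp add: comb_def)
  have "\<exists>\<delta>. 0 < \<delta> \<and> \<delta> < 1 \<and> (\<forall>s \<tau>. \<bar>s - 1\<bar> \<le> \<delta> \<longrightarrow> 0 \<le> \<tau> \<longrightarrow> \<tau> \<le> \<delta> \<longrightarrow> J' (comb s u (s * \<tau>) v) v < 0)"
  proof (rule ccontr)
    assume no: "\<not> ?thesis"
    define d where "d n = inverse (real (Suc (Suc n)))" for n
    have d: "0 < d n" "d n < 1" for n by (auto simp: d_def inverse_less_1_iff)
    have "\<exists>s \<tau>. \<bar>s - 1\<bar> \<le> d n \<and> 0 \<le> \<tau> \<and> \<tau> \<le> d n \<and> 0 \<le> J' (comb s u (s * \<tau>) v) v" for n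
      using no d[of n] by (meson not_less)
    then obtain s \<tau> where st: "\<And>n. \<bar>s n - 1\<bar> \<le> d n" "\<And>n. 0 \<le> \<tau> n" "\<And>n. \<tau> n \<le> d n"
      "\<And>n. 0 \<le> J' (comb (s n) u (s n * \<tau> n) v) v" by metis
    have dl: "d \<longlonglongrightarrow> 0" unfolding d_def[abs_def] using LIMSEQ_Suc[OF LIMSEQ_inverse_real_of_nat] .
    have s: "s \<longlonglongrightarrow> 1"
      by (rule LIM_zero_cancel, rule Lim_null_comparison[OF always_eventually dl]) (use st(1) in auto)
    have \<tau>: "\<tau> \<longlonglongrightarrow> 0"
      by (rule tendsto_sandwich[OF _ _ tendsto_const dl]) (use st in auto)
    have "(\<lambda>n. J' (comb (s n) u (s n * \<tau> n) v) v) \<longlonglongrightarrow> J' (comb 1 u 0 v) v"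
      using tendsto_mult[OF s \<tau>] by (intro J'_tendsto[OF uX v v s]) simp
    then have "0 \<le> J' (comb 1 u 0 v) v" by (rule LIMSEQ_le_const) (use st(4) in auto)
    then show False using neg by (simp add: u10)
  qed
  then obtain \<delta> where \<delta>: "0 < \<delta>" "\<delta> < 1" and G: "\<And>s \<tau>. \<bar>s - 1\<bar> \<le> \<delta> \<Longrightarrow> 0 \<le> \<tau> \<Longrightarrow> \<tau> \<le> \<delta> \<Longrightarrow> J' (comb s u (s * \<tau>) v) v < 0"
    by blast
  \<comment> \<open>Up to the factor \<open>s\<close>, a zero of \<open>H\<close> in \<open>s\<close> is a point of the Nehari manifold.\<close>
  define H where "H s \<tau> = J' (comb s u (s * \<tau>) v) (comb 1 u \<tau> v)" for s \<tau>
  have H_eq: "H s \<tau> = J' (comb s u (s * \<tau>) v) u + \<tau> * J' (comb s u (s * \<tau>) v) v" for s \<tau>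
    unfolding H_def by (subst J'_linear) (auto intro: comb_X uX v)
  have H_lim: "(\<lambda>n. H (s n) (\<tau> n)) \<longlonglongrightarrow> H s0 \<tau>0" if "s \<longlonglongrightarrow> s0" "\<tau> \<longlonglongrightarrow> \<tau>0" for s \<tau> s0 \<tau>0
    unfolding H_eq by (intro tendsto_intros J'_tendsto uX v that)
  have H0: "H s 0 = J' (ray s u) u" for s by (simp add: H_eq ray_comb(2)[of s u v])
  define e where "e n = \<delta> * inverse (real (Suc n))" for n
  have e: "0 < e n" "e n \<le> \<delta>" for n
  proof -
    show "0 < e n" using \<delta> by (simp add: e_def)
    have "\<delta> * inverse (real (Suc n)) \<le> \<delta> * 1" using \<delta> by (intro mult_left_mono) (auto simp: inverse_le_1_iff)
    then show "e n \<le> \<delta>" by (simp add: e_def)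
  qed
  have el: "e \<longlonglongrightarrow> 0"
    unfolding e_def[abs_def] using tendsto_mult_left[OF LIMSEQ_inverse_real_of_nat, of \<delta>] by simp
  have "0 < H (1 - \<delta>) 0" "H (1 + \<delta>) 0 < 0" unfolding H0 using nehari_fibre(1,2)[OF u] \<delta> by auto
  then have "\<forall>\<^sub>F n in sequentially. 0 < H (1 - \<delta>) (e n)" "\<forall>\<^sub>F n in sequentially. H (1 + \<delta>) (e n) < 0"
    using H_lim[OF tendsto_const el, of "1 - \<delta>"] H_lim[OF tendsto_const el, of "1 + \<delta>"]
    by (auto intro: order_tendstoD)
  then have "\<forall>\<^sub>F n in sequentially. 0 < H (1 - \<delta>) (e n) \<and> H (1 + \<delta>) (e n) < 0" by (rule eventually_conj)
  from eventually_happens'[OF sequentially_bot this]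
  obtain n where n: "0 < H (1 - \<delta>) (e n)" "H (1 + \<delta>) (e n) < 0" by blast
  define \<tau> where "\<tau> = e n"
  have \<tau>: "0 < \<tau>" "\<tau> \<le> \<delta>" using e by (auto simp: \<tau>_def)
  have cont: "continuous_on {1 - \<delta>..1 + \<delta>} (\<lambda>s. H s \<tau>)"
    unfolding continuous_on_sequentially o_def
  proof (intro allI ballI impI, elim conjE)
    fix x and s :: "nat \<Rightarrow> real" assume "s \<longlonglongrightarrow> x"
    then show "(\<lambda>n. H (s n) \<tau>) \<longlonglongrightarrow> H x \<tau>" by (rule H_lim[OF _ tendsto_const])
  qed
  have "1 - \<delta> \<le> 1 + \<delta>" using \<delta> by simp
  from IVT2'[of "\<lambda>s. H s \<tau>" "1 + \<delta>" 0 "1 - \<delta>", OF less_imp_le[OF n(2)[folded \<tau>_def]]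
      less_imp_le[OF n(1)[folded \<tau>_def]] this cont]
  obtain s where s: "1 - \<delta> \<le> s" "s \<le> 1 + \<delta>" "H s \<tau> = 0"
    by (elim exE conjE) (rule that)
  have s0: "0 < s" using s \<delta> by linarith
  define z where "z = comb s u (s * \<tau>) v"
  have zX: "z \<in> X" unfolding z_def by (rule comb_X[OF uX v])
  have z_ray: "z = ray s (comb 1 u \<tau> v)" by (simp add: z_def ray_def comb_def algebra_simps)
  have c1X: "comb 1 u \<tau> v \<in> X" by (rule comb_X[OF uX v])
  have "J' z z = s * H s \<tau>"
    unfolding H_def using J'_ray_right[OF zX c1X, of s] z_ray z_def by simp
  then have z0: "J' z z = 0" using s by simp
  have "\<not> (AE x in M. comb 1 u \<tau> v x = 0)"
  proof
    \<comment> \<open>The perturbed function does not vanish, since \<open>H\<close> would vanish with it.\<close>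
    assume "AE x in M. comb 1 u \<tau> v x = 0"
    then have "H (1 - \<delta>) \<tau> = 0" unfolding H_def by (intro J'_zero c1X comb_X uX v)
    then show False using n by (simp add: \<tau>_def)
  qed
  then have "\<not> (AE x in M. z x = 0)" using s0 by (simp add: z_ray ray_def)
  then have zN: "z \<in> \<N>" using zX z0 by (simp add: \<N>_def)
  have "J (comb s u (s * \<tau>) v) < J (comb s u 0 v)"
  proof (rule DERIV_neg_imp_decreasing[of 0 "s * \<tau>" "\<lambda>b. J (comb s u b v)"])
    show "0 < s * \<tau>" using s0 \<tau> by simp
    fix b assume b: "0 \<le> b" "b \<le> s * \<tau>"
    have "b = s * (b / s)" using s0 by simp
    moreover have "b / s \<le> \<delta>"
    proof -
      have "s * \<tau> \<le> s * \<delta>" using s0 \<tau> by (intro mult_left_mono) auto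
      then have "b \<le> s * \<delta>" by (rule order_trans[OF b(2)])
      then show ?thesis unfolding pos_divide_le_eq[OF s0] by (simp only: mult.commute)
    qed
    ultimately have "J' (comb s u b v) v < 0" using G[of s "b / s"] s s0 b by simp
    then show "\<exists>y. ((\<lambda>b. J (comb s u b v)) has_real_derivative y) (at b) \<and> y < 0"
      using J_DERIV[OF uX v, of s b] by blast
  qed
  also have "J (comb s u 0 v) \<le> J u" using nehari_fibre(3)[OF u s0] by (simp add: ray_comb(2)[of s u v])
  finally show False using min[OF zN] by (simp add: z_def)
qed

text \<open>The inequality for \<open>v\<close> and for \<open>-v\<close>.\<close>

theorem ground_state: "\<exists>u\<in>\<N>. (\<forall>v\<in>X. J' u v = 0) \<and> (\<forall>w\<in>\<N>. J u \<le> J w)"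
proof -
  obtain u where u: "u \<in> \<N>" "\<And>w. w \<in> \<N> \<Longrightarrow> J u \<le> J w" using minimizer_exists by blast
  have uX: "u \<in> X" using u by (simp add: \<N>_def)
  have "J' u v = 0" if v: "v \<in> X" for v
  proof -
    have "0 \<le> J' u (ray (-1) v)" by (rule minimizer_nonneg[OF u ray_X[OF v]])
    then show ?thesis using minimizer_nonneg[OF u v] J'_ray_right[OF uX v, of "-1"] by simp
  qed
  then show ?thesis using u by blast
qed

end

section \<open>The Orlicz--Sobolev space with zero boundary values\<close>

text \<open>An open set is a countable union of closed boxes.\<close>

lemma measurable_of_compacts:
  fixes g :: "real^'n \<Rightarrow> 'b::euclidean_space"
  assumes \<Omega>: "open \<Omega>" and g: "\<And>K. compact K \<Longrightarrow> K \<subseteq> \<Omega> \<Longrightarrow> g absolutely_integrable_on K"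
  shows "g \<in> borel_measurable (lebesgue_on \<Omega>)"
proof -
  obtain \<D> where D: "countable \<D>" "\<D> \<subseteq> Pow \<Omega>" "\<And>X. X \<in> \<D> \<Longrightarrow> \<exists>a b. X = cbox a b" "\<Union>\<D> = \<Omega>"
    using open_countable_Union_open_cbox[OF \<Omega>] by blast
  have \<Omega>m: "\<Omega> \<in> sets lebesgue" using \<Omega> by (rule open_sets_lebesgue)
  show ?thesis
  proof (rule measurable_piecewise_restrict[OF D(1)])
    show "space (lebesgue_on \<Omega>) \<subseteq> \<Union>\<D>" using D(4) by simp
    fix X assume X: "X \<in> \<D>"
    then obtain a b where ab: "X = cbox a b" using D(3) by blast
    have sub: "X \<subseteq> \<Omega>" using X D by auto
    have Xm: "X \<in> sets lebesgue" unfolding ab by simp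
    show "X \<inter> space (lebesgue_on \<Omega>) \<in> sets (lebesgue_on \<Omega>)"
      using sub Xm \<Omega>m by (auto simp: sets_restrict_space_iff Int_absorb2)
    have "set_integrable lebesgue X g" using g[of X] sub unfolding ab by auto
    then have "g \<in> borel_measurable (lebesgue_on X)"
      using Xm unfolding set_integrable_def by (simp add: borel_measurable_restrict_space_iff borel_measurable_integrable)
    then show "g \<in> borel_measurable (restrict_space (lebesgue_on \<Omega>) X)"
      using sub by (simp add: restrict_restrict_space Int_absorb1 \<Omega>m Xm)
  qed
qed

text \<open>Interpolation between \<open>L\<^sup>1\<close> and \<open>L\<^sup>q\<^sup>'\<close>: the region \<open>\<bar>w\<bar> \<le> T\<close> is controlled by the first, the region \<open>\<bar>w\<bar> > T\<close> by the second.
Convergence in mean together with a bound in \<open>L\<^sup>q\<^sup>'\<close> thus gives convergence in \<open>L\<^sup>q\<close>.\<close>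

lemma interpolation_small:
  assumes "finite_measure M" and q: "1 < q" "q < q'" and e: "0 < (e::real)"
  obtains d where "0 < d" "\<And>w :: 'a \<Rightarrow> real. integrable M (\<lambda>x. \<bar>w x\<bar>) \<Longrightarrow> integrable M (\<lambda>x. \<bar>w x\<bar> powr q) \<Longrightarrow> integrable M (\<lambda>x. \<bar>w x\<bar> powr q') \<Longrightarrow>
    (LINT x|M. \<bar>w x\<bar> powr q') \<le> C \<Longrightarrow> (LINT x|M. \<bar>w x\<bar>) < d \<Longrightarrow> (LINT x|M. \<bar>w x\<bar> powr q) < e"
proof -
  \<comment> \<open>The level at which the contribution of \<open>\<bar>w\<bar> > T\<close> drops to \<open>e/2\<close>.\<close>
  define T where "T = (2 * (\<bar>C\<bar> + 1) / e) powr (1 / (q' - q))"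
  have b0: "0 < 2 * (\<bar>C\<bar> + 1) / e" using e by simp
  have T: "0 < T" unfolding T_def powr_gt_zero by (rule dual_order.strict_implies_not_eq[OF b0])
  have "T powr (q - q') = 1 / (T powr (q' - q))" by (simp add: powr_minus_divide[symmetric])
  also have "T powr (q' - q) = 2 * (\<bar>C\<bar> + 1) / e" unfolding T_def using q e by (simp add: powr_powr)
  finally have TC': "T powr (q - q') = 1 / (2 * (\<bar>C\<bar> + 1) / e)" .
  have "1 / (2 * t / e) * t = e / 2" if "0 < t" for t using that e by simp
  from this[of "\<bar>C\<bar> + 1"] have TC: "T powr (q - q') * (\<bar>C\<bar> + 1) = e / 2"
    unfolding TC' by (simp add: add_nonneg_pos)
  define d where "d = e / (2 * T powr (q - 1))"
  have d: "0 < d" using e T by (simp add: d_def)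
  have Td: "T powr (q - 1) * d = e / 2" using T by (simp add: d_def)
  show thesis
  proof (rule that[OF d])
    fix w :: "'a \<Rightarrow> real" assume i: "integrable M (\<lambda>x. \<bar>w x\<bar>)" "integrable M (\<lambda>x. \<bar>w x\<bar> powr q)" "integrable M (\<lambda>x. \<bar>w x\<bar> powr q')"
      and b: "(LINT x|M. \<bar>w x\<bar> powr q') \<le> C" "(LINT x|M. \<bar>w x\<bar>) < d"
    have pw: "t powr q \<le> T powr (q - 1) * t + T powr (q - q') * t powr q'" if t: "0 \<le> t" for t
    proof (cases "t \<le> T")
      case True
      have "t powr q = t powr (q - 1) * t" using powr_mult_base[OF t, of "q - 1"] by (simp add: mult.commute)
      also have "\<dots> \<le> T powr (q - 1) * t" using True t q by (intro mult_right_mono powr_mono2) auto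
      finally show ?thesis by (simp add: add_increasing2)
    next
      case False
      have "t powr q = t powr (q - q') * t powr q'" by (simp add: powr_add[symmetric])
      also have "\<dots> \<le> T powr (q - q') * t powr q'" using False T q by (intro mult_right_mono powr_mono2') auto
      finally show ?thesis using t by (simp add: add_increasing)
    qed
    have "(LINT x|M. \<bar>w x\<bar> powr q) \<le> (LINT x|M. T powr (q - 1) * \<bar>w x\<bar> + T powr (q - q') * \<bar>w x\<bar> powr q')"
      by (rule integral_mono) (use i pw in auto)
    also have "\<dots> = T powr (q - 1) * (LINT x|M. \<bar>w x\<bar>) + T powr (q - q') * (LINT x|M. \<bar>w x\<bar> powr q')"
      using i by simp
    also have "\<dots> < T powr (q - 1) * d + T powr (q - q') * (\<bar>C\<bar> + 1)"
      using b T by (intro add_less_le_mono mult_strict_left_mono mult_left_mono) auto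
    also have "\<dots> = e" unfolding Td TC by simp
    finally show "(LINT x|M. \<bar>w x\<bar> powr q) < e" .
  qed
qed

lemma (in modular) L1_tendsto:
  fixes f :: "nat \<Rightarrow> 'a \<Rightarrow> 'b::{banach, second_countable_topology}"
  assumes "finite_measure M" "\<And>n. f n \<in> borel_measurable M" "\<And>n. integrable M (\<lambda>x. A (norm (f n x)))"
    and lim: "(\<lambda>n. LINT x|M. A (norm (f n x))) \<longlonglongrightarrow> 0"
  shows "(\<lambda>n. LINT x|M. norm (f n x)) \<longlonglongrightarrow> 0"
proof (rule LIMSEQ_I)
  fix e :: real assume e: "0 < e"
  obtain d where d: "0 < d" "\<And>f :: 'a \<Rightarrow> 'b. f \<in> borel_measurable M \<Longrightarrow>
    integrable M (\<lambda>x. A (norm (f x))) \<Longrightarrow> (LINT x|M. A (norm (f x))) < d \<Longrightarrow> (LINT x|M. norm (f x)) < e"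
    using L1_small[OF assms(1) e] by blast
  have "\<forall>\<^sub>F n in sequentially. (LINT x|M. A (norm (f n x))) < d" using lim d(1) by (rule order_tendstoD(2))
  then obtain N where "\<And>n. N \<le> n \<Longrightarrow> (LINT x|M. A (norm (f n x))) < d" by (auto simp: eventually_sequentially)
  then have "norm ((LINT x|M. norm (f n x)) - 0) < e" if "N \<le> n" for n
    using d(2)[OF assms(2,3)] that by simp
  then show "\<exists>N. \<forall>n\<ge>N. norm ((LINT x|M. norm (f n x)) - 0) < e" by blast
qed

locale sobolev_domain = power_growth \<phi> l m for \<phi> l m +
  fixes \<Omega> :: "(real^'n) set"
  assumes \<Omega>_open: "open \<Omega>" and \<Omega>_bounded: "bounded \<Omega>"
    and mN: "m < real CARD('n)"
begin

abbreviation "M \<equiv> lebesgue_on \<Omega>"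
abbreviation "X \<equiv> orlicz_sobolev0 \<Omega> P"
abbreviation "D \<equiv> weak_grad \<Omega>"

lemma \<Omega>_sets: "\<Omega> \<in> sets lebesgue" by (rule open_sets_lebesgue[OF \<Omega>_open])

lemma finite_M: "finite_measure M"
  by (intro finite_measure_lebesgue_on) (simp add: \<Omega>_bounded \<Omega>_open lmeasurable_open)

interpretation finite_measure M by (rule finite_M)
interpretation Pmod: modular P by (rule modular_P)

subsection \<open>Modular convergence and the Luxemburg norm\<close>

lemma P_combination:
  fixes f g :: "real^'n \<Rightarrow> 'b::{real_normed_vector, second_countable_topology}"
  assumes [measurable]: "f \<in> borel_measurable M" "g \<in> borel_measurable M"
    and i: "integrable M (\<lambda>x. P (norm (f x)))" "integrable M (\<lambda>x. P (norm (g x)))"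
  shows "integrable M (\<lambda>x. P (norm (a *\<^sub>R f x + b *\<^sub>R g x)))"
    "(LINT x|M. P (norm (a *\<^sub>R f x + b *\<^sub>R g x))) \<le> 2 powr m * ((1 + \<bar>a\<bar> powr m) * (LINT x|M. P (norm (f x))) + (1 + \<bar>b\<bar> powr m) * (LINT x|M. P (norm (g x))))"
proof -
  let ?b = "\<lambda>x. 2 powr m * ((1 + \<bar>a\<bar> powr m) * P (norm (f x)) + (1 + \<bar>b\<bar> powr m) * P (norm (g x)))"
  have le: "P (norm (a *\<^sub>R f x + b *\<^sub>R g x)) \<le> ?b x" for x
  proof -
    have "P (norm (a *\<^sub>R f x + b *\<^sub>R g x)) \<le> 2 powr m * (P (norm (a *\<^sub>R f x)) + P (norm (b *\<^sub>R g x)))"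
      by (rule P_norm_add_le)
    also have "\<dots> \<le> ?b x"
      using P_scale_le[of "\<bar>a\<bar>" "norm (f x)"] P_scale_le[of "\<bar>b\<bar>" "norm (g x)"] by (intro mult_left_mono add_mono) auto
    finally show ?thesis .
  qed
  have ib: "integrable M ?b" using i by auto
  show ii: "integrable M (\<lambda>x. P (norm (a *\<^sub>R f x + b *\<^sub>R g x)))"
  proof (rule Bochner_Integration.integrable_bound[OF ib])
    show "AE x in M. norm (P (norm (a *\<^sub>R f x + b *\<^sub>R g x))) \<le> norm (?b x)"
      using le by (intro AE_I2) (auto intro: order_trans[OF le abs_ge_self])
  qed measurable
  have "(LINT x|M. P (norm (a *\<^sub>R f x + b *\<^sub>R g x))) \<le> (LINT x|M. ?b x)" by (rule integral_mono[OF ii ib le])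
  also have "\<dots> = 2 powr m * ((1 + \<bar>a\<bar> powr m) * (LINT x|M. P (norm (f x))) + (1 + \<bar>b\<bar> powr m) * (LINT x|M. P (norm (g x))))"
    using i by simp
  finally show "(LINT x|M. P (norm (a *\<^sub>R f x + b *\<^sub>R g x))) \<le> 2 powr m * ((1 + \<bar>a\<bar> powr m) * (LINT x|M. P (norm (f x))) + (1 + \<bar>b\<bar> powr m) * (LINT x|M. P (norm (g x))))" .
qed

lemma P_sum:
  fixes f g :: "real^'n \<Rightarrow> 'b::{real_normed_vector, second_countable_topology}"
  assumes "f \<in> borel_measurable M" "g \<in> borel_measurable M"
    and i: "integrable M (\<lambda>x. P (norm (f x)))" "integrable M (\<lambda>x. P (norm (g x)))"
  shows "integrable M (\<lambda>x. P (norm (f x + g x)))" "integrable M (\<lambda>x. P (norm (f x - g x)))"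
    "(LINT x|M. P (norm (f x + g x))) \<le> 2 powr m * 2 * ((LINT x|M. P (norm (f x))) + (LINT x|M. P (norm (g x))))"
    "(LINT x|M. P (norm (f x - g x))) \<le> 2 powr m * 2 * ((LINT x|M. P (norm (f x))) + (LINT x|M. P (norm (g x))))"
  using P_combination[OF assms, of 1 1] P_combination[OF assms, of 1 "-1"] by (simp_all add: algebra_simps)

lemma P_combination_tendsto:
  fixes f g :: "nat \<Rightarrow> real^'n \<Rightarrow> 'b::{real_normed_vector, second_countable_topology}"
  assumes "\<And>n. f n \<in> borel_measurable M" "\<And>n. g n \<in> borel_measurable M"
    and i: "\<And>n. integrable M (\<lambda>x. P (norm (f n x)))" "\<And>n. integrable M (\<lambda>x. P (norm (g n x)))"
    and lim: "(\<lambda>n. LINT x|M. P (norm (f n x))) \<longlonglongrightarrow> 0" "(\<lambda>n. LINT x|M. P (norm (g n x))) \<longlonglongrightarrow> 0"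
  shows "(\<lambda>n. LINT x|M. P (norm (a *\<^sub>R f n x + b *\<^sub>R g n x))) \<longlonglongrightarrow> 0"
proof (rule tendsto_sandwich[OF _ _ tendsto_const])
  show "(\<lambda>n. 2 powr m * ((1 + \<bar>a\<bar> powr m) * (LINT x|M. P (norm (f n x))) + (1 + \<bar>b\<bar> powr m) * (LINT x|M. P (norm (g n x))))) \<longlonglongrightarrow> 0"
    by (rule tendsto_eq_intros lim refl | simp)+
qed (auto intro!: always_eventually P_combination(2) assms)

text \<open>By the \<open>\<Delta>\<^sub>2\<close> condition the modular is finite as soon as it is finite after some scaling.\<close>

lemma orlicz_iff: "u \<in> orlicz \<Omega> P \<longleftrightarrow> u \<in> borel_measurable M \<and> integrable M (\<lambda>x. P (u x))"
proof
  assume u: "u \<in> orlicz \<Omega> P"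
  then have [measurable]: "u \<in> borel_measurable M" by (simp add: orlicz_def)
  obtain c where c: "0 < c" "(\<integral>\<^sup>+x. ennreal (P (u x / c)) \<partial>M) < \<infinity>" using u by (auto simp: orlicz_def)
  have "integrable M (\<lambda>x. P (u x / c))" unfolding integrable_iff_bounded using c by simp
  then have "integrable M (\<lambda>x. (1 + \<bar>c\<bar> powr m) * P (u x / c))" by simp
  then have "integrable M (\<lambda>x. P (u x))"
  proof (rule Bochner_Integration.integrable_bound)
    show "AE x in M. norm (P (u x)) \<le> norm ((1 + \<bar>c\<bar> powr m) * P (u x / c))"
      using P_scale_le[of c "u _ / c"] c by (intro AE_I2) simp
  qed measurable
  then show "u \<in> borel_measurable M \<and> integrable M (\<lambda>x. P (u x))" by simp
next
  assume "u \<in> borel_measurable M \<and> integrable M (\<lambda>x. P (u x))"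
  then show "u \<in> orlicz \<Omega> P" unfolding orlicz_def by (auto intro!: exI[of _ 1] simp: integrable_iff_bounded)
qed

lemma nn_P:
  assumes "integrable M (\<lambda>x. P (u x))"
  shows "(\<integral>\<^sup>+x. ennreal (P (u x)) \<partial>M) = ennreal (LINT x|M. P (u x))"
  using assms by (intro nn_integral_eq_integral) auto

lemma scale_P_integrable:
  assumes u: "u \<in> orlicz \<Omega> P" shows "integrable M (\<lambda>x. P (u x / c))"
proof -
  have u': "u \<in> borel_measurable M" "integrable M (\<lambda>x. P (norm (u x)))" using u by (auto simp: orlicz_iff)
  have "integrable M (\<lambda>x. P (norm ((1 / c) *\<^sub>R u x + 0 *\<^sub>R u x)))" by (rule P_combination(1)[OF u'(1,1,2,2)])
  then show ?thesis by (simp add: abs_divide[symmetric] del: abs_divide)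
qed

lemma luxemburg_le:
  assumes u: "u \<in> orlicz \<Omega> P" and e: "0 < e" "e \<le> 1" and le: "(LINT x|M. P (u x)) \<le> e powr m"
  shows "luxemburg \<Omega> P u \<le> e"
  unfolding luxemburg_def
proof (rule cInf_lower)
  have i: "integrable M (\<lambda>x. P (u x))" using u by (simp add: orlicz_iff)
  note ic = scale_P_integrable[OF u, of e]
  have "(LINT x|M. P (u x / e)) \<le> (LINT x|M. (1 / e) powr m * P (u x))"
    using i ic e P_scale_le_m[of "1 / e" "u _"] by (intro integral_mono) auto
  also have "\<dots> \<le> (1 / e) powr m * e powr m" using le by (auto intro!: mult_left_mono)
  also have "\<dots> = 1" using e by (simp add: powr_divide)
  finally show "e \<in> {c. 0 < c \<and> (\<integral>\<^sup>+x. ennreal (P (u x / c)) \<partial>M) \<le> 1}"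
    using e by (simp add: nn_P[OF ic])
qed (auto intro!: bdd_belowI[of _ 0])

lemma luxemburg_set_nonempty:
  assumes u: "u \<in> orlicz \<Omega> P"
  shows "{c. 0 < c \<and> (\<integral>\<^sup>+x. ennreal (P (u x / c)) \<partial>M) \<le> 1} \<noteq> {}"
proof -
  have i: "integrable M (\<lambda>x. P (u x))" using u by (simp add: orlicz_iff)
  define c where "c = max 1 (LINT x|M. P (u x))"
  have c: "1 \<le> c" "(LINT x|M. P (u x)) \<le> c" by (auto simp: c_def)
  note ic = scale_P_integrable[OF u, of c]
  have "(LINT x|M. P (u x / c)) \<le> (LINT x|M. (1 / c) * P (u x))"
  proof (rule integral_mono)
    fix x
    have "P (1 / c * u x) \<le> (1 / c) powr l * P (u x)" using c by (intro P_scale_le_l) auto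
    also have "\<dots> \<le> (1 / c) powr 1 * P (u x)" using c lm by (intro mult_right_mono powr_mono') auto
    finally show "P (u x / c) \<le> 1 / c * P (u x)" using c by simp
  qed (use i ic in auto)
  also have "\<dots> \<le> 1" using c by simp
  finally have "c \<in> {c. 0 < c \<and> (\<integral>\<^sup>+x. ennreal (P (u x / c)) \<partial>M) \<le> 1}"
    using c by (simp add: nn_P[OF ic])
  then show ?thesis by blast
qed

lemma luxemburg_nonneg: "u \<in> orlicz \<Omega> P \<Longrightarrow> 0 \<le> luxemburg \<Omega> P u"
  unfolding luxemburg_def using luxemburg_set_nonempty by (intro cInf_greatest) auto

lemma luxemburg_less:
  assumes u: "u \<in> orlicz \<Omega> P" and e: "e \<le> 1" and le: "luxemburg \<Omega> P u < e"
  shows "(LINT x|M. P (u x)) < e"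
proof -
  obtain c where c: "0 < c" "(\<integral>\<^sup>+x. ennreal (P (u x / c)) \<partial>M) \<le> 1" "c < e"
    using le cInf_lessD[OF luxemburg_set_nonempty[OF u]] unfolding luxemburg_def by blast
  have i: "integrable M (\<lambda>x. P (u x))" using u by (simp add: orlicz_iff)
  note ic = scale_P_integrable[OF u, of c]
  have 1: "(LINT x|M. P (u x / c)) \<le> 1" using c(2) by (simp add: nn_P[OF ic])
  have "(LINT x|M. P (u x)) \<le> (LINT x|M. c * P (u x / c))"
  proof (rule integral_mono)
    fix x
    have "P (c * (u x / c)) \<le> c powr l * P (u x / c)" using c e by (intro P_scale_le_l) auto
    also have "\<dots> \<le> c powr 1 * P (u x / c)" using c e lm by (intro mult_right_mono powr_mono') auto
    finally show "P (u x) \<le> c * P (u x / c)" using c by simp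
  qed (use i ic in auto)
  also have "\<dots> \<le> c" using mult_left_mono[OF 1, of c] c by simp
  finally show ?thesis using c by simp
qed

text \<open>Near zero the modular and a power of the Luxemburg norm bound each other, by the scaling inequalities of \<open>\<Phi>\<close>.\<close>

lemma luxemburg_tendsto_iff:
  assumes u: "\<And>n. u n \<in> orlicz \<Omega> P"
  shows "(\<lambda>n. luxemburg \<Omega> P (u n)) \<longlonglongrightarrow> 0 \<longleftrightarrow> (\<lambda>n. LINT x|M. P (u n x)) \<longlonglongrightarrow> 0"
proof
  assume lim: "(\<lambda>n. luxemburg \<Omega> P (u n)) \<longlonglongrightarrow> 0"
  show "(\<lambda>n. LINT x|M. P (u n x)) \<longlonglongrightarrow> 0"
  proof (rule order_tendstoI)
    fix e :: real assume "0 < e"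
    then have "\<forall>\<^sub>F n in sequentially. luxemburg \<Omega> P (u n) < min e 1" using lim by (intro order_tendstoD(2)) auto
    then show "\<forall>\<^sub>F n in sequentially. (LINT x|M. P (u n x)) < e"
      by eventually_elim (use luxemburg_less[OF u, of "min e 1"] in force)
  next
    fix e :: real assume "e < 0"
    then show "\<forall>\<^sub>F n in sequentially. e < (LINT x|M. P (u n x))"
      by (intro always_eventually) (auto intro: less_le_trans)
  qed
next
  assume lim: "(\<lambda>n. LINT x|M. P (u n x)) \<longlonglongrightarrow> 0"
  show "(\<lambda>n. luxemburg \<Omega> P (u n)) \<longlonglongrightarrow> 0"
  proof (rule order_tendstoI)
    fix e :: real assume e: "0 < e"
    then have "\<forall>\<^sub>F n in sequentially. (LINT x|M. P (u n x)) < min (e / 2) 1 powr m" using lim by (intro order_tendstoD(2)) auto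
    then show "\<forall>\<^sub>F n in sequentially. luxemburg \<Omega> P (u n) < e"
    proof eventually_elim
      case (elim n)
      then have "luxemburg \<Omega> P (u n) \<le> min (e / 2) 1" using e by (intro luxemburg_le[OF u]) auto
      then show ?case using e by simp
    qed
  next
    fix e :: real assume "e < 0"
    then show "\<forall>\<^sub>F n in sequentially. e < luxemburg \<Omega> P (u n)"
      using luxemburg_nonneg[OF u] by (intro always_eventually) (auto intro: less_le_trans)
  qed
qed

subsection \<open>Membership and weak gradients\<close>

lemma weak_grad_measurable: "has_weak_grad \<Omega> u g \<Longrightarrow> g \<in> borel_measurable M"
  by (rule measurable_of_compacts[OF \<Omega>_open]) (auto simp: has_weak_grad_def)

lemma luxemburg_cong_AE: "AE x in M. u x = v x \<Longrightarrow> luxemburg \<Omega> P u = luxemburg \<Omega> P v"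
proof -
  assume ae: "AE x in M. u x = v x"
  have "(\<integral>\<^sup>+x. ennreal (P (u x / c)) \<partial>M) = (\<integral>\<^sup>+x. ennreal (P (v x / c)) \<partial>M)" for c
    using ae by (intro nn_integral_cong_AE) (auto elim: AE_mp)
  then show ?thesis by (simp add: luxemburg_def)
qed

text \<open>The approximation property in the definition of the space, expressed by modulars and with an explicit gradient \<open>g\<close>.\<close>

definition approx :: "(real^'n \<Rightarrow> real) \<Rightarrow> (real^'n \<Rightarrow> real^'n) \<Rightarrow> (nat \<Rightarrow> real^'n \<Rightarrow> real) \<Rightarrow> bool" where
  "approx u g \<eta> \<longleftrightarrow> (\<forall>k. \<eta> k \<in> test_functions \<Omega>) \<and> (\<lambda>k. LINT x|M. P (norm (u x - \<eta> k x))) \<longlonglongrightarrow> 0 \<and>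
     (\<lambda>k. LINT x|M. P (norm (g x - grad (\<eta> k) x))) \<longlonglongrightarrow> 0"

lemma test_in:
  assumes \<eta>: "\<eta> \<in> test_functions \<Omega>"
  shows "\<eta> \<in> borel_measurable M" "grad \<eta> \<in> borel_measurable M"
    "integrable M (\<lambda>x. P (norm (\<eta> x)))" "integrable M (\<lambda>x. P (norm (grad \<eta> x)))"
    "(LINT x|M. P (norm (grad \<eta> x))) = (LINT x|lborel. P (norm (grad \<eta> x)))"
proof -
  obtain K where K: "compact K" "K \<subseteq> \<Omega>" "\<And>x. x \<notin> K \<Longrightarrow> \<eta> x = 0" "\<And>x. x \<notin> K \<Longrightarrow> grad \<eta> x = 0"
    using test_support[OF \<eta>] by blast
  note c = continuous_on_test[OF \<eta>, of UNIV] continuous_on_grad[OF \<eta>, of UNIV]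
  have bm: "f \<in> borel_measurable M" if "continuous_on UNIV f" for f :: "real^'n \<Rightarrow> 'b::euclidean_space"
    using that by (intro measurable_restrict_space1 measurable_completion) (simp add: borel_measurable_continuous_onI)
  show "\<eta> \<in> borel_measurable M" "grad \<eta> \<in> borel_measurable M" using bm c by auto
  have cP: "continuous_on UNIV (\<lambda>x. P (norm (\<eta> x)))" "continuous_on UNIV (\<lambda>x. P (norm (grad \<eta> x)))"
    using c by (auto intro!: continuous_intros simp del: P_abs)
  have z: "\<eta> x = 0" "grad \<eta> x = 0" if "x \<notin> \<Omega>" for x using K(2-4) that by auto
  note eq1 = lebesgue_on_cong_lborel[OF borel_measurable_continuous_onI[OF cP(1)] \<Omega>_sets]
  note eq2 = lebesgue_on_cong_lborel[OF borel_measurable_continuous_onI[OF cP(2)] \<Omega>_sets]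
  show "integrable M (\<lambda>x. P (norm (\<eta> x)))"
    by (rule eq1(2)[THEN iffD2, OF _ integrable_compact_support[OF cP(1) K(1)]]) (simp_all add: K(3) z)
  show "integrable M (\<lambda>x. P (norm (grad \<eta> x)))"
    by (rule eq2(2)[THEN iffD2, OF _ integrable_compact_support[OF cP(2) K(1)]]) (simp_all add: K(4) z)
  show "(LINT x|M. P (norm (grad \<eta> x))) = (LINT x|lborel. P (norm (grad \<eta> x)))"
    by (rule eq2(1)) (simp add: z)
qed

lemma sobolev_iff:
  "u \<in> orlicz_sobolev \<Omega> P \<longleftrightarrow> u \<in> borel_measurable M \<and> integrable M (\<lambda>x. P (norm (u x))) \<and> has_weak_grad \<Omega> u (D u) \<and>
     D u \<in> borel_measurable M \<and> integrable M (\<lambda>x. P (norm (D u x)))"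
proof -
  have 1: "u \<in> orlicz_sobolev \<Omega> P \<longleftrightarrow> (u \<in> borel_measurable M \<and> integrable M (\<lambda>x. P (norm (u x)))) \<and>
     (\<exists>g. has_weak_grad \<Omega> u g) \<and> ((\<lambda>x. norm (D u x)) \<in> borel_measurable M \<and> integrable M (\<lambda>x. P (norm (D u x))))"
    unfolding orlicz_sobolev_def mem_Collect_eq orlicz_iff real_norm_def P_abs by (rule refl)
  have 2: "(\<exists>g. has_weak_grad \<Omega> u g) \<longleftrightarrow> has_weak_grad \<Omega> u (D u)"
    using has_weak_grad_weak_grad[of \<Omega> u] by blast
  have 3: "(\<lambda>x. norm (D u x)) \<in> borel_measurable M" if "D u \<in> borel_measurable M"
    using that by measurable
  show ?thesis unfolding 1 2 using 3 weak_grad_measurable[of u "D u"] by blast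
qed

text \<open>The weak gradient of \<open>u - \<eta>\<close> equals \<open>D u - grad \<eta>\<close> almost everywhere, which translates the Sobolev norm into two modulars.\<close>

lemma W0_iff: "u \<in> X \<longleftrightarrow> u \<in> orlicz_sobolev \<Omega> P \<and> (\<exists>\<eta>. approx u (D u) \<eta>)"
proof -
  have "(\<lambda>k. sobolev_norm \<Omega> P (\<lambda>x. u x - \<eta> k x)) \<longlonglongrightarrow> 0 \<longleftrightarrow>
     (\<lambda>k. LINT x|M. P (norm (u x - \<eta> k x))) \<longlonglongrightarrow> 0 \<and> (\<lambda>k. LINT x|M. P (norm (D u x - grad (\<eta> k) x))) \<longlonglongrightarrow> 0"
    if u: "u \<in> orlicz_sobolev \<Omega> P" and \<eta>: "\<And>k. \<eta> k \<in> test_functions \<Omega>" for \<eta> :: "nat \<Rightarrow> real^'n \<Rightarrow> real"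
  proof -
    have u': "u \<in> borel_measurable M" "integrable M (\<lambda>x. P (norm (u x)))" "has_weak_grad \<Omega> u (D u)"
     "D u \<in> borel_measurable M" "integrable M (\<lambda>x. P (norm (D u x)))" using u by (auto simp: sobolev_iff)
    note t = test_in[OF \<eta>]
    have g: "AE x in M. D (\<lambda>x. u x - \<eta> k x) x = D u x - grad (\<eta> k) x" for k
    proof -
      have "has_weak_grad \<Omega> (\<lambda>x. 1 * u x + (-1) * \<eta> k x) (\<lambda>x. 1 *\<^sub>R D u x + (-1) *\<^sub>R grad (\<eta> k) x)"
        by (rule has_weak_grad_combination[OF \<Omega>_open u'(3) has_weak_grad_test[OF \<Omega>_open \<eta>]])
      then have "has_weak_grad \<Omega> (\<lambda>x. u x - \<eta> k x) (\<lambda>x. D u x - grad (\<eta> k) x)" by simp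
      then show ?thesis by (rule weak_grad_AE[OF \<Omega>_open])
    qed
    have lg: "luxemburg \<Omega> P (\<lambda>x. norm (D (\<lambda>x. u x - \<eta> k x) x)) = luxemburg \<Omega> P (\<lambda>x. norm (D u x - grad (\<eta> k) x))" for k
      by (rule luxemburg_cong_AE) (use g[of k] in \<open>eventually_elim, simp\<close>)
    have o1: "(\<lambda>x. u x - \<eta> k x) \<in> orlicz \<Omega> P" for k
      using P_sum(2)[OF u'(1) t(1) u'(2) t(3), of k] u'(1) t(1)[of k] by (simp add: orlicz_iff)
    have o2: "(\<lambda>x. norm (D u x - grad (\<eta> k) x)) \<in> orlicz \<Omega> P" for k
      using P_sum(2)[OF u'(4) t(2) u'(5) t(4), of k] u'(4) t(2)[of k] by (simp add: orlicz_iff)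
    have "(\<lambda>k. sobolev_norm \<Omega> P (\<lambda>x. u x - \<eta> k x)) \<longlonglongrightarrow> 0 \<longleftrightarrow>
       (\<lambda>k. luxemburg \<Omega> P (\<lambda>x. u x - \<eta> k x)) \<longlonglongrightarrow> 0 \<and> (\<lambda>k. luxemburg \<Omega> P (\<lambda>x. norm (D u x - grad (\<eta> k) x))) \<longlonglongrightarrow> 0"
      (is "?S \<longlonglongrightarrow> 0 \<longleftrightarrow> ?L1 \<longlonglongrightarrow> 0 \<and> ?L2 \<longlonglongrightarrow> 0")
    proof
      have S: "?S k = ?L1 k + ?L2 k" for k unfolding sobolev_norm_def lg ..
      have n: "0 \<le> ?L1 k" "0 \<le> ?L2 k" for k using luxemburg_nonneg[OF o1] luxemburg_nonneg[OF o2] by auto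
      show "?L1 \<longlonglongrightarrow> 0 \<and> ?L2 \<longlonglongrightarrow> 0" if "?S \<longlonglongrightarrow> 0"
      proof
        show "?L1 \<longlonglongrightarrow> 0" by (rule tendsto_sandwich[OF _ _ tendsto_const that]) (use n S in \<open>auto intro!: always_eventually\<close>)
        show "?L2 \<longlonglongrightarrow> 0" by (rule tendsto_sandwich[OF _ _ tendsto_const that]) (use n S in \<open>auto intro!: always_eventually\<close>)
      qed
      show "?S \<longlonglongrightarrow> 0" if "?L1 \<longlonglongrightarrow> 0 \<and> ?L2 \<longlonglongrightarrow> 0"
        unfolding S using tendsto_add[OF conjunct1[OF that] conjunct2[OF that]] by simp
    qed
    then show ?thesis unfolding luxemburg_tendsto_iff[OF o1] luxemburg_tendsto_iff[OF o2] by simp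
  qed
  then show ?thesis unfolding orlicz_sobolev0_def approx_def by auto
qed

lemma W0_D:
  assumes "u \<in> X"
  shows "u \<in> borel_measurable M" "integrable M (\<lambda>x. P (norm (u x)))" "has_weak_grad \<Omega> u (D u)"
     "D u \<in> borel_measurable M" "integrable M (\<lambda>x. P (norm (D u x)))" "\<exists>\<eta>. approx u (D u) \<eta>"
  using assms by (auto simp: W0_iff sobolev_iff)

text \<open>Membership with any weak gradient \<open>g\<close>, not only with the one selected by choice.\<close>

lemma W0_I:
  assumes u: "u \<in> borel_measurable M" "integrable M (\<lambda>x. P (norm (u x)))" "has_weak_grad \<Omega> u g"
     "integrable M (\<lambda>x. P (norm (g x)))" "approx u g \<eta>"
  shows "u \<in> X" "AE x in M. D u x = g x"
proof -
  show ae: "AE x in M. D u x = g x" by (rule weak_grad_AE[OF \<Omega>_open u(3)])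
  have Du: "has_weak_grad \<Omega> u (D u)" by (rule has_weak_grad_weak_grad[OF u(3)])
  note [measurable] = weak_grad_measurable[OF Du] weak_grad_measurable[OF u(3)]
  have "integrable M (\<lambda>x. P (norm (D u x)))"
  proof (rule integrable_cong_AE_imp[OF u(4)])
    show "AE x in M. P (norm (g x)) = P (norm (D u x))" using ae by eventually_elim simp
  qed measurable
  then have "u \<in> orlicz_sobolev \<Omega> P" using u Du by (simp add: sobolev_iff)
  moreover have "approx u (D u) \<eta>"
  proof -
    have t: "\<And>k. \<eta> k \<in> test_functions \<Omega>" using u(5) by (simp add: approx_def)
    have "(LINT x|M. P (norm (D u x - grad (\<eta> k) x))) = (LINT x|M. P (norm (g x - grad (\<eta> k) x)))" for k
    proof (rule integral_cong_AE)
      show "AE x in M. P (norm (D u x - grad (\<eta> k) x)) = P (norm (g x - grad (\<eta> k) x))" using ae by eventually_elim simp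
    qed (use test_in(2)[OF t[of k]] in measurable)
    then show ?thesis using u(5) by (simp add: approx_def)
  qed
  ultimately show "u \<in> X" unfolding W0_iff by blast
qed

lemma test_W0:
  assumes "\<eta> \<in> test_functions \<Omega>" shows "\<eta> \<in> X" "AE x in M. D \<eta> x = grad \<eta> x"
proof -
  have "approx \<eta> (grad \<eta>) (\<lambda>k. \<eta>)" using assms by (simp add: approx_def)
  from W0_I[OF test_in(1)[OF assms] test_in(3)[OF assms] has_weak_grad_test[OF \<Omega>_open assms] test_in(4)[OF assms] this]
  show "\<eta> \<in> X" "AE x in M. D \<eta> x = grad \<eta> x" .
qed

lemma W0_combination:
  assumes u: "u \<in> X" and v: "v \<in> X"
  shows "(\<lambda>x. a * u x + b * v x) \<in> X" "AE x in M. D (\<lambda>x. a * u x + b * v x) x = a *\<^sub>R D u x + b *\<^sub>R D v x"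
proof -
  note ud = W0_D[OF u] and vd = W0_D[OF v]
  obtain \<eta> \<zeta> where \<eta>: "approx u (D u) \<eta>" and \<zeta>: "approx v (D v) \<zeta>" using ud(6) vd(6) by blast
  have t: "\<And>k. \<eta> k \<in> test_functions \<Omega>" "\<And>k. \<zeta> k \<in> test_functions \<Omega>" using \<eta> \<zeta> by (auto simp: approx_def)
  have "approx (\<lambda>x. a * u x + b * v x) (\<lambda>x. a *\<^sub>R D u x + b *\<^sub>R D v x) (\<lambda>k x. a * \<eta> k x + b * \<zeta> k x)"
    unfolding approx_def
  proof (intro conjI allI)
    show "(\<lambda>x. a * \<eta> k x + b * \<zeta> k x) \<in> test_functions \<Omega>" for k by (rule test_functions_combination(1)[OF t])
    have "(\<lambda>k. LINT x|M. P (norm (a *\<^sub>R (u x - \<eta> k x) + b *\<^sub>R (v x - \<zeta> k x)))) \<longlonglongrightarrow> 0"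
      by (rule P_combination_tendsto[OF borel_measurable_diff[OF ud(1) test_in(1)[OF t(1)]] borel_measurable_diff[OF vd(1) test_in(1)[OF t(2)]]
          P_sum(2)[OF ud(1) test_in(1)[OF t(1)] ud(2) test_in(3)[OF t(1)]] P_sum(2)[OF vd(1) test_in(1)[OF t(2)] vd(2) test_in(3)[OF t(2)]]])
        (use \<eta> \<zeta> in \<open>auto simp: approx_def\<close>)
    then show "(\<lambda>k. LINT x|M. P (norm (a * u x + b * v x - (a * \<eta> k x + b * \<zeta> k x)))) \<longlonglongrightarrow> 0"
      by (simp add: algebra_simps)
    have "(\<lambda>k. LINT x|M. P (norm (a *\<^sub>R (D u x - grad (\<eta> k) x) + b *\<^sub>R (D v x - grad (\<zeta> k) x)))) \<longlonglongrightarrow> 0"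
      by (rule P_combination_tendsto[OF borel_measurable_diff[OF ud(4) test_in(2)[OF t(1)]] borel_measurable_diff[OF vd(4) test_in(2)[OF t(2)]]
          P_sum(2)[OF ud(4) test_in(2)[OF t(1)] ud(5) test_in(4)[OF t(1)]] P_sum(2)[OF vd(4) test_in(2)[OF t(2)] vd(5) test_in(4)[OF t(2)]]])
        (use \<eta> \<zeta> in \<open>auto simp: approx_def\<close>)
    then show "(\<lambda>k. LINT x|M. P (norm (a *\<^sub>R D u x + b *\<^sub>R D v x - grad (\<lambda>x. a * \<eta> k x + b * \<zeta> k x) x))) \<longlonglongrightarrow> 0"
      unfolding test_functions_combination(2)[OF t] by (simp add: algebra_simps)
  qed
  note ap = this
  have bm: "(\<lambda>x. a * u x + b * v x) \<in> borel_measurable M"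
    by (intro borel_measurable_add borel_measurable_times borel_measurable_const ud(1) vd(1))
  have i1: "integrable M (\<lambda>x. P (norm (a * u x + b * v x)))"
    using P_combination(1)[OF ud(1) vd(1) ud(2) vd(2), of a b] unfolding real_scaleR_def .
  note W0 = W0_I[OF bm i1 has_weak_grad_combination[OF \<Omega>_open ud(3) vd(3)] P_combination(1)[OF ud(4) vd(4) ud(5) vd(5)] ap]
  show "(\<lambda>x. a * u x + b * v x) \<in> X" by (rule W0(1))
  show "AE x in M. D (\<lambda>x. a * u x + b * v x) x = a *\<^sub>R D u x + b *\<^sub>R D v x" by (rule W0(2))
qed

end

section \<open>Embedding and compactness for the Orlicz--Sobolev space\<close>

context sobolev_domain
begin

interpretation finite_measure M by (rule finite_M)
interpretation Pmod: modular P by (rule modular_P)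

text \<open>The Sobolev exponent of the lower index.\<close>

definition "critical = l * real CARD('n) / (real CARD('n) - l)"

lemma l_critical: "l < real CARD('n)" "1 < critical"
proof -
  show lN: "l < real CARD('n)" using lm mN by simp
  have "l * 1 \<le> l * real CARD('n)" using lm by (intro mult_left_mono) (auto simp: Suc_leI)
  moreover have "real CARD('n) < l * real CARD('n) + l"
  proof -
    have "1 * real CARD('n) < l * real CARD('n)" using lm by (intro mult_strict_right_mono) auto
    then show ?thesis using lm by linarith
  qed
  ultimately show "1 < critical" using lN by (simp add: critical_def)
qed

lemma compact_closure_\<Omega>: "compact (closure \<Omega>)" using \<Omega>_bounded by (simp add: compact_closure)

lemma test_c1:
  assumes "\<eta> \<in> test_functions \<Omega>" shows "c1_supp (closure \<Omega>) \<eta> (grad \<eta>)"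
proof -
  obtain K where K: "compact K" "K \<subseteq> \<Omega>" "\<And>x. x \<notin> K \<Longrightarrow> \<eta> x = 0" "\<And>x. x \<notin> K \<Longrightarrow> grad \<eta> x = 0"
    using test_support[OF assms] by blast
  have "x \<notin> closure \<Omega> \<Longrightarrow> x \<notin> K" for x using K(2) closure_subset by blast
  then show ?thesis unfolding c1_supp_def
    using K(3,4) by (auto intro: test_has_derivative[OF assms] continuous_on_grad[OF assms])
qed

lemma test_powr:
  assumes \<eta>: "\<eta> \<in> test_functions \<Omega>" and s: "0 < s"
  shows "integrable M (\<lambda>x. \<bar>\<eta> x\<bar> powr s)" "(LINT x|M. \<bar>\<eta> x\<bar> powr s) = (LINT x|lborel. \<bar>\<eta> x\<bar> powr s)"
proof -
  obtain K where K: "compact K" "K \<subseteq> \<Omega>" "\<And>x. x \<notin> K \<Longrightarrow> \<eta> x = 0" "\<And>x. x \<notin> K \<Longrightarrow> grad \<eta> x = 0"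
    using test_support[OF \<eta>] by blast
  have z: "\<eta> x = 0" if "x \<notin> \<Omega>" for x using K(2,3) that by auto
  note c1 = test_c1[OF \<eta>]
  have [measurable]: "\<eta> \<in> borel_measurable borel" by (rule c1_measurable(1)[OF compact_closure_\<Omega> c1])
  have bm: "(\<lambda>x. \<bar>\<eta> x\<bar> powr s) \<in> borel_measurable borel" by measurable
  note eq = lebesgue_on_cong_lborel[OF bm \<Omega>_sets]
  show "integrable M (\<lambda>x. \<bar>\<eta> x\<bar> powr s)"
    by (rule eq(2)[THEN iffD2, OF _ c1_integrable_powr[OF compact_closure_\<Omega> c1 s]]) (simp add: z)
  show "(LINT x|M. \<bar>\<eta> x\<bar> powr s) = (LINT x|lborel. \<bar>\<eta> x\<bar> powr s)"
    by (rule eq(1)) (simp add: z)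
qed

lemma test_grad_powr_l:
  assumes \<eta>: "\<eta> \<in> test_functions \<Omega>" and R: "(LINT x|M. P (norm (grad \<eta> x))) \<le> R"
  shows "(LINT x|lborel. norm (grad \<eta> x) powr l) \<le> measure lborel (closure \<Omega>) + R / P 1"
proof -
  let ?K = "closure \<Omega>"
  note c1 = test_c1[OF \<eta>]
  have [measurable]: "?K \<in> sets borel" by simp
  have iK: "integrable lborel (indicator ?K :: real^'n \<Rightarrow> real)"
    using emeasure_compact_finite[OF compact_closure_\<Omega>] by (simp add: integrable_indicator_iff)
  have cP: "continuous_on UNIV (\<lambda>x. P (norm (grad \<eta> x)))"
    using continuous_on_grad[OF \<eta>, of UNIV] by (auto intro!: continuous_intros simp del: P_abs)
  have iP: "integrable lborel (\<lambda>x. P (norm (grad \<eta> x)))"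
    by (rule integrable_compact_support[OF cP compact_closure_\<Omega>]) (simp add: c1_zero[OF compact_closure_\<Omega> c1])
  have il: "integrable lborel (\<lambda>x. norm (grad \<eta> x) powr l)"
    using lm by (intro c1_integrable_grad_powr[OF compact_closure_\<Omega> c1]) simp
  have "(LINT x|lborel. norm (grad \<eta> x) powr l) \<le> (LINT x|lborel. indicator ?K x + P (norm (grad \<eta> x)) / P 1)"
  proof (rule integral_mono[OF il])
    show "integrable lborel (\<lambda>x. indicator ?K x + P (norm (grad \<eta> x)) / P 1)" using iK iP by auto
    fix x show "norm (grad \<eta> x) powr l \<le> indicator ?K x + P (norm (grad \<eta> x)) / P 1"
      using powr_l_le[of "norm (grad \<eta> x)"] c1_zero(2)[OF compact_closure_\<Omega> c1, of x]
      by (cases "x \<in> ?K") auto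
  qed
  also have "\<dots> = measure lborel ?K + (LINT x|lborel. P (norm (grad \<eta> x))) / P 1" using iK iP by simp
  also have "\<dots> \<le> measure lborel ?K + R / P 1"
    using R test_in(5)[OF \<eta>] P_pos[of 1] by (intro add_left_mono divide_right_mono) auto
  finally show ?thesis .
qed

lemma test_sobolev:
  assumes s: "0 < s" "s < critical"
  shows "\<exists>C. \<forall>\<eta>\<in>test_functions \<Omega>. (LINT x|M. P (norm (grad \<eta> x))) \<le> R \<longrightarrow> (LINT x|M. \<bar>\<eta> x\<bar> powr s) \<le> C"
proof -
  have "sobolev_bound (closure \<Omega>) l s"
    using s lm l_critical by (intro subcritical_sobolev[OF compact_closure_\<Omega>]) (auto simp: critical_def)
  moreover define R' where "R' = \<bar>measure lborel (closure \<Omega>) + R / P 1\<bar> + 1"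
  moreover have "0 < R'" unfolding R'_def by (rule add_nonneg_pos) auto
  ultimately obtain C where C: "\<And>u D. c1_supp (closure \<Omega>) u D \<Longrightarrow> (LINT x|lborel. norm (D x) powr l) \<le> R' \<Longrightarrow> (LINT x|lborel. \<bar>u x\<bar> powr s) \<le> C"
    unfolding sobolev_bound_def by blast
  have "(LINT x|M. \<bar>\<eta> x\<bar> powr s) \<le> C" if \<eta>: "\<eta> \<in> test_functions \<Omega>" and R: "(LINT x|M. P (norm (grad \<eta> x))) \<le> R" for \<eta>
    using C[OF test_c1[OF \<eta>]] test_grad_powr_l[OF \<eta> R] test_powr(2)[OF \<eta> s(1)] by (simp add: R'_def)
  then show ?thesis by blast
qed

lemma W0_approx_energy:
  assumes u: "u \<in> X" and \<eta>: "\<eta> \<in> test_functions \<Omega>"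
    and R: "(LINT x|M. P (norm (D u x))) \<le> R" "(LINT x|M. P (norm (D u x - grad \<eta> x))) \<le> 1"
  shows "(LINT x|M. P (norm (grad \<eta> x))) \<le> 2 powr m * 2 * (R + 1)"
proof -
  note ud = W0_D[OF u] and t = test_in[OF \<eta>]
  note i = P_sum(2)[OF ud(4) t(2) ud(5) t(4)]
  have "(LINT x|M. P (norm (D u x - (D u x - grad \<eta> x)))) \<le> 2 powr m * 2 * ((LINT x|M. P (norm (D u x))) + (LINT x|M. P (norm (D u x - grad \<eta> x))))"
    by (rule P_sum(4)[OF ud(4) _ ud(5) i]) (use ud(4) t(2) in measurable)
  also have "\<dots> \<le> 2 powr m * 2 * (R + 1)" using R by (intro mult_left_mono add_mono) auto
  finally show ?thesis by simp
qed

lemma W0_approx: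
  assumes u: "u \<in> X" and e: "0 < e"
  obtains \<eta> where "\<eta> \<in> test_functions \<Omega>" "(LINT x|M. P (norm (u x - \<eta> x))) < e" "(LINT x|M. P (norm (D u x - grad \<eta> x))) < e"
proof -
  obtain \<eta> where "approx u (D u) \<eta>" using W0_D(6)[OF u] by blast
  then have \<eta>: "\<And>k. \<eta> k \<in> test_functions \<Omega>" "\<forall>\<^sub>F k in sequentially. (LINT x|M. P (norm (u x - \<eta> k x))) < e"
    "\<forall>\<^sub>F k in sequentially. (LINT x|M. P (norm (D u x - grad (\<eta> k) x))) < e"
    using e by (auto simp: approx_def intro: order_tendstoD(2))
  from eventually_happens'[OF sequentially_bot eventually_conj[OF \<eta>(2,3)]]
  obtain k where "(LINT x|M. P (norm (u x - \<eta> k x))) < e" "(LINT x|M. P (norm (D u x - grad (\<eta> k) x))) < e" by blast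
  then show thesis by (rule that[OF \<eta>(1)])
qed

lemma W0_approx_seq:
  assumes v: "\<And>n::nat. v n \<in> X"
  obtains \<eta> where "\<And>n. \<eta> n \<in> test_functions \<Omega>" "(\<lambda>n. LINT x|M. P (norm (v n x - \<eta> n x))) \<longlonglongrightarrow> 0"
    "(\<lambda>n. LINT x|M. P (norm (D (v n) x - grad (\<eta> n) x))) \<longlonglongrightarrow> 0" "\<And>n. (LINT x|M. P (norm (D (v n) x - grad (\<eta> n) x))) \<le> 1"
proof -
  have "\<exists>\<eta>. \<eta> \<in> test_functions \<Omega> \<and> (LINT x|M. P (norm (v n x - \<eta> x))) < inverse (real (Suc n)) \<and> (LINT x|M. P (norm (D (v n) x - grad \<eta> x))) < inverse (real (Suc n))" for n
  proof -
    have "0 < inverse (real (Suc n))" by (simp del: of_nat_Suc)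
    show ?thesis by (rule W0_approx[OF v[of n] \<open>0 < inverse (real (Suc n))\<close>]) (intro exI conjI)
  qed
  then have "\<forall>n. \<exists>\<eta>. \<eta> \<in> test_functions \<Omega> \<and> (LINT x|M. P (norm (v n x - \<eta> x))) < inverse (real (Suc n)) \<and> (LINT x|M. P (norm (D (v n) x - grad \<eta> x))) < inverse (real (Suc n))"
    by (rule allI)
  from choice[OF this] obtain \<eta> where ex: "\<forall>n. \<eta> n \<in> test_functions \<Omega> \<and> (LINT x|M. P (norm (v n x - \<eta> n x))) < inverse (real (Suc n)) \<and>
      (LINT x|M. P (norm (D (v n) x - grad (\<eta> n) x))) < inverse (real (Suc n))"
    by (elim exE) (rule that)
  have \<eta>: "\<eta> n \<in> test_functions \<Omega>" "(LINT x|M. P (norm (v n x - \<eta> n x))) < inverse (real (Suc n))"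
    "(LINT x|M. P (norm (D (v n) x - grad (\<eta> n) x))) < inverse (real (Suc n))" for n
    by (rule ex[THEN spec, THEN conjunct1], rule ex[THEN spec, THEN conjunct2, THEN conjunct1], rule ex[THEN spec, THEN conjunct2, THEN conjunct2])
  show thesis
  proof (rule that[OF \<eta>(1)])
    show "(\<lambda>n. LINT x|M. P (norm (v n x - \<eta> n x))) \<longlonglongrightarrow> 0"
      by (rule tendsto_sandwich[OF _ _ tendsto_const LIMSEQ_inverse_real_of_nat]) (intro always_eventually allI less_imp_le[OF \<eta>(2)] integral_nonneg_AE AE_I2 P_nonneg)+
    show "(\<lambda>n. LINT x|M. P (norm (D (v n) x - grad (\<eta> n) x))) \<longlonglongrightarrow> 0"
      by (rule tendsto_sandwich[OF _ _ tendsto_const LIMSEQ_inverse_real_of_nat]) (intro always_eventually allI less_imp_le[OF \<eta>(3)] integral_nonneg_AE AE_I2 P_nonneg)+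
    show "(LINT x|M. P (norm (D (v n) x - grad (\<eta> n) x))) \<le> 1" for n
    proof -
      have "inverse (real (Suc n)) \<le> 1" by (simp add: inverse_le_1_iff)
      then show ?thesis using \<eta>(3)[of n] by linarith
    qed
  qed
qed

text \<open>The estimate holds for the approximating test functions and passes to the limit by Fatou's lemma.\<close>

lemma W0_sobolev:
  assumes s: "1 < s" "s < critical"
  shows "\<exists>C. \<forall>u\<in>X. (LINT x|M. P (norm (D u x))) \<le> R \<longrightarrow> integrable M (\<lambda>x. \<bar>u x\<bar> powr s) \<and> (LINT x|M. \<bar>u x\<bar> powr s) \<le> C"
proof -
  interpret qm: modular "\<lambda>t. \<bar>t\<bar> powr s" by (rule modular_powr[OF s(1)])
  obtain C where C: "\<And>\<eta>. \<eta> \<in> test_functions \<Omega> \<Longrightarrow> (LINT x|M. P (norm (grad \<eta> x))) \<le> 2 powr m * 2 * (R + 1) \<Longrightarrow> (LINT x|M. \<bar>\<eta> x\<bar> powr s) \<le> C"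
    using test_sobolev[of s "2 powr m * 2 * (R + 1)"] s by auto
  have "integrable M (\<lambda>x. \<bar>u x\<bar> powr s) \<and> (LINT x|M. \<bar>u x\<bar> powr s) \<le> C"
    if u: "u \<in> X" and R: "(LINT x|M. P (norm (D u x))) \<le> R" for u
  proof -
    note ud = W0_D[OF u]
    obtain \<eta> where \<eta>: "\<And>n. \<eta> n \<in> test_functions \<Omega>" "(\<lambda>n. LINT x|M. P (norm (u x - \<eta> n x))) \<longlonglongrightarrow> 0"
      "\<And>n. (LINT x|M. P (norm (D u x - grad (\<eta> n) x))) \<le> 1"
      by (rule W0_approx_seq[of "\<lambda>n. u", OF u]) (rule that)
    note t = test_in[OF \<eta>(1)]
    have b: "(LINT x|M. \<bar>\<eta> n x\<bar> powr s) \<le> C" for n by (intro C W0_approx_energy[OF u] \<eta> R)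
    have bm: "(\<lambda>x. u x - \<eta> n x) \<in> borel_measurable M" for n using ud(1) t(1) by (rule borel_measurable_diff)
    have iP: "integrable M (\<lambda>x. P (norm (u x - \<eta> n x)))" for n by (rule P_sum(2)[OF ud(1) t(1) ud(2) t(3)])
    obtain K where K: "0 \<le> K" "\<And>t. 0 \<le> t \<Longrightarrow> t \<le> 1 + K * P t" using Pmod.A_linear[of 1] by auto
    have L1: "integrable M (\<lambda>x. u x - \<eta> n x)" for n by (rule Pmod.L1_bound(1)[OF finite_M bm iP K])
    obtain r where r: "strict_mono (r :: nat \<Rightarrow> nat)" "AE x in M. (\<lambda>n. u x - \<eta> (r n) x) \<longlonglongrightarrow> 0"
      using tendsto_L1_AE_subseq[OF L1 Pmod.L1_tendsto[OF finite_M bm iP \<eta>(2)]] by blast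
    have "AE x in M. (\<lambda>n. \<eta> (r n) x) \<longlonglongrightarrow> u x"
      using r(2)
    proof eventually_elim
      case (elim x)
      from tendsto_diff[OF tendsto_const elim, of "u x"] show ?case by simp
    qed
    from qm.fatou_modular[OF t(1) ud(1) _ _ this, of C] show ?thesis
      using test_powr(1)[OF \<eta>(1), of s] s b by simp
  qed
  then show ?thesis by blast
qed

text \<open>Convergence in \<open>L\<^sup>q\<close> with \<open>q > m\<close> implies convergence of the modular of the functions; a test function close to each \<open>v n\<close> then
yields an approximating sequence for the limit.\<close>

lemma W0_closed:
  assumes q: "m < q" and v: "\<And>n::nat. v n \<in> X" and w: "w \<in> borel_measurable M" "integrable M (\<lambda>x. \<bar>w x\<bar> powr q)"
    and vq: "\<And>n. integrable M (\<lambda>x. \<bar>v n x\<bar> powr q)"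
    and g: "g \<in> borel_measurable M" "integrable M (\<lambda>x. P (norm (g x)))"
    and lim: "(\<lambda>n. LINT x|M. \<bar>v n x - w x\<bar> powr q) \<longlonglongrightarrow> 0" "(\<lambda>n. LINT x|M. P (norm (D (v n) x - g x))) \<longlonglongrightarrow> 0"
  shows "w \<in> X \<and> (AE x in M. D w x = g x)"
proof -
  have q1: "1 < q" using q lm by simp
  interpret qm: modular "\<lambda>t. \<bar>t\<bar> powr q" by (rule modular_powr[OF q1])
  note vd = W0_D[OF v]
  obtain K where K: "0 \<le> K" "\<And>t. 0 \<le> t \<Longrightarrow> t \<le> 1 + K * P t" using Pmod.A_linear[of 1] by auto
  obtain K' where K': "0 \<le> K'" "\<And>t. 0 \<le> t \<Longrightarrow> t \<le> 1 + K' * \<bar>t\<bar> powr q" using qm.A_linear[of 1] by auto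
  have dw: "(\<lambda>x. v n x - w x) \<in> borel_measurable M" for n by (intro borel_measurable_diff vd(1) w(1))
  have idq: "integrable M (\<lambda>x. \<bar>norm (v n x - w x)\<bar> powr q)" for n
    by (rule qm.integrable_tri[where g = "v n" and h = w, OF dw]) (use vq w in \<open>auto simp: abs_triangle_ineq4\<close>)
  have dg: "(\<lambda>x. D (v n) x - g x) \<in> borel_measurable M" for n by (intro borel_measurable_diff vd(4) g(1))
  have idg: "integrable M (\<lambda>x. P (norm (D (v n) x - g x)))" for n by (rule P_sum(2)[OF vd(4) g(1) vd(5) g(2)])
  have L1v: "integrable M (v n)" for n by (rule Pmod.L1_bound(1)[OF finite_M vd(1) vd(2) K])
  have L1Dv: "integrable M (D (v n))" for n by (rule Pmod.L1_bound(1)[OF finite_M vd(4) vd(5) K])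
  have L1g: "integrable M g" by (rule Pmod.L1_bound(1)[OF finite_M g K])
  have L1w: "integrable M w" by (rule qm.L1_bound(1)[OF finite_M w(1) _ K']) (use w(2) in simp)
  have L1d: "(\<lambda>n. LINT x|M. norm (v n x - w x)) \<longlonglongrightarrow> 0" "(\<lambda>n. LINT x|M. norm (D (v n) x - g x)) \<longlonglongrightarrow> 0"
    by (rule qm.L1_tendsto[OF finite_M dw idq]) (use lim(1) in simp, rule Pmod.L1_tendsto[OF finite_M dg idg lim(2)])
  have wg: "has_weak_grad \<Omega> w g"
    by (rule has_weak_grad_limit[OF \<Omega>_open vd(3) L1v L1Dv L1w L1g _ L1d(2)]) (use L1d(1) in simp)
  have iPw: "integrable M (\<lambda>x. P (norm (w x)))"
  proof (rule Bochner_Integration.integrable_bound)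
    show "integrable M (\<lambda>x. P 1 * (\<bar>w x\<bar> + \<bar>w x\<bar> powr q))" using L1w w(2) by auto
    show "(\<lambda>x. P (norm (w x))) \<in> borel_measurable M" using w(1) by measurable
    show "AE x in M. norm (P (norm (w x))) \<le> norm (P 1 * (\<bar>w x\<bar> + \<bar>w x\<bar> powr q))"
      using P_le_powr[of q] q by (intro AE_I2) (auto intro: order_trans[OF _ abs_ge_self])
  qed
  have iPd: "integrable M (\<lambda>x. P (norm (w x - v n x)))" for n by (rule P_sum(2)[OF w(1) vd(1) iPw vd(2)])
  have Pd: "(\<lambda>n. LINT x|M. P (norm (w x - v n x))) \<longlonglongrightarrow> 0"
  proof (rule tendsto_sandwich[OF _ _ tendsto_const])
    show "(\<lambda>n. P 1 * ((LINT x|M. norm (v n x - w x)) + (LINT x|M. \<bar>v n x - w x\<bar> powr q))) \<longlonglongrightarrow> 0"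
      by (rule tendsto_eq_intros L1d(1) lim(1) refl | simp)+
    have "(LINT x|M. P (norm (w x - v n x))) \<le> P 1 * ((LINT x|M. norm (v n x - w x)) + (LINT x|M. \<bar>v n x - w x\<bar> powr q))" for n
    proof -
      have i1: "integrable M (\<lambda>x. norm (v n x - w x))" "integrable M (\<lambda>x. \<bar>v n x - w x\<bar> powr q)"
        using L1v L1w idq[of n] by auto
      have "(LINT x|M. P (norm (w x - v n x))) \<le> (LINT x|M. P 1 * (norm (v n x - w x) + \<bar>v n x - w x\<bar> powr q))"
      proof (rule integral_mono[OF iPd])
        show "integrable M (\<lambda>x. P 1 * (norm (v n x - w x) + \<bar>v n x - w x\<bar> powr q))" using i1 by auto
        show "P (norm (w x - v n x)) \<le> P 1 * (norm (v n x - w x) + \<bar>v n x - w x\<bar> powr q)" for x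
          using P_le_powr[of q "v n x - w x"] q P_minus[of "v n x - w x"] by simp
      qed
      also have "\<dots> = P 1 * ((LINT x|M. norm (v n x - w x)) + (LINT x|M. \<bar>v n x - w x\<bar> powr q))" using i1 by simp
      finally show ?thesis .
    qed
    then show "\<forall>\<^sub>F n in sequentially. (LINT x|M. P (norm (w x - v n x))) \<le> P 1 * ((LINT x|M. norm (v n x - w x)) + (LINT x|M. \<bar>v n x - w x\<bar> powr q))"
      by (intro always_eventually allI)
  qed simp
  obtain \<eta> where \<eta>: "\<And>n. \<eta> n \<in> test_functions \<Omega>" "(\<lambda>n. LINT x|M. P (norm (v n x - \<eta> n x))) \<longlonglongrightarrow> 0"
    "(\<lambda>n. LINT x|M. P (norm (D (v n) x - grad (\<eta> n) x))) \<longlonglongrightarrow> 0"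
    by (rule W0_approx_seq[of v, OF v]) (rule that)
  note t = test_in[OF \<eta>(1)]
  have "approx w g \<eta>"
    unfolding approx_def
  proof (intro conjI allI \<eta>(1))
    have "(\<lambda>n. LINT x|M. P (norm (1 *\<^sub>R (w x - v n x) + 1 *\<^sub>R (v n x - \<eta> n x)))) \<longlonglongrightarrow> 0"
      by (rule P_combination_tendsto[OF borel_measurable_diff[OF w(1) vd(1)] borel_measurable_diff[OF vd(1) t(1)]
          iPd P_sum(2)[OF vd(1) t(1) vd(2) t(3)] Pd \<eta>(2)])
    then show "(\<lambda>n. LINT x|M. P (norm (w x - \<eta> n x))) \<longlonglongrightarrow> 0" by simp
    have "(\<lambda>n. LINT x|M. P (norm ((-1) *\<^sub>R (D (v n) x - g x) + 1 *\<^sub>R (D (v n) x - grad (\<eta> n) x)))) \<longlonglongrightarrow> 0"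
      by (rule P_combination_tendsto[OF dg borel_measurable_diff[OF vd(4) t(2)]
          idg P_sum(2)[OF vd(4) t(2) vd(5) t(4)] lim(2) \<eta>(3)])
    then show "(\<lambda>n. LINT x|M. P (norm (g x - grad (\<eta> n) x))) \<longlonglongrightarrow> 0" by simp
  qed
  from W0_I[OF w(1) iPw wg g(2) this] show ?thesis by blast
qed

text \<open>Test functions close to \<open>v n\<close> have bounded energy, hence gradients bounded in \<open>L\<^sup>1\<close>, and Rellich's theorem gives a subsequence that
is Cauchy in \<open>L\<^sup>1\<close>. Interpolation with an exponent \<open>q'\<close> between \<open>q\<close> and the critical one turns this into convergence in \<open>L\<^sup>q\<close>, both
for the test functions and for the differences \<open>v n - \<eta> n\<close>.\<close>

lemma W0_precompact:
  assumes q: "1 < q" "q < critical" and v: "\<And>n::nat. v n \<in> X" and R: "\<And>n. (LINT x|M. P (norm (D (v n) x))) \<le> R"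
  shows "\<exists>k w. strict_mono (k :: nat \<Rightarrow> nat) \<and> w \<in> borel_measurable M \<and> integrable M (\<lambda>x. \<bar>w x\<bar> powr q) \<and>
        (\<lambda>n. LINT x|M. \<bar>v (k n) x - w x\<bar> powr q) \<longlonglongrightarrow> 0"
proof -
  interpret qm: modular "\<lambda>t. \<bar>t\<bar> powr q" by (rule modular_powr[OF q(1)])
  obtain q' where q': "q < q'" "q' < critical" using dense[OF q(2)] by blast
  have q'1: "1 < q'" using q q' by simp
  interpret qm': modular "\<lambda>t. \<bar>t\<bar> powr q'" by (rule modular_powr[OF q'1])
  note vd = W0_D[OF v]
  obtain \<eta> where \<eta>: "\<And>n. \<eta> n \<in> test_functions \<Omega>" "(\<lambda>n. LINT x|M. P (norm (v n x - \<eta> n x))) \<longlonglongrightarrow> 0"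
    "(\<lambda>n. LINT x|M. P (norm (D (v n) x - grad (\<eta> n) x))) \<longlonglongrightarrow> 0" "\<And>n. (LINT x|M. P (norm (D (v n) x - grad (\<eta> n) x))) \<le> 1"
    by (rule W0_approx_seq[of v, OF v]) (rule that)
  note t = test_in[OF \<eta>(1)]
  define R1 where "R1 = 2 powr m * 2 * (R + 1)"
  have \<eta>R: "(LINT x|M. P (norm (grad (\<eta> n) x))) \<le> R1" for n
    unfolding R1_def by (rule W0_approx_energy[OF v \<eta>(1) R \<eta>(4)])
  define Kc where "Kc = closure \<Omega>"
  have Kc: "compact Kc" unfolding Kc_def by (rule compact_closure_\<Omega>)
  have c1: "c1_supp Kc (\<eta> n) (grad (\<eta> n))" for n unfolding Kc_def by (rule test_c1[OF \<eta>(1)])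
  note bl = test_grad_powr_l[OF \<eta>(1) \<eta>R, folded Kc_def]
  have [measurable]: "Kc \<in> sets borel" by (simp add: Kc_def)
  have iK: "integrable lborel (indicator Kc :: real^'n \<Rightarrow> real)"
    using emeasure_compact_finite[OF Kc] by (simp add: integrable_indicator_iff)
  define R2 where "R2 = measure lborel Kc + (measure lborel Kc + R1 / P 1)"
  have b1: "(LINT x|lborel. norm (grad (\<eta> n) x)) \<le> R2" for n
  proof -
    have il: "integrable lborel (\<lambda>x. norm (grad (\<eta> n) x) powr l)" "integrable lborel (\<lambda>x. norm (grad (\<eta> n) x))"
      using c1_integrable_grad_powr[OF Kc c1, of l n] c1_integrable_grad_powr[OF Kc c1, of 1 n] lm by auto
    have "(LINT x|lborel. norm (grad (\<eta> n) x)) \<le> (LINT x|lborel. indicator Kc x + norm (grad (\<eta> n) x) powr l)"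
    proof (rule integral_mono)
      fix x
      show "norm (grad (\<eta> n) x) \<le> indicator Kc x + norm (grad (\<eta> n) x) powr l"
      proof (cases "x \<in> Kc")
        case True
        have "t \<le> 1 + t powr l" if "0 \<le> t" for t
        proof (cases "t \<le> 1")
          case False
          then have "t powr 1 \<le> t powr l" using lm by (intro powr_mono) auto
          then show ?thesis using False by simp
        qed (simp add: add_increasing2)
        then show ?thesis using True by simp
      qed (simp add: c1_zero(2)[OF Kc c1])
    qed (use il iK in auto)
    also have "\<dots> = measure lborel Kc + (LINT x|lborel. norm (grad (\<eta> n) x) powr l)" using il iK by simp
    finally show ?thesis using bl[of n] by (simp add: R2_def)
  qed
  obtain C1 where C1: "\<And>\<eta>. \<eta> \<in> test_functions \<Omega> \<Longrightarrow> (LINT x|M. P (norm (grad \<eta> x))) \<le> R1 \<Longrightarrow> (LINT x|M. \<bar>\<eta> x\<bar> powr 1) \<le> C1"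
    using test_sobolev[of 1 R1] l_critical by auto
  have b2: "(LINT x|lborel. \<bar>\<eta> n x\<bar>) \<le> C1" for n
    using C1[OF \<eta>(1) \<eta>R, of n] test_powr(2)[OF \<eta>(1), of 1 n] by simp
  obtain k where k: "strict_mono (k :: nat \<Rightarrow> nat)"
    and L1c: "\<And>e. 0 < e \<Longrightarrow> \<exists>N. \<forall>i\<ge>N. \<forall>j\<ge>N. (LINT x|lborel. \<bar>\<eta> (k i) x - \<eta> (k j) x\<bar>) < (e::real)"
  proof (rule rellich[where R = "max R2 C1", OF Kc c1])
    show "(LINT x|lborel. norm (grad (\<eta> n) x)) \<le> max R2 C1" for n using b1[of n] by simp
    show "(LINT x|lborel. \<bar>\<eta> n x\<bar>) \<le> max R2 C1" for n using b2[of n] by simp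
  qed (rule that)
  have difft: "(\<lambda>x. \<eta> i x - \<eta> j x) \<in> test_functions \<Omega>" "grad (\<lambda>x. \<eta> i x - \<eta> j x) x = grad (\<eta> i) x - grad (\<eta> j) x" for i j x
    using test_functions_combination[OF \<eta>(1) \<eta>(1), of 1 i "-1" j] by auto
  obtain C2 where C2: "\<And>\<eta>. \<eta> \<in> test_functions \<Omega> \<Longrightarrow> (LINT x|M. P (norm (grad \<eta> x))) \<le> 2 powr m * 2 * (R1 + R1) \<Longrightarrow> (LINT x|M. \<bar>\<eta> x\<bar> powr q') \<le> C2"
    using test_sobolev[of q' "2 powr m * 2 * (R1 + R1)"] q'1 q' by auto
  have dq': "(LINT x|M. \<bar>\<eta> i x - \<eta> j x\<bar> powr q') \<le> C2" for i j
  proof (rule C2[OF difft(1)])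
    have "(LINT x|M. P (norm (grad (\<eta> i) x - grad (\<eta> j) x))) \<le> 2 powr m * 2 * ((LINT x|M. P (norm (grad (\<eta> i) x))) + (LINT x|M. P (norm (grad (\<eta> j) x))))"
      by (rule P_sum(4)[OF t(2) t(2) t(4) t(4)])
    also have "\<dots> \<le> 2 powr m * 2 * (R1 + R1)" by (intro mult_left_mono add_mono \<eta>R) auto
    finally show "(LINT x|M. P (norm (grad (\<lambda>x. \<eta> i x - \<eta> j x) x))) \<le> 2 powr m * 2 * (R1 + R1)" by (simp add: difft(2))
  qed
  have idiff: "integrable M (\<lambda>x. \<bar>\<eta> i x - \<eta> j x\<bar> powr s)" "(LINT x|M. \<bar>\<eta> i x - \<eta> j x\<bar>) = (LINT x|lborel. \<bar>\<eta> i x - \<eta> j x\<bar>)"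
    "integrable M (\<lambda>x. \<bar>\<eta> i x - \<eta> j x\<bar>)" if "0 < s" for i j s
    using test_powr(1)[OF difft(1) that, of i j] test_powr(2)[OF difft(1), of 1 i j] test_powr(1)[OF difft(1), of 1 i j] by auto
  have cauchy: "\<exists>N. \<forall>i\<ge>N. \<forall>j\<ge>N. (LINT x|M. \<bar>norm (\<eta> (k i) x - \<eta> (k j) x)\<bar> powr q) < e" if e: "0 < e" for e
  proof -
    obtain d where d: "0 < d" "\<And>w :: real^'n \<Rightarrow> real. integrable M (\<lambda>x. \<bar>w x\<bar>) \<Longrightarrow> integrable M (\<lambda>x. \<bar>w x\<bar> powr q) \<Longrightarrow> integrable M (\<lambda>x. \<bar>w x\<bar> powr q') \<Longrightarrow>
      (LINT x|M. \<bar>w x\<bar> powr q') \<le> C2 \<Longrightarrow> (LINT x|M. \<bar>w x\<bar>) < d \<Longrightarrow> (LINT x|M. \<bar>w x\<bar> powr q) < e"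
      using interpolation_small[OF finite_M q(1) q'(1) e, of C2] by blast
    obtain N where N: "\<forall>i\<ge>N. \<forall>j\<ge>N. (LINT x|lborel. \<bar>\<eta> (k i) x - \<eta> (k j) x\<bar>) < d" using L1c[OF d(1)] by blast
    have "(LINT x|M. \<bar>\<eta> (k i) x - \<eta> (k j) x\<bar> powr q) < e" if "N \<le> i" "N \<le> j" for i j
      using N that q q'1 by (intro d(2) idiff(1) idiff(3)[of 1] dq') (auto simp: idiff(2)[of 1])
    then show ?thesis by auto
  qed
  have iq: "integrable M (\<lambda>x. \<bar>norm (\<eta> n x)\<bar> powr q)" for n using test_powr(1)[OF \<eta>(1), of q n] q by simp
  have idq: "integrable M (\<lambda>x. \<bar>norm (\<eta> i x - \<eta> j x)\<bar> powr q)" for i j using idiff(1)[of q i j] q by simp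
  obtain w where w: "w \<in> borel_measurable M" and
    lim: "\<And>n. integrable M (\<lambda>x. \<bar>norm (\<eta> (k n) x - w x)\<bar> powr q)" "(\<lambda>n. LINT x|M. \<bar>norm (\<eta> (k n) x - w x)\<bar> powr q) \<longlonglongrightarrow> 0"
    by (rule qm.complete[of M "\<lambda>n. \<eta> (k n)", OF finite_M t(1) iq idq cauchy]) (assumption | rule that)+
  have wq: "integrable M (\<lambda>x. \<bar>norm (w x)\<bar> powr q)"
  proof (rule qm.integrable_tri[OF w iq[of "k 0"] lim(1)[of 0]])
    show "norm (w x) \<le> norm (\<eta> (k 0) x) + norm (\<eta> (k 0) x - w x)" for x by simp
  qed
  have vE: "(\<lambda>x. v n x - \<eta> n x) \<in> X" "(LINT x|M. P (norm (D (\<lambda>x. v n x - \<eta> n x) x))) \<le> 1" for n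
  proof -
    have c: "(\<lambda>x. 1 * v n x + (-1) * \<eta> n x) \<in> X" "AE x in M. D (\<lambda>x. 1 * v n x + (-1) * \<eta> n x) x = 1 *\<^sub>R D (v n) x + (-1) *\<^sub>R D (\<eta> n) x"
      by (rule W0_combination[OF v test_W0(1)[OF \<eta>(1)]])+
    show X': "(\<lambda>x. v n x - \<eta> n x) \<in> X" using c(1) by simp
    have "(LINT x|M. P (norm (D (\<lambda>x. v n x - \<eta> n x) x))) = (LINT x|M. P (norm (D (v n) x - grad (\<eta> n) x)))"
    proof (rule integral_cong_AE)
      show "AE x in M. P (norm (D (\<lambda>x. v n x - \<eta> n x) x)) = P (norm (D (v n) x - grad (\<eta> n) x))"
        using c(2) test_W0(2)[OF \<eta>(1)[of n]] by eventually_elim simp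
    qed (use W0_D(4)[OF X'] vd(4)[of n] t(2)[of n] in measurable)
    then show "(LINT x|M. P (norm (D (\<lambda>x. v n x - \<eta> n x) x))) \<le> 1" using \<eta>(4)[of n] by simp
  qed
  obtain C3 where C3: "\<And>u. u \<in> X \<Longrightarrow> (LINT x|M. P (norm (D u x))) \<le> 1 \<Longrightarrow> integrable M (\<lambda>x. \<bar>u x\<bar> powr q') \<and> (LINT x|M. \<bar>u x\<bar> powr q') \<le> C3"
    using W0_sobolev[OF q'1 q'(2), of 1] by blast
  obtain C4 where C4: "\<And>u. u \<in> X \<Longrightarrow> (LINT x|M. P (norm (D u x))) \<le> 1 \<Longrightarrow> integrable M (\<lambda>x. \<bar>u x\<bar> powr q)"
    using W0_sobolev[OF q, of 1] by blast
  have bmv: "(\<lambda>x. v n x - \<eta> n x) \<in> borel_measurable M" for n by (rule W0_D(1)[OF vE(1)])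
  have iPv: "integrable M (\<lambda>x. P (norm (v n x - \<eta> n x)))" for n by (rule W0_D(2)[OF vE(1)])
  obtain K where K: "0 \<le> K" "\<And>t. 0 \<le> t \<Longrightarrow> t \<le> 1 + K * P t" using Pmod.A_linear[of 1] by auto
  have L1v: "integrable M (\<lambda>x. v n x - \<eta> n x)" for n by (rule Pmod.L1_bound(1)[OF finite_M bmv iPv K])
  have L1lim: "(\<lambda>n. LINT x|M. norm (v n x - \<eta> n x)) \<longlonglongrightarrow> 0" by (rule Pmod.L1_tendsto[OF finite_M bmv iPv \<eta>(2)])
  have vq: "(\<lambda>n. LINT x|M. \<bar>v n x - \<eta> n x\<bar> powr q) \<longlonglongrightarrow> 0"
  proof (rule order_tendstoI)
    fix e :: real assume e: "0 < e"
    obtain d where d: "0 < d" "\<And>w :: real^'n \<Rightarrow> real. integrable M (\<lambda>x. \<bar>w x\<bar>) \<Longrightarrow> integrable M (\<lambda>x. \<bar>w x\<bar> powr q) \<Longrightarrow> integrable M (\<lambda>x. \<bar>w x\<bar> powr q') \<Longrightarrow>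
      (LINT x|M. \<bar>w x\<bar> powr q') \<le> C3 \<Longrightarrow> (LINT x|M. \<bar>w x\<bar>) < d \<Longrightarrow> (LINT x|M. \<bar>w x\<bar> powr q) < e"
      using interpolation_small[OF finite_M q(1) q'(1) e, of C3] by blast
    have "\<forall>\<^sub>F n in sequentially. (LINT x|M. norm (v n x - \<eta> n x)) < d" using L1lim d(1) by (rule order_tendstoD(2))
    then show "\<forall>\<^sub>F n in sequentially. (LINT x|M. \<bar>v n x - \<eta> n x\<bar> powr q) < e"
    proof eventually_elim
      case (elim n)
      have "integrable M (\<lambda>x. \<bar>v n x - \<eta> n x\<bar>)" by (rule integrable_abs[OF L1v])
      from d(2)[OF this C4[OF vE] C3[OF vE, THEN conjunct1] C3[OF vE, THEN conjunct2]] elim show ?case by simp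
    qed
  next
    fix e :: real assume "e < 0"
    then show "\<forall>\<^sub>F n in sequentially. e < (LINT x|M. \<bar>v n x - \<eta> n x\<bar> powr q)"
      by (intro always_eventually) (auto intro: less_le_trans)
  qed
  have fin: "(\<lambda>n. LINT x|M. \<bar>v (k n) x - w x\<bar> powr q) \<longlonglongrightarrow> 0"
  proof (rule tendsto_sandwich[OF _ _ tendsto_const])
    have "(\<lambda>n. LINT x|M. \<bar>v (k n) x - \<eta> (k n) x\<bar> powr q) \<longlonglongrightarrow> 0"
      using LIMSEQ_subseq_LIMSEQ[OF vq k] by (simp add: o_def)
    then show "(\<lambda>n. 2 powr q * ((LINT x|M. \<bar>v (k n) x - \<eta> (k n) x\<bar> powr q) + (LINT x|M. \<bar>norm (\<eta> (k n) x - w x)\<bar> powr q))) \<longlonglongrightarrow> 0"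
      by (auto intro!: tendsto_eq_intros lim(2)[simplified])
    have "(LINT x|M. \<bar>v (k n) x - w x\<bar> powr q) \<le> 2 powr q * ((LINT x|M. \<bar>v (k n) x - \<eta> (k n) x\<bar> powr q) + (LINT x|M. \<bar>norm (\<eta> (k n) x - w x)\<bar> powr q))" for n
    proof -
      note i = C4[OF vE, of "k n"] lim(1)[of n]
      have i3: "integrable M (\<lambda>x. \<bar>norm (v (k n) x - w x)\<bar> powr q)"
      proof (rule qm.integrable_tri[where g = "\<lambda>x. v (k n) x - \<eta> (k n) x" and h = "\<lambda>x. \<eta> (k n) x - w x"])
        show "(\<lambda>x. v (k n) x - w x) \<in> borel_measurable M" by (intro borel_measurable_diff vd(1) w)
        show "norm (v (k n) x - w x) \<le> norm (v (k n) x - \<eta> (k n) x) + norm (\<eta> (k n) x - w x)" for x by simp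
      qed (use i in auto)
      have "(LINT x|M. \<bar>v (k n) x - w x\<bar> powr q) \<le> (LINT x|M. 2 powr q * (\<bar>v (k n) x - \<eta> (k n) x\<bar> powr q + \<bar>norm (\<eta> (k n) x - w x)\<bar> powr q))"
      proof (rule integral_mono)
        show "integrable M (\<lambda>x. \<bar>v (k n) x - w x\<bar> powr q)" using i3 by simp
        fix x
        define a where "a = \<bar>v (k n) x - \<eta> (k n) x\<bar>"
        define b where "b = \<bar>norm (\<eta> (k n) x - w x)\<bar>"
        have "\<bar>v (k n) x - w x\<bar> \<le> a + b" by (simp add: a_def b_def)
        then have "\<bar>v (k n) x - w x\<bar> \<le> 2 * max a b" by linarith
        then have "\<bar>v (k n) x - w x\<bar> powr q \<le> (2 * max a b) powr q" using q by (intro powr_mono2) auto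
        also have "\<dots> = 2 powr q * max a b powr q" by (rule powr_mult)
        also have "\<dots> \<le> 2 powr q * (a powr q + b powr q)" by (intro mult_left_mono) (auto simp: max_def)
        finally show "\<bar>v (k n) x - w x\<bar> powr q \<le> 2 powr q * (\<bar>v (k n) x - \<eta> (k n) x\<bar> powr q + \<bar>norm (\<eta> (k n) x - w x)\<bar> powr q)"
          unfolding a_def b_def .
      qed (use i in auto)
      also have "\<dots> = 2 powr q * ((LINT x|M. \<bar>v (k n) x - \<eta> (k n) x\<bar> powr q) + (LINT x|M. \<bar>norm (\<eta> (k n) x - w x)\<bar> powr q))"
        using i by simp
      finally show ?thesis .
    qed
    then show "\<forall>\<^sub>F n in sequentially. (LINT x|M. \<bar>v (k n) x - w x\<bar> powr q) \<le> 2 powr q * ((LINT x|M. \<bar>v (k n) x - \<eta> (k n) x\<bar> powr q) + (LINT x|M. \<bar>norm (\<eta> (k n) x - w x)\<bar> powr q))"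
      by (intro always_eventually allI)
  qed simp
  show ?thesis
    by (intro exI[of _ k] exI[of _ w] conjI k w fin) (use wq in simp)
qed

lemma W0_nonzero:
  assumes "\<Omega> \<noteq> {}" shows "\<exists>u\<in>X. \<not> (AE x in M. u x = 0)"
proof (rule ccontr)
  assume no: "\<not> ?thesis"
  obtain x0 where "x0 \<in> \<Omega>" using assms by blast
  then obtain a b where ab: "x0 \<in> box a b" "cbox a b \<subseteq> \<Omega>"
    by (rule open_contains_cbox[OF \<Omega>_open]) (rule that)
  have no': "AE x in M. u x = 0" if "u \<in> X" for u using no that by (simp add: bex_simps)
  have "AE x in M. box_bump a b k x = 0" for k by (rule no'[OF test_W0(1)[OF box_bump_test[OF ab(2)]]])
  then have "AE x in M. \<forall>k. box_bump a b k x = 0" by (simp add: AE_all_countable)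
  then have "AE x in M. x \<notin> box a b"
  proof eventually_elim
    case (elim x)
    then have "(\<lambda>k. 0) \<longlonglongrightarrow> indicat_real (box a b) x" using box_bump_tendsto[of a b x] by simp
    then have "indicat_real (box a b) x = 0" by (rule LIMSEQ_unique[OF _ tendsto_const])
    then show ?case by (simp add: indicator_def split: if_splits)
  qed
  then have "AE x in lebesgue. x \<in> \<Omega> \<longrightarrow> x \<notin> box a b" using \<Omega>_sets by (simp add: AE_restrict_space_iff)
  then have "AE x in lebesgue. x \<notin> box a b" by eventually_elim (use ab box_subset_cbox[of a b] in auto)
  then have "box a b \<in> null_sets lebesgue" by (subst (asm) AE_iff_null_sets[symmetric]) auto
  then have "negligible (box a b)" by (simp add: negligible_iff_null_sets)
  moreover have "box a b \<noteq> {}" using ab by auto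
  ultimately show False using open_not_negligible[OF open_box] by blast
qed

theorem W0_setting:
  assumes q: "m < q" "q < critical" and ne: "\<Omega> \<noteq> {}"
  shows "sobolev_setting \<phi> l m M X D q"
proof -
  have q1: "1 < q" using q lm by simp
  have Xq: "integrable M (\<lambda>x. \<bar>u x\<bar> powr q)" if "u \<in> X" for u
    using W0_sobolev[OF q1 q(2), of "LINT x|M. P (norm (D u x))"] that by blast
  show ?thesis
  proof (intro sobolev_setting.intro power_growth_axioms finite_M sobolev_setting_axioms.intro)
    show "\<exists>C. \<forall>u\<in>X. (LINT x|M. P (norm (D u x))) \<le> 1 \<longrightarrow> (LINT x|M. \<bar>u x\<bar> powr q) \<le> C"
      using W0_sobolev[OF q1 q(2), of 1] by blast
    show "\<And>v R. (\<And>n::nat. v n \<in> X) \<Longrightarrow> (\<And>n. (LINT x|M. P (norm (D (v n) x))) \<le> R) \<Longrightarrow>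
      \<exists>k w. strict_mono (k :: nat \<Rightarrow> nat) \<and> w \<in> borel_measurable M \<and> integrable M (\<lambda>x. \<bar>w x\<bar> powr q) \<and>
        (\<lambda>n. LINT x|M. \<bar>v (k n) x - w x\<bar> powr q) \<longlonglongrightarrow> 0"
      by (rule W0_precompact[OF q1 q(2)])
    fix v w g
    assume a: "\<And>n::nat. v n \<in> X" and b: "w \<in> borel_measurable M" "integrable M (\<lambda>x. \<bar>w x\<bar> powr q)"
      "g \<in> borel_measurable M" "integrable M (\<lambda>x. P (norm (g x)))"
      "(\<lambda>n. LINT x|M. \<bar>v n x - w x\<bar> powr q) \<longlonglongrightarrow> 0" "(\<lambda>n. LINT x|M. P (norm (D (v n) x - g x))) \<longlonglongrightarrow> 0"
    show "w \<in> X \<and> (AE x in M. D w x = g x)" by (rule W0_closed[OF q(1) a b(1,2) Xq[OF a] b(3-6)])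
  next
    show "\<And>u v a b. u \<in> X \<Longrightarrow> v \<in> X \<Longrightarrow> (\<lambda>x. a * u x + b * v x) \<in> X" by (rule W0_combination(1))
    show "\<And>u v a b. u \<in> X \<Longrightarrow> v \<in> X \<Longrightarrow> AE x in M. D (\<lambda>x. a * u x + b * v x) x = a *\<^sub>R D u x + b *\<^sub>R D v x"
      by (rule W0_combination(2))
    show "\<exists>u\<in>X. \<not> (AE x in M. u x = 0)" by (rule W0_nonzero[OF ne])
  qed (use q Xq in \<open>auto intro: W0_D\<close>)
qed

end

section \<open>Indices, growth bounds and primitives\<close>

text \<open>The logarithmic derivative of \<open>H\<close> is at least \<open>a / x\<close>. No sign of \<open>H\<close> is assumed, so upper bounds follow by applying this to
\<open>-H\<close>.\<close>

lemma powr_quotient_mono: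
  fixes H g :: "real \<Rightarrow> real"
  assumes d: "\<And>x. s \<le> x \<Longrightarrow> x \<le> t \<Longrightarrow> (H has_real_derivative g x) (at x)"
    and le: "\<And>x. s \<le> x \<Longrightarrow> x \<le> t \<Longrightarrow> a * H x \<le> x * g x"
    and st: "0 < s" "s \<le> t"
  shows "H s / s powr a \<le> H t / t powr a"
proof -
  have "H s * s powr (-a) \<le> H t * t powr (-a)"
  proof (rule DERIV_nonneg_imp_nondecreasing[where f = "\<lambda>x. H x * x powr (-a)", OF st(2)])
    fix x assume x: "s \<le> x" "x \<le> t"
    then have x0: "0 < x" using st by simp
    have "((\<lambda>x. H x * x powr (-a)) has_real_derivative H x * (-a * x powr (-a - 1)) + g x * x powr (-a)) (at x)"
      by (rule DERIV_mult'[OF d[OF x] has_real_derivative_powr[OF x0]])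
    moreover have "x powr (-a) = x * x powr (-a - 1)"
      using powr_mult_base[of x "-a - 1"] x0 by simp
    then have "H x * (-a * x powr (-a - 1)) + g x * x powr (-a) = x powr (-a - 1) * (x * g x - a * H x)"
      by (simp add: algebra_simps)
    then have "0 \<le> H x * (-a * x powr (-a - 1)) + g x * x powr (-a)" using le[OF x] by simp
    ultimately show "\<exists>y. ((\<lambda>x. H x * x powr (-a)) has_real_derivative y) (at x) \<and> 0 \<le> y" by blast
  qed
  then show ?thesis by (simp add: powr_minus divide_inverse)
qed

text \<open>Bounds for \<open>x g' / g\<close> are integrated once. Where \<open>g\<close> vanishes the quotient carries no information, but there \<open>g \<ge> 0\<close> has a
minimum and \<open>g'\<close> vanishes too, so \<open>(l - 2) g \<le> x g' \<le> (m - 2) g\<close> holds everywhere. Hence \<open>x g - (l - 1) H\<close> and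
\<open>(m - 1) H - x g\<close> are nondecreasing, and it remains to see that their limits at \<open>0\<close> are not negative.\<close>

lemma index_bounds:
  fixes H g g' :: "real \<Rightarrow> real"
  assumes dH: "\<And>t. 0 < t \<Longrightarrow> (H has_real_derivative g t) (at t)"
    and dg: "\<And>t. 0 < t \<Longrightarrow> (g has_real_derivative g' t) (at t)"
    and Hpos: "\<And>t. 0 < t \<Longrightarrow> 0 < H t" and mono: "\<And>s t. 0 < s \<Longrightarrow> s < t \<Longrightarrow> H s < H t"
    and zero: "(H \<longlongrightarrow> 0) (at_right 0)" and l: "1 < l"
    and ratio: "\<And>t. 0 < t \<Longrightarrow> l - 2 \<le> g' t * t / g t" "\<And>t. 0 < t \<Longrightarrow> g' t * t / g t \<le> m - 2"
    and t: "0 < t"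
  shows "(l - 1) * H t \<le> t * g t" "t * g t \<le> (m - 1) * H t"
proof -
  have g0: "0 \<le> g x" if x: "0 < x" for x
  proof (rule ccontr)
    assume "\<not> 0 \<le> g x"
    then obtain d where "0 < d" "\<forall>h>0. h < d \<longrightarrow> H (x + h) < H x"
      using DERIV_neg_dec_right[OF dH[OF x]] by auto
    then have "H (x + d / 2) < H x" by simp
    with mono[of x "x + d / 2"] x \<open>0 < d\<close> show False by simp
  qed
  have g'0: "g' x = 0" if x: "0 < x" and "g x = 0" for x
  proof (rule DERIV_local_min[OF dg[OF x] x])
    show "\<forall>y. \<bar>x - y\<bar> < x \<longrightarrow> g x \<le> g y" using g0 that by auto
  qed
  have lb: "(l - 2) * g x \<le> x * g' x" and ub: "x * g' x \<le> (m - 2) * g x" if x: "0 < x" for x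
    using ratio[OF x] g0[OF x] g'0[OF x] by (cases "g x = 0"; simp add: field_simps)+
  have m1: "0 \<le> m - 1" using ratio[of 1] l by simp
  have small: "\<forall>\<^sub>F s in at_right 0. s < t \<and> 0 < s"
    using eventually_at_right_real[OF t] by eventually_elim simp
  have "0 \<le> t * g t - (l - 1) * H t"
  proof (rule tendsto_upperbound)
    show "((\<lambda>s. - (l - 1) * H s) \<longlongrightarrow> 0) (at_right 0)" by (rule tendsto_mult_right_zero[OF zero])
    show "\<forall>\<^sub>F s in at_right 0. - (l - 1) * H s \<le> t * g t - (l - 1) * H t"
      using small
    proof eventually_elim
      case (elim s)
      have "s * g s - (l - 1) * H s \<le> t * g t - (l - 1) * H t"
      proof (rule DERIV_nonneg_imp_nondecreasing[where f = "\<lambda>x. x * g x - (l - 1) * H x"])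
        fix x assume "s \<le> x" "x \<le> t"
        then have x: "0 < x" using elim by simp
        have "((\<lambda>x. x * g x - (l - 1) * H x) has_real_derivative x * g' x - (l - 2) * g x) (at x)"
          by (rule derivative_eq_intros dg[OF x] dH[OF x] refl)+ (simp add: algebra_simps)
        then show "\<exists>y. ((\<lambda>x. x * g x - (l - 1) * H x) has_real_derivative y) (at x) \<and> 0 \<le> y" using lb[OF x] by force
      qed (use elim in simp)
      moreover have "0 \<le> s * g s" using g0 elim by simp
      ultimately show ?case by (simp add: algebra_simps)
    qed
  qed simp
  then show "(l - 1) * H t \<le> t * g t" by simp
  have "0 \<le> (m - 1) * H t - t * g t"
  proof (rule tendsto_upperbound)
    show "((\<lambda>s. - 2 * H s) \<longlongrightarrow> 0) (at_right 0)" by (rule tendsto_mult_right_zero[OF zero])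
    show "\<forall>\<^sub>F s in at_right 0. - 2 * H s \<le> (m - 1) * H t - t * g t"
      using small
    proof eventually_elim
      case (elim s)
      \<comment> \<open>The mean value theorem on \<open>[s/2, s]\<close> provides points near \<open>0\<close> at which \<open>z * g z\<close> is small.\<close>
      have "s / 2 < s" using elim by simp
      from MVT2[OF this, of H g] dH elim
      obtain z where z: "s / 2 < z" "z < s" "H s - H (s / 2) = (s - s / 2) * g z" by auto
      have z0: "0 < z" using z elim by simp
      have "z * g z \<le> s * g z" using z g0[OF z0] by (intro mult_right_mono) auto
      also have "\<dots> = 2 * (H s - H (s / 2))" using z(3) by simp
      also have "\<dots> \<le> 2 * H s" using Hpos[of "s / 2"] elim by simp
      finally have zg: "z * g z \<le> 2 * H s" .
      have "(m - 1) * H z - z * g z \<le> (m - 1) * H t - t * g t"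
      proof (rule DERIV_nonneg_imp_nondecreasing[where f = "\<lambda>x. (m - 1) * H x - x * g x"])
        fix x assume "z \<le> x" "x \<le> t"
        then have x: "0 < x" using z0 by simp
        have "((\<lambda>x. (m - 1) * H x - x * g x) has_real_derivative (m - 2) * g x - x * g' x) (at x)"
          by (rule derivative_eq_intros dg[OF x] dH[OF x] refl)+ (simp add: algebra_simps)
        then show "\<exists>y. ((\<lambda>x. (m - 1) * H x - x * g x) has_real_derivative y) (at x) \<and> 0 \<le> y" using ub[OF x] by force
      qed (use elim z in simp)
      moreover have "0 \<le> (m - 1) * H z" using m1 Hpos[OF z0] by simp
      ultimately show ?case using zg by linarith
    qed
  qed simp
  then show "t * g t \<le> (m - 1) * H t" by simp
qed

lemma Ck_on_2_real:
  assumes "Ck_on 2 S (\<phi> :: real \<Rightarrow> real)"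
  obtains \<phi>1 \<phi>2 where "\<And>t. t \<in> S \<Longrightarrow> (\<phi> has_real_derivative \<phi>1 t) (at t)" "\<And>t. t \<in> S \<Longrightarrow> (\<phi>1 has_real_derivative \<phi>2 t) (at t)"
proof -
  from assms obtain G1 where G1: "\<forall>x\<in>S. (\<phi> has_derivative (\<lambda>h. h * G1 (1::real) x)) (at x)" "Ck_on (Suc 0) S (G1 1)"
    by (auto simp: numeral_2_eq_2 Basis_real_def)
  from G1(2) obtain G2 where G2: "\<forall>x\<in>S. (G1 1 has_derivative (\<lambda>h. h * G2 (1::real) x)) (at x)"
    by (auto simp: Basis_real_def)
  show thesis
  proof (rule that[of "G1 1" "G2 1"])
    show "(\<phi> has_real_derivative G1 1 t) (at t)" "(G1 1 has_real_derivative G2 1 t) (at t)" if "t \<in> S" for t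
      by (rule has_derivative_imp_has_field_derivative[OF G1(1)[rule_format, OF that]], rule refl)
        (rule has_derivative_imp_has_field_derivative[OF G2[rule_format, OF that]], rule refl)
  qed
qed

lemma power_growth_of_indices:
  assumes phi_pos: "\<forall>t>0. \<phi> t > 0" and phi_C2: "Ck_on 2 {0<..} \<phi>"
    and phi_zero: "((\<lambda>t. t * \<phi> t) \<longlongrightarrow> 0) (at_right 0)"
    and phi_mono: "strict_mono_on {0<..} (\<lambda>t. t * \<phi> t)"
    and l_def: "ereal (l - 2) = (INF t\<in>{0<..}. ereal (deriv (deriv (\<lambda>s. s * \<phi> s)) t * t / deriv (\<lambda>s. s * \<phi> s) t))"
    and m_def: "ereal (m - 2) = (SUP t\<in>{0<..}. ereal (deriv (deriv (\<lambda>s. s * \<phi> s)) t * t / deriv (\<lambda>s. s * \<phi> s) t))"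
    and lm: "1 < l" "l \<le> m"
  shows "power_growth \<phi> l m"
proof -
  obtain \<phi>1 \<phi>2 where d1: "\<And>t. t \<in> {0<..} \<Longrightarrow> (\<phi> has_real_derivative \<phi>1 t) (at t)"
    and d2: "\<And>t. t \<in> {0<..} \<Longrightarrow> (\<phi>1 has_real_derivative \<phi>2 t) (at t)"
    by (rule Ck_on_2_real[OF phi_C2]) (rule that)
  define H where "H = (\<lambda>t. t * \<phi> t)"
  define g where "g = (\<lambda>t. \<phi> t + t * \<phi>1 t)"
  define g' where "g' = (\<lambda>t. 2 * \<phi>1 t + t * \<phi>2 t)"
  have dH: "(H has_real_derivative g t) (at t)" if "0 < t" for t
    unfolding H_def g_def by (rule DERIV_cong[OF DERIV_mult'[OF DERIV_ident d1]]) (use that in simp_all)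
  have dg: "(g has_real_derivative g' t) (at t)" if "0 < t" for t
    unfolding g_def g'_def by (rule DERIV_cong[OF DERIV_add[OF d1 DERIV_mult'[OF DERIV_ident d2]]]) (use that in simp_all)
  have D1: "deriv H t = g t" if "0 < t" for t by (rule DERIV_imp_deriv[OF dH[OF that]])
  have D2: "deriv (deriv H) t = g' t" if t: "0 < t" for t
  proof (rule DERIV_imp_deriv)
    show "(deriv H has_real_derivative g' t) (at t)"
      by (rule has_field_derivative_transform_within_open[OF dg[OF t], of "{0<..}"]) (use t D1 in auto)
  qed
  have r1: "l - 2 \<le> g' t * t / g t" if t: "0 < t" for t
  proof -
    have "ereal (l - 2) \<le> ereal (deriv (deriv H) t * t / deriv H t)"
      unfolding l_def H_def by (rule INF_lower) (use t in simp)
    then show ?thesis using D1[OF t] D2[OF t] by simp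
  qed
  have r2: "g' t * t / g t \<le> m - 2" if t: "0 < t" for t
  proof -
    have "ereal (deriv (deriv H) t * t / deriv H t) \<le> ereal (m - 2)"
      unfolding m_def H_def by (rule SUP_upper) (use t in simp)
    then show ?thesis using D1[OF t] D2[OF t] by simp
  qed
  have Hpos: "0 < H t" if "0 < t" for t using that phi_pos by (simp add: H_def)
  have Hm: "H s < H t" if "0 < s" "s < t" for s t
    using strict_mono_onD[OF phi_mono, of s t] that by (simp add: H_def)
  have H0: "(H \<longlongrightarrow> 0) (at_right 0)" unfolding H_def by (rule phi_zero)
  note ib = index_bounds[of H g g' l m, OF dH dg Hpos Hm H0 lm(1) r1 r2]
  show ?thesis
  proof
    show "0 < \<phi> t" if "0 < t" for t using phi_pos that by simp
    show "continuous_on {0..} (\<lambda>t. t * \<phi> t)"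
      unfolding continuous_on_eq_continuous_within
    proof
      fix x :: real assume x: "x \<in> {0..}"
      show "continuous (at x within {0..}) (\<lambda>t. t * \<phi> t)"
      proof (cases "x = 0")
        case True
        then show ?thesis using phi_zero by (simp add: continuous_within at_within_Ici_at_right)
      next
        case False
        then have "isCont H x" using x by (intro DERIV_isCont[OF dH]) simp
        then show ?thesis unfolding H_def by (rule continuous_at_imp_continuous_at_within)
      qed
    qed
    fix s t :: real assume st: "0 < s" "s \<le> t"
    show "s * \<phi> s / s powr (l - 1) \<le> t * \<phi> t / t powr (l - 1)"
      using powr_quotient_mono[of s t H g "l - 1", OF dH ib(1) st] st by (simp add: H_def)
    have "- H s / s powr (m - 1) \<le> - H t / t powr (m - 1)"
    proof (rule powr_quotient_mono[of s t "\<lambda>t. - H t" "\<lambda>t. - g t" "m - 1", OF _ _ st])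
      show "((\<lambda>t. - H t) has_real_derivative - g x) (at x)" if "s \<le> x" "x \<le> t" for x
        by (rule DERIV_minus[OF dH]) (use st that in simp)
      show "(m - 1) * - H x \<le> x * - g x" if "s \<le> x" "x \<le> t" for x
        using ib(2)[of x] st that by simp
    qed
    then show "t * \<phi> t / t powr (m - 1) \<le> s * \<phi> s / s powr (m - 1)" by (simp add: H_def)
  qed (use lm in auto)
qed

text \<open>Gronwall's inequality for \<open>\<Psi>\<close>: beyond \<open>1\<close> the integral inequality \<open>\<Psi>(t) \<le> \<Psi>(1) + \<integral> q \<Psi>(r) / r dr\<close> gives \<open>\<Psi>(t) \<le> \<Psi>(1) t\<^sup>q\<close>, and
on \<open>[0, 1]\<close> convexity gives \<open>\<Psi>(t) \<le> t \<Psi>(1)\<close>. The density is only known to be integrable, so the integral inequality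
is used in place of a differential inequality for \<open>\<Psi>\<close>.\<close>

lemma density_le_powr:
  fixes \<psi> :: "real \<Rightarrow> real"
  assumes nonneg: "\<forall>t\<ge>0. \<psi> t \<ge> 0" and N: "N_function (int0 \<psi>)"
    and ratio: "\<And>t. 0 < t \<Longrightarrow> t * \<psi> t / int0 \<psi> t \<le> q" and q: "1 < q"
  obtains K where "0 \<le> K" "\<And>t. 0 < t \<Longrightarrow> \<psi> t \<le> K * (1 + t powr (q - 1))"
proof -
  let ?\<Psi> = "int0 \<psi>"
  have pos: "0 < ?\<Psi> t" if "0 < t" for t using N that by (simp add: N_function_def)
  have cont: "continuous_on {0..} ?\<Psi>" and conv: "convex_on {0..} ?\<Psi>" and zero: "?\<Psi> 0 = 0"
    using N by (simp_all add: N_function_def)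
  have \<psi>_le: "\<psi> t \<le> q * ?\<Psi> t / t" if "0 < t" for t
    using ratio[OF that] pos[OF that] that by (simp add: field_simps)
  \<comment> \<open>A non-integrable function would have integral \<open>0\<close>, against positivity of \<open>\<Psi>\<close>.\<close>
  have ig: "\<psi> integrable_on {0..t}" if "0 < t" for t
    using pos[OF that] that not_integrable_integral[of \<psi> "{0..t}"] by (auto simp: int0_def)
  \<comment> \<open>The maximum makes the integrand continuous on the whole line without changing it beyond \<open>1\<close>.\<close>
  define G where "G r = q * ?\<Psi> (max r 1) / max r 1" for r
  have cG: "continuous_on UNIV G"
    unfolding G_def by (intro continuous_intros continuous_on_compose2[OF cont]) (auto simp: max_def)
  define R where "R t = ?\<Psi> 1 + (int0 G t - int0 G 1)" for t
  have dR: "(R has_real_derivative G t) (at t)" for t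
    unfolding R_def by (rule derivative_eq_intros int0_has_real_derivative[OF cG] refl)+ simp
  have \<Psi>R: "?\<Psi> t \<le> R t" if t: "1 \<le> t" for t
  proof -
    have "?\<Psi> t = ?\<Psi> 1 + integral {1..t} \<psi>"
      using Henstock_Kurzweil_Integration.integral_combine[of 0 1 t \<psi>] ig[of t] t by (simp add: int0_def)
    also have "integral {1..t} \<psi> \<le> integral {1..t} G"
    proof (rule integral_le)
      show "\<psi> integrable_on {1..t}" by (rule integrable_subinterval_real[OF ig[of t]]) (use t in auto)
      show "G integrable_on {1..t}" by (intro integrable_continuous_interval continuous_on_subset[OF cG]) simp
      show "\<psi> x \<le> G x" if "x \<in> {1..t}" for x using \<psi>_le[of x] that by (simp add: G_def max_absorb1)
    qed
    also have "integral {1..t} G = int0 G t - int0 G 1"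
    proof -
      have "G integrable_on {0..t}" by (intro integrable_continuous_interval continuous_on_subset[OF cG]) simp
      then show ?thesis using Henstock_Kurzweil_Integration.integral_combine[of 0 1 t G] t by (simp add: int0_def)
    qed
    finally show ?thesis by (simp add: R_def)
  qed
  have big: "?\<Psi> t \<le> ?\<Psi> 1 * t powr q" if t: "1 \<le> t" for t
  proof -
    have "- R 1 / 1 powr q \<le> - R t / t powr q"
    proof (rule powr_quotient_mono[of 1 t "\<lambda>t. - R t" "\<lambda>t. - G t"])
      show "((\<lambda>t. - R t) has_real_derivative - G x) (at x)" for x by (rule DERIV_minus[OF dR])
      show "q * - R x \<le> x * - G x" if "1 \<le> x" "x \<le> t" for x
        using \<Psi>R[OF that(1)] that q by (simp add: G_def max_absorb1)
    qed (use t in auto)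
    moreover have "R 1 = ?\<Psi> 1" by (simp add: R_def)
    ultimately have "R t \<le> ?\<Psi> 1 * t powr q" using t by (simp add: field_simps)
    then show ?thesis using \<Psi>R[OF t] by simp
  qed
  have small: "?\<Psi> t \<le> t * ?\<Psi> 1" if "0 < t" "t \<le> 1" for t
    using convex_onD[OF conv, of t 0 1] that zero by simp
  show thesis
  proof (rule that[of "q * ?\<Psi> 1"])
    show "0 \<le> q * ?\<Psi> 1" using q pos[of 1] by simp
    fix t :: real assume t: "0 < t"
    have "?\<Psi> t / t \<le> ?\<Psi> 1 * (1 + t powr (q - 1))"
    proof (cases "t \<le> 1")
      case True
      have "?\<Psi> t / t \<le> ?\<Psi> 1 * 1" using small[OF t True] t by (simp add: field_simps)
      also have "\<dots> \<le> ?\<Psi> 1 * (1 + t powr (q - 1))" using pos[of 1] by (intro mult_left_mono) auto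
      finally show ?thesis .
    next
      case False
      then have "?\<Psi> t / t \<le> ?\<Psi> 1 * (t powr q / t)" using big[of t] t by (simp add: field_simps)
      also have "t powr q / t = t powr (q - 1)" using t by (simp add: powr_diff)
      also have "?\<Psi> 1 * t powr (q - 1) \<le> ?\<Psi> 1 * (1 + t powr (q - 1))" using pos[of 1] by (intro mult_left_mono) auto
      finally show ?thesis .
    qed
    then have "q * (?\<Psi> t / t) \<le> q * (?\<Psi> 1 * (1 + t powr (q - 1)))" using q by (intro mult_left_mono) auto
    then show "\<psi> t \<le> q * ?\<Psi> 1 * (1 + t powr (q - 1))" using \<psi>_le[OF t] by (simp add: mult.assoc)
  qed
qed

lemma int0_ray_DERIV:
  assumes "continuous_on UNIV g"
  shows "((\<lambda>s. int0 g (y * s)) has_real_derivative y * g (y * s)) (at s)"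
proof -
  have "((\<lambda>s. y * s) has_real_derivative y) (at s)" by (auto intro!: derivative_eq_intros)
  from DERIV_chain2[OF int0_has_real_derivative[OF assms] this] show ?thesis by (simp add: mult.commute)
qed

lemma int0_growth:
  assumes g: "continuous_on UNIV g" and C: "0 \<le> C" "\<And>t. \<bar>g t\<bar> \<le> C * (1 + \<bar>t\<bar> powr (q - 1))" and q: "1 < q"
  shows "\<bar>int0 g t\<bar> \<le> C * (\<bar>t\<bar> + \<bar>t\<bar> powr q)"
proof -
  have "norm (int0 g t - int0 g 0) \<le> C * (1 + \<bar>t\<bar> powr (q - 1)) * norm (t - 0)"
  proof (rule field_differentiable_bound[where S = "{-\<bar>t\<bar>..\<bar>t\<bar>}" and f' = g])
    show "(int0 g has_field_derivative g z) (at z within {-\<bar>t\<bar>..\<bar>t\<bar>})" for z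
      by (rule has_field_derivative_at_within[OF int0_has_real_derivative[OF g]])
    show "norm (g z) \<le> C * (1 + \<bar>t\<bar> powr (q - 1))" if "z \<in> {-\<bar>t\<bar>..\<bar>t\<bar>}" for z
    proof -
      have "\<bar>z\<bar> powr (q - 1) \<le> \<bar>t\<bar> powr (q - 1)" using that q by (intro powr_mono2) auto
      then have "C * (1 + \<bar>z\<bar> powr (q - 1)) \<le> C * (1 + \<bar>t\<bar> powr (q - 1))" using C by (intro mult_left_mono) auto
      then show ?thesis using C(2)[of z] by simp
    qed
  qed auto
  also have "\<bar>t\<bar> * \<bar>t\<bar> powr (q - 1) = \<bar>t\<bar> powr q" using powr_mult_base[of "\<bar>t\<bar>" "q - 1"] by simp
  then have "C * (1 + \<bar>t\<bar> powr (q - 1)) * norm (t - 0) = C * (\<bar>t\<bar> + \<bar>t\<bar> powr q)" by (simp add: algebra_simps)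
  finally show ?thesis by (simp add: int0_def)
qed

text \<open>The lower bound for the quotient is integrated along both half-lines from \<open>\<bar>t\<bar> = R\<close>; the values up to \<open>R\<close> are absorbed by the constant.\<close>

lemma primitive_superpower:
  assumes g: "continuous_on UNIV g" and C: "0 \<le> C" "\<And>t. \<bar>g t\<bar> \<le> C * (1 + \<bar>t\<bar> powr (q - 1))" and q: "1 < q"
    and m: "1 < m" and R: "0 < R" "\<And>t. R \<le> \<bar>t\<bar> \<Longrightarrow> \<bar>B\<bar> * m \<le> g t / (\<bar>t\<bar> powr (m - 2) * t)"
  shows "B * \<bar>t\<bar> powr m - (C * (R + R powr q) + \<bar>B\<bar> * R powr m) \<le> int0 g t"
proof -
  have "\<bar>B\<bar> * \<bar>t\<bar> powr m - (C * (R + R powr q) + \<bar>B\<bar> * R powr m) \<le> int0 g t"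
  proof (cases "\<bar>t\<bar> \<le> R")
    case True
    have "C * (\<bar>t\<bar> + \<bar>t\<bar> powr q) \<le> C * (R + R powr q)"
      using C True q by (intro mult_left_mono add_mono powr_mono2) auto
    moreover have "\<bar>B\<bar> * \<bar>t\<bar> powr m \<le> \<bar>B\<bar> * R powr m" using True m by (intro mult_left_mono powr_mono2) auto
    ultimately show ?thesis using int0_growth[OF g C q, of t] by linarith
  next
    case False
    define y where "y = sgn t"
    have y: "y = 1 \<or> y = -1" and ty: "t = y * \<bar>t\<bar>" "0 < \<bar>t\<bar>" using False R(1) by (auto simp: y_def sgn_if)
    have "int0 g (y * R) - \<bar>B\<bar> * R powr m \<le> int0 g (y * \<bar>t\<bar>) - \<bar>B\<bar> * \<bar>t\<bar> powr m"
    proof (rule DERIV_nonneg_imp_nondecreasing[where f = "\<lambda>s. int0 g (y * s) - \<bar>B\<bar> * s powr m"])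
      fix s assume "R \<le> s" "s \<le> \<bar>t\<bar>"
      then have s: "0 < s" "R \<le> s" using R by auto
      have "((\<lambda>s. int0 g (y * s) - \<bar>B\<bar> * s powr m) has_real_derivative y * g (y * s) - \<bar>B\<bar> * (m * s powr (m - 1))) (at s)"
        by (intro DERIV_diff int0_ray_DERIV[OF g] DERIV_cmult has_real_derivative_powr s)
      moreover have "\<bar>B\<bar> * (m * s powr (m - 1)) \<le> y * g (y * s)"
      proof -
        have ys: "\<bar>y * s\<bar> = s" using y s by auto
        have "s powr (m - 1) = s powr (m - 2) * s" using powr_mult_base[of s "m - 2"] s by (simp add: mult.commute)
        then have "\<bar>B\<bar> * m \<le> y * g (y * s) / s powr (m - 1)" using R(2)[of "y * s"] s y unfolding ys by auto
        then show ?thesis using s by (simp add: field_simps)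
      qed
      ultimately show "\<exists>d. ((\<lambda>s. int0 g (y * s) - \<bar>B\<bar> * s powr m) has_real_derivative d) (at s) \<and> 0 \<le> d" by force
    qed (use False in simp)
    moreover have "\<bar>y * R\<bar> = R" using y R by auto
    then have "- (C * (R + R powr q)) \<le> int0 g (y * R)" using int0_growth[OF g C q, of "y * R"] by (simp add: abs_le_iff)
    ultimately show ?thesis using ty(1) by simp
  qed
  moreover have "B * \<bar>t\<bar> powr m \<le> \<bar>B\<bar> * \<bar>t\<bar> powr m" by (intro mult_right_mono) auto
  ultimately show ?thesis by linarith
qed

text \<open>Close to \<open>0\<close> the bound on the quotient is integrated. Away from \<open>0\<close> the primitive is at most a multiple of \<open>\<bar>t\<bar>\<^sup>q\<close>, since
\<open>\<bar>t\<bar> \<le> d\<^sup>1\<^sup>-\<^sup>q \<bar>t\<bar>\<^sup>q\<close> for \<open>\<bar>t\<bar> \<ge> d\<close>.\<close>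

lemma (in power_growth) primitive_near_zero:
  assumes g: "continuous_on UNIV g" and C: "0 \<le> C" "\<And>t. \<bar>g t\<bar> \<le> C * (1 + \<bar>t\<bar> powr (q - 1))" and q: "1 < q"
    and d: "0 < d" "\<And>t. t \<noteq> 0 \<Longrightarrow> \<bar>t\<bar> < d \<Longrightarrow> g t / (t * \<phi> \<bar>t\<bar>) \<le> \<mu>" and \<mu>: "0 \<le> \<mu>"
  shows "int0 g t \<le> \<mu> * P t + C * (d powr (1 - q) + 1) * \<bar>t\<bar> powr q"
proof (cases "\<bar>t\<bar> < d")
  case True
  have "int0 g t \<le> \<mu> * P t"
  proof (cases "t = 0")
    case False
    define y where "y = sgn t"
    have y: "y = 1 \<or> y = -1" and ty: "t = y * \<bar>t\<bar>" "0 < \<bar>t\<bar>" using False by (auto simp: y_def sgn_if)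
    have "\<mu> * P 0 - int0 g (y * 0) \<le> \<mu> * P \<bar>t\<bar> - int0 g (y * \<bar>t\<bar>)"
    proof (rule DERIV_nonneg_imp_increasing_open[where f = "\<lambda>s. \<mu> * P s - int0 g (y * s)", OF _ _ continuous_at_imp_continuous_on])
      fix s assume s: "0 < s" "s < \<bar>t\<bar>"
      have ys: "\<bar>y * s\<bar> = s" using y s by auto
      have "y * g (y * s) / (s * \<phi> s) \<le> \<mu>" using d(2)[of "y * s"] s True y unfolding ys by auto
      then have "y * g (y * s) \<le> \<mu> * h s" using s pos[of s] by (simp add: h_def field_simps)
      moreover have "((\<lambda>s. \<mu> * P s - int0 g (y * s)) has_real_derivative \<mu> * h s - y * g (y * s)) (at s)"
        by (intro DERIV_diff int0_ray_DERIV[OF g] DERIV_cmult DERIV_P)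
      ultimately show "\<exists>d. ((\<lambda>s. \<mu> * P s - int0 g (y * s)) has_real_derivative d) (at s) \<and> 0 \<le> d" by force
    next
      show "\<forall>s\<in>{0..\<bar>t\<bar>}. isCont (\<lambda>s. \<mu> * P s - int0 g (y * s)) s"
        by (intro ballI DERIV_isCont[OF DERIV_diff[OF DERIV_cmult[OF DERIV_P] int0_ray_DERIV[OF g]]])
    qed (use ty in simp)
    then show ?thesis using ty(1) by (simp add: int0_def[of g 0])
  qed (simp add: int0_def)
  moreover have "0 \<le> C * (d powr (1 - q) + 1) * \<bar>t\<bar> powr q" using C by simp
  ultimately show ?thesis by linarith
next
  case False
  then have t: "0 < \<bar>t\<bar>" using d by simp
  have "1 powr (q - 1) \<le> (\<bar>t\<bar> / d) powr (q - 1)" using False d q by (intro powr_mono2) auto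
  then have "1 \<le> \<bar>t\<bar> powr (q - 1) * d powr (1 - q)"
    using t d by (simp add: powr_divide powr_diff field_simps)
  then have "\<bar>t\<bar> * 1 \<le> \<bar>t\<bar> * (\<bar>t\<bar> powr (q - 1) * d powr (1 - q))" using t by (intro mult_left_mono) auto
  also have "\<dots> = \<bar>t\<bar> powr q * d powr (1 - q)" using powr_mult_base[of "\<bar>t\<bar>" "q - 1"] by (simp add: mult.assoc[symmetric])
  finally have "C * (\<bar>t\<bar> + \<bar>t\<bar> powr q) \<le> C * (\<bar>t\<bar> powr q * d powr (1 - q) + \<bar>t\<bar> powr q)" using C by (intro mult_left_mono) auto
  then have "int0 g t \<le> C * (d powr (1 - q) + 1) * \<bar>t\<bar> powr q"
    using int0_growth[OF g C q, of t] by (simp add: algebra_simps)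
  moreover have "0 \<le> \<mu> * P t" using \<mu> by simp
  ultimately show ?thesis by linarith
qed

text \<open>Both signs of \<open>y\<close> lead to the same inequality, because multiplication by a negative \<open>y\<close> reverses the order of the arguments
while the quotient decreases on the negative half-line.\<close>

lemma quotient_monotone_ray:
  fixes g :: "real \<Rightarrow> real"
  assumes "strict_mono_on {0<..} (\<lambda>t. g t / (\<bar>t\<bar> powr (m - 2) * t))" "strict_antimono_on {..<0} (\<lambda>t. g t / (\<bar>t\<bar> powr (m - 2) * t))"
    and y: "y \<noteq> 0" and st: "0 < s" "s < t"
  shows "g (s * y) * y / s powr (m - 1) < g (t * y) * y / t powr (m - 1)"
proof -
  define r where "r t = g t / (\<bar>t\<bar> powr (m - 2) * t)" for t
  have r: "r (s * y) < r (t * y)"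
  proof (cases "0 < y")
    case True
    then show ?thesis using strict_mono_onD[OF assms(1), of "s * y" "t * y"] st by (simp add: r_def)
  next
    case False
    then have "y < 0" using y by simp
    then have "t * y < s * y" "s * y < 0" "t * y < 0" using st by (auto simp: mult_less_0_iff)
    then show ?thesis using monotone_onD[OF assms(2), of "t * y" "s * y"] by (simp add: r_def)
  qed
  have eq: "g (a * y) * y / a powr (m - 1) = r (a * y) * (\<bar>y\<bar> powr (m - 2) * (y * y))" if "0 < a" for a
  proof -
    have "a powr (m - 1) = a powr (m - 2) * a" using powr_mult_base[of a "m - 2"] that by (simp add: mult.commute)
    then show ?thesis using that y by (simp add: r_def abs_mult powr_mult field_simps)
  qed
  have "r (s * y) * (\<bar>y\<bar> powr (m - 2) * (y * y)) < r (t * y) * (\<bar>y\<bar> powr (m - 2) * (y * y))"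
    using r y by (intro mult_strict_right_mono) (auto simp: zero_less_mult_iff)
  then show ?thesis using eq st by simp
qed

text \<open>Below the spectral bound the lower order part \<open>\<nu> \<integral> \<Phi>(u)\<close> of the primitive costs at most the fraction \<open>\<kappa> < 1\<close> of the energy.\<close>

lemma (in sobolev_domain) energy_below:
  assumes f: "\<And>t. (\<lambda>x. f x t) \<in> borel_measurable M" "\<And>x. x \<in> \<Omega> \<Longrightarrow> continuous_on UNIV (f x)"
    and growth: "0 \<le> C" "\<And>x t. x \<in> \<Omega> \<Longrightarrow> \<bar>f x t\<bar> \<le> C * (1 + \<bar>t\<bar> powr (q - 1))"
    and q: "m < q" "q < critical"
    and \<mu>: "\<mu> < lambda1 \<Omega> \<phi>" "\<forall>\<^sub>F t in at 0. \<forall>x\<in>\<Omega>. f x t / (t * \<phi> \<bar>t\<bar>) \<le> \<mu>"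
  shows "\<exists>\<delta>>0. \<exists>K. \<forall>u\<in>X. \<delta> * (LINT x|M. P (norm (D u x))) - K * (LINT x|M. \<bar>u x\<bar> powr q)
      \<le> (LINT x|M. P (norm (D u x))) - (LINT x|M. int0 (f x) (u x))"
proof -
  interpret finite_measure M by (rule finite_M)
  interpret Pmod: modular P by (rule modular_P)
  have q1: "1 < q" using q lm by simp
  obtain K where K: "0 \<le> K" "\<And>t. 0 \<le> t \<Longrightarrow> t \<le> 1 + K * P t" using Pmod.A_linear[of 1] by auto
  obtain d where d: "0 < d" "\<And>x t. x \<in> \<Omega> \<Longrightarrow> t \<noteq> 0 \<Longrightarrow> \<bar>t\<bar> < d \<Longrightarrow> f x t / (t * \<phi> \<bar>t\<bar>) \<le> \<mu>"
    using \<mu>(2) unfolding eventually_at by (auto simp: dist_real_def)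
  \<comment> \<open>A negative \<open>\<mu>\<close> is replaced by \<open>0\<close>, because nothing is known about the sign of the spectral bound.\<close>
  obtain \<nu> \<kappa> where \<nu>: "\<mu> \<le> \<nu>" "0 \<le> \<nu>" "\<kappa> < 1"
    "\<And>u. u \<in> X \<Longrightarrow> \<nu> * (LINT x|M. P (u x)) \<le> \<kappa> * (LINT x|M. P (norm (D u x)))"
  proof (cases "\<mu> \<le> 0")
    case True
    then show thesis using that[of 0 0] by simp
  next
    case False
    let ?S = "{c. \<forall>u\<in>X. c * (LINT x|M. P (u x)) \<le> (LINT x|M. P (norm (D u x)))}"
    have "0 \<in> ?S" by simp
    then have "?S \<noteq> {}" by blast
    from less_cSupD[OF this \<mu>(1)[unfolded lambda1_def]]
    obtain c where c: "\<mu> < c" "\<forall>u\<in>X. c * (LINT x|M. P (u x)) \<le> (LINT x|M. P (norm (D u x)))" by blast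
    show thesis
    proof (rule that[of \<mu> "\<mu> / c"])
      show "\<mu> / c < 1" using c(1) False by simp
      fix u assume "u \<in> X"
      then have "\<mu> / c * (c * (LINT x|M. P (u x))) \<le> \<mu> / c * (LINT x|M. P (norm (D u x)))"
        using c False by (intro mult_left_mono) auto
      then show "\<mu> * (LINT x|M. P (u x)) \<le> \<mu> / c * (LINT x|M. P (norm (D u x)))" using c(1) False by simp
    qed (use False in auto)
  qed
  define K' where "K' = C * (d powr (1 - q) + 1)"
  have "(1 - \<kappa>) * (LINT x|M. P (norm (D u x))) - K' * (LINT x|M. \<bar>u x\<bar> powr q)
      \<le> (LINT x|M. P (norm (D u x))) - (LINT x|M. int0 (f x) (u x))" if u: "u \<in> X" for u
  proof -
    note ud = W0_D[OF u]
    have uq: "integrable M (\<lambda>x. \<bar>u x\<bar> powr q)"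
      using W0_sobolev[OF q1 q(2), of "LINT x|M. P (norm (D u x))"] u by blast
    have u1: "integrable M u" by (rule Pmod.L1_bound(1)[OF finite_M ud(1) ud(2) K])
    have iP: "integrable M (\<lambda>x. P (u x))" using ud(2) by simp
    have Fm: "(\<lambda>x. int0 (f x) (u x)) \<in> borel_measurable M"
    proof (rule caratheodory_compose[of "\<lambda>x. int0 (f x)", OF measurable_int0 _ ud(1)])
      show "continuous_on UNIV (int0 (f x))" if "x \<in> space M" for x
        using that by (intro continuous_at_imp_continuous_on ballI DERIV_isCont[OF int0_has_real_derivative[OF f(2)]]) simp
    qed (use f in auto)
    have Fi: "integrable M (\<lambda>x. int0 (f x) (u x))"
    proof (rule Bochner_Integration.integrable_bound[OF _ Fm])
      show "integrable M (\<lambda>x. C * (\<bar>u x\<bar> + \<bar>u x\<bar> powr q))" using u1 uq by auto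
      show "AE x in M. norm (int0 (f x) (u x)) \<le> norm (C * (\<bar>u x\<bar> + \<bar>u x\<bar> powr q))"
      proof (rule AE_I2)
        fix x assume "x \<in> space M"
        then have "x \<in> \<Omega>" by simp
        from int0_growth[OF f(2)[OF this] growth(1) growth(2)[OF this] q1, of "u x"]
        show "norm (int0 (f x) (u x)) \<le> norm (C * (\<bar>u x\<bar> + \<bar>u x\<bar> powr q))" using growth(1) by simp
      qed
    qed
    have "(LINT x|M. int0 (f x) (u x)) \<le> (LINT x|M. \<nu> * P (u x) + K' * \<bar>u x\<bar> powr q)"
    proof (rule integral_mono[OF Fi])
      show "integrable M (\<lambda>x. \<nu> * P (u x) + K' * \<bar>u x\<bar> powr q)" using iP uq by auto
      fix x assume "x \<in> space M"
      then have x: "x \<in> \<Omega>" by simp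
      have "\<And>t. t \<noteq> 0 \<Longrightarrow> \<bar>t\<bar> < d \<Longrightarrow> f x t / (t * \<phi> \<bar>t\<bar>) \<le> \<nu>" using d(2)[OF x] \<nu>(1) by (meson order_trans)
      from primitive_near_zero[OF f(2)[OF x] growth(1) growth(2)[OF x] q1 d(1) this \<nu>(2)]
      show "int0 (f x) (u x) \<le> \<nu> * P (u x) + K' * \<bar>u x\<bar> powr q" by (simp add: K'_def)
    qed
    also have "\<dots> = \<nu> * (LINT x|M. P (u x)) + K' * (LINT x|M. \<bar>u x\<bar> powr q)" using iP uq by simp
    finally show ?thesis using \<nu>(4)[OF u] by (simp add: algebra_simps)
  qed
  then show ?thesis using \<nu>(3) by (intro exI[of _ "1 - \<kappa>"]) auto
qed

theorem theorem3p1: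
  fixes \<Omega> :: "(real^'n) set"
    and \<phi> \<psi> :: "real \<Rightarrow> real"
    and f :: "real^'n \<Rightarrow> real \<Rightarrow> real"
    and l m C :: real
  assumes N: "CARD('n) \<ge> 2"
    and domain: "smooth_bounded_domain \<Omega>"
    and phi_pos: "\<forall>t>0. \<phi> t > 0"
    and phi_C2: "Ck_on 2 {0<..} \<phi>"
    and phi_zero: "((\<lambda>t. t * \<phi> t) \<longlongrightarrow> 0) (at_right 0)"
    and phi_infty: "filterlim (\<lambda>t. t * \<phi> t) at_top at_top"
    and phi_mono: "strict_mono_on {0<..} (\<lambda>t. t * \<phi> t)"
    and l_def: "ereal (l - 2) =
      (INF t\<in>{0<..}. ereal (deriv (deriv (\<lambda>s. s * \<phi> s)) t * t / deriv (\<lambda>s. s * \<phi> s) t))"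
    and m_def: "ereal (m - 2) =
      (SUP t\<in>{0<..}. ereal (deriv (deriv (\<lambda>s. s * \<phi> s)) t * t / deriv (\<lambda>s. s * \<phi> s) t))"
    and lm: "- 1 < l - 2" "l - 2 \<le> m - 2" "m - 2 < real CARD('n) - 2"
    and f_car: "caratheodory \<Omega> f"
    and f_C1: "\<forall>x\<in>\<Omega>. f x C1_differentiable_on UNIV"
    and psi_nonneg: "\<forall>t\<ge>0. \<psi> t \<ge> 0"
    and C_pos: "C > 0"
    and growth: "\<forall>x\<in>\<Omega>. \<forall>t. \<bar>f x t\<bar> \<le> C * (1 + \<psi> \<bar>t\<bar>)"
    and Psi_N: "N_function (int0 \<psi>)"
    and Psi_slow: "essentially_slower (int0 \<psi>) (Phi_star CARD('n) \<phi>)"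
    and psi_ind: "1 < l" "l \<le> m"
      "ereal m < (INF t\<in>{0<..}. ereal (t * \<psi> t / int0 \<psi> t))"
      "(INF t\<in>{0<..}. ereal (t * \<psi> t / int0 \<psi> t))
         \<le> (SUP t\<in>{0<..}. ereal (t * \<psi> t / int0 \<psi> t))"
      "(SUP t\<in>{0<..}. ereal (t * \<psi> t / int0 \<psi> t))
         < ereal (l * real CARD('n) / (real CARD('n) - l))"
    and f_mono: "\<forall>x\<in>\<Omega>. strict_mono_on {0<..} (\<lambda>t. f x t / (\<bar>t\<bar> powr (m - 2) * t)) \<and>
                        strict_antimono_on {..<0} (\<lambda>t. f x t / (\<bar>t\<bar> powr (m - 2) * t))"
    and f_zero_lim: "\<forall>x\<in>\<Omega>. \<exists>a::ereal. ((\<lambda>t. ereal (f x t / (t * \<phi> \<bar>t\<bar>))) \<longlongrightarrow> a) (at 0)"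
    and f_zero: "\<exists>\<mu><lambda1 \<Omega> \<phi>. \<forall>\<^sub>F t in at 0. \<forall>x\<in>\<Omega>. f x t / (t * \<phi> \<bar>t\<bar>) \<le> \<mu>"
    and f_infty: "\<forall>M. \<exists>R>0. \<forall>x\<in>\<Omega>. \<forall>t. \<bar>t\<bar> \<ge> R \<longrightarrow> f x t / (\<bar>t\<bar> powr (m - 2) * t) \<ge> M"
  shows "\<exists>u\<in>nehari \<Omega> \<phi> f.
      (\<forall>v\<in>orlicz_sobolev0 \<Omega> (Phi \<phi>).
         (LINT x|lebesgue_on \<Omega>.
            (\<phi> (norm (weak_grad \<Omega> u x)) *\<^sub>R weak_grad \<Omega> u x) \<bullet> weak_grad \<Omega> v x) =
         (LINT x|lebesgue_on \<Omega>. f x (u x) * v x)) \<and>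
      ereal (energy \<Omega> \<phi> f u) = (INF w\<in>nehari \<Omega> \<phi> f. ereal (energy \<Omega> \<phi> f w))"
proof -
  have pg: "power_growth \<phi> l m"
    using lm by (intro power_growth_of_indices[OF phi_pos phi_C2 phi_zero phi_mono l_def m_def]) auto
  have dom: "open \<Omega>" "bounded \<Omega>" "\<Omega> \<noteq> {}" using domain by (auto simp: smooth_bounded_domain_def)
  interpret sobolev_domain \<phi> l m \<Omega>
    using pg dom lm(3) by (intro sobolev_domain.intro sobolev_domain_axioms.intro) auto
  let ?r = "\<lambda>t. t * \<psi> t / int0 \<psi> t"
  \<comment> \<open>The growth exponent is the upper index of \<open>\<Psi>\<close>; it is finite, as it lies between \<open>m\<close> and the critical exponent.\<close>
  obtain q where qS: "(SUP t\<in>{0<..}. ereal (?r t)) = ereal q"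
    using psi_ind(3-5) by (cases "SUP t\<in>{0<..}. ereal (?r t)") auto
  have "ereal m < ereal q" using less_le_trans[OF psi_ind(3) psi_ind(4)] by (simp only: qS)
  then have q: "m < q" by simp
  have qc: "q < critical" using psi_ind(5) unfolding qS critical_def by simp
  have q1: "1 < q" using q psi_ind by simp
  have ratio: "?r t \<le> q" if "0 < t" for t
  proof -
    have "ereal (?r t) \<le> (SUP t\<in>{0<..}. ereal (?r t))" by (rule SUP_upper) (use that in simp)
    then show ?thesis unfolding qS by simp
  qed
  obtain K where K: "0 \<le> K" "\<And>t. 0 < t \<Longrightarrow> \<psi> t \<le> K * (1 + t powr (q - 1))"
    by (rule density_le_powr[OF psi_nonneg Psi_N ratio q1]) (assumption | rule that)+
  \<comment> \<open>The value \<open>\<psi> 0\<close> enters because the power bound holds for positive arguments only.\<close>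
  define C' where "C' = C * (1 + K + \<psi> 0)"
  have psi0: "0 \<le> \<psi> 0" using psi_nonneg by simp
  have C': "0 \<le> C'" using C_pos K(1) psi0 by (simp add: C'_def)
  have grow: "\<bar>f x t\<bar> \<le> C' * (1 + \<bar>t\<bar> powr (q - 1))" if x: "x \<in> \<Omega>" for x t
  proof -
    define p where "p = \<bar>t\<bar> powr (q - 1)"
    have p: "0 \<le> p" by (simp add: p_def)
    have "\<psi> \<bar>t\<bar> \<le> \<psi> 0 + K * (1 + p)"
    proof (cases "t = 0")
      case True
      have "0 \<le> K * (1 + p)" using K(1) p by simp
      then show ?thesis using True by simp
    next
      case False
      then show ?thesis using K(2)[of "\<bar>t\<bar>"] psi0 unfolding p_def by simp
    qed
    then have "1 + \<psi> \<bar>t\<bar> \<le> (1 + K + \<psi> 0) * (1 + p)" using p mult_nonneg_nonneg[OF p psi0] by (simp add: algebra_simps)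
    then have "C * (1 + \<psi> \<bar>t\<bar>) \<le> C * ((1 + K + \<psi> 0) * (1 + p))" using C_pos by (intro mult_left_mono) auto
    moreover have "\<bar>f x t\<bar> \<le> C * (1 + \<psi> \<bar>t\<bar>)" using growth x by blast
    ultimately show ?thesis by (simp add: C'_def p_def mult.assoc)
  qed
  have f_meas: "(\<lambda>x. f x t) \<in> borel_measurable M" for t using f_car by (simp add: caratheodory_def)
  have f_cont: "continuous_on UNIV (f x)" if "x \<in> \<Omega>" for x
    using f_C1 that C1_differentiable_imp_continuous_on by blast
  obtain \<mu> where \<mu>: "\<mu> < lambda1 \<Omega> \<phi>" "\<forall>\<^sub>F t in at 0. \<forall>x\<in>\<Omega>. f x t / (t * \<phi> \<bar>t\<bar>) \<le> \<mu>"
    using f_zero by blast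
  interpret nehari_setting \<phi> l m M X D q f
  proof (intro nehari_setting.intro nehari_setting_axioms.intro)
    show "sobolev_setting \<phi> l m M X D q" by (rule W0_setting[OF q qc dom(3)])
    show "(\<lambda>x. f x t) \<in> borel_measurable M" for t by (rule f_meas)
    show "continuous_on UNIV (f x)" if "x \<in> space M" for x using f_cont that by simp
    show "\<exists>C\<ge>0. \<forall>x\<in>space M. \<forall>t. \<bar>f x t\<bar> \<le> C * (1 + \<bar>t\<bar> powr (q - 1))"
      using C' grow by (intro exI[of _ C']) auto
    show "f x (s * y) * y / s powr (m - 1) < f x (t * y) * y / t powr (m - 1)"
      if "x \<in> space M" "y \<noteq> 0" "0 < s" "s < t" for x y s t
      by (rule quotient_monotone_ray) (use f_mono that in auto)
    show "\<exists>\<delta>>0. \<exists>C. \<forall>u\<in>X. \<delta> * (LINT x|M. P (norm (D u x))) - C * (LINT x|M. \<bar>u x\<bar> powr q)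
      \<le> (LINT x|M. P (norm (D u x))) - (LINT x|M. int0 (f x) (u x))"
      by (rule energy_below[OF f_meas f_cont C' grow q qc \<mu>])
    show "\<exists>K. \<forall>x\<in>space M. \<forall>t. B * \<bar>t\<bar> powr m - K \<le> int0 (f x) t" for B
    proof -
      obtain R where R: "R > 0" "\<forall>x\<in>\<Omega>. \<forall>t. \<bar>t\<bar> \<ge> R \<longrightarrow> f x t / (\<bar>t\<bar> powr (m - 2) * t) \<ge> \<bar>B\<bar> * m"
        using f_infty by blast
      have "B * \<bar>t\<bar> powr m - (C' * (R + R powr q) + \<bar>B\<bar> * R powr m) \<le> int0 (f x) t" if x: "x \<in> \<Omega>" for x t
        by (rule primitive_superpower[OF f_cont[OF x] C' grow[OF x] q1 _ R(1)]) (use R(2) x psi_ind in auto)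
      then show ?thesis by (intro exI ballI allI) simp
    qed
  qed
  have nehari: "nehari \<Omega> \<phi> f = \<N>" by (simp add: nehari_def \<N>_def energy_deriv_def J'_def A_def)
  have energy: "energy \<Omega> \<phi> f u = J u" for u by (simp add: energy_def J_def E_def)
  obtain u where u: "u \<in> \<N>" "\<forall>v\<in>X. J' u v = 0" "\<forall>w\<in>\<N>. J u \<le> J w" using ground_state by blast
  have "ereal (J u) = (INF w\<in>\<N>. ereal (J w))"
    by (rule antisym[OF INF_greatest INF_lower[OF u(1)]]) (use u(3) in simp)
  moreover have "(LINT x|M. (\<phi> (norm (D u x)) *\<^sub>R D u x) \<bullet> D v x) = (LINT x|M. f x (u x) * v x)" if "v \<in> X" for v
    using u(2)[rule_format, OF that] by (simp add: J'_def A_def)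
  ultimately show ?thesis using u(1) unfolding nehari energy by blast
qed

end
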